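(* For fixed integers $a\ge2$, even $d\ge2$, and $k\ge1$, the function $q\mapsto W_{a,d}(q,k)$ has infinitely many simple real poles approaching $1$. For every sufficiently large integer $j$, there is exactly one such pole $q_j=e^{-t_j/a}$ (with $t_j>0$) in the phase window $$|\Theta(t)-\phi-\pi(j+1/2)|<\pi/4,$$ and these are all its real poles sufficiently close to $1$. They satisfy, as $j\to\infty$, $$\Theta(t_j)=\pi\left(j+\frac{k+1}{8}\right)+O(j^{-1}),\qquad 1-q_j\sim\frac{\pi k}{3aj^2},$$ $$\operatorname{Res}_{q=q_j}W_{a,d}(q,k)=\frac{2q_jt_j\sin(\pi/a)}{ad\,\Theta(t_j)}(1+O(\sqrt{t_j}))\sim\frac{2k\sin(\pi/a)}{3ad\,j^3}.$$ In particular the residues are eventually positive. In the variable $Q=q^a$, these poles are precisely all zeros in $(0,1)$ sufficiently close to $1$ of the single function $\mathcal D(Q)=\sum_{m\ge0}(-1)^mQ^m\Phi(Q^{m+1})^k$. Writing $q_{a,j}$ for the $j$th denominator zero for dilation $a$ (in the $q$ variable, under the common phase indexing above), one has $q_{a,j}=q_{2,j}^{2/a}$.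
   Context: $\Phi(q)=\prod_{n\ge1}(1-q^n)$. For $0<|q|<1$, $$W_{a,d}(q,k)=\frac1d\sum_{z^d=1}\frac{\sum_{m\ge0}z^mq^{am+1}\Phi(q^{am+1})^k}{\sum_{m\ge0}z^mq^{a(m+1)}\Phi(q^{a(m+1)})^k},$$ a meromorphic function of $q$ on $0<|q|<1$. The denominator at $z=-1$ equals $Q\mathcal D(Q)$ with $Q=q^a$. For $t>0$, $$\Theta(t)=\pi^{3/2}\sqrt{\frac{k}{3t}},\qquad \phi=\frac{(k-3)\pi}{8}.$$ *)

theory Defs
  imports "HOL-Complex_Analysis.Complex_Analysis" "HOL-Library.Landau_Symbols"
begin

definition Phi :: "complex \<Rightarrow> complex" where
  "Phi q = (\<Prod>n. 1 - q ^ Suc n)"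

definition W_num :: "nat \<Rightarrow> nat \<Rightarrow> complex \<Rightarrow> complex \<Rightarrow> complex" where
  "W_num a k z q = (\<Sum>m. z ^ m * q ^ (a * m + 1) * Phi (q ^ (a * m + 1)) ^ k)"

definition W_den :: "nat \<Rightarrow> nat \<Rightarrow> complex \<Rightarrow> complex \<Rightarrow> complex" where
  "W_den a k z q = (\<Sum>m. z ^ m * q ^ (a * (m + 1)) * Phi (q ^ (a * (m + 1))) ^ k)"

text \<open>Only the behaviour on \<open>0 < |q| < 1\<close> matters. At zeros of a denominator the total division
  convention assigns some value; poles, pole orders and residues only see punctured neighbourhoods
  and do not depend on it.\<close>

definition W :: "nat \<Rightarrow> nat \<Rightarrow> nat \<Rightarrow> complex \<Rightarrow> complex" where
  "W a d k q = 1 / of_nat d * (\<Sum>z | z ^ d = 1. W_num a k z q / W_den a k z q)"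

definition calD :: "nat \<Rightarrow> complex \<Rightarrow> complex" where
  "calD k Q = (\<Sum>m. (-1) ^ m * Q ^ m * Phi (Q ^ (m + 1)) ^ k)"

definition phase :: "nat \<Rightarrow> real \<Rightarrow> real" where
  "phase k t = pi powr (3 / 2) * sqrt (real k / (3 * t))"

definition phase_shift :: "nat \<Rightarrow> real" where
  "phase_shift k = (real k - 3) * pi / 8"

definition in_phase_window :: "nat \<Rightarrow> nat \<Rightarrow> real \<Rightarrow> bool" where
  "in_phase_window k j t \<longleftrightarrow>
     0 < t \<and> \<bar>phase k t - phase_shift k - pi * (real j + 1 / 2)\<bar> < pi / 4"

definition simple_pole :: "(complex \<Rightarrow> complex) \<Rightarrow> complex \<Rightarrow> bool" where
  "simple_pole f z \<longleftrightarrow> isolated_singularity_at f z \<and> is_pole f z \<and> zorder f z = -1"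

text \<open>The zeros, in the variable \<open>q\<close>, of the \<open>z = -1\<close> denominator for dilation \<open>a\<close> that receive
  the index \<open>j\<close>. The phase is measured in \<open>t\<close> with \<open>q ^ a = exp (- t)\<close>, so that the indexing is
  common to all dilations.\<close>

definition indexed_den_zero :: "nat \<Rightarrow> nat \<Rightarrow> nat \<Rightarrow> real \<Rightarrow> bool" where
  "indexed_den_zero a k j x \<longleftrightarrow>
     (\<exists>t. in_phase_window k j t \<and> x = exp (- t / real a)) \<and> W_den a k (-1) (of_real x) = 0"

end

theory Submission
  imports Defs "HOL-Probability.Sinc_Integral" "HOL-Real_Asymp.Real_Asymp"
begin

text \<open>
  With \<open>q = exp (- t / a)\<close> and \<open>F x = exp (- x) * Phi (exp (- x)) ^ k\<close>, the denominator at \<open>z\<close> is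
  \<open>\<Sum>m. z ^ m * F ((m + 1) * t)\<close> and the numerator is \<open>\<Sum>m. z ^ m * F ((m + 1 / a) * t)\<close>. Near
  \<open>0\<close>, in a sector, \<open>F x\<close> is asymptotic to a constant times \<open>x powr (- k / 2) * exp (- c / x)\<close> with
  \<open>c = k * pi\<^sup>2 / 6\<close>. For \<open>z = exp (2 * pi * i * \<theta>)\<close> with \<open>0 < \<theta> < 1\<close>, the residue theorem turns such a
  sum into two integrals along the rays of argument \<open>pi / 4\<close> and \<open>- pi / 4\<close>, which pass through the saddle
  points belonging to the frequencies \<open>\<theta>\<close> and \<open>1 - \<theta>\<close>. For \<open>\<theta> \<noteq> 1 / 2\<close> one of them dominates
  exponentially, so that the denominator does not vanish for small \<open>t\<close>; for \<open>z = 1\<close> all terms are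
  positive. For \<open>\<theta> = 1 / 2\<close> the two contributions are conjugate and add up to a positive amplitude times
  the cosine of a phase.

  Up to a relative error \<open>O(sqrt t)\<close> the denominator at \<open>-1\<close> is therefore \<open>- A * cos (phase - phase_shift)\<close>,
  the numerator is \<open>A * cos (phase - phase_shift - pi / a)\<close>, and \<open>t * d/dt\<close> of the denominator is given by
  the same analysis applied to \<open>x * F' x\<close>. Hence every phase window far out contains exactly one zero, it
  is simple, the numerator does not vanish there, and the residue is read off from the three asymptotics.
\<close>

subsection \<open>A Laplace integral along a rotated path\<close>

text \<open>Near \<open>q = 1\<close> the size of \<open>Phi\<close> would classically come from the
  modular transformation of the eta function. Only its leading shape is needed, but uniformly in the
  sector bounded by the two rays; it is obtained by bounding a regularised logarithmic derivative
  and integrating it. The relative error has the form \<open>B * norm x * exp (B * norm x)\<close>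
  on the whole unbounded sector, so that a ray integral is compared with its saddle approximation in
  one estimate, without cutting out a neighbourhood of the saddle. The model integral has the
  exponent \<open>2 * cosh y - 2\<close>, the square of \<open>2 * sinh (y / 2)\<close>; this allows
  an exact evaluation for one particular weight and makes every other weight a perturbation.
  Asymptotic formulas may not be differentiated, yet simplicity and residues require the slope of
  the denominator. The operator \<open>x * d/dx\<close> commutes with dilations, so it turns the
  dilated sum of \<open>F\<close> into that of \<open>x * F' x\<close>, which has the same kind of
  saddle approximation with \<beta> raised by one.\<close>

lemma filterlim_Icc_indicator:
  fixes a b :: "nat \<Rightarrow> real"
  assumes "filterlim a at_bot sequentially" "filterlim b at_top sequentially"
  shows "eventually (\<lambda>n. x \<in> {a n..b n}) sequentially"
  using eventually_conj[OF filterlim_at_bot[THEN iffD1, OF assms(1), rule_format, of x]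
      filterlim_at_top[THEN iffD1, OF assms(2), rule_format, of x]] by simp

lemma continuous_imp_lborel_measurable:
  fixes f :: "real \<Rightarrow> 'a::topological_space"
  shows "continuous_on UNIV f \<Longrightarrow> f \<in> borel_measurable lborel"
  by (simp add: borel_measurable_continuous_onI)

text \<open>Dominated convergence with an arbitrary exhaustion of the line. The freedom in the
  endpoints does the work of a substitution rule: two integrals agree as soon as they are limits of
  the same increments of one primitive.\<close>

lemma primitive_tendsto_integral:
  fixes f Q :: "real \<Rightarrow> complex"
  assumes f: "integrable lborel f" and cont: "continuous_on UNIV f"
    and der: "\<And>y. (Q has_vector_derivative f y) (at y)"
    and a: "filterlim a at_bot sequentially" and b: "filterlim b at_top sequentially"
  shows "(\<lambda>n. Q (b n) - Q (a n)) \<longlonglongrightarrow> integral\<^sup>L lborel f"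
proof -
  have "(\<lambda>n. LINT x|lborel. indicator {a n..b n} x *\<^sub>R f x) \<longlonglongrightarrow> integral\<^sup>L lborel f"
  proof (rule integral_dominated_convergence[where w = "\<lambda>x. norm (f x)"])
    show "AE x in lborel. (\<lambda>n. indicator {a n..b n} x *\<^sub>R f x) \<longlonglongrightarrow> f x"
    proof (rule AE_I2)
      fix x
      have "eventually (\<lambda>n. indicator {a n..b n} x *\<^sub>R f x = f x) sequentially"
        using filterlim_Icc_indicator[OF a b, of x] by eventually_elim simp
      then show "(\<lambda>n. indicator {a n..b n} x *\<^sub>R f x) \<longlonglongrightarrow> f x"
        by (rule tendsto_eventually)
    qed
  qed (use f in \<open>auto simp: indicator_def\<close>)
  moreover have "eventually (\<lambda>n. (LINT x|lborel. indicator {a n..b n} x *\<^sub>R f x) = Q (b n) - Q (a n)) sequentially"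
    using filterlim_Icc_indicator[OF a b, of 0]
  proof eventually_elim
    case (elim n)
    then have "a n \<le> b n" by auto
    then show ?case
      by (rule integral_FTC_atLeastAtMost)
        (auto intro: has_vector_derivative_at_within der continuous_on_subset[OF cont])
  qed
  ultimately show ?thesis
    by (rule Lim_transform_eventually)
qed

lemma primitive_on_convex_open:
  assumes "open S" "convex S" "f holomorphic_on S"
  shows "\<exists>P. \<forall>z\<in>S. (P has_field_derivative f z) (at z)"
proof (rule holomorphic_convex_primitive[of S "{}" f])
  show "f field_differentiable at x" if "x \<in> interior S - {}" for x
    using that assms by (auto simp: interior_open intro: holomorphic_on_imp_differentiable_at)
  fix g assume "\<And>x. x \<in> S \<Longrightarrow> (g has_field_derivative f x) (at x within S)"
  then show "\<exists>P. \<forall>z\<in>S. (P has_field_derivative f z) (at z)"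
    using assms(1) by (metis at_within_open)
qed (use assms in \<open>auto intro: holomorphic_on_imp_continuous_on\<close>)

section \<open>Gaussian integrals along rotated lines\<close>

lemma gaussian_real:
  fixes L :: real
  assumes "L > 0"
  shows "has_bochner_integral lborel (\<lambda>u. exp (- (L * u\<^sup>2))) (sqrt (pi / L))"
proof -
  have "has_bochner_integral lborel (\<lambda>u::real. exp (- u\<^sup>2)) (2 *\<^sub>R (sqrt pi / 2))"
    by (rule has_bochner_integral_even_function[OF gaussian_moment_0]) simp
  then have "has_bochner_integral lborel (\<lambda>u. exp (- (0 + sqrt L * u)\<^sup>2)) (sqrt pi /\<^sub>R \<bar>sqrt L\<bar>)"
    using assms by (subst (asm) lborel_has_bochner_integral_real_affine_iff[where c = "sqrt L" and t = 0]) auto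
  moreover have "sqrt pi /\<^sub>R \<bar>sqrt L\<bar> = sqrt (pi / L)"
    using assms by (simp add: real_sqrt_divide field_simps)
  ultimately show ?thesis
    using assms by (simp add: power_mult_distrib)
qed

lemma norm_exp_cis_pi4:
  fixes E L :: real
  shows "norm (exp (- (cis (- pi / 4) * of_real (L * E)))) = exp (- (L / sqrt 2 * E))"
  by (simp add: norm_exp_eq_Re cos_45 real_div_sqrt field_simps)

lemma cis_pi8_square: "(cis (- pi / 8))\<^sup>2 = cis (- pi / 4)"
  by (simp add: power2_eq_square cis_mult)

lemma Re_power2_sector:
  assumes "\<bar>Im z\<bar> \<le> c * Re z" "0 \<le> c" "c < 1" "r \<le> Re z" "0 \<le> r"
  shows "(1 - c\<^sup>2) * r\<^sup>2 \<le> Re (z\<^sup>2)"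
proof -
  have "(Im z)\<^sup>2 \<le> (c * Re z)\<^sup>2"
    using assms(1) by (metis abs_ge_zero power2_abs power_mono)
  then have "(1 - c\<^sup>2) * (Re z)\<^sup>2 \<le> (Re z)\<^sup>2 - (Im z)\<^sup>2"
    by (simp add: algebra_simps power_mult_distrib)
  moreover have "(1 - c\<^sup>2) * r\<^sup>2 \<le> (1 - c\<^sup>2) * (Re z)\<^sup>2"
    using assms by (intro mult_left_mono power_mono) (auto simp: abs_square_le_1)
  ultimately show ?thesis
    by (simp add: Re_power2)
qed

text \<open>Rotation of the line of integration. Both integrals are limits of increments of one
  primitive \<open>P\<close> of \<open>exp (- z\<^sup>2)\<close>, taken along the lines through
  \<open>w\<close> and through \<open>sqrt L\<close>; the increments differ by values of
  \<open>P\<close> at points joined by segments on which \<open>exp (- z\<^sup>2)\<close> is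
  tiny.\<close>

lemma gaussian_rotated:
  fixes L :: real
  assumes "L > 0"
  shows "has_bochner_integral lborel (\<lambda>u. exp (- (cis (- pi / 4) * of_real (L * u\<^sup>2))))
           (cis (pi / 8) * of_real (sqrt (pi / L)))"
proof -
  \<comment> \<open>\<open>w\<close> is a square root of the complex coefficient, so that
    \<open>z = u * w\<close> turns the integrand into \<open>exp (- z\<^sup>2)\<close>.\<close>
  define w where "w = of_real (sqrt L) * cis (- pi / 8)"
  have w2: "w\<^sup>2 = cis (- pi / 4) * of_real L"
    unfolding w_def power_mult_distrib cis_pi8_square using assms by (simp flip: of_real_power)
  have [simp]: "w \<noteq> 0" using assms by (simp add: w_def)
  let ?f = "\<lambda>u::real. exp (- (cis (- pi / 4) * of_real (L * u\<^sup>2)))"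
  let ?g = "\<lambda>u::real. complex_of_real (exp (- (L * u\<^sup>2)))"
  have g: "has_bochner_integral lborel ?g (of_real (sqrt (pi / L)))"
    using gaussian_real[OF assms] by (rule has_bochner_integral_of_real)
  have f: "integrable lborel ?f"
  proof (rule Bochner_Integration.integrable_bound)
    show "integrable lborel (\<lambda>u. exp (- (L / sqrt 2 * u\<^sup>2)))"
      using gaussian_real[of "L / sqrt 2"] assms by (simp add: has_bochner_integral_iff)
    show "?f \<in> borel_measurable lborel" by simp
    show "AE x in lborel. norm (?f x) \<le> norm (exp (- (L / sqrt 2 * x\<^sup>2)))"
      by (rule AE_I2) (simp only: norm_exp_cis_pi4, simp)
  qed
  have "(\<lambda>z. exp (- z\<^sup>2)) holomorphic_on UNIV" by (intro holomorphic_intros)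
  from primitive_on_convex_open[OF open_UNIV convex_UNIV this]
  obtain P where P: "\<And>z::complex. (P has_field_derivative exp (- z\<^sup>2)) (at z)" by auto
  have der: "((\<lambda>u. P (of_real u * v)) has_vector_derivative (v * exp (- (of_real u * v)\<^sup>2))) (at u)" for u v
  proof -
    have "((\<lambda>z. P (z * v)) has_field_derivative (exp (- (of_real u * v)\<^sup>2) * v)) (at (of_real u))"
      by (rule DERIV_chain2[OF P]) (auto intro!: derivative_eq_intros)
    from has_vector_derivative_real_field[OF this] show ?thesis by (simp add: mult.commute)
  qed
  let ?a = "\<lambda>n. - real n" and ?b = "\<lambda>n. real n"
  have ab: "filterlim ?a at_bot sequentially" "filterlim ?b at_top sequentially"
    by (auto simp: filterlim_real_sequentially filterlim_uminus_at_top[symmetric])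
  have lim1: "(\<lambda>n. P (of_real (?b n) * w) / w - P (of_real (?a n) * w) / w) \<longlonglongrightarrow> integral\<^sup>L lborel ?f"
  proof (rule primitive_tendsto_integral[OF f _ _ ab])
    show "continuous_on UNIV ?f" by (intro continuous_intros)
    fix y
    have "((\<lambda>u. P (of_real u * w) / w) has_vector_derivative (w * exp (- (of_real y * w)\<^sup>2)) / w) (at y)"
      using has_vector_derivative_mult_left[OF der[where v = w and u = y], of "1 / w"] by simp
    then show "((\<lambda>u. P (of_real u * w) / w) has_vector_derivative ?f y) (at y)"
      by (simp add: power_mult_distrib w2 mult_ac)
  qed
  let ?s = "complex_of_real (sqrt L)"
  have s2: "?s\<^sup>2 = of_real L" using assms by (simp flip: of_real_power)
  have [simp]: "?s \<noteq> 0" using assms by simp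
  have lim2: "(\<lambda>n. P (of_real (?b n) * ?s) / ?s - P (of_real (?a n) * ?s) / ?s) \<longlonglongrightarrow> integral\<^sup>L lborel ?g"
  proof (rule primitive_tendsto_integral[OF _ _ _ ab])
    show "integrable lborel ?g" using g by (simp add: has_bochner_integral_iff)
    show "continuous_on UNIV ?g" by (intro continuous_intros)
    fix y
    have "((\<lambda>u. P (of_real u * ?s) / ?s) has_vector_derivative (?s * exp (- (of_real y * ?s)\<^sup>2)) / ?s) (at y)"
      using has_vector_derivative_mult_left[OF der[where v = ?s and u = y], of "1 / ?s"] by simp
    then show "((\<lambda>u. P (of_real u * ?s) / ?s) has_vector_derivative ?g y) (at y)"
      using assms by (simp add: power_mult_distrib s2 mult_ac exp_of_real[symmetric])
  qed
  \<comment> \<open>On the segment joining the right ends of the two paths the argument stays within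
    \<pi>/8 of the real axis and the real part is at least \<open>n * sqrt L * cos (pi/8)\<close>;
    this bounds \<open>Re (z\<^sup>2)\<close> below by \<open>K * n\<^sup>2\<close>.\<close>
  define K where "K = (1 - (tan (pi/8))\<^sup>2) * (cos (pi/8))\<^sup>2 * L"
  have c8: "0 < cos (pi/8)" "0 < sin (pi/8)" by (auto intro: cos_gt_zero sin_gt_zero)
  have t8: "0 \<le> tan (pi / 8)" "tan (pi / 8) < 1"
    using tan_monotone[of "pi/8" "pi/4"] tan_gt_zero[of "pi/8"] by (simp_all add: tan_45)
  have K: "K > 0" unfolding K_def using t8 c8 assms by (auto simp: abs_square_less_1 intro!: mult_pos_pos)
  \<comment> \<open>The sign \<open>e\<close> treats right and left ends together; since
    \<open>exp (- z\<^sup>2)\<close> is even, both reduce to the right half-plane.\<close>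
  have bound: "norm (P (e * of_real (real n) * w) - P (e * of_real (real n) * ?s)) \<le> exp (- (K * (real n)\<^sup>2)) * (real n * norm (w - ?s))"
    if e: "e = 1 \<or> e = -1" for n e
  proof -
    let ?S = "closed_segment (e * of_real (real n) * ?s) (e * of_real (real n) * w)"
    have e2: "e * e = 1" "norm e = 1" using e by auto
    have "norm (P (e * of_real (real n) * w) - P (e * of_real (real n) * ?s)) \<le> exp (- (K * (real n)\<^sup>2)) * norm (e * of_real (real n) * w - e * of_real (real n) * ?s)"
    proof (rule field_differentiable_bound[where S = ?S])
      show "(P has_field_derivative exp (- z\<^sup>2)) (at z within ?S)" for z
        by (rule has_field_derivative_at_within[OF P])
      fix z assume z: "z \<in> ?S"
      then obtain v where v: "0 \<le> v" "v \<le> 1" "z = (1 - v) *\<^sub>R (e * of_real (real n) * ?s) + v *\<^sub>R (e * of_real (real n) * w)"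
        by (auto simp: in_segment)
      define y where "y = (1 - v) *\<^sub>R (of_real (real n) * ?s) + v *\<^sub>R (of_real (real n) * w)"
      have "z = e * y" by (simp add: v y_def scaleR_conv_of_real algebra_simps)
      then have zy: "z\<^sup>2 = y\<^sup>2" by (simp add: power_mult_distrib e2 power2_eq_square)
      have cL: "0 \<le> v * (1 - cos (pi/8))" "v * (1 - cos (pi/8)) \<le> 1 - cos (pi/8)"
        using v mult_right_mono[of v 1 "1 - cos (pi/8)"] by auto
      have "cos (pi/8) \<le> (1 - v) + v * cos (pi/8)"
        using cL by (simp add: algebra_simps)
      then have Rey: "real n * sqrt L * cos (pi/8) \<le> Re y"
        unfolding y_def w_def using assms mult_left_mono[of "cos (pi/8)" "(1 - v) + v * cos (pi/8)" "real n * sqrt L"] by (simp add: algebra_simps)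
      have "\<bar>Im y\<bar> = tan (pi/8) * (real n * sqrt L * (v * cos (pi/8)))"
        unfolding y_def w_def using assms v c8 by (simp add: tan_def abs_mult)
      also have "\<dots> \<le> tan (pi/8) * Re y"
        unfolding y_def w_def using assms v t8
        by (intro mult_left_mono) (auto simp: algebra_simps intro!: mult_left_le_one_le)
      finally have "(1 - (tan (pi/8))\<^sup>2) * (real n * sqrt L * cos (pi/8))\<^sup>2 \<le> Re (y\<^sup>2)"
        using t8 Rey c8 assms by (intro Re_power2_sector) auto
      then have "K * (real n)\<^sup>2 \<le> Re (y\<^sup>2)"
        using assms by (simp add: K_def power_mult_distrib mult_ac)
      then show "norm (exp (- z\<^sup>2)) \<le> exp (- (K * (real n)\<^sup>2))"
        by (simp add: norm_exp_eq_Re zy del: Re_power2)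
    qed (auto)
    also have "norm (e * of_real (real n) * w - e * of_real (real n) * ?s) = real n * norm (w - ?s)"
      by (simp add: norm_mult e2 flip: right_diff_distrib)
    finally show ?thesis .
  qed
  have lim0: "(\<lambda>n. P (e * of_real (real n) * w) - P (e * of_real (real n) * ?s)) \<longlonglongrightarrow> 0"
    if e: "e = 1 \<or> e = -1" for e
  proof (rule Lim_null_comparison)
    show "\<forall>\<^sub>F n in sequentially. norm (P (e * of_real (real n) * w) - P (e * of_real (real n) * ?s)) \<le> exp (- (K * (real n)\<^sup>2)) * (real n * norm (w - ?s))"
      using bound[OF e] by simp
    show "(\<lambda>n. exp (- (K * (real n)\<^sup>2)) * (real n * norm (w - ?s))) \<longlonglongrightarrow> 0"
      using K by real_asymp
  qed
  have "(\<lambda>n. (P (of_real (?b n) * w) / w - P (of_real (?a n) * w) / w) * w - (P (of_real (?b n) * ?s) / ?s - P (of_real (?a n) * ?s) / ?s) * ?s) \<longlonglongrightarrow> integral\<^sup>L lborel ?f * w - integral\<^sup>L lborel ?g * ?s"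
    by (intro tendsto_diff tendsto_mult lim1 lim2 tendsto_const)
  moreover have "(\<lambda>n. (P (of_real (?b n) * w) / w - P (of_real (?a n) * w) / w) * w - (P (of_real (?b n) * ?s) / ?s - P (of_real (?a n) * ?s) / ?s) * ?s) \<longlonglongrightarrow> 0"
    using tendsto_diff[OF lim0[of 1] lim0[of "-1"]] assms by (simp add: algebra_simps)
  ultimately have "integral\<^sup>L lborel ?f * w = integral\<^sup>L lborel ?g * ?s"
    using LIMSEQ_unique by fastforce
  moreover have "integral\<^sup>L lborel ?g = of_real (sqrt (pi / L))"
    using g by (rule has_bochner_integral_integral_eq)
  moreover have "cis (pi / 8) * w = ?s" by (simp add: w_def mult_ac cis_mult)
  ultimately have "integral\<^sup>L lborel ?f * w = cis (pi / 8) * of_real (sqrt (pi / L)) * w"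
    by (simp add: mult_ac)
  then show ?thesis
    using f by (simp add: has_bochner_integral_iff)
qed

section \<open>Exponents given by the hyperbolic cosine\<close>

lemma sinh_real_ge: "(x::real) \<le> sinh x" if "x \<ge> 0" for x
proof -
  have "(\<lambda>x::real. sinh x - x) 0 \<le> (\<lambda>x::real. sinh x - x) x"
  proof (rule DERIV_nonneg_imp_nondecreasing[OF that])
    fix y :: real
    show "\<exists>z. ((\<lambda>x::real. sinh x - x) has_real_derivative z) (at y) \<and> 0 \<le> z"
      by (rule exI[of _ "cosh y - 1"]) (auto intro!: derivative_eq_intros simp: cosh_real_ge_1)
  qed
  then show ?thesis by simp
qed

lemma sinh_square_ge: "(x::real)\<^sup>2 \<le> (sinh x)\<^sup>2"
proof (cases "x \<ge> 0")
  case True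
  then show ?thesis by (intro power_mono sinh_real_ge)
next
  case False
  then have "(-x)\<^sup>2 \<le> (sinh (-x))\<^sup>2" by (intro power_mono sinh_real_ge) auto
  then show ?thesis by simp
qed

text \<open>On a ray through a saddle point the two terms of the exponent contribute
  \<open>exp y\<close> and \<open>exp (- y)\<close> with a common coefficient. This is their sum
  minus its value at the saddle \<open>y = 0\<close>.\<close>

abbreviation cosh_excess :: "real \<Rightarrow> real" where
  "cosh_excess y \<equiv> 2 * cosh y - 2"

lemma cosh_excess_sinh: "cosh_excess y = (2 * sinh (y / 2))\<^sup>2"
  using cosh_double[of "y/2"] cosh_square_eq[of "y/2"] by (simp add: power_mult_distrib)

lemma cosh_excess_ge: "y\<^sup>2 \<le> cosh_excess y"
  using sinh_square_ge[of "y/2"] by (simp add: cosh_excess_sinh power_mult_distrib power_divide)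

lemma cosh_excess_nonneg: "0 \<le> cosh_excess y"
  using cosh_real_ge_1[of y] by simp

text \<open>Completing the square: \<open>g * y \<le> g\<^sup>2 / 4 + y\<^sup>2\<close>. One unit of
  decay pays for any exponential weight.\<close>

lemma exp_linear_le_cosh_excess: "exp (g * y) \<le> exp (g\<^sup>2 / 4) * exp (cosh_excess y)"
proof -
  have "0 \<le> (y - g / 2)\<^sup>2" by simp
  then have "g * y \<le> g\<^sup>2 / 4 + y\<^sup>2" by (simp add: power2_eq_square field_simps)
  then show ?thesis using cosh_excess_ge[of y] by (simp flip: exp_add)
qed

text \<open>One unit of \<open>L\<close> absorbs \<open>exp (g * y)\<close>. The remaining
  \<open>L - 1\<close> leaves a Gaussian majorant, and \<open>L \<ge> 2\<close> lets
  \<open>L - 1\<close> be compared with \<open>L\<close>.\<close>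

lemma laplace_bound:
  fixes g L :: real
  assumes "L \<ge> 2"
  shows "integrable lborel (\<lambda>y. exp (g * y - L * cosh_excess y))"
    and "(LINT y|lborel. exp (g * y - L * cosh_excess y)) \<le> 2 * exp (g\<^sup>2 / 4) * sqrt (pi / L)"
proof -
  have G: "has_bochner_integral lborel (\<lambda>y. exp (g\<^sup>2 / 4) * exp (- ((L - 1) * y\<^sup>2))) (exp (g\<^sup>2 / 4) * sqrt (pi / (L - 1)))"
    using assms by (intro has_bochner_integral_mult_right gaussian_real) auto
  have le: "exp (g * y - L * cosh_excess y) \<le> exp (g\<^sup>2 / 4) * exp (- ((L - 1) * y\<^sup>2))" for y
  proof -
    have "exp (g * y - L * cosh_excess y) \<le> exp (g\<^sup>2 / 4) * exp (cosh_excess y) * exp (- (L * cosh_excess y))"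
      using mult_right_mono[OF exp_linear_le_cosh_excess[of g y], of "exp (- (L * cosh_excess y))"]
      by (simp flip: exp_add)
    also have "\<dots> = exp (g\<^sup>2 / 4) * exp (- ((L - 1) * cosh_excess y))"
      by (simp flip: exp_add add: algebra_simps)
    also have "\<dots> \<le> exp (g\<^sup>2 / 4) * exp (- ((L - 1) * y\<^sup>2))"
      using assms cosh_excess_ge[of y] by (intro mult_left_mono) auto
    finally show ?thesis .
  qed
  show int: "integrable lborel (\<lambda>y. exp (g * y - L * cosh_excess y))"
  proof (rule Bochner_Integration.integrable_bound)
    show "integrable lborel (\<lambda>y. exp (g\<^sup>2 / 4) * exp (- ((L - 1) * y\<^sup>2)))"
      using G by (simp add: has_bochner_integral_iff)
    show "(\<lambda>y. exp (g * y - L * cosh_excess y)) \<in> borel_measurable lborel"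
      by (intro continuous_imp_lborel_measurable continuous_intros)
    show "AE x in lborel. norm (exp (g * x - L * cosh_excess x)) \<le> norm (exp (g\<^sup>2 / 4) * exp (- ((L - 1) * x\<^sup>2)))"
      using le by (auto simp: abs_mult)
  qed
  have "(LINT y|lborel. exp (g * y - L * cosh_excess y)) \<le> (LINT y|lborel. exp (g\<^sup>2 / 4) * exp (- ((L - 1) * y\<^sup>2)))"
    by (rule integral_mono[OF int]) (use G le in \<open>auto simp: has_bochner_integral_iff\<close>)
  also have "\<dots> = exp (g\<^sup>2 / 4) * sqrt (pi / (L - 1))"
    using G by (rule has_bochner_integral_integral_eq)
  also have "sqrt (pi / (L - 1)) \<le> sqrt (4 * (pi / L))"
    using assms by (intro real_sqrt_le_mono) (simp add: field_simps)
  also have "sqrt (4 * (pi / L)) = 2 * sqrt (pi / L)"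
    unfolding real_sqrt_mult by simp
  finally show "(LINT y|lborel. exp (g * y - L * cosh_excess y)) \<le> 2 * exp (g\<^sup>2 / 4) * sqrt (pi / L)"
    by simp
qed

text \<open>The difference vanishes to second order at 0, as \<open>cosh_excess\<close> does.
  Keeping that factor, instead of a plain bound on the hyperbolic cosine, is what later yields the
  additional \<open>1 / L\<close>.\<close>

lemma cosh_diff_bound:
  fixes g y :: real
  shows "\<bar>cosh (g * y) - 1\<bar> \<le> g\<^sup>2 * exp (g\<^sup>2 / 4) * (cosh_excess y * exp (cosh_excess y))"
proof -
  have "\<bar>cosh x - 1\<bar> \<le> x\<^sup>2 * exp \<bar>x\<bar>" for x :: real
  proof -
    have "\<bar>sinh (x/2)\<bar> \<le> \<bar>x/2\<bar> * cosh (x/2)"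
    proof -
      have *: "sinh z \<le> z * cosh z" if "z \<ge> 0" for z :: real
      proof -
        have "(\<lambda>x::real. x * cosh x - sinh x) 0 \<le> (\<lambda>x::real. x * cosh x - sinh x) z"
        proof (rule DERIV_nonneg_imp_nondecreasing[OF that])
          fix y :: real assume "0 \<le> y"
          then show "\<exists>w. ((\<lambda>x::real. x * cosh x - sinh x) has_real_derivative w) (at y) \<and> 0 \<le> w"
            by (intro exI[of _ "y * sinh y"]) (auto intro!: derivative_eq_intros)
        qed
        then show ?thesis by simp
      qed
      show ?thesis
        using *[of "\<bar>x/2\<bar>"] by (cases "x \<ge> 0") (auto simp: abs_if)
    qed
    then have "(sinh (x/2))\<^sup>2 \<le> (\<bar>x/2\<bar> * cosh (x/2))\<^sup>2"
      by (metis abs_ge_zero power2_abs power_mono)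
    moreover have c: "cosh x - 1 = 2 * (sinh (x/2))\<^sup>2"
      using cosh_excess_sinh[of x] by (simp add: power_mult_distrib)
    moreover have "cosh (x/2) \<le> exp (\<bar>x\<bar>/2)"
      by (cases "x \<ge> 0") (auto simp: cosh_def field_simps)
    then have "(cosh (x/2))\<^sup>2 \<le> (exp (\<bar>x\<bar>/2))\<^sup>2" by (intro power_mono) auto
    then have "(cosh (x/2))\<^sup>2 \<le> exp \<bar>x\<bar>" by (simp flip: exp_double)
    moreover have "(\<bar>x/2\<bar> * cosh (x/2))\<^sup>2 = x\<^sup>2/4 * (cosh (x/2))\<^sup>2" by (simp add: power_mult_distrib power_divide)
    ultimately have "(sinh (x/2))\<^sup>2 \<le> x\<^sup>2/4 * exp \<bar>x\<bar>"
      using mult_left_mono[of "(cosh (x/2))\<^sup>2" "exp \<bar>x\<bar>" "x\<^sup>2/4"] by simp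
    then have "cosh x - 1 \<le> 2 * (x\<^sup>2/4 * exp \<bar>x\<bar>)" unfolding c by (simp add: mult_ac)
    also have "\<dots> \<le> x\<^sup>2 * exp \<bar>x\<bar>" by simp
    finally show ?thesis using cosh_real_ge_1[of x] by simp
  qed
  then have "\<bar>cosh (g * y) - 1\<bar> \<le> g\<^sup>2 * (y\<^sup>2 * exp (\<bar>g\<bar> * \<bar>y\<bar>))"
    by (metis abs_mult mult.assoc power_mult_distrib)
  also have "\<dots> \<le> g\<^sup>2 * (cosh_excess y * (exp (g\<^sup>2 / 4) * exp (cosh_excess y)))"
    using exp_linear_le_cosh_excess[of "\<bar>g\<bar>" "\<bar>y\<bar>"] cosh_excess_ge[of y] cosh_excess_nonneg[of y]
    by (intro mult_left_mono mult_mono) auto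
  finally show ?thesis by (simp add: mult_ac)
qed

lemma cosh_excess_integral_bound:
  fixes L :: real
  assumes "L \<ge> 6"
  shows "integrable lborel (\<lambda>y. cosh_excess y * exp (cosh_excess y) * exp (- (L * cosh_excess y)))"
    and "(LINT y|lborel. cosh_excess y * exp (cosh_excess y) * exp (- (L * cosh_excess y))) \<le> 8 / L * sqrt (pi / L)"
proof -
  let ?f = "\<lambda>y. cosh_excess y * exp (cosh_excess y) * exp (- (L * cosh_excess y))"
  have le: "?f y \<le> 2 / L * exp (0 * y - (L / 2 - 1) * cosh_excess y)" for y
  proof -
    \<comment> \<open>Half of the decay is spent on converting the factor
      \<open>cosh_excess y\<close> into \<open>2 / L\<close>.\<close>
    have "L * cosh_excess y / 2 \<le> exp (L * cosh_excess y / 2)"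
      using exp_ge_add_one_self[of "L * cosh_excess y / 2"] by linarith
    then have "cosh_excess y \<le> 2 / L * exp (L * cosh_excess y / 2)"
      using assms by (simp add: field_simps)
    then have "?f y \<le> 2 / L * exp (L * cosh_excess y / 2) * exp (cosh_excess y) * exp (- (L * cosh_excess y))"
      by (intro mult_right_mono) auto
    also have "\<dots> = 2 / L * exp (0 * y - (L / 2 - 1) * cosh_excess y)"
      by (simp add: mult.assoc flip: exp_add) (simp add: field_simps)
    finally show ?thesis .
  qed
  have L2: "L / 2 - 1 \<ge> 2" using assms by simp
  note b = laplace_bound[OF L2, of 0]
  show int: "integrable lborel ?f"
  proof (rule Bochner_Integration.integrable_bound)
    show "integrable lborel (\<lambda>y. 2 / L * exp (0 * y - (L / 2 - 1) * cosh_excess y))"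
      by (intro integrable_mult_right b)
    show "?f \<in> borel_measurable lborel"
      by (intro continuous_imp_lborel_measurable continuous_intros)
    show "AE x in lborel. norm (?f x) \<le> norm (2 / L * exp (0 * x - (L / 2 - 1) * cosh_excess x))"
    proof (rule AE_I2)
      fix x
      have "0 \<le> ?f x" using cosh_excess_nonneg[of x] by (intro mult_nonneg_nonneg) auto
      then show "norm (?f x) \<le> norm (2 / L * exp (0 * x - (L / 2 - 1) * cosh_excess x))"
        using le[of x] assms by simp
    qed
  qed
  have "integral\<^sup>L lborel ?f \<le> (LINT y|lborel. 2 / L * exp (0 * y - (L / 2 - 1) * cosh_excess y))"
    by (intro integral_mono int integrable_mult_right b le)
  also have "\<dots> = 2 / L * (LINT y|lborel. exp (0 * y - (L / 2 - 1) * cosh_excess y))"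
    by (rule integral_mult_right_zero)
  also have "\<dots> \<le> 2 / L * (2 * exp (0\<^sup>2 / 4) * sqrt (pi / (L / 2 - 1)))"
    using assms by (intro mult_left_mono b) auto
  also have "\<dots> \<le> 2 / L * (2 * (2 * sqrt (pi / L)))"
  proof -
    have "sqrt (pi / (L / 2 - 1)) \<le> sqrt (4 * (pi / L))"
      using assms by (intro real_sqrt_le_mono) (simp add: field_simps)
    also have "\<dots> = 2 * sqrt (pi / L)"
      unfolding real_sqrt_mult by simp
    finally show ?thesis using assms by (intro mult_left_mono) auto
  qed
  finally show "integral\<^sup>L lborel ?f \<le> 8 / L * sqrt (pi / L)" by simp
qed

text \<open>The weight \<open>cosh (y / 2)\<close> is the derivative of
  \<open>u = 2 * sinh (y / 2)\<close>, and the exponent is a multiple of \<open>u\<^sup>2\<close>,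
  so this integral equals a rotated Gaussian without any error term. The substitution is carried out
  by comparing increments of one primitive.\<close>

lemma cosh_half_integral:
  fixes L :: real
  assumes "L \<ge> 12"
  defines "f \<equiv> \<lambda>y. of_real (cosh (y / 2)) * exp (- (cis (- pi / 4) * of_real (L * cosh_excess y)))"
  shows "integrable lborel f" and "integral\<^sup>L lborel f = cis (pi / 8) * of_real (sqrt (pi / L))"
proof -
  have s2: "sqrt 2 \<le> 2" by (rule real_le_lsqrt) auto
  have L2: "L / sqrt 2 \<ge> 2"
    using assms(1) s2 by (simp add: field_simps)
  have contf: "continuous_on UNIV f" unfolding f_def by (intro continuous_intros) auto
  show int: "integrable lborel f"
  proof (rule Bochner_Integration.integrable_bound)
    show "integrable lborel (\<lambda>y. exp (1/2 * y - L / sqrt 2 * cosh_excess y) + exp ((-1/2) * y - L / sqrt 2 * cosh_excess y))"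
      by (intro Bochner_Integration.integrable_add laplace_bound L2)
    show "f \<in> borel_measurable lborel"
      by (intro continuous_imp_lborel_measurable contf)
    show "AE x in lborel. norm (f x) \<le> norm (exp (1/2 * x - L / sqrt 2 * cosh_excess x) + exp ((-1/2) * x - L / sqrt 2 * cosh_excess x))"
    proof (rule AE_I2)
      fix x
      have "norm (f x) = cosh (x/2) * exp (- (L / sqrt 2 * cosh_excess x))"
        unfolding f_def norm_mult norm_exp_cis_pi4 by simp
      also have "\<dots> \<le> (exp (1/2 * x) + exp ((-1/2) * x)) * exp (- (L / sqrt 2 * cosh_excess x))"
        by (intro mult_right_mono) (auto simp: cosh_def)
      also have "\<dots> = exp (1/2 * x - L / sqrt 2 * cosh_excess x) + exp ((-1/2) * x - L / sqrt 2 * cosh_excess x)"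
        by (simp add: algebra_simps flip: exp_add)
      finally show "norm (f x) \<le> norm (exp (1/2 * x - L / sqrt 2 * cosh_excess x) + exp ((-1/2) * x - L / sqrt 2 * cosh_excess x))"
        by simp
    qed
  qed
  let ?h = "\<lambda>u::real. exp (- (cis (- pi / 4) * of_real (L * u\<^sup>2)))"
  have "(\<lambda>z. exp (- (cis (- pi / 4) * (of_real L * z\<^sup>2)))) holomorphic_on UNIV" by (intro holomorphic_intros)
  from primitive_on_convex_open[OF open_UNIV convex_UNIV this]
  obtain P where P: "\<And>z. (P has_field_derivative exp (- (cis (- pi / 4) * (of_real L * z\<^sup>2)))) (at z)" by auto
  have derP: "((\<lambda>u. P (of_real u)) has_vector_derivative ?h u) (at u)" for u
    using has_vector_derivative_real_field[OF P[of "of_real u"]] by simp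
  let ?s = "\<lambda>y::real. 2 * sinh (y / 2)"
  have "((P \<circ> of_real \<circ> ?s) has_vector_derivative f y) (at y)" for y
  proof -
    have "(?s has_field_derivative cosh (y/2)) (at y)"
      by (auto intro!: derivative_eq_intros)
    then have "(?s has_vector_derivative cosh (y/2)) (at y)"
      by (simp add: has_real_derivative_iff_has_vector_derivative)
    from vector_diff_chain_at[OF this derP[of "?s y"]]
    show ?thesis by (simp add: o_def f_def cosh_excess_sinh scaleR_conv_of_real)
  qed
  then have d2: "((\<lambda>y. P (of_real (?s y))) has_vector_derivative f y) (at y)" for y
    by (simp add: o_def)
  let ?a = "\<lambda>n. - real n" and ?b = "\<lambda>n. real n"
  have ab: "filterlim ?a at_bot sequentially" "filterlim ?b at_top sequentially"
    by (auto simp: filterlim_real_sequentially filterlim_uminus_at_top[symmetric])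
  have "filterlim (\<lambda>n. ?s (real n)) at_top sequentially"
    unfolding sinh_def real_scaleR_def by real_asymp
  then have ab2: "filterlim (\<lambda>n. ?s (?a n)) at_bot sequentially" "filterlim (\<lambda>n. ?s (?b n)) at_top sequentially"
    by (auto simp: filterlim_uminus_at_top[symmetric])
  have "(\<lambda>n. P (of_real (?s (?b n))) - P (of_real (?s (?a n)))) \<longlonglongrightarrow> integral\<^sup>L lborel f"
    by (rule primitive_tendsto_integral[OF int contf d2 ab])
  moreover have "(\<lambda>n. P (of_real (?s (?b n))) - P (of_real (?s (?a n)))) \<longlonglongrightarrow> integral\<^sup>L lborel ?h"
    using gaussian_rotated[of L] assms(1)
    by (intro primitive_tendsto_integral[OF _ _ derP ab2]) (auto simp: has_bochner_integral_iff intro!: continuous_intros)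
  ultimately have "integral\<^sup>L lborel f = integral\<^sup>L lborel ?h" by (rule LIMSEQ_unique)
  also have "\<dots> = cis (pi / 8) * of_real (sqrt (pi / L))"
    using gaussian_rotated[of L] assms(1) by (simp add: has_bochner_integral_iff)
  finally show "integral\<^sup>L lborel f = cis (pi / 8) * of_real (sqrt (pi / L))" .
qed

lemma laplace_ray_integrable:
  fixes g L :: real
  assumes "L \<ge> 12"
  shows "integrable lborel (\<lambda>y. of_real (exp (g * y)) * exp (- (cis (- pi / 4) * of_real (L * cosh_excess y))))"
proof (rule Bochner_Integration.integrable_bound)
  let ?f = "\<lambda>y. of_real (exp (g * y)) * exp (- (cis (- pi / 4) * of_real (L * cosh_excess y)))"
  have "sqrt 2 \<le> 2" by (rule real_le_lsqrt) auto
  then have L2: "L / sqrt 2 \<ge> 2" using assms by (simp add: field_simps)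
  show "integrable lborel (\<lambda>y. exp (g * y - L / sqrt 2 * cosh_excess y))"
    by (intro laplace_bound L2)
  show "?f \<in> borel_measurable lborel"
    by (intro continuous_imp_lborel_measurable continuous_intros) auto
  show "AE x in lborel. norm (?f x) \<le> norm (exp (g * x - L / sqrt 2 * cosh_excess x))"
    unfolding norm_mult norm_exp_cis_pi4 by (simp flip: exp_add)
qed

text \<open>By symmetry the weight \<open>exp (g * y)\<close> may be replaced by
  \<open>cosh (g * y)\<close>, and this by the exactly integrable \<open>cosh (y / 2)\<close> up to
  a second-order error. The threshold 12 guarantees \<open>L / sqrt 2 \<ge> 6\<close>, as the bound
  for that error requires.\<close>

lemma laplace_ray:
  fixes g :: real
  obtains C where "C > 0" and "\<And>L. L \<ge> 12 \<Longrightarrow>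
    norm ((LINT y|lborel. of_real (exp (g * y)) * exp (- (cis (- pi / 4) * of_real (L * cosh_excess y))))
          - cis (pi / 8) * of_real (sqrt (pi / L))) \<le> C / L * sqrt (pi / L)"
proof -
  define K where "K = g\<^sup>2 * exp (g\<^sup>2 / 4) + (1/2)\<^sup>2 * exp ((1/2)\<^sup>2 / 4)"
  have K: "K > 0" unfolding K_def by (intro add_nonneg_pos) auto
  show ?thesis
  proof (rule that[of "K * 32"])
    show "K * 32 > 0" using K by simp
    fix L :: real assume L: "L \<ge> 12"
    define e where "e = (\<lambda>y. exp (- (cis (- pi / 4) * of_real (L * cosh_excess y))))"
    define I where "I = (\<lambda>g. LINT y|lborel. of_real (exp (g * y)) * e y)"
    have int: "integrable lborel (\<lambda>y. of_real (exp (g * y)) * e y)" for g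
      unfolding e_def using laplace_ray_integrable[OF L, of g] .
    \<comment> \<open>\<open>e\<close> is even, so reflecting \<open>y\<close> only changes the sign
      of \<open>g\<close>.\<close>
    have "I g = I (-g)"
      unfolding I_def by (subst lborel_integral_real_affine[where c = "-1" and t = 0]) (simp_all add: e_def)
    then have Ig: "I g = (I g + I (- g)) / 2" by simp
    also have "\<dots> = (LINT y|lborel. (of_real (exp (g * y)) * e y + of_real (exp (- g * y)) * e y) / 2)"
      unfolding I_def using int[of g] int[of "-g"] by (subst integral_divide_zero, subst Bochner_Integration.integral_add) auto
    also have "\<dots> = (LINT y|lborel. of_real (cosh (g * y)) * e y)"
      by (rule Bochner_Integration.integral_cong) (auto simp: cosh_def field_simps)
    finally have Igc: "I g = (LINT y|lborel. of_real (cosh (g * y)) * e y)" .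
    have intc: "integrable lborel (\<lambda>y. of_real (cosh (g * y)) * e y)"
    proof -
      have "integrable lborel (\<lambda>y. (of_real (exp (g * y)) * e y + of_real (exp (- g * y)) * e y) / 2)"
        using int[of g] int[of "-g"] by auto
      then show ?thesis
        by (rule Bochner_Integration.integrable_cong[THEN iffD1, rotated 2]) (auto simp: cosh_def field_simps)
    qed
    note h = cosh_half_integral[OF L, folded e_def]
    have "I g - cis (pi / 8) * of_real (sqrt (pi / L)) = (LINT y|lborel. of_real (cosh (g * y)) * e y - of_real (cosh (y / 2)) * e y)"
      unfolding Igc using intc h by (subst Bochner_Integration.integral_diff) (auto simp: e_def)
    also have "norm \<dots> \<le> (LINT y|lborel. norm (of_real (cosh (g * y)) * e y - of_real (cosh (y / 2)) * e y))"
      by (rule integral_norm_bound)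
    also have "\<dots> \<le> (LINT y|lborel. K * (cosh_excess y * exp (cosh_excess y) * exp (- (L / sqrt 2 * cosh_excess y))))"
    proof (rule integral_mono)
      show "integrable lborel (\<lambda>y. norm (of_real (cosh (g * y)) * e y - of_real (cosh (y / 2)) * e y))"
        using intc h by (intro integrable_norm Bochner_Integration.integrable_diff) (auto simp: e_def)
      have s2: "sqrt 2 \<le> 2" by (rule real_le_lsqrt) auto
      then have "L / sqrt 2 \<ge> 6" using L by (simp add: field_simps)
      then show "integrable lborel (\<lambda>y. K * (cosh_excess y * exp (cosh_excess y) * exp (- (L / sqrt 2 * cosh_excess y))))"
        by (intro integrable_mult_right cosh_excess_integral_bound)
      fix y
      have "norm (of_real (cosh (g * y)) * e y - of_real (cosh (y / 2)) * e y) = \<bar>cosh (g * y) - cosh (y/2)\<bar> * norm (e y)"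
        by (metis (no_types, lifting) left_diff_distrib norm_mult norm_of_real of_real_diff)
      also have "\<dots> \<le> K * (cosh_excess y * exp (cosh_excess y)) * norm (e y)"
        using cosh_diff_bound[of g y] cosh_diff_bound[of "1/2" y]
        by (intro mult_right_mono) (simp_all add: K_def algebra_simps)
      also have "norm (e y) = exp (- (L / sqrt 2 * cosh_excess y))"
        unfolding e_def by (rule norm_exp_cis_pi4)
      finally show "norm (of_real (cosh (g * y)) * e y - of_real (cosh (y / 2)) * e y) \<le> K * (cosh_excess y * exp (cosh_excess y) * exp (- (L / sqrt 2 * cosh_excess y)))"
        by (simp add: mult_ac)
    qed
    also have "\<dots> \<le> K * (8 / (L / sqrt 2) * sqrt (pi / (L / sqrt 2)))"
    proof -
      have s2: "sqrt 2 \<le> 2" by (rule real_le_lsqrt) auto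
      then have "L / sqrt 2 \<ge> 6" using L by (simp add: field_simps)
      note b = cosh_excess_integral_bound[OF this]
      show ?thesis unfolding integral_mult_right_zero using K b by (intro mult_left_mono) auto
    qed
    also have "\<dots> \<le> K * (16 / L * (2 * sqrt (pi / L)))"
    proof -
      have s2: "sqrt 2 \<le> 2" by (rule real_le_lsqrt) auto
      have "sqrt (pi / (L / sqrt 2)) \<le> sqrt (4 * (pi / L))"
        using L s2 by (intro real_sqrt_le_mono) (auto simp: field_simps)
      also have "\<dots> = 2 * sqrt (pi / L)" unfolding real_sqrt_mult by simp
      finally have "sqrt (pi / (L / sqrt 2)) \<le> 2 * sqrt (pi / L)" .
      moreover have "8 / (L / sqrt 2) \<le> 16 / L" using L s2 by (simp add: field_simps)
      ultimately show ?thesis using K L by (intro mult_left_mono mult_mono) auto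
    qed
    finally show "norm ((LINT y|lborel. of_real (exp (g * y)) * exp (- (cis (- pi / 4) * of_real (L * cosh_excess y))))
          - cis (pi / 8) * of_real (sqrt (pi / L))) \<le> K * 32 / L * sqrt (pi / L)"
      by (simp add: I_def e_def mult_ac)
  qed
qed

subsection \<open>Twisted sums as ray integrals\<close>

text \<open>The closed sector bounded by the two rays of integration, without its tip 0, where the
  functions are singular.\<close>

definition sector :: "complex set" where
  "sector = {x. 0 < Re x \<and> \<bar>Im x\<bar> \<le> Re x}"

text \<open>The exponential parametrisation makes the curve its own derivative, hence the factor
  \<open>ray \<rho> y\<close> in \<open>ray_integral\<close>. Changing \<open>\<rho>\<close> is a
  translation in \<open>y\<close>, so \<open>y = 0\<close> can be placed at the saddle.\<close>

definition ray :: "real \<Rightarrow> real \<Rightarrow> complex" where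
  "ray \<rho> y = of_real (\<rho> * exp y) * cis (pi / 4)"

text \<open>At its simple poles \<open>x = (m + s) * t\<close> the numerator of the kernel equals \<open>cis (2 * pi * \<theta>) ^ m\<close>, so
  the residues of \<open>F x * wave \<theta> s t x\<close> are the terms of a twisted sum, up to a constant factor.\<close>

definition wave :: "real \<Rightarrow> real \<Rightarrow> real \<Rightarrow> complex \<Rightarrow> complex" where
  "wave \<theta> s t x = exp (2 * of_real pi * \<i> * of_real \<theta> * (x / of_real t - of_real s))
      / (1 - exp (2 * of_real pi * \<i> * (x / of_real t - of_real s)))"

definition ray_integral :: "(complex \<Rightarrow> complex) \<Rightarrow> real \<Rightarrow> real \<Rightarrow> real \<Rightarrow> real \<Rightarrow> complex" where
  "ray_integral F \<theta> s t \<rho> = (LINT y|lborel. F (ray \<rho> y) * ray \<rho> y * wave \<theta> s t (ray \<rho> y))"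

lemma Re_ray: "Re (ray \<rho> y) = \<rho> * exp y / sqrt 2"
  and Im_ray: "Im (ray \<rho> y) = \<rho> * exp y / sqrt 2"
  and norm_ray: "\<rho> > 0 \<Longrightarrow> norm (ray \<rho> y) = \<rho> * exp y"
  by (simp_all add: ray_def cos_45 sin_45 norm_mult real_div_sqrt field_simps)

lemma ray_in_sector: "\<rho> > 0 \<Longrightarrow> ray \<rho> y \<in> sector"
  by (simp add: sector_def Re_ray Im_ray)

section \<open>Bounds, poles and symmetry of the kernel\<close>

lemma norm_exp_2pi_i:
  "norm (exp (2 * of_real pi * \<i> * of_real \<theta> * (x / of_real t - of_real s))) = exp (- (2 * pi * \<theta> * Im x / t))"
  by (simp add: norm_exp_eq_Re)

text \<open>With \<open>?q\<close> the exponential in the denominator,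
  \<open>1 / (1 - ?q) - 1 = ?q / (1 - ?q)\<close>, and
  \<open>exp (- a) / (1 - exp (- a)) \<le> 1 / a\<close>. Hence in the upper half-plane the kernel
  is a pure exponential up to a relative error \<open>t / Im x\<close>.\<close>

lemma norm_wave_upper:
  assumes "t > 0" "Im x > 0" "\<theta> \<ge> 0"
  shows "norm (wave \<theta> s t x) \<le> 1 + t / Im x"
    and "norm (wave \<theta> s t x - exp (2 * of_real pi * \<i> * of_real \<theta> * (x / of_real t - of_real s)))
           \<le> t / Im x * norm (exp (2 * of_real pi * \<i> * of_real \<theta> * (x / of_real t - of_real s)))"
proof -
  define a where "a = 2 * pi * Im x / t"
  have a: "a > 0" using assms by (simp add: a_def)
  let ?q = "exp (2 * of_real pi * \<i> * (x / of_real t - of_real s))"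
  let ?e = "exp (2 * of_real pi * \<i> * of_real \<theta> * (x / of_real t - of_real s))"
  have q: "norm ?q = exp (- a)" using norm_exp_2pi_i[of 1 x t s] by (simp add: a_def)
  have ne: "1 - exp (- a) > 0" using a by simp
  have "1 - exp (- a) \<le> norm (1 - ?q)"
    using norm_triangle_ineq2[of 1 ?q] q by simp
  then have d: "norm (1 - ?q) \<ge> 1 - exp (- a)" by simp
  then have nz: "1 - ?q \<noteq> 0" using ne by auto
  have "1 + a \<le> exp a" by simp
  then have a1: "exp (- a) / (1 - exp (- a)) \<le> 1 / a"
    using a ne by (simp add: exp_minus field_simps)
  have a2: "1 / a \<le> t / Im x"
    using assms pi_ge_two by (simp add: a_def field_simps)
  have w: "wave \<theta> s t x - ?e = ?e * (?q / (1 - ?q))"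
    using nz by (simp add: wave_def field_simps)
  have "norm (?q / (1 - ?q)) \<le> exp (- a) / (1 - exp (- a))"
    unfolding norm_divide q using d ne by (intro divide_left_mono mult_pos_pos) (auto intro: less_le_trans[OF ne])
  then have *: "norm (?q / (1 - ?q)) \<le> t / Im x" using a1 a2 by linarith
  show le: "norm (wave \<theta> s t x - ?e) \<le> t / Im x * norm ?e"
    unfolding w norm_mult using mult_left_mono[OF *, of "norm ?e"] by (simp add: mult.commute)
  have e1: "norm ?e \<le> 1"
    unfolding norm_exp_2pi_i using assms by simp
  have "norm (wave \<theta> s t x) \<le> norm ?e + norm (wave \<theta> s t x - ?e)"
    by (metis add.commute diff_add_cancel norm_triangle_ineq)
  also have "\<dots> \<le> 1 + t / Im x * 1"
    by (intro add_mono e1 order_trans[OF le] mult_left_mono) (use assms in auto)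
  finally show "norm (wave \<theta> s t x) \<le> 1 + t / Im x" by simp
qed

text \<open>Midway between two poles the exponential in the denominator is a negative real number,
  so the denominator cannot be small; for \<theta> between 0 and 1 it dominates the numerator in
  both half-planes.\<close>

lemma norm_wave_half:
  assumes "t > 0" "0 \<le> \<theta>" "\<theta> \<le> 1" "Re x = (real n + s + 1 / 2) * t"
  shows "norm (wave \<theta> s t x) \<le> 1"
proof -
  let ?q = "exp (2 * of_real pi * \<i> * (x / of_real t - of_real s))"
  define a where "a = 2 * pi * Im x / t"
  have w: "x / of_real t - of_real s = of_real (real n + 1 / 2) + \<i> * of_real (Im x / t)"
    using assms by (auto simp: complex_eq_iff field_simps)
  have "2 * of_real pi * \<i> * (x / of_real t - of_real s) = of_real (- a) + \<i> * of_real (2 * real n * pi + pi)"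
    unfolding w by (simp add: a_def complex_eq_iff algebra_simps)
  then have "?q = of_real (exp (- a)) * cis (2 * real n * pi + pi)"
    by (metis exp_add exp_of_real cis_conv_exp)
  also have "cis (2 * real n * pi + pi) = -1"
  proof -
    have "cis (2 * real n * pi + pi) = cis (2 * real n * pi) * cis pi" by (rule cis_mult[symmetric])
    also have "cis (2 * real n * pi) = 1"
      using cis_multiple_2pi[of "of_nat n"] by (simp add: mult_ac)
    finally show ?thesis by simp
  qed
  finally have "norm (1 - ?q) = norm (complex_of_real (1 + exp (- a)))" by simp
  then have q: "norm (1 - ?q) = 1 + exp (- a)" by (simp only: norm_of_real) simp
  have "exp (- (\<theta> * a)) \<le> 1 + exp (- a)"
  proof (cases "a \<ge> 0")
    case True
    then have "exp (- (\<theta> * a)) \<le> 1" using assms by simp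
    moreover have "0 < exp (- a)" by simp
    ultimately show ?thesis by linarith
  next
    case False
    then have "\<theta> * (- a) \<le> 1 * (- a)" using assms by (intro mult_right_mono) auto
    then have "exp (- (\<theta> * a)) \<le> exp (- a)" by simp
    then show ?thesis by linarith
  qed
  moreover have "norm (exp (2 * of_real pi * \<i> * of_real \<theta> * (x / of_real t - of_real s))) = exp (- (\<theta> * a))"
    unfolding norm_exp_2pi_i by (simp add: a_def)
  ultimately show ?thesis
    unfolding wave_def norm_divide q by (simp add: add_pos_pos)
qed

lemma exp_2pi_i_eq_1_iff:
  assumes "t > 0"
  shows "exp (2 * of_real pi * \<i> * (x / of_real t - of_real s)) = 1 \<longleftrightarrow> (\<exists>m::int. x = of_real ((of_int m + s) * t))"
proof -
  have "exp (2 * of_real pi * \<i> * (x / of_real t - of_real s)) = 1 \<longleftrightarrow>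
      (\<exists>m::int. Re (2 * of_real pi * \<i> * (x / of_real t - of_real s)) = 0 \<and>
         Im (2 * of_real pi * \<i> * (x / of_real t - of_real s)) = of_int (2 * m) * pi)"
    by (auto simp: exp_eq_1)
  also have "\<dots> \<longleftrightarrow> (\<exists>m::int. Im x = 0 \<and> Re x = (of_int m + s) * t)"
  proof (intro ex_cong1)
    fix m :: int
    have "Re (2 * of_real pi * \<i> * (x / of_real t - of_real s)) = - (2 * pi / t) * Im x"
      using assms by simp
    moreover have "Im (2 * of_real pi * \<i> * (x / of_real t - of_real s)) = 2 * pi * (Re x / t - s)"
      by simp
    ultimately have "Re (2 * of_real pi * \<i> * (x / of_real t - of_real s)) = 0 \<and>
         Im (2 * of_real pi * \<i> * (x / of_real t - of_real s)) = of_int (2 * m) * pi \<longleftrightarrow> Im x = 0 \<and> Re x / t - s = of_int m"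
      using assms by auto
    also have "\<dots> \<longleftrightarrow> Im x = 0 \<and> Re x = (of_int m + s) * t"
      using assms by (auto simp: field_simps)
    finally show "Re (2 * of_real pi * \<i> * (x / of_real t - of_real s)) = 0 \<and>
         Im (2 * of_real pi * \<i> * (x / of_real t - of_real s)) = of_int (2 * m) * pi \<longleftrightarrow> Im x = 0 \<and> Re x = (of_int m + s) * t" .
  qed
  also have "\<dots> \<longleftrightarrow> (\<exists>m::int. x = of_real ((of_int m + s) * t))"
    by (simp add: complex_eq_iff conj_commute)
  finally show ?thesis .
qed

lemma wave_holomorphic:
  assumes "\<And>x. x \<in> S \<Longrightarrow> exp (2 * of_real pi * \<i> * (x / of_real t - of_real s)) \<noteq> 1" "t \<noteq> 0"
  shows "wave \<theta> s t holomorphic_on S"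
proof -
  have "1 - exp (2 * of_real pi * \<i> * (x / of_real t - of_real s)) \<noteq> 0" if "x \<in> S" for x
    using assms(1)[OF that] by (metis eq_iff_diff_eq_0)
  moreover have "complex_of_real t \<noteq> 0" using assms(2) by simp
  ultimately show ?thesis
    unfolding wave_def by (intro holomorphic_intros)
qed

lemma exp_quotient_reflect:
  fixes c w :: complex
  shows "exp (- c * w) / (1 - exp (- w)) = - (exp ((1 - c) * w) / (1 - exp w))"
proof (cases "exp w = 1")
  case True
  then show ?thesis by (simp add: exp_minus)
next
  case False
  have e: "exp ((1 - c) * w) = exp w * exp (- c * w)"
    by (simp add: left_diff_distrib exp_diff exp_minus field_simps)
  have m: "exp (- w) = 1 / exp w" by (simp add: exp_minus field_simps)
  show ?thesis unfolding e m using False by (simp add: field_simps)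
qed

text \<open>Reflection in the real axis exchanges \<open>\<theta>\<close> and
  \<open>1 - \<theta>\<close>. Thus only the upper ray has to be analysed; the lower one is its
  conjugate at the complementary frequency.\<close>

lemma wave_cnj: "cnj (wave \<theta> s t (cnj x)) = - wave (1 - \<theta>) s t x"
proof -
  let ?w = "2 * of_real pi * \<i> * (x / of_real t - of_real s)"
  have "cnj (wave \<theta> s t (cnj x)) = exp (- of_real \<theta> * ?w) / (1 - exp (- ?w))"
    by (simp add: wave_def exp_cnj mult_ac)
  also have "\<dots> = - (exp ((1 - of_real \<theta>) * ?w) / (1 - exp ?w))"
    by (rule exp_quotient_reflect)
  also have "(1 - of_real \<theta>) * ?w = 2 * of_real pi * \<i> * of_real (1 - \<theta>) * (x / of_real t - of_real s)"
    unfolding of_real_diff of_real_1 by (simp only: mult_ac)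
  finally show ?thesis
    unfolding wave_def .
qed

lemma integrable_exp_neg_abs: "integrable lborel (\<lambda>y::real. exp (- \<bar>y\<bar>))"
proof (rule Bochner_Integration.integrable_bound)
  have "integrable lborel (\<lambda>x::real. inverse (1 + x^2))"
    using integrable_inverse_1_plus_square by (simp add: einterval_eq_UNIV set_integrable_def)
  then show "integrable lborel (\<lambda>x::real. 2 * inverse (1 + x^2))"
    by (rule integrable_mult_right)
  show "AE x in lborel. norm (exp (- \<bar>x\<bar>)) \<le> norm (2 * inverse (1 + (x::real)^2))"
  proof (rule AE_I2)
    fix x :: real
    have "1 + \<bar>x\<bar> + \<bar>x\<bar>\<^sup>2 / 2 \<le> exp \<bar>x\<bar>" by (rule exp_lower_Taylor_quadratic) simp
    then have "1 + x\<^sup>2 \<le> 2 * exp \<bar>x\<bar>" using abs_ge_zero[of x] by simp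
    then have "inverse (2 * exp \<bar>x\<bar>) \<le> inverse (1 + x\<^sup>2)"
      by (intro le_imp_inverse_le) (auto simp: add_pos_nonneg)
    then show "norm (exp (- \<bar>x\<bar>)) \<le> norm (2 * inverse (1 + x^2))"
      by (simp add: exp_minus add_pos_nonneg)
  qed
qed (intro continuous_imp_lborel_measurable continuous_intros)

text \<open>For integral \<open>s\<close> the kernel itself has a pole at \<open>0\<close>; hence the factor \<open>x\<close>.\<close>

lemma wave_near_0:
  assumes "t > 0"
  obtains B \<delta> where "B > 0" "\<delta> > 0" "\<And>x. 0 < norm x \<Longrightarrow> norm x < \<delta> \<Longrightarrow> norm (x * wave \<theta> s t x) \<le> B"
proof -
  let ?g = "\<lambda>x. 1 - exp (2 * of_real pi * \<i> * (x / of_real t - of_real s))"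
  let ?e = "\<lambda>x. exp (2 * of_real pi * \<i> * of_real \<theta> * (x / of_real t - of_real s))"
  have "\<exists>l. ((\<lambda>x. x * wave \<theta> s t x) \<longlongrightarrow> l) (at 0)"
  proof (cases "?g 0 = 0")
    case False
    have "((\<lambda>x. x * (?e x / ?g x)) \<longlongrightarrow> 0 * (?e 0 / ?g 0)) (at 0)"
      using False assms by (intro tendsto_intros) auto
    then show ?thesis unfolding wave_def by blast
  next
    case True
    have "(?g has_field_derivative - (2 * of_real pi * \<i> / of_real t)) (at 0)"
      using assms True by (auto intro!: derivative_eq_intros)
    then have "((\<lambda>x. (?g x - ?g 0) / (x - 0)) \<longlongrightarrow> - (2 * of_real pi * \<i> / of_real t)) (at 0)"
      by (simp add: has_field_derivative_iff)
    then have "((\<lambda>x. ?e x / (?g x / x)) \<longlongrightarrow> ?e 0 / (- (2 * of_real pi * \<i> / of_real t))) (at 0)"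
      using assms True by (intro tendsto_intros) auto
    moreover have "(\<lambda>x. ?e x / (?g x / x)) = (\<lambda>x. x * wave \<theta> s t x)"
      by (auto simp: wave_def)
    ultimately show ?thesis by auto
  qed
  then obtain l where l: "((\<lambda>x. x * wave \<theta> s t x) \<longlongrightarrow> l) (at 0)" by blast
  have "eventually (\<lambda>x. dist (x * wave \<theta> s t x) l < 1) (at 0)"
    by (rule tendstoD[OF l]) simp
  then obtain \<delta> where \<delta>: "\<delta> > 0" "\<And>x. x \<noteq> 0 \<Longrightarrow> dist x 0 < \<delta> \<Longrightarrow> dist (x * wave \<theta> s t x) l < 1"
    unfolding eventually_at by auto
  show ?thesis
  proof (rule that[of "1 + norm l" \<delta>])
    fix x :: complex assume "0 < norm x" "norm x < \<delta>"
    then have "dist (x * wave \<theta> s t x) l < 1" using \<delta>(2)[of x] by simp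
    then show "norm (x * wave \<theta> s t x) \<le> 1 + norm l"
      using norm_triangle_ineq2[of "x * wave \<theta> s t x" l] by (simp add: dist_norm)
  qed (auto simp: \<delta> add_pos_nonneg)
qed

text \<open>The denominator of the kernel has derivative \<open>- 2 * pi * i / t\<close> at each
  pole. The minus sign in front of the product compensates the sign, so that the residue theorem
  gives \<open>t\<close> times the term of the sum.\<close>

lemma residue_wave:
  fixes m :: nat
  assumes "t > 0" "s > 0" and F: "F holomorphic_on {x. 0 < Re x}"
  shows "residue (\<lambda>x. - (F x * wave \<theta> s t x)) (of_real ((real m + s) * t))
    = of_real t / (2 * of_real pi * \<i>) * (cis (2 * pi * \<theta>) ^ m * F (of_real ((real m + s) * t)))"
proof -
  define p where "p = complex_of_real ((real m + s) * t)"
  let ?g = "\<lambda>x. 1 - exp (2 * of_real pi * \<i> * (x / of_real t - of_real s))"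
  let ?e = "\<lambda>x. exp (2 * of_real pi * \<i> * of_real \<theta> * (x / of_real t - of_real s))"
  have w: "p / of_real t - of_real s = of_nat m" using assms by (simp add: p_def)
  have "cis (2 * pi * \<theta>) ^ m = cis (real m * (2 * pi * \<theta>))" by (rule Complex.DeMoivre)
  also have "\<dots> = ?e p" unfolding w cis_conv_exp by (simp add: mult_ac)
  finally have ep: "?e p = cis (2 * pi * \<theta>) ^ m" ..
  have "exp (2 * of_real pi * \<i> * (p / of_real t - of_real s)) = 1"
    unfolding exp_2pi_i_eq_1_iff[OF assms(1)] by (rule exI[of _ "int m"]) (simp add: p_def)
  then have g0: "?g p = 0" by simp
  have p: "Re p > 0" using assms by (simp add: p_def)
  have o: "open {x. 0 < Re x}" by (rule open_halfspace_Re_gt)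
  define S where "S = {x. 0 < Re x} \<inter> ball p t"
  show ?thesis unfolding p_def[symmetric]
  proof (rule residue_simple'[of S])
    show "open S" unfolding S_def using o by auto
    show "p \<in> S" unfolding S_def using p assms by auto
    show "(\<lambda>x. - (F x * wave \<theta> s t x)) holomorphic_on (S - {p})"
    proof (intro holomorphic_intros wave_holomorphic)
      show "F holomorphic_on S - {p}" by (rule holomorphic_on_subset[OF F]) (auto simp: S_def)
      fix x assume x: "x \<in> S - {p}"
      show "exp (2 * of_real pi * \<i> * (x / of_real t - of_real s)) \<noteq> 1"
      proof
        assume "exp (2 * of_real pi * \<i> * (x / of_real t - of_real s)) = 1"
        then obtain j :: int where j: "x = of_real ((of_int j + s) * t)"
          unfolding exp_2pi_i_eq_1_iff[OF assms(1)] by auto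
        have "p - x = of_real (of_int (int m - j) * t)" unfolding j p_def by (simp add: algebra_simps)
        then have "dist p x = \<bar>real_of_int (int m - j)\<bar> * t"
          using assms by (simp add: dist_norm abs_mult del: of_int_diff of_real_mult)
        moreover have "dist p x < 1 * t" using x by (simp add: S_def)
        ultimately have "\<bar>real_of_int (int m - j)\<bar> < 1" using assms by (metis mult_less_cancel_right_pos)
        then have "j = int m" by linarith
        then show False using x j by (simp add: p_def)
      qed
    qed (use assms in auto)
    have "(?g has_field_derivative - (2 * of_real pi * \<i> / of_real t)) (at p)"
      using assms g0 by (auto intro!: derivative_eq_intros)
    then have "((\<lambda>x. (?g x - ?g p) / (x - p)) \<longlongrightarrow> - (2 * of_real pi * \<i> / of_real t)) (at p)"
      by (simp add: has_field_derivative_iff)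
    moreover have "(F \<longlongrightarrow> F p) (at p)"
      using F o p by (metis (no_types, lifting) continuous_on_eq_continuous_at holomorphic_on_imp_continuous_on isCont_def mem_Collect_eq)
    ultimately have "((\<lambda>x. - (F x * (?e x / (?g x / (x - p))))) \<longlongrightarrow> - (F p * (?e p / (- (2 * of_real pi * \<i> / of_real t))))) (at p)"
      using assms g0 by (intro tendsto_intros) auto
    moreover have "(\<lambda>x. - (F x * (?e x / (?g x / (x - p))))) = (\<lambda>x. - (F x * wave \<theta> s t x) * (x - p))"
      unfolding wave_def divide_divide_eq_right by (simp add: mult.assoc)
    moreover have "- (F p * (?e p / (- (2 * of_real pi * \<i> / of_real t)))) = of_real t / (2 * of_real pi * \<i>) * (cis (2 * pi * \<theta>) ^ m * F p)"
      unfolding ep using assms by (simp add: field_simps)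
    ultimately show "((\<lambda>x. - (F x * wave \<theta> s t x) * (x - p)) \<longlongrightarrow> of_real t / (2 * of_real pi * \<i>) * (cis (2 * pi * \<theta>) ^ m * F p)) (at p)"
      by (simp only:)
  qed
qed

section \<open>From residues to ray integrals\<close>

lemma ray_wave_continuous:
  assumes F: "F holomorphic_on {x. 0 < Re x}" and "\<rho> > 0" "t > 0"
  shows "continuous_on UNIV (\<lambda>y. F (ray \<rho> y) * ray \<rho> y * wave \<theta> s t (ray \<rho> y))"
proof -
  have ray: "continuous_on UNIV (ray \<rho>)"
    unfolding ray_def by (intro continuous_intros)
  have im: "ray \<rho> ` UNIV \<subseteq> {x. 0 < Re x \<and> 0 < Im x}"
    using assms by (auto simp: Re_ray Im_ray)
  have "continuous_on {x. 0 < Re x \<and> 0 < Im x} (\<lambda>x. F x * x * wave \<theta> s t x)"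
  proof (intro holomorphic_on_imp_continuous_on holomorphic_intros wave_holomorphic)
    show "F holomorphic_on {x. 0 < Re x \<and> 0 < Im x}" by (rule holomorphic_on_subset[OF F]) auto
  qed (use assms in \<open>auto simp: exp_2pi_i_eq_1_iff\<close>)
  from continuous_on_compose2[OF this ray im] show ?thesis by simp
qed

text \<open>In \<open>r = \<rho> * exp y\<close> the assumptions say that \<open>F\<close> is
  \<open>O(r\<^sup>2)\<close> at 0 and \<open>O(1 / r\<^sup>2)\<close> at infinity. The kernel costs
  at most a factor \<open>1 + 2 * t / r\<close>, so the integrand stays below a multiple of
  \<open>min r (1 / r)\<close>, which decays exponentially in \<open>y\<close> in both
  directions.\<close>

lemma ray_wave_integrable:
  assumes F: "F holomorphic_on {x. 0 < Re x}" and "\<rho> > 0" "t > 0" "\<theta> \<ge> 0"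
    and M1: "\<And>x. x \<in> sector \<Longrightarrow> norm (F x) \<le> M * (norm x)\<^sup>2"
    and M2: "\<And>x. x \<in> sector \<Longrightarrow> norm (F x) * (norm x)\<^sup>2 \<le> M"
  shows "integrable lborel (\<lambda>y. F (ray \<rho> y) * ray \<rho> y * wave \<theta> s t (ray \<rho> y))"
proof (rule Bochner_Integration.integrable_bound)
  define K where "K = M * (1 + 2 * t) * (\<rho> + 1 / \<rho>)"
  have M: "M \<ge> 0"
    using M2[OF ray_in_sector[OF assms(2), of 0]] by (smt (verit) mult_nonneg_nonneg norm_ge_zero zero_le_power2)
  show "integrable lborel (\<lambda>y. K * exp (- \<bar>y\<bar>))"
    by (intro integrable_mult_right integrable_exp_neg_abs)
  show "(\<lambda>y. F (ray \<rho> y) * ray \<rho> y * wave \<theta> s t (ray \<rho> y)) \<in> borel_measurable lborel"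
    by (intro continuous_imp_lborel_measurable ray_wave_continuous assms)
  show "AE y in lborel. norm (F (ray \<rho> y) * ray \<rho> y * wave \<theta> s t (ray \<rho> y)) \<le> norm (K * exp (- \<bar>y\<bar>))"
  proof (rule AE_I2)
    fix y
    define r where "r = \<rho> * exp y"
    have r: "r > 0" "norm (ray \<rho> y) = r" using assms by (simp_all add: r_def norm_ray)
    have s2: "sqrt 2 \<le> 2" by (rule real_le_lsqrt) auto
    have "norm (wave \<theta> s t (ray \<rho> y)) \<le> 1 + t / Im (ray \<rho> y)"
      using assms by (intro norm_wave_upper) (auto simp: Im_ray)
    also have "t / Im (ray \<rho> y) = sqrt 2 * t / r" by (simp add: Im_ray r_def)
    also have "1 + sqrt 2 * t / r \<le> 1 + 2 * t / r"
      using assms r s2 by (intro add_left_mono divide_right_mono mult_right_mono) auto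
    finally have w: "norm (wave \<theta> s t (ray \<rho> y)) \<le> 1 + 2 * t / r" .
    have F1: "norm (F (ray \<rho> y)) \<le> M * r\<^sup>2" and F2: "norm (F (ray \<rho> y)) * r\<^sup>2 \<le> M"
      using M1[OF ray_in_sector[OF assms(2), of y]] M2[OF ray_in_sector[OF assms(2), of y]] r by auto
    have "norm (F (ray \<rho> y) * ray \<rho> y * wave \<theta> s t (ray \<rho> y)) \<le> norm (F (ray \<rho> y)) * r * (1 + 2 * t / r)"
      unfolding norm_mult r(2) using w r by (intro mult_left_mono) auto
    also have "\<dots> = norm (F (ray \<rho> y)) * (r + 2 * t)"
      using r by (simp add: field_simps)
    also have "\<dots> \<le> M * (1 + 2 * t) * min r (1 / r)"
    proof (cases "r \<le> 1")
      case True
      have "norm (F (ray \<rho> y)) * (r + 2 * t) \<le> M * r\<^sup>2 * (1 + 2 * t)"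
        using True r F1 assms M by (intro mult_mono) auto
      also have "\<dots> \<le> M * r * (1 + 2 * t)"
        using True r M assms by (intro mult_right_mono mult_left_mono) (auto simp: power2_eq_square mult_left_le_one_le)
      finally have "norm (F (ray \<rho> y)) * (r + 2 * t) \<le> M * r * (1 + 2 * t)" .
      moreover have "r \<le> 1 / r"
      proof -
        have "1 \<le> 1 / r" using True r by simp
        then show ?thesis using True by linarith
      qed
      then have "min r (1 / r) = r" by (simp add: min_def)
      ultimately show ?thesis by (simp add: mult_ac)
    next
      case False
      then have r1: "r > 1" by simp
      have "norm (F (ray \<rho> y)) \<le> M / r\<^sup>2" using F2 r by (simp add: field_simps)
      then have "norm (F (ray \<rho> y)) * (r + 2 * t) \<le> M / r\<^sup>2 * (r * (1 + 2 * t))"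
        using r1 assms M mult_right_mono[of 1 r "2 * t"] by (intro mult_mono) (auto simp: algebra_simps)
      also have "\<dots> = M * (1 + 2 * t) * (1 / r)" using r by (simp add: field_simps power2_eq_square)
      also have "1 / r = min r (1 / r)"
      proof -
        have "1 / r \<le> 1" using r1 by simp
        then show ?thesis using r1 by linarith
      qed
      finally show ?thesis .
    qed
    also have "\<dots> \<le> M * (1 + 2 * t) * ((\<rho> + 1 / \<rho>) * exp (- \<bar>y\<bar>))"
    proof (intro mult_left_mono)
      show "min r (1 / r) \<le> (\<rho> + 1 / \<rho>) * exp (- \<bar>y\<bar>)"
    proof (cases "y \<ge> 0")
      case True
      have "min r (1 / r) \<le> 1 / \<rho> * exp (- y)" by (simp add: r_def exp_minus field_simps)
      also have "\<dots> \<le> (\<rho> + 1 / \<rho>) * exp (- y)" using assms by (intro mult_right_mono) auto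
      finally show ?thesis using True by simp
    next
      case False
      have "min r (1 / r) \<le> \<rho> * exp y" by (simp add: r_def)
      also have "\<dots> \<le> (\<rho> + 1 / \<rho>) * exp y" using assms by (intro mult_right_mono) auto
      finally show ?thesis using False by simp
    qed
    qed (use M assms in auto)
    finally have "norm (F (ray \<rho> y) * ray \<rho> y * wave \<theta> s t (ray \<rho> y)) \<le> K * exp (- \<bar>y\<bar>)"
      by (simp add: K_def mult_ac)
    then show "norm (F (ray \<rho> y) * ray \<rho> y * wave \<theta> s t (ray \<rho> y)) \<le> norm (K * exp (- \<bar>y\<bar>))"
      by simp
  qed
qed

text \<open>The horizontal sides are recorded as increments of primitives on the open quadrants,
  because these can afterwards be evaluated at points of the rays instead. The right side lies
  midway between two poles, the left side before the first one.\<close>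

lemma rectangle_residues:
  fixes n :: nat
  assumes F: "F holomorphic_on {x. 0 < Re x}" and ts: "t > 0" "s > 0" "s \<le> 1"
    and f: "f = (\<lambda>x. - (F x * wave \<theta> s t x))"
    and R: "R = (real n + s + 1 / 2) * t" and \<epsilon>: "0 < \<epsilon>" "\<epsilon> < s * t"
    and Pp: "\<And>x. 0 < Re x \<Longrightarrow> 0 < Im x \<Longrightarrow> (Pp has_field_derivative f x) (at x)"
    and Pm: "\<And>x. 0 < Re x \<Longrightarrow> Im x < 0 \<Longrightarrow> (Pm has_field_derivative f x) (at x)"
  shows "of_real t * (\<Sum>m\<le>n. cis (2 * pi * \<theta>) ^ m * F (of_real ((real m + s) * t))) =
     (Pm (Complex R (- \<epsilon>)) - Pm (Complex \<epsilon> (- \<epsilon>))) + contour_integral (linepath (Complex R (- \<epsilon>)) (Complex R \<epsilon>)) f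
     + (Pp (Complex \<epsilon> \<epsilon>) - Pp (Complex R \<epsilon>)) + contour_integral (linepath (Complex \<epsilon> \<epsilon>) (Complex \<epsilon> (- \<epsilon>))) f"
    and "continuous_on (closed_segment (Complex R (- \<epsilon>)) (Complex R \<epsilon>)) f"
    and "continuous_on (closed_segment (Complex \<epsilon> \<epsilon>) (Complex \<epsilon> (- \<epsilon>))) f"
proof -
  define p where "p = (\<lambda>m::nat. complex_of_real ((real m + s) * t))"
  \<comment> \<open>\<open>R + t / 2\<close> is exactly the next pole
    \<open>(n + 1 + s) * t\<close>, so the open strip reaches up to it without containing it;
    \<open>s \<le> 1\<close> excludes poles of negative index.\<close>
  define S where "S = {x. 0 < Re x \<and> Re x < R + t / 2}"
  define c1 where "c1 = Complex \<epsilon> (- \<epsilon>)"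
  define c2 where "c2 = Complex R (- \<epsilon>)"
  define c3 where "c3 = Complex R \<epsilon>"
  define c4 where "c4 = Complex \<epsilon> \<epsilon>"
  note cs = c1_def c2_def c3_def c4_def
  have "0 \<le> real n * t" "0 < t / 2" using ts by auto
  then have "s * t < R" unfolding R distrib_right by linarith
  then have \<epsilon>R: "\<epsilon> < R" "0 < R" using \<epsilon> by auto
  have pole: "exp (2 * of_real pi * \<i> * (x / of_real t - of_real s)) \<noteq> 1" if "x \<in> S - p ` {..n}" for x
  proof
    assume "exp (2 * of_real pi * \<i> * (x / of_real t - of_real s)) = 1"
    then obtain j :: int where j: "x = of_real ((of_int j + s) * t)"
      unfolding exp_2pi_i_eq_1_iff[OF ts(1)] by auto
    from that have "0 < (of_int j + s) * t" "(of_int j + s) * t < (real n + s + 1) * t"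
      by (auto simp: S_def j R algebra_simps)
    then have "0 < of_int j + s" "of_int j + s < real n + s + 1" using ts
      by (auto simp: zero_less_mult_iff mult_less_cancel_right)
    then have "0 \<le> j" "j \<le> int n" using ts by linarith+
    then have "x = p (nat j)" "nat j \<le> n" by (auto simp: j p_def)
    then show False using that by auto
  qed
  have F': "F holomorphic_on S - p ` {..n}"
    by (rule holomorphic_on_subset[OF F]) (auto simp: S_def)
  have fS: "f holomorphic_on S - p ` {..n}"
    unfolding f by (intro holomorphic_intros wave_holomorphic F' pole) (use ts in auto)
  have box: "p m \<in> box c1 c3" if "m \<le> n" for m
  proof -
    have "s * t \<le> (real m + s) * t" using ts by (intro mult_right_mono) auto
    moreover have "(real m + s) * t < R" unfolding R using ts that by (intro mult_strict_right_mono) auto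
    ultimately show ?thesis
      using \<epsilon> by (simp add: in_box_complex_iff p_def cs)
  qed
  have cboxS: "cbox c1 c3 \<subseteq> S"
    using \<epsilon> \<epsilon>R ts by (auto simp: in_cbox_complex_iff cs S_def)
  have seg: "closed_segment c2 c3 \<subseteq> S - p ` {..n}" "closed_segment c4 c1 \<subseteq> S - p ` {..n}"
    using box \<epsilon> \<epsilon>R ts
    by (auto simp: closed_segment_same_Re cs S_def in_box_complex_iff)
  show c23: "continuous_on (closed_segment c2 c3) f" and c41: "continuous_on (closed_segment c4 c1) f"
    using holomorphic_on_imp_continuous_on[OF fS] seg by (auto intro: continuous_on_subset)
  have i12: "(f has_contour_integral (Pm c2 - Pm c1)) (linepath c1 c2)"
  proof -
    have sub: "path_image (linepath c1 c2) \<subseteq> {x. 0 < Re x \<and> Im x < 0}"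
      using \<epsilon> \<epsilon>R by (auto simp: closed_segment_same_Im closed_segment_eq_real_ivl cs)
    have "(f has_contour_integral (Pm (pathfinish (linepath c1 c2)) - Pm (pathstart (linepath c1 c2)))) (linepath c1 c2)"
      by (rule contour_integral_primitive[OF _ _ sub]) (auto intro: has_field_derivative_at_within Pm)
    then show ?thesis by simp
  qed
  have i34: "(f has_contour_integral (Pp c4 - Pp c3)) (linepath c3 c4)"
  proof -
    have sub: "path_image (linepath c3 c4) \<subseteq> {x. 0 < Re x \<and> 0 < Im x}"
      using \<epsilon> \<epsilon>R by (auto simp: closed_segment_same_Im closed_segment_eq_real_ivl cs)
    have "(f has_contour_integral (Pp (pathfinish (linepath c3 c4)) - Pp (pathstart (linepath c3 c4)))) (linepath c3 c4)"
      by (rule contour_integral_primitive[OF _ _ sub]) (auto intro: has_field_derivative_at_within Pp)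
    then show ?thesis by simp
  qed
  have i23: "(f has_contour_integral contour_integral (linepath c2 c3) f) (linepath c2 c3)"
    by (intro has_contour_integral_integral contour_integrable_continuous_linepath c23)
  have i41: "(f has_contour_integral contour_integral (linepath c4 c1) f) (linepath c4 c1)"
    by (intro has_contour_integral_integral contour_integrable_continuous_linepath c41)
  have rp: "rectpath c1 c3 = linepath c1 c2 +++ linepath c2 c3 +++ linepath c3 c4 +++ linepath c4 c1"
    by (simp add: rectpath_def Let_def cs)
  have "(f has_contour_integral ((Pm c2 - Pm c1) + (contour_integral (linepath c2 c3) f
      + ((Pp c4 - Pp c3) + contour_integral (linepath c4 c1) f)))) (rectpath c1 c3)"
    unfolding rp by (intro has_contour_integral_join i12 i23 i34 i41 valid_path_join) auto
  then have I1: "contour_integral (rectpath c1 c3) f = (Pm c2 - Pm c1) + (contour_integral (linepath c2 c3) f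
      + ((Pp c4 - Pp c3) + contour_integral (linepath c4 c1) f))"
    by (rule contour_integral_unique)
  have "contour_integral (rectpath c1 c3) f = 2 * pi * \<i> * (\<Sum>z\<in>p ` {..n}. winding_number (rectpath c1 c3) z * residue f z)"
  proof (rule Residue_theorem[of S])
    have Seq: "S = {x. 0 < Re x} \<inter> {x. Re x < R + t / 2}" by (auto simp: S_def)
    show "open S" unfolding Seq by (intro open_Int open_halfspace_Re_gt open_halfspace_Re_lt)
    show "connected S" unfolding Seq
      by (intro convex_connected convex_Int convex_halfspace_Re_gt convex_halfspace_Re_lt)
    show "path_image (rectpath c1 c3) \<subseteq> S - p ` {..n}"
      using box cboxS \<epsilon> \<epsilon>R path_image_rectpath_cbox_minus_box[of c1 c3] by (auto simp: cs)
    show "\<forall>z. z \<notin> S \<longrightarrow> winding_number (rectpath c1 c3) z = 0"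
      using cboxS \<epsilon> \<epsilon>R by (intro allI impI winding_number_rectpath_outside) (auto simp: cs)
  qed (use fS in auto)
  also have "(\<Sum>z\<in>p ` {..n}. winding_number (rectpath c1 c3) z * residue f z) = (\<Sum>z\<in>p ` {..n}. residue f z)"
    using box by (intro sum.cong refl) (auto simp: winding_number_rectpath)
  also have "\<dots> = (\<Sum>m\<le>n. residue f (p m))"
    by (subst sum.reindex) (use ts in \<open>auto simp: inj_on_def p_def\<close>)
  also have "\<dots> = (\<Sum>m\<le>n. of_real t / (2 * of_real pi * \<i>) * (cis (2 * pi * \<theta>) ^ m * F (p m)))"
    unfolding p_def f by (intro sum.cong refl residue_wave F) (use ts in auto)
  also have "2 * pi * \<i> * \<dots> = of_real t * (\<Sum>m\<le>n. cis (2 * pi * \<theta>) ^ m * F (p m))"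
    by (simp add: sum_distrib_left mult_ac)
  finally show "of_real t * (\<Sum>m\<le>n. cis (2 * pi * \<theta>) ^ m * F (of_real ((real m + s) * t))) =
     (Pm c2 - Pm c1) + contour_integral (linepath c2 c3) f
     + (Pp c4 - Pp c3) + contour_integral (linepath c4 c1) f"
    unfolding I1 p_def by (simp add: add.assoc)
qed

text \<open>No contour along the rays is formed. Rectangles supply the residues, and the primitives
  carry the horizontal sides over to the rays: the upper side becomes an increment between two
  points of the upper ray plus an increment along a vertical segment that vanishes in the limit. The
  lower side is treated likewise and conjugated.\<close>

lemma dilated_sum_ray:
  assumes F: "F holomorphic_on {x. 0 < Re x}" and ts: "t > 0" "s > 0" "s \<le> 1"
    and \<theta>: "0 < \<theta>" "\<theta> < 1" and \<rho>: "\<rho> > 0"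
    and cnjF: "\<And>x. 0 < Re x \<Longrightarrow> F (cnj x) = cnj (F x)"
    and M1: "\<And>x. x \<in> sector \<Longrightarrow> norm (F x) \<le> M * (norm x)\<^sup>2"
    and M2: "\<And>x. x \<in> sector \<Longrightarrow> norm (F x) * (norm x)\<^sup>2 \<le> M"
  shows "(\<lambda>m. cis (2 * pi * \<theta>) ^ m * F (of_real ((real m + s) * t))) sums
     ((ray_integral F \<theta> s t \<rho> + cnj (ray_integral F (1 - \<theta>) s t \<rho>)) / of_real t)"
proof -
  define f where "f = (\<lambda>x. - (F x * wave \<theta> s t x))"
  define Q1 where "Q1 = {x. 0 < Re x \<and> 0 < Im x}"
  define Q4 where "Q4 = {x. 0 < Re x \<and> Im x < 0}"
  have Q: "Q1 = {x. 0 < Re x} \<inter> {x. 0 < Im x}" "Q4 = {x. 0 < Re x} \<inter> {x. Im x < 0}"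
    by (auto simp: Q1_def Q4_def)
  have M: "M \<ge> 0"
    using M2[OF ray_in_sector[OF \<rho>, of 0]] by (smt (verit) mult_nonneg_nonneg norm_ge_zero zero_le_power2)
  have fQ: "f holomorphic_on Q1" "f holomorphic_on Q4"
    unfolding f_def
    by (intro holomorphic_intros wave_holomorphic holomorphic_on_subset[OF F];
        use ts in \<open>auto simp: Q1_def Q4_def exp_2pi_i_eq_1_iff\<close>)+
  have QQ: "open Q1" "convex Q1" "open Q4" "convex Q4"
    unfolding Q by (auto intro!: open_Int open_halfspace_Re_gt open_halfspace_Im_gt open_halfspace_Im_lt
      convex_Int convex_halfspace_Re_gt convex_halfspace_Im_gt convex_halfspace_Im_lt)
  obtain Pp where Pp: "\<And>x. x \<in> Q1 \<Longrightarrow> (Pp has_field_derivative f x) (at x)"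
    using primitive_on_convex_open[OF QQ(1,2) fQ(1)] by blast
  obtain Pm where Pm: "\<And>x. x \<in> Q4 \<Longrightarrow> (Pm has_field_derivative f x) (at x)"
    using primitive_on_convex_open[OF QQ(3,4) fQ(2)] by blast
  define u where "u = (\<lambda>\<theta> y. F (ray \<rho> y) * ray \<rho> y * wave \<theta> s t (ray \<rho> y))"
  have u: "integrable lborel (u \<theta>)" "integrable lborel (u (1 - \<theta>))"
    unfolding u_def using \<theta> by (auto intro!: ray_wave_integrable[OF F \<rho> ts(1) _ M1 M2])
  have contu: "continuous_on UNIV (u \<theta>)" for \<theta>
    unfolding u_def by (intro ray_wave_continuous F \<rho> ts)
  have Uu: "ray_integral F \<theta> s t \<rho> = integral\<^sup>L lborel (u \<theta>)" for \<theta>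
    by (simp add: ray_integral_def u_def)
  have ray_der: "(ray \<rho> has_vector_derivative ray \<rho> y) (at y)" for y
    unfolding ray_def by (auto intro!: derivative_eq_intros simp: has_vector_derivative_def scaleR_conv_of_real algebra_simps)
  have rayQ: "ray \<rho> y \<in> Q1" "cnj (ray \<rho> y) \<in> Q4" for y
    using \<rho> by (auto simp: Q1_def Q4_def Re_ray Im_ray)
  \<comment> \<open>The minus sign cancels the one in \<open>f\<close>; it agrees with the upper
    side being traversed from right to left.\<close>
  have d1: "((\<lambda>y. - Pp (ray \<rho> y)) has_vector_derivative u \<theta> y) (at y)" for y
  proof -
    have "((Pp \<circ> ray \<rho>) has_vector_derivative ray \<rho> y * f (ray \<rho> y)) (at y)"
      by (rule field_vector_diff_chain_at[OF ray_der Pp[OF rayQ(1)]])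
    from has_vector_derivative_minus[OF this] show ?thesis
      by (simp add: o_def u_def f_def mult_ac)
  qed
  have d4: "((\<lambda>y. cnj (Pm (cnj (ray \<rho> y)))) has_vector_derivative u (1 - \<theta>) y) (at y)" for y
  proof -
    have "((\<lambda>y. cnj (ray \<rho> y)) has_vector_derivative cnj (ray \<rho> y)) (at y)"
      by (rule has_vector_derivative_cnj[OF ray_der])
    from field_vector_diff_chain_at[OF this Pm[OF rayQ(2)]]
    have "((Pm \<circ> (\<lambda>y. cnj (ray \<rho> y))) has_vector_derivative cnj (ray \<rho> y) * f (cnj (ray \<rho> y))) (at y)" .
    from has_vector_derivative_cnj[OF this]
    have "((\<lambda>y. cnj (Pm (cnj (ray \<rho> y)))) has_vector_derivative ray \<rho> y * cnj (f (cnj (ray \<rho> y)))) (at y)"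
      by (simp add: o_def)
    moreover have "cnj (f (cnj (ray \<rho> y))) = F (ray \<rho> y) * wave (1 - \<theta>) s t (ray \<rho> y)"
      unfolding f_def complex_cnj_minus complex_cnj_mult wave_cnj using cnjF[of "ray \<rho> y"] rayQ(1)[of y] by (simp add: Q1_def)
    ultimately show ?thesis by (simp add: u_def mult_ac)
  qed
  define \<epsilon> where "\<epsilon> = (\<lambda>n::nat. s * t / (real n + 2))"
  define R where "R = (\<lambda>n::nat. (real n + s + 1 / 2) * t)"
  \<comment> \<open>These parameters place the ray at \<epsilon> + i\<epsilon>, a corner of the
    rectangle, and at R + iR, vertically above another corner.\<close>
  define a where "a = (\<lambda>n. ln (sqrt 2 * \<epsilon> n / \<rho>))"
  define b where "b = (\<lambda>n. ln (sqrt 2 * R n / \<rho>))"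
  have \<epsilon>: "0 < \<epsilon> n" "\<epsilon> n < s * t" for n
    using ts by (auto simp: \<epsilon>_def field_simps intro!: add_pos_nonneg)
  have R: "0 < R n" for n using ts by (auto simp: R_def intro!: mult_pos_pos add_nonneg_pos)
  have \<epsilon>R: "\<epsilon> n < R n" for n
  proof -
    have "s * t \<le> R n" unfolding R_def using ts by (intro mult_right_mono) auto
    then show ?thesis using \<epsilon>(2)[of n] by linarith
  qed
  have raya: "ray \<rho> (a n) = Complex (\<epsilon> n) (\<epsilon> n)" for n
    using \<epsilon>(1)[of n] \<rho> by (simp add: complex_eq_iff Re_ray Im_ray a_def)
  have rayb: "ray \<rho> (b n) = Complex (R n) (R n)" for n
    using R[of n] \<rho> by (simp add: complex_eq_iff Re_ray Im_ray b_def)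
  have a: "filterlim a at_bot sequentially"
    unfolding a_def \<epsilon>_def using ts \<rho> by real_asymp
  have b: "filterlim b at_top sequentially"
    unfolding b_def R_def using ts \<rho> by real_asymp
  have l1: "(\<lambda>n. - Pp (Complex (R n) (R n)) - - Pp (Complex (\<epsilon> n) (\<epsilon> n))) \<longlonglongrightarrow> ray_integral F \<theta> s t \<rho>"
    using primitive_tendsto_integral[OF u(1) contu d1 a b] by (simp only: Uu raya rayb)
  have "(\<lambda>n. cnj (Pm (cnj (Complex (R n) (R n)))) - cnj (Pm (cnj (Complex (\<epsilon> n) (\<epsilon> n))))) \<longlonglongrightarrow> ray_integral F (1 - \<theta>) s t \<rho>"
    using primitive_tendsto_integral[OF u(2) contu d4 a b] by (simp only: Uu raya rayb)
  moreover have "cnj (Complex x y) = Complex x (- y)" for x y by (simp add: complex_eq_iff)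
  ultimately have "(\<lambda>n. cnj (Pm (Complex (R n) (- R n))) - cnj (Pm (Complex (\<epsilon> n) (- \<epsilon> n)))) \<longlonglongrightarrow> ray_integral F (1 - \<theta>) s t \<rho>"
    by simp
  from tendsto_cnj[OF this]
  have l4: "(\<lambda>n. Pm (Complex (R n) (- R n)) - Pm (Complex (\<epsilon> n) (- \<epsilon> n))) \<longlonglongrightarrow> cnj (ray_integral F (1 - \<theta>) s t \<rho>)"
    by simp
  have fb: "norm (f x) \<le> M / (R n)\<^sup>2" if "Re x = R n" "\<bar>Im x\<bar> \<le> R n" for x n
  proof -
    have x: "x \<in> sector" using that R[of n] by (simp add: sector_def)
    have "norm (F x) * (R n)\<^sup>2 \<le> norm (F x) * (norm x)\<^sup>2"
      using that R[of n] complex_Re_le_cmod[of x] by (intro mult_left_mono power_mono) auto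
    then have "norm (F x) \<le> M / (R n)\<^sup>2" using M2[OF x] R[of n] by (simp add: field_simps)
    moreover have "norm (wave \<theta> s t x) \<le> 1"
      by (rule norm_wave_half[where n = n]) (use ts \<theta> that in \<open>auto simp: R_def\<close>)
    ultimately have "norm (F x) * norm (wave \<theta> s t x) \<le> M / (R n)\<^sup>2 * 1"
      using M by (intro mult_mono) auto
    then show ?thesis by (simp add: f_def norm_mult)
  qed
  have MR: "M / (R n)\<^sup>2 \<ge> 0" for n using M by simp
  have e1: "norm (Pp (Complex (R n) (R n)) - Pp (Complex (R n) (\<epsilon> n))) \<le> M / (R n)\<^sup>2 * R n" for n
  proof -
    have "norm (Pp (Complex (R n) (R n)) - Pp (Complex (R n) (\<epsilon> n))) \<le> M / (R n)\<^sup>2 * norm (Complex (R n) (R n) - Complex (R n) (\<epsilon> n))"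
    proof (rule field_differentiable_bound[where S = "closed_segment (Complex (R n) (\<epsilon> n)) (Complex (R n) (R n))"])
      fix z assume z: "z \<in> closed_segment (Complex (R n) (\<epsilon> n)) (Complex (R n) (R n))"
      then have z': "Re z = R n" "\<epsilon> n \<le> Im z" "Im z \<le> R n"
        using \<epsilon>R[of n] by (auto simp: closed_segment_same_Re closed_segment_eq_real_ivl split: if_splits)
      then show "(Pp has_field_derivative f z) (at z within closed_segment (Complex (R n) (\<epsilon> n)) (Complex (R n) (R n)))"
        using R[of n] \<epsilon>(1)[of n] by (intro has_field_derivative_at_within[OF Pp]) (auto simp: Q1_def)
      show "norm (f z) \<le> M / (R n)\<^sup>2" using z' \<epsilon>(1)[of n] by (intro fb) auto
    qed auto
    also have "norm (Complex (R n) (R n) - Complex (R n) (\<epsilon> n)) = R n - \<epsilon> n"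
      using \<epsilon>R[of n] by (simp add: cmod_def)
    also have "M / (R n)\<^sup>2 * (R n - \<epsilon> n) \<le> M / (R n)\<^sup>2 * R n"
      using \<epsilon>(1)[of n] MR[of n] by (intro mult_left_mono) auto
    finally show ?thesis .
  qed
  have e4: "norm (Pm (Complex (R n) (- R n)) - Pm (Complex (R n) (- \<epsilon> n))) \<le> M / (R n)\<^sup>2 * R n" for n
  proof -
    have "norm (Pm (Complex (R n) (- R n)) - Pm (Complex (R n) (- \<epsilon> n))) \<le> M / (R n)\<^sup>2 * norm (Complex (R n) (- R n) - Complex (R n) (- \<epsilon> n))"
    proof (rule field_differentiable_bound[where S = "closed_segment (Complex (R n) (- R n)) (Complex (R n) (- \<epsilon> n))"])
      fix z assume z: "z \<in> closed_segment (Complex (R n) (- R n)) (Complex (R n) (- \<epsilon> n))"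
      then have z': "Re z = R n" "Im z \<le> - \<epsilon> n" "- R n \<le> Im z"
        using \<epsilon>R[of n] by (auto simp: closed_segment_same_Re closed_segment_eq_real_ivl split: if_splits)
      then show "(Pm has_field_derivative f z) (at z within closed_segment (Complex (R n) (- R n)) (Complex (R n) (- \<epsilon> n)))"
        using R[of n] \<epsilon>(1)[of n] by (intro has_field_derivative_at_within[OF Pm]) (auto simp: Q4_def)
      show "norm (f z) \<le> M / (R n)\<^sup>2" using z' \<epsilon>(1)[of n] by (intro fb) auto
    qed auto
    also have "norm (Complex (R n) (- R n) - Complex (R n) (- \<epsilon> n)) = R n - \<epsilon> n"
      using \<epsilon>R[of n] by (simp add: cmod_def)
    also have "M / (R n)\<^sup>2 * (R n - \<epsilon> n) \<le> M / (R n)\<^sup>2 * R n"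
      using \<epsilon>(1)[of n] MR[of n] by (intro mult_left_mono) auto
    finally show ?thesis .
  qed
  have MR0: "(\<lambda>n. M / (R n)\<^sup>2 * R n) \<longlonglongrightarrow> 0"
    unfolding R_def using ts by real_asymp
  have E1: "(\<lambda>n. Pp (Complex (R n) (R n)) - Pp (Complex (R n) (\<epsilon> n))) \<longlonglongrightarrow> 0"
    by (rule Lim_null_comparison[OF always_eventually MR0]) (use e1 in auto)
  have E4: "(\<lambda>n. Pm (Complex (R n) (- R n)) - Pm (Complex (R n) (- \<epsilon> n))) \<longlonglongrightarrow> 0"
    by (rule Lim_null_comparison[OF always_eventually MR0]) (use e4 in auto)
  have Rn: "R n = (real n + s + 1 / 2) * t" for n by (simp add: R_def)
  have Pp': "0 < Re x \<Longrightarrow> 0 < Im x \<Longrightarrow> (Pp has_field_derivative f x) (at x)"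
    and Pm': "0 < Re x \<Longrightarrow> Im x < 0 \<Longrightarrow> (Pm has_field_derivative f x) (at x)" for x
    using Pp Pm by (auto simp: Q1_def Q4_def)
  have rect1: "of_real t * (\<Sum>m\<le>n. cis (2 * pi * \<theta>) ^ m * F (of_real ((real m + s) * t))) =
     (Pm (Complex (R n) (- \<epsilon> n)) - Pm (Complex (\<epsilon> n) (- \<epsilon> n))) + contour_integral (linepath (Complex (R n) (- \<epsilon> n)) (Complex (R n) (\<epsilon> n))) f
     + (Pp (Complex (\<epsilon> n) (\<epsilon> n)) - Pp (Complex (R n) (\<epsilon> n))) + contour_integral (linepath (Complex (\<epsilon> n) (\<epsilon> n)) (Complex (\<epsilon> n) (- \<epsilon> n))) f" for n
    by (rule rectangle_residues(1)[OF F ts f_def Rn \<epsilon> Pp' Pm'])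
  have rect2: "continuous_on (closed_segment (Complex (R n) (- \<epsilon> n)) (Complex (R n) (\<epsilon> n))) f" for n
    by (rule rectangle_residues(2)[OF F ts f_def Rn \<epsilon> Pp' Pm'])
  have rect3: "continuous_on (closed_segment (Complex (\<epsilon> n) (\<epsilon> n)) (Complex (\<epsilon> n) (- \<epsilon> n))) f" for n
    by (rule rectangle_residues(3)[OF F ts f_def Rn \<epsilon> Pp' Pm'])
  have E2: "(\<lambda>n. contour_integral (linepath (Complex (R n) (- \<epsilon> n)) (Complex (R n) (\<epsilon> n))) f) \<longlonglongrightarrow> 0"
  proof (rule Lim_null_comparison[OF always_eventually])
    show "(\<lambda>n. M / (R n)\<^sup>2 * (2 * R n)) \<longlonglongrightarrow> 0"
      unfolding R_def using ts by real_asymp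
    show "\<forall>n. norm (contour_integral (linepath (Complex (R n) (- \<epsilon> n)) (Complex (R n) (\<epsilon> n))) f) \<le> M / (R n)\<^sup>2 * (2 * R n)"
    proof
      fix n
      have "norm (contour_integral (linepath (Complex (R n) (- \<epsilon> n)) (Complex (R n) (\<epsilon> n))) f) \<le> M / (R n)\<^sup>2 * norm (Complex (R n) (\<epsilon> n) - Complex (R n) (- \<epsilon> n))"
      proof (rule contour_integral_bound_linepath[OF contour_integrable_continuous_linepath[OF rect2] MR])
        fix x assume "x \<in> closed_segment (Complex (R n) (- \<epsilon> n)) (Complex (R n) (\<epsilon> n))"
        then have "Re x = R n" "\<bar>Im x\<bar> \<le> \<epsilon> n"
          using \<epsilon>[of n] by (auto simp: closed_segment_same_Re closed_segment_eq_real_ivl split: if_splits)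
        then show "norm (f x) \<le> M / (R n)\<^sup>2" using \<epsilon>R[of n] by (intro fb) auto
      qed
      also have "norm (Complex (R n) (\<epsilon> n) - Complex (R n) (- \<epsilon> n)) = 2 * \<epsilon> n"
        using \<epsilon>(1)[of n] by (simp add: cmod_def real_sqrt_mult)
      also have "M / (R n)\<^sup>2 * (2 * \<epsilon> n) \<le> M / (R n)\<^sup>2 * (2 * R n)"
        using \<epsilon>R[of n] MR[of n] by (intro mult_left_mono) auto
      finally show "norm (contour_integral (linepath (Complex (R n) (- \<epsilon> n)) (Complex (R n) (\<epsilon> n))) f) \<le> M / (R n)\<^sup>2 * (2 * R n)" .
    qed
  qed
  \<comment> \<open>The left side shrinks to 0, where the kernel may have a pole. The bound on
    \<open>x * wave \<theta> s t x\<close> together with the quadratic bound on \<open>F\<close>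
    keeps the integrand bounded there.\<close>
  obtain B \<delta> where B: "B > 0" "\<delta> > 0" "\<And>x. 0 < norm x \<Longrightarrow> norm x < \<delta> \<Longrightarrow> norm (x * wave \<theta> s t x) \<le> B"
    using wave_near_0[OF ts(1)] by metis
  have \<epsilon>0: "\<epsilon> \<longlonglongrightarrow> 0" unfolding \<epsilon>_def using ts by real_asymp
  have E3: "(\<lambda>n. contour_integral (linepath (Complex (\<epsilon> n) (\<epsilon> n)) (Complex (\<epsilon> n) (- \<epsilon> n))) f) \<longlonglongrightarrow> 0"
  proof (rule Lim_null_comparison)
    show "(\<lambda>n. M * \<delta> * B * (2 * \<epsilon> n)) \<longlonglongrightarrow> 0"
      using tendsto_mult_right[OF \<epsilon>0, of "M * \<delta> * B * 2"] by (simp add: mult_ac)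
    have "eventually (\<lambda>n. \<epsilon> n < \<delta> / 2) sequentially"
      using order_tendstoD(2)[OF \<epsilon>0, of "\<delta> / 2"] B by simp
    then show "\<forall>\<^sub>F n in sequentially. norm (contour_integral (linepath (Complex (\<epsilon> n) (\<epsilon> n)) (Complex (\<epsilon> n) (- \<epsilon> n))) f) \<le> M * \<delta> * B * (2 * \<epsilon> n)"
    proof eventually_elim
      case (elim n)
      have "norm (contour_integral (linepath (Complex (\<epsilon> n) (\<epsilon> n)) (Complex (\<epsilon> n) (- \<epsilon> n))) f) \<le> M * \<delta> * B * norm (Complex (\<epsilon> n) (- \<epsilon> n) - Complex (\<epsilon> n) (\<epsilon> n))"
      proof (rule contour_integral_bound_linepath[OF contour_integrable_continuous_linepath[OF rect3]])
        show "0 \<le> M * \<delta> * B" using M B by auto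
        fix x assume "x \<in> closed_segment (Complex (\<epsilon> n) (\<epsilon> n)) (Complex (\<epsilon> n) (- \<epsilon> n))"
        then have x: "Re x = \<epsilon> n" "\<bar>Im x\<bar> \<le> \<epsilon> n"
          using \<epsilon>[of n] by (auto simp: closed_segment_same_Re closed_segment_eq_real_ivl split: if_splits)
        then have xc: "x \<in> sector" using \<epsilon>(1)[of n] by (auto simp: sector_def)
        have nx: "0 < norm x" "norm x < \<delta>"
          using x \<epsilon>(1)[of n] elim cmod_le[of x] by (auto simp: complex_eq_iff)
        have "norm (F x * wave \<theta> s t x) \<le> M * (norm x)\<^sup>2 * norm (wave \<theta> s t x)"
          unfolding norm_mult by (intro mult_right_mono M1[OF xc]) auto
        also have "\<dots> = M * norm x * norm (x * wave \<theta> s t x)"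
          by (simp add: norm_mult power2_eq_square)
        also have "\<dots> \<le> M * \<delta> * B"
          using nx M B by (intro mult_mono B(3)) auto
        finally show "norm (f x) \<le> M * \<delta> * B" by (simp add: f_def)
      qed
      also have "norm (Complex (\<epsilon> n) (- \<epsilon> n) - Complex (\<epsilon> n) (\<epsilon> n)) = 2 * \<epsilon> n"
        using \<epsilon>(1)[of n] by (simp add: cmod_def real_sqrt_mult)
      finally show ?case .
    qed
  qed
  have "(\<lambda>n. of_real t * (\<Sum>m\<le>n. cis (2 * pi * \<theta>) ^ m * F (of_real ((real m + s) * t)))) \<longlonglongrightarrow>
     ray_integral F \<theta> s t \<rho> + cnj (ray_integral F (1 - \<theta>) s t \<rho>)"
    unfolding rect1
    using tendsto_add[OF tendsto_add[OF tendsto_add[OF l1 l4] tendsto_diff[OF E1 E4]] tendsto_add[OF E2 E3]]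
    by (simp add: algebra_simps)
  from tendsto_divide[OF this tendsto_const[of "complex_of_real t"]]
  show ?thesis
    unfolding sums_def_le using ts by simp
qed

subsection \<open>Saddle-point asymptotics\<close>

text \<open>The function \<open>x powr (- \<beta>) * exp (- c / x)\<close> with the principal branch
  of the power, written as one exponential so that exponents can be added.\<close>

definition saddle :: "real \<Rightarrow> real \<Rightarrow> complex \<Rightarrow> complex" where
  "saddle \<beta> c x = exp (- of_real \<beta> * Ln x - of_real c / x)"

lemma ray_eq_exp:
  assumes "\<rho> > 0"
  shows "ray \<rho> y = exp (of_real (ln \<rho> + y) + \<i> * of_real (pi / 4))"
proof -
  have "complex_of_real (\<rho> * exp y) = exp (of_real (ln \<rho> + y))"
    unfolding exp_of_real using assms by (simp add: exp_add)
  then show ?thesis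
    unfolding ray_def cis_conv_exp exp_add by simp
qed

lemma Ln_ray: "\<rho> > 0 \<Longrightarrow> Ln (ray \<rho> y) = of_real (ln \<rho> + y) + \<i> * of_real (pi / 4)"
  unfolding ray_eq_exp by (rule Ln_exp) auto

text \<open>The two relations on \<open>L\<close> balance the terms \<open>c / x\<close> and
  \<open>2 * pi * \<theta> * x / t\<close> at \<open>y = 0\<close>. Both then have the coefficient
  \<open>L * cis (- pi / 4)\<close> in modulus and direction and combine to a multiple of
  \<open>cosh y\<close>. The value at the saddle,
  \<open>2 * L * cis (- pi / 4) = sqrt 2 * L * (1 - i)\<close>, splits into the decay
  \<open>exp (- (sqrt 2 * L))\<close> and the equally large phase \<open>sqrt 2 * L\<close>.\<close>

lemma saddle_on_ray:
  assumes \<rho>: "\<rho> > 0" and L1: "c = L * \<rho>" and L2: "2 * pi * \<theta> * \<rho> = L * t" and t: "t > 0"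
  shows "saddle \<beta> c (ray \<rho> y) * ray \<rho> y * exp (2 * of_real pi * \<i> * of_real \<theta> * (ray \<rho> y / of_real t - of_real s)) =
    of_real (\<rho> powr (1 - \<beta>) * exp (- (sqrt 2 * L))) * cis ((1 - \<beta>) * pi / 4 - 2 * pi * \<theta> * s + sqrt 2 * L)
     * (of_real (exp ((1 - \<beta>) * y)) * exp (- (cis (- pi / 4) * of_real (L * (2 * cosh y - 2)))))"
proof -
  note r = ray_eq_exp[OF \<rho>, of y]
  have c: "of_real c / ray \<rho> y = of_real (L * exp (- y)) * cis (- pi / 4)"
  proof -
    have "of_real (L * exp (- y)) * cis (- pi / 4) * ray \<rho> y = of_real (L * exp (- y) * (\<rho> * exp y)) * (cis (- pi / 4) * cis (pi / 4))"
      unfolding ray_def of_real_mult by (simp only: mult_ac)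
    also have "\<dots> = of_real c"
      by (simp add: cis_mult L1 exp_minus)
    finally show ?thesis
      using r by (metis exp_not_eq_zero nonzero_eq_divide_eq)
  qed
  have th: "\<theta> = L * t / (2 * pi * \<rho>)" using \<rho> L2 by (simp add: field_simps)
  have i: "\<i> * cis (pi / 4) = - cis (- pi / 4)"
    by (simp add: complex_eq_iff cos_45 sin_45)
  have "2 * of_real pi * \<i> * of_real \<theta> * (ray \<rho> y / of_real t) = (of_real (2 * pi * \<theta> * \<rho> / t * exp y)) * (\<i> * cis (pi / 4))"
    by (simp add: ray_def)
  also have "2 * pi * \<theta> * \<rho> / t = L" using t by (simp add: L2)
  finally have e: "2 * of_real pi * \<i> * of_real \<theta> * (ray \<rho> y / of_real t) = - (of_real (L * exp y) * cis (- pi / 4))"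
    unfolding i by simp
  have cc: "cis (- pi / 4) * of_real (2 * L) = of_real (sqrt 2 * L) - \<i> * of_real (sqrt 2 * L)"
    by (simp add: complex_eq_iff cos_45 sin_45)
  have "saddle \<beta> c (ray \<rho> y) * ray \<rho> y * exp (2 * of_real pi * \<i> * of_real \<theta> * (ray \<rho> y / of_real t - of_real s)) =
     exp (- of_real \<beta> * (of_real (ln \<rho> + y) + \<i> * of_real (pi / 4)) - of_real (L * exp (- y)) * cis (- pi / 4)
        + (of_real (ln \<rho> + y) + \<i> * of_real (pi / 4))
        + (- (of_real (L * exp y) * cis (- pi / 4)) - 2 * of_real pi * \<i> * of_real \<theta> * of_real s))"
    unfolding saddle_def Ln_ray[OF \<rho>] c right_diff_distrib e by (simp only: exp_add r)
  also have "- of_real \<beta> * (of_real (ln \<rho> + y) + \<i> * of_real (pi / 4)) - of_real (L * exp (- y)) * cis (- pi / 4)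
        + (of_real (ln \<rho> + y) + \<i> * of_real (pi / 4))
        + (- (of_real (L * exp y) * cis (- pi / 4)) - 2 * of_real pi * \<i> * of_real \<theta> * of_real s) =
     of_real ((1 - \<beta>) * ln \<rho>) + of_real ((1 - \<beta>) * y) + \<i> * of_real ((1 - \<beta>) * pi / 4 - 2 * pi * \<theta> * s)
       - cis (- pi / 4) * of_real (L * (exp y + exp (- y)))"
    by (simp add: algebra_simps diff_divide_distrib)
  also have "L * (exp y + exp (- y)) = L * (2 * cosh y - 2) + 2 * L"
    by (simp add: cosh_def algebra_simps)
  also have "of_real ((1 - \<beta>) * ln \<rho>) + of_real ((1 - \<beta>) * y) + \<i> * of_real ((1 - \<beta>) * pi / 4 - 2 * pi * \<theta> * s)
       - cis (- pi / 4) * of_real (L * (2 * cosh y - 2) + 2 * L) =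
     of_real ((1 - \<beta>) * ln \<rho>) + of_real (- (sqrt 2 * L)) + (\<i> * of_real ((1 - \<beta>) * pi / 4 - 2 * pi * \<theta> * s + sqrt 2 * L))
       + of_real ((1 - \<beta>) * y) + - (cis (- pi / 4) * of_real (L * (2 * cosh y - 2)))"
    using cc by (simp add: algebra_simps)
  also have "exp \<dots> = of_real (\<rho> powr (1 - \<beta>) * exp (- (sqrt 2 * L))) * cis ((1 - \<beta>) * pi / 4 - 2 * pi * \<theta> * s + sqrt 2 * L)
     * (of_real (exp ((1 - \<beta>) * y)) * exp (- (cis (- pi / 4) * of_real (L * (2 * cosh y - 2)))))"
    using \<rho> unfolding exp_add exp_of_real cis_conv_exp by (simp add: powr_def)
  finally show ?thesis .
qed

lemma error_terms_collect:
  fixes r :: real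
  assumes "r \<noteq> 0"
  shows "(B * r * X * S) * r * ((1 + 2 * t / r) * E) + k * S * r * (2 * t / r * E) * X
    = S * r * E * (X * (B * r + 2 * B * t + 2 * k * t / r))"
  using assms by (simp add: field_simps)

lemma error_terms_expand:
  fixes \<rho> Y :: real
  assumes "\<rho> \<noteq> 0" "Y \<noteq> 0"
  shows "q * (B * (\<rho> * Y) + 2 * B * t + 2 * k * t / (\<rho> * Y))
    = B * \<rho> * (q * Y) + 2 * B * t * q + 2 * k * (t / \<rho>) * (q * inverse Y)"
  using assms by (simp add: field_simps)

lemma error_terms_factor:
  fixes p :: real
  shows "p * E * X * (B * \<rho> * (4 * e2 * S) + 2 * B * t * (4 * e1 * S) + 2 * k * u * (4 * e0 * S))
    = p * S * E * (4 * X * (B * e2 * \<rho> + 2 * B * e1 * t + 2 * k * e0 * u))"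
  by (simp add: algebra_simps)

text \<open>Three errors are added: the Laplace integral against its main term, \<open>F\<close>
  against its saddle model, and the kernel against a pure exponential. For
  \<open>\<rho> \<le> 1\<close> the growth \<open>exp (B * norm x)\<close> is bounded through
  \<open>norm x \<le> 2 * cosh y\<close>, so it only lowers the coefficient of the decay by
  \<open>B\<close>.\<close>

lemma ray_asymptotic_fixed:
  fixes g L :: real
  assumes \<rho>: "0 < \<rho>" "\<rho> \<le> 1" and L1: "c = L * \<rho>" and L2: "2 * pi * \<theta> * \<rho> = L * t" and t: "t > 0" and \<theta>: "\<theta> > 0"
    and \<kappa>: "\<kappa> \<ge> 0" and B: "B \<ge> 0" and L: "L \<ge> 12" "L \<ge> 4 * B + 8"
    and int: "integrable lborel (\<lambda>y. F (ray \<rho> y) * ray \<rho> y * wave \<theta> s t (ray \<rho> y))"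
    and F: "\<And>x. x \<in> sector \<Longrightarrow> norm (F x - of_real \<kappa> * saddle \<beta> c x) \<le> B * norm x * exp (B * norm x) * norm (saddle \<beta> c x)"
    and C0: "norm ((LINT y|lborel. of_real (exp ((1 - \<beta>) * y)) * exp (- (cis (- pi / 4) * of_real (L * (2 * cosh y - 2)))))
          - cis (pi / 8) * of_real (sqrt (pi / L))) \<le> C0 / L * sqrt (pi / L)"
  defines "A \<equiv> \<rho> powr (1 - \<beta>) * sqrt (pi / L) * exp (- (sqrt 2 * L))"
  shows "norm (ray_integral F \<theta> s t \<rho> - of_real (\<kappa> * A) * cis ((1 - \<beta>) * pi / 4 + pi / 8 - 2 * pi * \<theta> * s + sqrt 2 * L))
     \<le> A * (\<kappa> * C0 / L + 4 * exp (2 * B) * (B * exp ((2 - \<beta>)\<^sup>2 / 4) * \<rho> + 2 * B * exp ((1 - \<beta>)\<^sup>2 / 4) * t + 2 * \<kappa> * exp (\<beta>\<^sup>2 / 4) * (t / \<rho>)))"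
proof -
  define P where "P = of_real (\<rho> powr (1 - \<beta>) * exp (- (sqrt 2 * L))) * cis ((1 - \<beta>) * pi / 4 - 2 * pi * \<theta> * s + sqrt 2 * L)"
  define N where "N = \<rho> powr (1 - \<beta>) * exp (- (sqrt 2 * L))"
  have N: "N > 0" using \<rho> by (simp add: N_def)
  have normP: "norm P = N" unfolding P_def N_def norm_mult norm_of_real norm_cis using \<rho> by simp
  define h where "h = (\<lambda>y. of_real (exp ((1 - \<beta>) * y)) * exp (- (cis (- pi / 4) * of_real (L * (2 * cosh y - 2)))))"
  define e where "e = (\<lambda>x. exp (2 * of_real pi * \<i> * of_real \<theta> * (x / of_real t - of_real s)))"
  define f where "f = (\<lambda>y. F (ray \<rho> y) * ray \<rho> y * wave \<theta> s t (ray \<rho> y))"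
  \<comment> \<open>The decay rate left after paying \<open>B\<close>;
    \<open>L \<ge> 4 * B + 8\<close> keeps it at least \<open>L / 4\<close> and at least 2.\<close>
  define K where "K = L / sqrt 2 - B"
  have s2: "sqrt 2 \<le> 3 / 2" by (rule real_le_lsqrt) (auto simp: power2_eq_square)
  have s2': "1 < sqrt 2" by simp
  have "L * sqrt 2 \<le> L * (3/2)" using s2 L by (intro mult_left_mono) auto
  then have "L / 2 \<le> L / sqrt 2" using L s2' by (simp add: field_simps)
  then have K: "K \<ge> L / 4" "K \<ge> 2" unfolding K_def using L B by linarith+
  have hP: "saddle \<beta> c (ray \<rho> y) * ray \<rho> y * e (ray \<rho> y) = P * h y" for y
    unfolding e_def P_def h_def by (rule saddle_on_ray[OF \<rho>(1) L1 L2 t])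
  have inth: "integrable lborel h"
    unfolding h_def by (rule laplace_ray_integrable[OF L(1)])
  have normh: "norm (h y) = exp ((1 - \<beta>) * y) * exp (- (L / sqrt 2 * (2 * cosh y - 2)))" for y
    unfolding h_def norm_mult norm_exp_cis_pi4 by simp
  \<comment> \<open>Powers of \<open>norm x = \<rho> * exp y\<close> shift the parameter
    \<open>g\<close>, so all error terms are integrals of this one family.\<close>
  define q where "q = (\<lambda>g y. exp (g * y - K * (2 * cosh y - 2)))"
  have q1: "integrable lborel (q g)" and q2: "integral\<^sup>L lborel (q g) \<le> 4 * exp (g\<^sup>2 / 4) * sqrt (pi / L)" for g
  proof -
    note b = laplace_bound[OF K(2), of g]
    show "integrable lborel (q g)" using b(1) by (simp add: q_def)
    have "sqrt (pi / K) \<le> sqrt (4 * (pi / L))"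
      using K L by (intro real_sqrt_le_mono) (simp add: field_simps)
    also have "\<dots> = 2 * sqrt (pi / L)" unfolding real_sqrt_mult by simp
    finally have "2 * exp (g\<^sup>2 / 4) * sqrt (pi / K) \<le> 2 * exp (g\<^sup>2 / 4) * (2 * sqrt (pi / L))"
      by (intro mult_left_mono) auto
    then show "integral\<^sup>L lborel (q g) \<le> 4 * exp (g\<^sup>2 / 4) * sqrt (pi / L)"
      using b(2) unfolding q_def by linarith
  qed
  let ?E = "\<lambda>y. N * exp (2 * B) * (B * \<rho> * q (2 - \<beta>) y + 2 * B * t * q (1 - \<beta>) y + 2 * \<kappa> * (t / \<rho>) * q (- \<beta>) y)"
  have err: "norm (f y - of_real \<kappa> * (P * h y)) \<le> ?E y" for y
  proof -
    define r where "r = \<rho> * exp y"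
    have r: "r > 0" "norm (ray \<rho> y) = r" using \<rho> by (simp_all add: r_def norm_ray)
    let ?x = "ray \<rho> y"
    have Imx: "t / Im ?x = sqrt 2 * t / r" by (simp add: Im_ray r_def)
    have Im0: "Im ?x > 0" using \<rho> by (simp add: Im_ray)
    have tr: "sqrt 2 * t / r \<le> 2 * t / r"
      using t r s2 by (intro divide_right_mono mult_right_mono) auto
    have w2: "norm (wave \<theta> s t ?x - e ?x) \<le> 2 * t / r * norm (e ?x)"
    proof -
      have "norm (wave \<theta> s t ?x - e ?x) \<le> sqrt 2 * t / r * norm (e ?x)"
        using norm_wave_upper(2)[OF t Im0, of \<theta> s] \<theta> unfolding e_def Imx by simp
      also have "\<dots> \<le> 2 * t / r * norm (e ?x)" by (rule mult_right_mono[OF tr]) simp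
      finally show ?thesis .
    qed
    have w1: "norm (wave \<theta> s t ?x) \<le> (1 + 2 * t / r) * norm (e ?x)"
      using w2 norm_triangle_ineq2[of "wave \<theta> s t ?x" "e ?x"] by (simp add: algebra_simps)
    have Fx: "norm (F ?x - of_real \<kappa> * saddle \<beta> c ?x) \<le> B * r * exp (B * r) * norm (saddle \<beta> c ?x)"
      using F[OF ray_in_sector[OF \<rho>(1)], of y] unfolding r(2) .
    have eB: "1 \<le> exp (B * r)" using B r by simp
    have "f y - of_real \<kappa> * (P * h y) = (F ?x - of_real \<kappa> * saddle \<beta> c ?x) * ?x * wave \<theta> s t ?x
        + of_real \<kappa> * saddle \<beta> c ?x * ?x * (wave \<theta> s t ?x - e ?x)"
    proof -
      have "u * X * v - k * (w * X * z) = (u - k * w) * X * v + k * w * X * (v - z)" for u X v k w z :: complex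
        by (simp add: algebra_simps)
      then show ?thesis unfolding hP[symmetric] f_def .
    qed
    also have "norm \<dots> \<le> norm ((F ?x - of_real \<kappa> * saddle \<beta> c ?x) * ?x * wave \<theta> s t ?x)
        + norm (of_real \<kappa> * saddle \<beta> c ?x * ?x * (wave \<theta> s t ?x - e ?x))"
      by (rule norm_triangle_ineq)
    also have "norm ((F ?x - of_real \<kappa> * saddle \<beta> c ?x) * ?x * wave \<theta> s t ?x)
        \<le> (B * r * exp (B * r) * norm (saddle \<beta> c ?x)) * r * ((1 + 2 * t / r) * norm (e ?x))"
      unfolding norm_mult r(2) using B r t by (intro mult_mono[OF mult_right_mono[OF Fx] w1]) auto
    also have "norm (of_real \<kappa> * saddle \<beta> c ?x * ?x * (wave \<theta> s t ?x - e ?x))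
        \<le> \<kappa> * norm (saddle \<beta> c ?x) * r * (2 * t / r * norm (e ?x))"
      unfolding norm_mult r(2) norm_of_real using \<kappa> r by (intro mult_mono[OF _ w2]) auto
    also have "\<dots> \<le> \<kappa> * norm (saddle \<beta> c ?x) * r * (2 * t / r * norm (e ?x)) * exp (B * r)"
    proof -
      have "0 \<le> \<kappa> * norm (saddle \<beta> c ?x) * r * (2 * t / r * norm (e ?x))" using \<kappa> r t by simp
      from mult_left_mono[OF eB this] show ?thesis by simp
    qed
    also have "(B * r * exp (B * r) * norm (saddle \<beta> c ?x)) * r * ((1 + 2 * t / r) * norm (e ?x))
       + \<kappa> * norm (saddle \<beta> c ?x) * r * (2 * t / r * norm (e ?x)) * exp (B * r)
       = norm (saddle \<beta> c ?x * ?x * e ?x) * (exp (B * r) * (B * r + 2 * B * t + 2 * \<kappa> * t / r))"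
      unfolding norm_mult r(2) by (rule error_terms_collect) (use r in simp)
    also have "norm (saddle \<beta> c ?x * ?x * e ?x) = N * (exp ((1 - \<beta>) * y) * exp (- (L / sqrt 2 * (2 * cosh y - 2))))"
      unfolding hP norm_mult normP normh ..
    also have "N * (exp ((1 - \<beta>) * y) * exp (- (L / sqrt 2 * (2 * cosh y - 2)))) * (exp (B * r) * (B * r + 2 * B * t + 2 * \<kappa> * t / r))
        \<le> N * (exp ((1 - \<beta>) * y) * exp (- (L / sqrt 2 * (2 * cosh y - 2)))) * ((exp (2 * B) * exp (B * (2 * cosh y - 2))) * (B * r + 2 * B * t + 2 * \<kappa> * t / r))"
    proof (intro mult_left_mono mult_right_mono)
      have "r \<le> 1 * exp y" unfolding r_def using \<rho> by (intro mult_right_mono) auto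
      also have "\<dots> \<le> 2 * cosh y" by (simp add: cosh_def)
      finally have "B * r \<le> B * (2 * cosh y)" using B by (rule mult_left_mono)
      then show "exp (B * r) \<le> exp (2 * B) * exp (B * (2 * cosh y - 2))"
        by (simp add: algebra_simps flip: exp_add)
    qed (use N B \<kappa> r t in auto)
    also have "\<dots> = N * exp (2 * B) * (q (1 - \<beta>) y * (B * r + 2 * B * t + 2 * \<kappa> * t / r))"
    proof -
      have "q (1 - \<beta>) y = exp ((1 - \<beta>) * y) * exp (- (L / sqrt 2 * (2 * cosh y - 2))) * exp (B * (2 * cosh y - 2))"
        unfolding q_def K_def exp_add[symmetric] by (simp add: algebra_simps)
      then show ?thesis by (simp add: mult_ac)
    qed
    also have "q (1 - \<beta>) y * (B * r + 2 * B * t + 2 * \<kappa> * t / r) = B * \<rho> * (q (1 - \<beta>) y * exp y) + 2 * B * t * q (1 - \<beta>) y + 2 * \<kappa> * (t / \<rho>) * (q (1 - \<beta>) y * exp (- y))"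
      unfolding r_def exp_minus by (rule error_terms_expand) (use \<rho> in auto)
    also have "q (1 - \<beta>) y * exp y = q (2 - \<beta>) y"
      unfolding q_def exp_add[symmetric] by (simp add: algebra_simps)
    also have "q (1 - \<beta>) y * exp (- y) = q (- \<beta>) y"
      unfolding q_def exp_add[symmetric] by (simp add: algebra_simps)
    finally show ?thesis by simp
  qed
  have intE: "integrable lborel ?E"
    by (intro integrable_mult_right Bochner_Integration.integrable_add q1)
  have "ray_integral F \<theta> s t \<rho> - of_real \<kappa> * (P * integral\<^sup>L lborel h) = (LINT y|lborel. f y - of_real \<kappa> * (P * h y))"
    unfolding ray_integral_def f_def[symmetric]
    by (subst Bochner_Integration.integral_diff) (use int inth in \<open>simp_all add: f_def\<close>)
  also have "norm \<dots> \<le> (LINT y|lborel. norm (f y - of_real \<kappa> * (P * h y)))"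
    by (rule integral_norm_bound)
  also have "\<dots> \<le> integral\<^sup>L lborel ?E"
  proof (rule integral_mono[OF _ intE err])
    show "integrable lborel (\<lambda>y. norm (f y - of_real \<kappa> * (P * h y)))"
      using int unfolding f_def[symmetric]
      by (intro integrable_norm Bochner_Integration.integrable_diff integrable_mult_right inth)
  qed
  also have "\<dots> = N * exp (2 * B) * (B * \<rho> * integral\<^sup>L lborel (q (2 - \<beta>)) + 2 * B * t * integral\<^sup>L lborel (q (1 - \<beta>)) + 2 * \<kappa> * (t / \<rho>) * integral\<^sup>L lborel (q (- \<beta>)))"
  proof -
    have "integral\<^sup>L lborel (\<lambda>y. a * (b1 * q g1 y + b2 * q g2 y + b3 * q g3 y))
      = a * (b1 * integral\<^sup>L lborel (q g1) + b2 * integral\<^sup>L lborel (q g2) + b3 * integral\<^sup>L lborel (q g3))" for a b1 b2 b3 g1 g2 g3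
      by (simp add: q1)
    then show ?thesis .
  qed
  also have "\<dots> \<le> N * exp (2 * B) * (B * \<rho> * (4 * exp ((2 - \<beta>)\<^sup>2 / 4) * sqrt (pi / L)) + 2 * B * t * (4 * exp ((1 - \<beta>)\<^sup>2 / 4) * sqrt (pi / L)) + 2 * \<kappa> * (t / \<rho>) * (4 * exp ((- \<beta>)\<^sup>2 / 4) * sqrt (pi / L)))"
    using N B \<rho> t \<kappa> by (intro mult_left_mono add_mono q2) auto
  also have "\<dots> = A * (4 * exp (2 * B) * (B * exp ((2 - \<beta>)\<^sup>2 / 4) * \<rho> + 2 * B * exp ((1 - \<beta>)\<^sup>2 / 4) * t + 2 * \<kappa> * exp (\<beta>\<^sup>2 / 4) * (t / \<rho>)))"
    unfolding A_def N_def power2_minus by (rule error_terms_factor)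
  finally have E1: "norm (ray_integral F \<theta> s t \<rho> - of_real \<kappa> * (P * integral\<^sup>L lborel h)) \<le> A * (4 * exp (2 * B) * (B * exp ((2 - \<beta>)\<^sup>2 / 4) * \<rho> + 2 * B * exp ((1 - \<beta>)\<^sup>2 / 4) * t + 2 * \<kappa> * exp (\<beta>\<^sup>2 / 4) * (t / \<rho>)))" .
  have main: "of_real (\<kappa> * A) * cis ((1 - \<beta>) * pi / 4 + pi / 8 - 2 * pi * \<theta> * s + sqrt 2 * L) = of_real \<kappa> * (P * (cis (pi / 8) * of_real (sqrt (pi / L))))"
  proof -
    have "cis ((1 - \<beta>) * pi / 4 + pi / 8 - 2 * pi * \<theta> * s + sqrt 2 * L) = cis ((1 - \<beta>) * pi / 4 - 2 * pi * \<theta> * s + sqrt 2 * L) * cis (pi / 8)"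
      unfolding cis_mult by (rule arg_cong[where f = cis]) simp
    then show ?thesis by (simp add: P_def A_def mult_ac)
  qed
  have "norm (of_real \<kappa> * (P * integral\<^sup>L lborel h) - of_real \<kappa> * (P * (cis (pi / 8) * of_real (sqrt (pi / L))))) = \<kappa> * N * norm (integral\<^sup>L lborel h - cis (pi / 8) * of_real (sqrt (pi / L)))"
    unfolding right_diff_distrib[symmetric] norm_mult normP using \<kappa> by simp
  also have "\<dots> \<le> \<kappa> * N * (C0 / L * sqrt (pi / L))"
    using \<kappa> N C0 unfolding h_def by (intro mult_left_mono) auto
  also have "\<dots> = A * (\<kappa> * C0 / L)" by (simp add: A_def N_def)
  finally have E2: "norm (of_real \<kappa> * (P * integral\<^sup>L lborel h) - of_real \<kappa> * (P * (cis (pi / 8) * of_real (sqrt (pi / L))))) \<le> A * (\<kappa> * C0 / L)" .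
  have tri: "norm (u - w) \<le> A * (e2 + e1)" if "norm (u - v) \<le> A * e1" "norm (v - w) \<le> A * e2" for u v w :: complex and e1 e2
    using norm_diff_triangle_le[OF that] by (simp add: algebra_simps)
  show ?thesis
    unfolding main by (rule tri[OF E1 E2])
qed

text \<open>The stationary points of \<open>2 * pi * i * \<theta> * x / t - c / x\<close> satisfy \<open>x\<^sup>2 = i * c * t / (2 * pi * \<theta>)\<close>;
  the one on the ray of argument \<open>pi / 4\<close> has modulus \<open>saddle_scale \<theta> c t\<close>.\<close>

definition saddle_scale :: "real \<Rightarrow> real \<Rightarrow> real \<Rightarrow> real" where
  "saddle_scale \<theta> c t = sqrt (c * t / (2 * pi * \<theta>))"

text \<open>The common coefficient \<open>L\<close> of the two exponential terms at the saddle,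
  equal to \<open>c / saddle_scale \<theta> c t\<close> for positive parameters.\<close>

definition saddle_exponent :: "real \<Rightarrow> real \<Rightarrow> real \<Rightarrow> real" where
  "saddle_exponent \<theta> c t = sqrt (2 * pi * \<theta> * c / t)"

definition saddle_amplitude :: "real \<Rightarrow> real \<Rightarrow> real \<Rightarrow> real \<Rightarrow> real" where
  "saddle_amplitude \<beta> \<theta> c t = saddle_scale \<theta> c t powr (1 - \<beta>) * sqrt (pi / saddle_exponent \<theta> c t)
     * exp (- (sqrt 2 * saddle_exponent \<theta> c t))"

text \<open>At the saddle \<open>L\<close> is of order \<open>1 / sqrt t\<close> and
  \<open>\<rho>\<close> of order \<open>sqrt t\<close>, so each of \<open>1 / L\<close>,
  \<open>\<rho>\<close>, \<open>t\<close> and \<open>t / \<rho>\<close> in the preceding bound is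
  \<open>O(sqrt t)\<close>.\<close>

lemma ray_asymptotic:
  assumes c: "c > 0" and \<theta>: "\<theta> > 0" and \<kappa>: "\<kappa> \<ge> 0" and B: "B \<ge> 0"
    and int: "\<And>\<rho> t. \<rho> > 0 \<Longrightarrow> t > 0 \<Longrightarrow> integrable lborel (\<lambda>y. F (ray \<rho> y) * ray \<rho> y * wave \<theta> s t (ray \<rho> y))"
    and F: "\<And>x. x \<in> sector \<Longrightarrow> norm (F x - of_real \<kappa> * saddle \<beta> c x) \<le> B * norm x * exp (B * norm x) * norm (saddle \<beta> c x)"
  obtains C T where "C > 0" "T > 0" "\<And>t. 0 < t \<Longrightarrow> t < T \<Longrightarrow>
     norm (ray_integral F \<theta> s t (saddle_scale \<theta> c t) - of_real (\<kappa> * saddle_amplitude \<beta> \<theta> c t) *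
        cis ((1 - \<beta>) * pi / 4 + pi / 8 - 2 * pi * \<theta> * s + sqrt 2 * saddle_exponent \<theta> c t))
      \<le> C * sqrt t * saddle_amplitude \<beta> \<theta> c t"
proof -
  obtain C0 where C0: "C0 > 0" "\<And>L. L \<ge> 12 \<Longrightarrow>
    norm ((LINT y|lborel. of_real (exp ((1 - \<beta>) * y)) * exp (- (cis (- pi / 4) * of_real (L * (2 * cosh y - 2)))))
          - cis (pi / 8) * of_real (sqrt (pi / L))) \<le> C0 / L * sqrt (pi / L)"
    by (rule laplace_ray[of "1 - \<beta>"]) (rule that)
  define a where "a = 2 * pi * \<theta> * c"
  define b where "b = c / (2 * pi * \<theta>)"
  have ab: "a > 0" "b > 0" using c \<theta> by (auto simp: a_def b_def)
  define K where "K = max 12 (4 * B + 8)"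
  have K: "K \<ge> 12" "K \<ge> 4 * B + 8" "K > 0" by (auto simp: K_def)
  define C where "C = \<kappa> * C0 / sqrt a + 4 * exp (2 * B) * (B * exp ((2 - \<beta>)\<^sup>2 / 4) * sqrt b + 2 * B * exp ((1 - \<beta>)\<^sup>2 / 4) + 2 * \<kappa> * exp (\<beta>\<^sup>2 / 4) / sqrt b)"
  \<comment> \<open>Here \<open>L = sqrt (a / t)\<close> and \<open>\<rho> = sqrt (b * t)\<close>:
    the bound \<open>1 / b\<close> ensures \<open>\<rho> \<le> 1\<close>, and
    \<open>a / K\<^sup>2\<close> ensures \<open>L \<ge> K\<close>.\<close>
  define T where "T = min (min 1 (1 / b)) (a / K\<^sup>2)"
  show ?thesis
  proof (rule that[of "C + 1" T])
    have "C \<ge> 0" unfolding C_def using \<kappa> C0 B ab by (intro add_nonneg_nonneg mult_nonneg_nonneg) auto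
    then show "C + 1 > 0" by simp
    show "T > 0" using ab K by (simp add: T_def)
    fix t assume t: "0 < t" "t < T"
    define \<rho> where "\<rho> = saddle_scale \<theta> c t"
    define L where "L = saddle_exponent \<theta> c t"
    have \<rho>s: "\<rho> = sqrt b * sqrt t" by (simp add: \<rho>_def saddle_scale_def b_def real_sqrt_mult real_sqrt_divide)
    have Ls: "L = sqrt a / sqrt t" by (simp add: L_def saddle_exponent_def a_def real_sqrt_divide)
    have tt: "t \<le> 1" "b * t \<le> 1" "K\<^sup>2 * t \<le> a"
    proof -
      have "t \<le> 1" "t \<le> 1 / b" "t \<le> a / K\<^sup>2" using t by (auto simp: T_def)
      then show "t \<le> 1" "b * t \<le> 1" "K\<^sup>2 * t \<le> a"
        using ab K by (simp_all add: pos_le_divide_eq mult.commute)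
    qed
    have st: "0 < sqrt t" "sqrt t \<le> 1" "sqrt t * sqrt t = t" using t tt by auto
    have "t \<le> sqrt t" using st mult_left_le_one_le[of "sqrt t" "sqrt t"] by simp
    have \<rho>1: "\<rho> > 0" "\<rho> \<le> 1"
      using ab st tt by (simp_all add: \<rho>s real_sqrt_mult[symmetric])
    have sqab: "sqrt a * sqrt b = c"
    proof -
      have "a * b = c\<^sup>2" using \<theta> by (simp add: a_def b_def power2_eq_square)
      then show ?thesis using c by (simp flip: real_sqrt_mult)
    qed
    have sqab': "2 * pi * \<theta> * sqrt b = sqrt a"
    proof -
      have "sqrt a = sqrt ((2 * pi * \<theta>)\<^sup>2 * b)" using \<theta> by (simp add: a_def b_def power2_eq_square)
      then show ?thesis using \<theta> by (simp add: real_sqrt_mult)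
    qed
    have L1: "c = L * \<rho>" using st sqab by (simp add: Ls \<rho>s)
    have L2: "2 * pi * \<theta> * \<rho> = L * t"
    proof -
      have "L * t = sqrt a * sqrt t" using st by (simp add: Ls field_simps)
      then show ?thesis by (simp add: \<rho>s flip: sqab')
    qed
    have "sqrt (K\<^sup>2 * t) \<le> sqrt a" using tt by simp
    then have "K * sqrt t \<le> sqrt a" using K by (simp add: real_sqrt_mult)
    then have LK: "L \<ge> K" using st by (simp add: Ls field_simps)
    have L: "L \<ge> 12" "L \<ge> 4 * B + 8" using LK K by auto
    have LA: "saddle_amplitude \<beta> \<theta> c t = \<rho> powr (1 - \<beta>) * sqrt (pi / L) * exp (- (sqrt 2 * L))"
      by (simp add: saddle_amplitude_def \<rho>_def L_def)
    then have A0: "saddle_amplitude \<beta> \<theta> c t \<ge> 0" using \<rho>1 L by simp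
    have "norm (ray_integral F \<theta> s t \<rho> - of_real (\<kappa> * saddle_amplitude \<beta> \<theta> c t) * cis ((1 - \<beta>) * pi / 4 + pi / 8 - 2 * pi * \<theta> * s + sqrt 2 * L))
     \<le> saddle_amplitude \<beta> \<theta> c t * (\<kappa> * C0 / L + 4 * exp (2 * B) * (B * exp ((2 - \<beta>)\<^sup>2 / 4) * \<rho> + 2 * B * exp ((1 - \<beta>)\<^sup>2 / 4) * t + 2 * \<kappa> * exp (\<beta>\<^sup>2 / 4) * (t / \<rho>)))"
      unfolding LA
      by (rule ray_asymptotic_fixed[OF \<rho>1 L1 L2 t(1) \<theta> \<kappa> B L int[OF \<rho>1(1) t(1)] F C0(2)[OF L(1)]])
    also have "\<dots> \<le> saddle_amplitude \<beta> \<theta> c t * ((C + 1) * sqrt t)"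
    proof (rule mult_left_mono[OF _ A0])
      have e1: "\<kappa> * C0 / L = \<kappa> * C0 / sqrt a * sqrt t" by (simp add: Ls)
      have e2: "t / \<rho> = 1 / sqrt b * sqrt t" using st ab by (simp add: \<rho>s field_simps)
      have "\<kappa> * C0 / L + 4 * exp (2 * B) * (B * exp ((2 - \<beta>)\<^sup>2 / 4) * \<rho> + 2 * B * exp ((1 - \<beta>)\<^sup>2 / 4) * t + 2 * \<kappa> * exp (\<beta>\<^sup>2 / 4) * (t / \<rho>))
        \<le> \<kappa> * C0 / sqrt a * sqrt t + 4 * exp (2 * B) * (B * exp ((2 - \<beta>)\<^sup>2 / 4) * (sqrt b * sqrt t) + 2 * B * exp ((1 - \<beta>)\<^sup>2 / 4) * sqrt t + 2 * \<kappa> * exp (\<beta>\<^sup>2 / 4) * (1 / sqrt b * sqrt t))"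
        unfolding e1 e2 unfolding \<rho>s using \<open>t \<le> sqrt t\<close> B by (intro add_mono mult_left_mono order_refl) auto
      also have "\<dots> = C * sqrt t" by (simp add: C_def algebra_simps)
      also have "\<dots> \<le> (C + 1) * sqrt t" using st by (simp add: algebra_simps)
      finally show "\<kappa> * C0 / L + 4 * exp (2 * B) * (B * exp ((2 - \<beta>)\<^sup>2 / 4) * \<rho> + 2 * B * exp ((1 - \<beta>)\<^sup>2 / 4) * t + 2 * \<kappa> * exp (\<beta>\<^sup>2 / 4) * (t / \<rho>)) \<le> (C + 1) * sqrt t" .
    qed
    finally show "norm (ray_integral F \<theta> s t (saddle_scale \<theta> c t) - of_real (\<kappa> * saddle_amplitude \<beta> \<theta> c t) *
        cis ((1 - \<beta>) * pi / 4 + pi / 8 - 2 * pi * \<theta> * s + sqrt 2 * saddle_exponent \<theta> c t))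
      \<le> (C + 1) * sqrt t * saddle_amplitude \<beta> \<theta> c t"
      unfolding \<rho>_def L_def by (simp add: mult_ac)
  qed
qed

subsection \<open>The product in a sector at 1\<close>

lemma Phi_uniform_limit:
  assumes "r < 1"
  shows "uniform_limit (cball 0 r) (\<lambda>N x. \<Prod>n<N. 1 - x ^ Suc n) Phi sequentially"
proof -
  have "uniformly_convergent_on (cball 0 r) (\<lambda>N x::complex. \<Prod>n<N. 1 - x ^ Suc n)"
  proof (rule Infinite_Products.uniformly_convergent_on_prod')
    show "continuous_on (cball 0 r) (\<lambda>x::complex. 1 - x ^ Suc n)" for n
      by (intro continuous_intros)
    show "compact (cball (0::complex) r)" by simp
    show "uniformly_convergent_on (cball 0 r) (\<lambda>N x::complex. \<Sum>n<N. norm (1 - x ^ Suc n - 1))"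
    proof (rule Weierstrass_m_test')
      show "norm (norm (1 - x ^ Suc n - 1 :: complex)) \<le> max 0 r ^ Suc n" if "x \<in> cball 0 r" for n x
        using that by (auto simp: norm_power simp del: power_Suc intro!: power_mono)
      show "summable (\<lambda>n. max 0 r ^ Suc n)"
        using assms by (subst summable_Suc_iff) (intro summable_geometric, auto)
    qed
  qed
  then have "uniform_limit (cball 0 r) (\<lambda>N x::complex. \<Prod>n<N. 1 - x ^ Suc n) (\<lambda>x. lim (\<lambda>N. \<Prod>n<N. 1 - x ^ Suc n)) sequentially"
    by (simp add: uniformly_convergent_uniform_limit_iff)
  moreover have "lim (\<lambda>N. \<Prod>n<N. 1 - x ^ Suc n) = Phi x" if "x \<in> cball 0 r" for x :: complex
  proof (rule limI)
    have "summable (\<lambda>n. norm x ^ Suc n)"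
      using that assms by (subst summable_Suc_iff) (intro summable_geometric, auto)
    then have "abs_convergent_prod (\<lambda>n. 1 - x ^ Suc n)"
      by (simp add: abs_convergent_prod_conv_summable norm_power norm_mult)
    then have "convergent_prod (\<lambda>n. 1 - x ^ Suc n)"
      by (rule abs_convergent_prod_imp_convergent_prod)
    then show "(\<lambda>N. \<Prod>n<N. 1 - x ^ Suc n) \<longlonglongrightarrow> Phi x"
      unfolding Phi_def using convergent_prod_LIMSEQ LIMSEQ_lessThan_iff_atMost by blast
  qed
  ultimately show ?thesis
    by (metis (no_types, lifting) uniform_limit_cong')
qed

lemma one_minus_power_nonzero:
  fixes q :: complex
  assumes "norm q < 1"
  shows "1 - q ^ Suc n \<noteq> 0"
proof
  assume "1 - q ^ Suc n = 0"
  then have "norm (q ^ Suc n) = 1" by (metis eq_iff_diff_eq_0 norm_one)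
  then show False using assms power_less_one_iff[of "norm q" "Suc n"] by (simp add: norm_power del: power_Suc)
qed

lemma Phi_nonzero:
  assumes "norm q < 1"
  shows "Phi q \<noteq> 0"
proof -
  have "summable (\<lambda>n. norm q ^ Suc n)"
    using assms by (subst summable_Suc_iff) (intro summable_geometric, auto)
  then have "abs_convergent_prod (\<lambda>n. 1 - q ^ Suc n)"
    by (simp add: abs_convergent_prod_conv_summable norm_power norm_mult)
  then show ?thesis
    unfolding Phi_def using one_minus_power_nonzero[OF assms]
    by (intro prodinf_nonzero abs_convergent_prod_imp_convergent_prod)
qed

lemma Phi_holomorphic: "Phi holomorphic_on ball 0 1"
proof (rule holomorphic_uniform_sequence)
  show "(\<lambda>x. \<Prod>n<N. 1 - x ^ Suc n) holomorphic_on ball 0 1" for N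
    by (intro holomorphic_intros)
  fix x :: complex assume "x \<in> ball 0 1"
  define r where "r = (norm x + 1) / 2"
  have r: "norm x < r" "r < 1" using \<open>x \<in> ball 0 1\<close> by (auto simp: r_def)
  have sub: "cball x (r - norm x) \<subseteq> cball 0 r"
    using norm_triangle_ineq2 by (auto simp: dist_norm) (smt (verit) norm_minus_commute norm_triangle_ineq2)
  show "\<exists>d>0. cball x d \<subseteq> ball 0 1 \<and> uniform_limit (cball x d) (\<lambda>N x. \<Prod>n<N. 1 - x ^ Suc n) Phi sequentially"
  proof (intro exI[of _ "r - norm x"] conjI)
    show "uniform_limit (cball x (r - norm x)) (\<lambda>N x. \<Prod>n<N. 1 - x ^ Suc n) Phi sequentially"
      by (rule uniform_limit_on_subset[OF Phi_uniform_limit[OF r(2)] sub])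
    show "cball x (r - norm x) \<subseteq> ball 0 1" using sub r by auto
  qed (use r in auto)
qed auto

section \<open>The logarithmic derivative of the product as a Riemann sum\<close>

lemma Phi_logderiv:
  assumes "norm q < 1"
  shows "(\<lambda>n. - (of_nat (Suc n) * q ^ n) / (1 - q ^ Suc n)) sums (deriv Phi q / Phi q)"
proof -
  define r where "r = (norm q + 1) / 2"
  have r: "norm q < r" "r < 1" using assms by (auto simp: r_def)
  have "(\<lambda>k. deriv (\<lambda>x. 1 - x ^ Suc k) q / (1 - q ^ Suc k)) sums (deriv Phi q / Phi q)"
  proof (rule logderiv_prodinf_complex_uniform_limit[where A = "ball 0 r"])
    show "uniform_limit (ball 0 r) (\<lambda>N x. \<Prod>n<N. 1 - x ^ Suc n) Phi sequentially"
      by (rule uniform_limit_on_subset[OF Phi_uniform_limit[OF r(2)]]) auto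
    show "Phi q \<noteq> 0" using assms by (rule Phi_nonzero)
  qed (use r in \<open>auto intro!: holomorphic_intros\<close>)
  moreover have "deriv (\<lambda>x::complex. 1 - x ^ Suc k) q = - (of_nat (Suc k) * q ^ k)" for k
    by (rule DERIV_imp_deriv) (auto intro!: derivative_eq_intros simp del: power_Suc)
  ultimately show ?thesis by simp
qed

text \<open>Absolute summability, which licenses exchanging the two summations. The majorant rests
  on \<open>(i + 1) * (j + 1) \<ge> i + j\<close>.\<close>

lemma lambert_double_has_sum:
  fixes q :: complex
  assumes "norm q < 1"
  obtains S where "((\<lambda>(i, j). of_nat (Suc i) * q ^ (Suc i * Suc j)) has_sum S) (UNIV \<times> UNIV)"
proof -
  define r where "r = norm q"
  have r: "0 \<le> r" "r < 1" using assms by (auto simp: r_def)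
  have "(\<lambda>x. norm ((\<lambda>(i, j). real (Suc i) * r ^ i * r ^ j) x)) summable_on UNIV \<times> UNIV"
  proof (rule Infinite_Sum.abs_summable_on_Sigma_iff[THEN iffD2], intro conjI ballI)
    have geo: "(\<lambda>j. r ^ j) summable_on UNIV"
      using r by (intro summable_nonneg_imp_summable_on summable_geometric) auto
    show "(\<lambda>y. norm (case (i, y) of (i, j) \<Rightarrow> real (Suc i) * r ^ i * r ^ j)) summable_on UNIV" for i
      using summable_on_cmult_right[OF geo, of "real (Suc i) * r ^ i"] r by (simp add: abs_mult)
    have "summable (\<lambda>i. real (Suc i) * r ^ i)"
      using geometric_deriv_sums[of r] r by (simp add: sums_iff)
    then have s: "(\<lambda>i. real (Suc i) * r ^ i) summable_on UNIV"
      using r by (intro summable_nonneg_imp_summable_on) auto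
    have "(\<lambda>i. real (Suc i) * r ^ i * infsum (\<lambda>j. r ^ j) UNIV) summable_on UNIV"
      by (rule summable_on_cmult_left[OF s])
    moreover have "(\<Sum>\<^sub>\<infinity>y. norm (case (i, y) of (i, j) \<Rightarrow> real (Suc i) * r ^ i * r ^ j)) = real (Suc i) * r ^ i * infsum (\<lambda>j. r ^ j) UNIV" for i
      using r by (simp add: abs_mult infsum_cmult_right')
    moreover have "0 \<le> infsum (\<lambda>j. r ^ j) UNIV" using r by (intro infsum_nonneg) auto
    ultimately show "(\<lambda>x. norm (\<Sum>\<^sub>\<infinity>y. norm (case (x, y) of (i, j) \<Rightarrow> real (Suc i) * r ^ i * r ^ j))) summable_on UNIV"
      using r by (simp add: abs_mult)
  qed
  then have "(\<lambda>x. norm ((\<lambda>(i, j). of_nat (Suc i) * q ^ (Suc i * Suc j)) x)) summable_on UNIV \<times> UNIV"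
  proof (rule Infinite_Sum.abs_summable_on_comparison_test)
    fix x :: "nat \<times> nat"
    obtain i j where x: "x = (i, j)" by (cases x)
    have "r ^ (Suc i * Suc j) \<le> r ^ (i + j)"
      using r by (intro power_decreasing) auto
    then show "norm (case x of (i, j) \<Rightarrow> of_nat (Suc i) * q ^ (Suc i * Suc j)) \<le> norm (case x of (i, j) \<Rightarrow> real (Suc i) * r ^ i * r ^ j)"
      using r by (simp add: x norm_mult norm_power r_def abs_mult power_add mult_left_mono del: mult_Suc mult_Suc_right of_nat_Suc)
  qed
  then have "(\<lambda>(i, j). of_nat (Suc i) * q ^ (Suc i * Suc j)) summable_on UNIV \<times> UNIV"
    by (rule Infinite_Sum.abs_summable_summable)
  then show ?thesis using that by (auto simp: summable_on_def)
qed

text \<open>Resumming the Lambert series of the logarithmic derivative of \<open>Phi\<close> turns it into samples of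
  a single function at the multiples of \<open>x\<close>.\<close>

lemma Phi_logderiv_resummed:
  assumes x: "0 < Re x"
  shows "(\<lambda>m. exp (- (of_nat (Suc m) * x)) / (1 - exp (- (of_nat (Suc m) * x)))\<^sup>2)
    sums (- exp (- x) * (deriv Phi (exp (- x)) / Phi (exp (- x))))"
proof -
  define q where "q = exp (- x)"
  have q: "norm q < 1" using x by (simp add: q_def norm_exp_eq_Re)
  have qp: "norm (q ^ Suc n) < 1" for n
    using q power_less_one_iff[of "norm q" "Suc n"] by (simp add: norm_power del: power_Suc)
  obtain S where S: "((\<lambda>(i, j). of_nat (Suc i) * q ^ (Suc i * Suc j)) has_sum S) (UNIV \<times> UNIV)"
    using lambert_double_has_sum[OF q] by blast
  have g: "(\<lambda>j. z ^ Suc j) sums (z / (1 - z))" if "norm z < 1" for z :: complex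
    using sums_mult[OF geometric_sums[OF that], of z] by simp
  have h1: "((\<lambda>j. of_nat (Suc i) * q ^ (Suc i * Suc j)) has_sum (of_nat (Suc i) * (q ^ Suc i / (1 - q ^ Suc i)))) UNIV" for i
  proof -
    have "((\<lambda>j. (q ^ Suc i) ^ Suc j) has_sum (q ^ Suc i / (1 - q ^ Suc i))) UNIV"
    proof (rule norm_summable_imp_has_sum[OF _ g[OF qp]])
      show "summable (\<lambda>n. norm ((q ^ Suc i) ^ Suc n))"
        unfolding norm_power[of "q ^ Suc i"] using qp[of i]
        by (subst summable_Suc_iff) (intro summable_geometric, simp)
    qed
    then show ?thesis unfolding power_mult[of q "Suc i"] by (rule has_sum_cmult_right)
  qed
  have "((\<lambda>i. of_nat (Suc i) * (q ^ Suc i / (1 - q ^ Suc i))) has_sum S) UNIV"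
    by (rule has_sum_SigmaD[OF S]) (use h1 in simp)
  then have s1: "(\<lambda>i. of_nat (Suc i) * (q ^ Suc i / (1 - q ^ Suc i))) sums S"
    by (rule has_sum_imp_sums)
  have "(\<lambda>n. - q * (- (of_nat (Suc n) * q ^ n) / (1 - q ^ Suc n))) sums (- q * (deriv Phi q / Phi q))"
    by (rule sums_mult[OF Phi_logderiv[OF q]])
  also have "(\<lambda>n. - q * (- (of_nat (Suc n) * q ^ n) / (1 - q ^ Suc n))) = (\<lambda>i. of_nat (Suc i) * (q ^ Suc i / (1 - q ^ Suc i)))"
    by (rule ext) simp
  finally have Seq: "S = - q * (deriv Phi q / Phi q)" using s1 sums_unique2 by blast
  \<comment> \<open>Summed over \<open>i\<close> first, the inner series is the derivative of a
    geometric series in \<open>q ^ Suc j\<close>; its double pole at \<open>x = 0\<close> is the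
    source of the term \<open>pi\<^sup>2 / 6 / x\<^sup>2\<close>.\<close>
  have h2: "((\<lambda>i. of_nat (Suc i) * q ^ (Suc i * Suc j)) has_sum (q ^ Suc j / (1 - q ^ Suc j)\<^sup>2)) UNIV" for j
  proof -
    define z where "z = q ^ Suc j"
    have z: "norm z < 1" using qp by (simp add: z_def del: power_Suc)
    have "((\<lambda>i. z * (of_nat (Suc i) * z ^ i)) has_sum (z * (1 / (1 - z)\<^sup>2))) UNIV"
    proof (rule norm_summable_imp_has_sum)
      show "(\<lambda>i. z * (of_nat (Suc i) * z ^ i)) sums (z * (1 / (1 - z)\<^sup>2))"
        by (rule sums_mult[OF geometric_deriv_sums[OF z]])
      have "summable (\<lambda>i. real (Suc i) * norm z ^ i)"
        using geometric_deriv_sums[of "norm z"] z by (simp add: sums_iff)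
      from summable_mult[OF this, of "norm z"]
      show "summable (\<lambda>n. norm (z * (of_nat (Suc n) * z ^ n)))"
        by (simp add: norm_mult norm_power del: of_nat_Suc)
    qed
    moreover have "z * (of_nat (Suc i) * z ^ i) = of_nat (Suc i) * q ^ (Suc i * Suc j)" for i
    proof -
      have "z * (of_nat (Suc i) * z ^ i) = of_nat (Suc i) * z ^ Suc i" by simp
      also have "z ^ Suc i = q ^ (Suc i * Suc j)" unfolding z_def power_mult[symmetric] by (simp only: mult.commute)
      finally show ?thesis .
    qed
    ultimately show ?thesis by (simp only: z_def) simp
  qed
  have "((\<lambda>(j, i). of_nat (Suc i) * q ^ (Suc i * Suc j)) has_sum S) (UNIV \<times> UNIV)"
    using S by (subst has_sum_swap) simp
  then have "((\<lambda>j. q ^ Suc j / (1 - q ^ Suc j)\<^sup>2) has_sum S) UNIV"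
    by (rule has_sum_SigmaD) (use h2 in simp)
  then have "(\<lambda>j. q ^ Suc j / (1 - q ^ Suc j)\<^sup>2) sums S"
    by (rule has_sum_imp_sums)
  moreover have "q ^ Suc j = exp (- (of_nat (Suc j) * x))" for j
    unfolding q_def by (simp only: exp_of_nat_mult[symmetric] mult_minus_right)
  ultimately show ?thesis by (simp only: Seq q_def)
qed

text \<open>The derivative of this function is \<open>sample\<close> below. The sum of \<open>x * sample ((m + 1) * x)\<close> is thus a
  Riemann sum for its total increment \<open>- 1 / 2\<close>, with an error controlled by the second derivative.\<close>

definition sample_primitive :: "complex \<Rightarrow> complex" where
  "sample_primitive y = (if y = 0 then 1 / 2 else 1 / y - 1 / (exp y - 1))"

lemma exp_eq_1_small:
  fixes y :: complex
  assumes "exp y = 1" "0 < Re y \<or> norm y < 1"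
  shows "y = 0"
proof -
  obtain n :: int where n: "Re y = 0" "Im y = of_int (2 * n) * pi"
    using assms(1) by (auto simp: exp_eq_1)
  then have "norm y < 1" using assms(2) by auto
  then have "\<bar>Im y\<bar> < 1" using abs_Im_le_cmod[of y] by linarith
  moreover have "\<bar>Im y\<bar> = \<bar>real_of_int n\<bar> * (2 * pi)" by (simp add: n abs_mult)
  ultimately have lt: "\<bar>real_of_int n\<bar> * (2 * pi) < 1" by simp
  have "n = 0"
  proof (rule ccontr)
    assume "n \<noteq> 0"
    then have "1 \<le> \<bar>real_of_int n\<bar>" by linarith
    then have "1 * (2 * pi) \<le> \<bar>real_of_int n\<bar> * (2 * pi)" by (intro mult_right_mono) auto
    then show False using lt pi_ge_two by linarith
  qed
  then show ?thesis using n by (simp add: complex_eq_iff)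
qed

text \<open>The unit disc is adjoined because the first step of the Riemann sum begins at 0; it
  contains no other zero of \<open>exp y - 1\<close>.\<close>

abbreviation sample_domain :: "complex set" where
  "sample_domain \<equiv> {y. 0 < Re y} \<union> ball 0 1"

lemma open_sample_domain: "open sample_domain"
  by (intro open_Un open_halfspace_Re_gt open_ball)

lemma sample_primitive_limit: "((\<lambda>y::complex. 1 / y - 1 / (exp y - 1)) \<longlongrightarrow> 1 / 2) (at 0)"
proof -
  have l1: "((\<lambda>y::complex. (exp y - 1) / y) \<longlongrightarrow> 1) (at 0)"
    using DERIV_exp[of "0::complex"] by (simp add: has_field_derivative_iff)
  \<comment> \<open>The poles of the two fractions cancel, so \<open>exp\<close> is needed to second
    order; its quadratic coefficient is the value 1/2.\<close>
  have l2: "((\<lambda>y::complex. (exp y - 1 - y) / y\<^sup>2) \<longlongrightarrow> 1 / 2) (at 0)"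
  proof (rule Lim_transform)
    show "((\<lambda>y::complex. 1 / 2) \<longlongrightarrow> 1 / 2) (at 0)" by simp
    show "((\<lambda>y::complex. (exp y - 1 - y) / y\<^sup>2 - 1 / 2) \<longlongrightarrow> 0) (at 0)"
    proof (rule Lim_null_comparison)
      show "((\<lambda>y::complex. exp (norm y) * norm y) \<longlongrightarrow> 0) (at 0)"
        by (auto intro!: tendsto_eq_intros)
      have "norm (1 / 2 - (exp y - 1 - y) / y\<^sup>2) \<le> exp (norm y) * norm y" if "y \<noteq> 0" for y :: complex
      proof -
        have "norm (exp y - (\<Sum>i\<le>2. y ^ i / fact i)) \<le> exp (norm y) * (norm y ^ Suc 2) / fact 2"
          by (rule Taylor_exp_field)
        also have "(\<Sum>i\<le>2. y ^ i / fact i) = 1 + y + y\<^sup>2 / 2"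
          by (simp add: numeral_2_eq_2)
        finally have t: "norm (exp y - (1 + y + y\<^sup>2 / 2)) \<le> exp (norm y) * norm y ^ 3 / 2"
          by (simp add: numeral_3_eq_3)
        have "1 / 2 - (exp y - 1 - y) / y\<^sup>2 = - ((exp y - (1 + y + y\<^sup>2 / 2)) / y\<^sup>2)"
          using that by (simp add: field_simps)
        then have "norm (1 / 2 - (exp y - 1 - y) / y\<^sup>2) = norm (exp y - (1 + y + y\<^sup>2 / 2)) / (norm y)\<^sup>2"
          by (simp only: norm_minus_cancel norm_divide norm_power)
        also have "\<dots> \<le> (exp (norm y) * norm y ^ 3 / 2) / (norm y)\<^sup>2"
          using t by (intro divide_right_mono) auto
        also have "\<dots> \<le> exp (norm y) * norm y"
          using that by (simp add: power2_eq_square power3_eq_cube)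
        finally show ?thesis .
      qed
      then show "\<forall>\<^sub>F y in at (0::complex). norm ((exp y - 1 - y) / y\<^sup>2 - 1 / 2) \<le> exp (norm y) * norm y"
        by (auto simp: eventually_at_filter norm_minus_commute)
    qed
  qed
  have "((\<lambda>y::complex. ((exp y - 1 - y) / y\<^sup>2) / ((exp y - 1) / y)) \<longlongrightarrow> (1 / 2) / 1) (at 0)"
    by (intro tendsto_divide l1 l2) simp
  moreover have "\<forall>\<^sub>F y in at (0::complex). ((exp y - 1 - y) / y\<^sup>2) / ((exp y - 1) / y) = 1 / y - 1 / (exp y - 1)"
  proof -
    have "\<forall>\<^sub>F y in at (0::complex). y \<in> ball 0 1 - {0}"
      by (rule eventually_at_in_open) auto
    then show ?thesis
    proof eventually_elim
      case (elim y)
      then have "exp y - 1 \<noteq> 0" "y \<noteq> 0" using exp_eq_1_small[of y] by auto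
      then show ?case by (simp add: field_simps power2_eq_square)
    qed
  qed
  ultimately show ?thesis
    by (simp add: tendsto_cong)
qed

lemma sample_primitive_holomorphic: "sample_primitive holomorphic_on sample_domain"
proof (rule no_isolated_singularity'[where K = "{0}"])
  show "(sample_primitive \<longlongrightarrow> sample_primitive z) (at z within sample_domain)" if "z \<in> {0}" for z
  proof -
    have "(sample_primitive \<longlongrightarrow> 1 / 2) (at 0)"
      using sample_primitive_limit
      by (rule Lim_transform_eventually) (auto simp: sample_primitive_def eventually_at_filter)
    then show ?thesis using that by (auto simp: sample_primitive_def intro: tendsto_within_subset)
  qed
  have "(\<lambda>y. 1 / y - 1 / (exp y - 1)) holomorphic_on sample_domain - {0}"
    by (intro holomorphic_intros) (use exp_eq_1_small in auto)
  then show "sample_primitive holomorphic_on sample_domain - {0}"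
    by (rule holomorphic_transform) (auto simp: sample_primitive_def)
qed (use open_sample_domain in auto)

text \<open>The first term is the summand of the resummed logarithmic derivative, the second its
  double pole at 0. Over the multiples of \<open>x\<close> the subtracted terms add up to
  \<open>pi\<^sup>2 / 6 / x\<^sup>2\<close>.\<close>

definition sample :: "complex \<Rightarrow> complex" where
  "sample y = exp (- y) / (1 - exp (- y))\<^sup>2 - 1 / y\<^sup>2"

lemma quotient_deriv_simp:
  fixes w :: complex
  assumes "1 - w \<noteq> 0"
  shows "(- w * (1 - w)\<^sup>2 - w * (2 * (1 - w) * w)) / ((1 - w)\<^sup>2 * (1 - w)\<^sup>2) = - (w * (1 + w) / (1 - w) ^ 3)"
proof -
  define d where "d = 1 - w"
  have d: "d \<noteq> 0" "w = 1 - d" using assms by (auto simp: d_def)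
  have "(- w * d\<^sup>2 - w * (2 * d * w)) / (d\<^sup>2 * d\<^sup>2) = - (w * (1 + w) / d ^ 3)"
    using d(1) unfolding d(2) by (simp add: divide_simps) (simp add: eval_nat_numeral algebra_simps)
  then show ?thesis by (simp add: d_def)
qed

lemma deriv_sample_primitive:
  assumes "0 < Re y"
  shows "deriv sample_primitive y = sample y"
    and "deriv (deriv sample_primitive) y = 2 / y ^ 3 - exp (- y) * (1 + exp (- y)) / (1 - exp (- y)) ^ 3"
proof -
  have o: "open {y::complex. 0 < Re y}" by (rule open_halfspace_Re_gt)
  have ne: "exp y - 1 \<noteq> 0" "1 - exp (- y) \<noteq> 0" "y \<noteq> 0" if "0 < Re y" for y
    using exp_eq_1_small[of y] that by (auto simp: exp_minus field_simps)
  have d1: "deriv sample_primitive y = sample y" if y: "0 < Re y" for y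
  proof (rule DERIV_imp_deriv)
    have "((\<lambda>y. 1 / y - 1 / (exp y - 1)) has_field_derivative sample y) (at y)"
      using ne[OF y] by (auto intro!: derivative_eq_intros simp: sample_def exp_minus field_simps power2_eq_square)
    then show "(sample_primitive has_field_derivative sample y) (at y)"
      by (rule has_field_derivative_transform_within_open[OF _ o]) (use y ne in \<open>auto simp: sample_primitive_def\<close>)
  qed
  then show "deriv sample_primitive y = sample y" using assms .
  show "deriv (deriv sample_primitive) y = 2 / y ^ 3 - exp (- y) * (1 + exp (- y)) / (1 - exp (- y)) ^ 3"
  proof (rule DERIV_imp_deriv)
    have "((\<lambda>y. exp (- y) / (1 - exp (- y))\<^sup>2) has_field_derivative
        (- exp (- y) * (1 - exp (- y))\<^sup>2 - exp (- y) * (2 * (1 - exp (- y)) * exp (- y))) / ((1 - exp (- y))\<^sup>2 * (1 - exp (- y))\<^sup>2)) (at y)"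
      using ne(2)[OF assms] by (auto intro!: derivative_eq_intros)
    moreover have "((\<lambda>y. 1 / y\<^sup>2) has_field_derivative - (2 / y ^ 3)) (at y)"
      using ne(3)[OF assms] by (auto intro!: derivative_eq_intros simp: power2_eq_square power3_eq_cube)
    ultimately have "(sample has_field_derivative
        (- exp (- y) * (1 - exp (- y))\<^sup>2 - exp (- y) * (2 * (1 - exp (- y)) * exp (- y))) / ((1 - exp (- y))\<^sup>2 * (1 - exp (- y))\<^sup>2) - - (2 / y ^ 3)) (at y)"
      unfolding sample_def by (rule DERIV_diff)
    then have "(sample has_field_derivative 2 / y ^ 3 - exp (- y) * (1 + exp (- y)) / (1 - exp (- y)) ^ 3) (at y)"
      unfolding quotient_deriv_simp[OF ne(2)[OF assms]] by simp
    then show "(deriv sample_primitive has_field_derivative 2 / y ^ 3 - exp (- y) * (1 + exp (- y)) / (1 - exp (- y)) ^ 3) (at y)"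
      by (rule has_field_derivative_transform_within_open[OF _ o]) (use assms d1 in auto)
  qed
qed

lemma norm_exp_sector:
  assumes "y \<in> sector"
  shows "norm (exp (- y)) \<le> exp (- (norm y / sqrt 2))"
proof -
  have "(norm y)\<^sup>2 = (Re y)\<^sup>2 + (Im y)\<^sup>2" by (rule cmod_power2)
  also have "\<dots> \<le> (Re y)\<^sup>2 + (Re y)\<^sup>2"
    using assms by (intro add_left_mono) (auto simp: sector_def abs_le_square_iff[symmetric])
  also have "\<dots> = (sqrt 2 * Re y)\<^sup>2" by (simp add: power_mult_distrib)
  finally have "norm y \<le> sqrt 2 * Re y"
    using assms by (auto simp: sector_def intro: power2_le_imp_le)
  then have "norm y / sqrt 2 \<le> Re y" by (simp add: field_simps)
  then show ?thesis by (simp add: norm_exp_eq_Re)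
qed

lemma norm_one_minus_exp_sector:
  assumes "y \<in> sector" "1 \<le> norm y"
  shows "1 / 4 \<le> norm (1 - exp (- y))"
proof -
  have "sqrt 2 \<le> 3 / 2" by (rule real_le_lsqrt) (auto simp: power2_eq_square)
  then have "2 / 3 \<le> norm y / sqrt 2" using assms(2) by (simp add: field_simps)
  then have "norm (exp (- y)) \<le> exp (- (2 / 3))"
    using norm_exp_sector[OF assms(1)] by (elim order_trans) simp
  moreover have "exp (- (2 / 3)) \<le> (3 / 4 :: real)"
  proof -
    have "4 / 3 \<le> exp (2 / 3 :: real)" using exp_ge_add_one_self[of "2 / 3"] by simp
    then show ?thesis by (simp add: exp_minus field_simps)
  qed
  moreover have "1 - norm (exp (- y)) \<le> norm (1 - exp (- y))"
    using norm_triangle_ineq2[of 1 "exp (- y)"] by simp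
  ultimately show ?thesis by linarith
qed

lemma exp_decay_bound:
  fixes r :: real
  assumes "1 \<le> r"
  shows "exp (- (r / sqrt 2)) \<le> 16 / (1 + r)\<^sup>2"
proof -
  have "1 + r / sqrt 2 + (r / sqrt 2)\<^sup>2 / 2 \<le> exp (r / sqrt 2)"
    using assms by (intro exp_lower_Taylor_quadratic) auto
  moreover have "(r / sqrt 2)\<^sup>2 / 2 = r\<^sup>2 / 4" by (simp add: power_divide)
  moreover have "0 \<le> r / sqrt 2" using assms by simp
  ultimately have "r\<^sup>2 / 4 \<le> exp (r / sqrt 2)" by linarith
  moreover have "(1 + r)\<^sup>2 \<le> (2 * r)\<^sup>2" using assms by (intro power_mono) auto
  ultimately have "(1 + r)\<^sup>2 \<le> 16 * exp (r / sqrt 2)" by (simp add: power_mult_distrib)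
  then show ?thesis using assms by (simp add: exp_minus field_simps add_pos_nonneg)
qed

text \<open>Where \<open>norm y \<le> 1\<close>, the tip 0 included, continuity on a compact set
  suffices, thanks to the removable singularity. Farther out the explicit formula is
  \<open>2 / y ^ 3\<close> plus an exponentially small term. The quadratic decay makes the errors of
  the Riemann sum summable.\<close>

lemma second_deriv_bound:
  obtains M where "M > 0"
    "\<And>y. y \<in> insert 0 sector \<Longrightarrow> norm (deriv (deriv sample_primitive) y) \<le> M / (1 + norm y)\<^sup>2"
proof -
  let ?f = "deriv (deriv sample_primitive)"
  have hol: "?f holomorphic_on sample_domain"
    using sample_primitive_holomorphic open_sample_domain by (intro holomorphic_deriv) auto
  let ?K = "cball 0 1 \<inter> {y. 0 \<le> Re y} \<inter> {y::complex. \<bar>Im y\<bar> \<le> Re y}"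
  have K: "compact ?K"
    by (intro compact_Int_closed compact_cball closed_halfspace_Re_ge closed_Collect_le continuous_intros)
  have "?K \<subseteq> sample_domain"
  proof
    fix y assume y: "y \<in> ?K"
    show "y \<in> sample_domain"
    proof (cases "Re y = 0")
      case True
      then have "y = 0" using y by (auto simp: complex_eq_iff)
      then show ?thesis by simp
    next
      case False
      then show ?thesis using y by auto
    qed
  qed
  then have "compact (?f ` ?K)"
    by (intro compact_continuous_image K holomorphic_on_imp_continuous_on) (rule holomorphic_on_subset[OF hol])
  then have "bounded (?f ` ?K)" by (rule compact_imp_bounded)
  then obtain B where B0: "B > 0" "\<forall>z\<in>?f ` ?K. norm z \<le> B"
    unfolding bounded_pos by blast
  then have B: "norm (?f y) \<le> B" if "y \<in> ?K" for y using that by blast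
  \<comment> \<open>\<open>4 * B\<close> covers \<open>(1 + norm y)\<^sup>2 \<le> 4\<close> near 0.
    Farther out 8 comes from \<open>2 / y ^ 3\<close>, while 16, 2 and 64 bound the exponential,
    \<open>1 + exp (- y)\<close> and the inverse cube of \<open>1 - exp (- y)\<close>.\<close>
  define M where "M = max (4 * B) (8 + 2 * 64 * 16)"
  show ?thesis
  proof (rule that[of M])
    show "M > 0" by (simp add: M_def)
    fix y assume y: "y \<in> insert 0 sector"
    show "norm (?f y) \<le> M / (1 + norm y)\<^sup>2"
    proof (cases "norm y \<le> 1")
      case True
      then have "y \<in> ?K" using y by (auto simp: sector_def)
      then have "norm (?f y) \<le> B" by (rule B)
      also have "\<dots> \<le> M / 4" by (simp add: M_def)
      also have "\<dots> \<le> M / (1 + norm y)\<^sup>2"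
      proof (rule divide_left_mono)
        have "(1 + norm y)\<^sup>2 \<le> 2\<^sup>2" using True by (intro power_mono) auto
        then show "(1 + norm y)\<^sup>2 \<le> 4" by simp
      qed (use norm_ge_zero[of y] in \<open>auto simp: M_def simp del: norm_ge_zero\<close>)
      finally show ?thesis .
    next
      case False
      then have s: "y \<in> sector" and n: "1 \<le> norm y" using y by auto
      then have re: "0 < Re y" by (auto simp: sector_def)
      let ?w = "exp (- y)"
      have w: "norm ?w \<le> 16 / (1 + norm y)\<^sup>2"
        using norm_exp_sector[OF s] exp_decay_bound[OF n] by linarith
      have w1: "norm ?w \<le> 1" using re by (simp add: norm_exp_eq_Re)
      have d: "(1 / 4) ^ 3 \<le> norm (1 - ?w) ^ 3"
        using norm_one_minus_exp_sector[OF s n] by (intro power_mono) auto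
      have dp: "0 < norm (1 - ?w) ^ 3" by (rule less_le_trans[OF _ d]) simp
      have "norm (?w * (1 + ?w) / (1 - ?w) ^ 3) = norm ?w * norm (1 + ?w) / norm (1 - ?w) ^ 3"
        by (simp add: norm_mult norm_divide norm_power)
      also have "\<dots> \<le> (16 / (1 + norm y)\<^sup>2) * 2 / (1 / 4) ^ 3"
      proof (intro frac_le mult_mono w d)
        show "norm (1 + ?w) \<le> 2" using norm_triangle_ineq[of 1 ?w] w1 unfolding norm_one by linarith
      qed auto
      finally have p1: "norm (?w * (1 + ?w) / (1 - ?w) ^ 3) \<le> (2 * 64 * 16) / (1 + norm y)\<^sup>2"
        by (simp add: power3_eq_cube)
      have "norm (2 / y ^ 3) = 2 / norm y ^ 3" by (simp add: norm_divide norm_power)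
      also have "\<dots> \<le> 8 / (1 + norm y)\<^sup>2"
      proof -
        have "2 * (1 + norm y)\<^sup>2 \<le> 2 * (2 * norm y)\<^sup>2" using n by (intro mult_left_mono power_mono) auto
        also have "\<dots> = 8 * (norm y)\<^sup>2" by (simp add: power_mult_distrib)
        also have "\<dots> \<le> 8 * norm y ^ 3" using n by (intro mult_left_mono power_increasing) auto
        finally have "2 * (1 + norm y)\<^sup>2 \<le> 8 * norm y ^ 3" .
        moreover have "0 < norm y ^ 3" "0 < (1 + norm y)\<^sup>2" using n by (auto intro!: zero_less_power add_pos_nonneg)
        ultimately show ?thesis by (simp add: divide_le_eq pos_le_divide_eq mult.commute)
      qed
      finally have p2: "norm (2 / y ^ 3) \<le> 8 / (1 + norm y)\<^sup>2" .
      have "norm (?f y) \<le> 8 / (1 + norm y)\<^sup>2 + (2 * 64 * 16) / (1 + norm y)\<^sup>2"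
        unfolding deriv_sample_primitive(2)[OF re]
        by (rule order_trans[OF norm_triangle_ineq4 add_mono[OF p2 p1]])
      also have "\<dots> = (8 + 2 * 64 * 16) / (1 + norm y)\<^sup>2" by (simp add: add_divide_distrib)
      also have "\<dots> \<le> M / (1 + norm y)\<^sup>2" by (intro divide_right_mono) (auto simp: M_def)
      finally show ?thesis .
    qed
  qed
qed

lemma sector_scale: "x \<in> sector \<Longrightarrow> 0 < u \<Longrightarrow> of_real u * x \<in> sector"
  by (auto simp: sector_def abs_mult)

lemma sector_Re_pos: "x \<in> sector \<Longrightarrow> 0 < Re x"
  by (simp add: sector_def)

text \<open>Comparing the primitive with its tangent at the right end \<open>b\<close> bounds the
  error of the right-endpoint rule by the second derivative times \<open>(norm x)\<^sup>2\<close>.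
  The bound on that derivative decreases away from 0, so its value at the left end serves for the
  entire step.\<close>

lemma sample_step:
  assumes x: "x \<in> sector" and M: "\<And>y. y \<in> insert 0 sector \<Longrightarrow> norm (deriv (deriv sample_primitive) y) \<le> M / (1 + norm y)\<^sup>2"
    and "M > 0"
  shows "norm (x * sample (of_nat (Suc m) * x) - (sample_primitive (of_nat (Suc m) * x) - sample_primitive (of_nat m * x)))
    \<le> M * (norm x)\<^sup>2 / (1 + real m * norm x)\<^sup>2"
proof -
  define a where "a = of_nat m * x"
  define b where "b = of_nat (Suc m) * x"
  define K where "K = M / (1 + real m * norm x)\<^sup>2"
  let ?S = "closed_segment a b"
  have K: "K \<ge> 0" using \<open>M > 0\<close> by (simp add: K_def)
  have S: "\<exists>u\<ge>real m. u \<le> real (Suc m) \<and> z = of_real u * x" if zS: "z \<in> ?S" for z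
  proof -
    obtain v where v: "0 \<le> v" "v \<le> 1" and z: "z = (1 - v) *\<^sub>R a + v *\<^sub>R b"
      using zS unfolding in_segment by blast
    have "z = of_real (1 - v) * a + of_real v * b"
      unfolding z scaleR_conv_of_real ..
    also have "\<dots> = of_real (real m + v) * x"
      unfolding a_def b_def by (simp add: algebra_simps)
    finally have "real m \<le> real m + v \<and> real m + v \<le> real (Suc m) \<and> z = of_real (real m + v) * x"
      using v by simp
    then show ?thesis by blast
  qed
  have Ssec: "z \<in> insert 0 sector" if z: "z \<in> ?S" for z
  proof -
    obtain u where u: "u \<ge> real m" "z = of_real u * x" using S[OF z] by blast
    show ?thesis
    proof (cases "u = 0")
      case False
      then have "u > 0" using u by linarith
      then show ?thesis using u sector_scale[OF x] by simp
    qed (use u in simp)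
  qed
  have Snorm: "norm (deriv (deriv sample_primitive) z) \<le> K" if z: "z \<in> ?S" for z
  proof -
    obtain u where u: "u \<ge> real m" "z = of_real u * x" using S[OF z] by blast
    then have "real m * norm x \<le> norm z" by (simp add: norm_mult mult_right_mono)
    then have "(1 + real m * norm x)\<^sup>2 \<le> (1 + norm z)\<^sup>2" by (intro power_mono) auto
    moreover have "0 < 1 + norm z" "0 < 1 + real m * norm x" by (simp_all add: add_pos_nonneg)
    ultimately have "M / (1 + norm z)\<^sup>2 \<le> K" unfolding K_def using \<open>M > 0\<close>
      by (intro divide_left_mono mult_pos_pos zero_less_power) simp_all
    then show ?thesis using M[OF Ssec[OF z]] by linarith
  qed
  have Sdom: "z \<in> sample_domain" if "z \<in> ?S" for z
    using Ssec[OF that] sector_Re_pos by auto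
  have d1: "(sample_primitive has_field_derivative deriv sample_primitive z) (at z within ?S)" if "z \<in> ?S" for z
    using holomorphic_derivI[OF sample_primitive_holomorphic open_sample_domain Sdom[OF that]]
    by (rule has_field_derivative_at_within)
  have h2: "deriv sample_primitive holomorphic_on sample_domain"
    by (rule holomorphic_deriv[OF sample_primitive_holomorphic open_sample_domain])
  have d2: "(deriv sample_primitive has_field_derivative deriv (deriv sample_primitive) z) (at z within ?S)" if "z \<in> ?S" for z
    using holomorphic_derivI[OF h2 open_sample_domain Sdom[OF that]]
    by (rule has_field_derivative_at_within)
  have ba: "b - a = x" by (simp add: a_def b_def algebra_simps)
  have st: "norm (deriv sample_primitive z - deriv sample_primitive b) \<le> K * norm x" if z: "z \<in> ?S" for z
  proof -
    have "norm (deriv sample_primitive z - deriv sample_primitive b) \<le> K * norm (z - b)"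
      by (rule field_differentiable_bound[where S = ?S, OF _ d2 Snorm]) (use z in auto)
    also have "norm (z - b) \<le> norm (b - a)" using segment_bound(2)[OF z] by (simp add: norm_minus_commute)
    finally show ?thesis using K ba by (simp add: mult_left_mono)
  qed
  have "norm ((sample_primitive b - b * deriv sample_primitive b) - (sample_primitive a - a * deriv sample_primitive b)) \<le> K * norm x * norm (b - a)"
  proof (rule field_differentiable_bound[where S = ?S])
    fix z assume z: "z \<in> ?S"
    show "((\<lambda>z. sample_primitive z - z * deriv sample_primitive b) has_field_derivative (deriv sample_primitive z - deriv sample_primitive b)) (at z within ?S)"
      by (auto intro!: derivative_eq_intros d1[OF z])
  qed (use st in auto)
  moreover have "deriv sample_primitive b = sample b"
    using sector_Re_pos[OF x] by (intro deriv_sample_primitive) (simp add: b_def)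
  moreover have "(p - b * v) - (q - a * v) = - (x * v - (p - q))" for p q v
    unfolding ba[symmetric] by (simp add: algebra_simps)
  ultimately have "norm (x * sample b - (sample_primitive b - sample_primitive a)) \<le> K * norm x * norm x"
    by (simp only: ba norm_minus_cancel)
  then show ?thesis by (simp add: a_def b_def K_def power2_eq_square)
qed

text \<open>The term \<open>m = 0\<close> contributes \<open>r\<^sup>2\<close>; each later one is
  dominated by a difference of consecutive values of \<open>r / (1 + m * r)\<close>, and these
  telescope to at most \<open>r\<close>.\<close>

lemma sum_inverse_square_bound:
  fixes r :: real
  assumes "r > 0"
  shows "(\<Sum>m<N. r\<^sup>2 / (1 + real m * r)\<^sup>2) \<le> r\<^sup>2 + r"
proof -
  have *: "(\<Sum>m<Suc N. r\<^sup>2 / (1 + real m * r)\<^sup>2) \<le> r\<^sup>2 + r * (1 - 1 / (1 + real N * r))" for N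
  proof (induction N)
    case (Suc N)
    have p: "1 + real N * r > 0" "1 + real (Suc N) * r > 0" using assms by (auto intro!: add_pos_nonneg)
    have "r\<^sup>2 / (1 + real (Suc N) * r)\<^sup>2 \<le> r\<^sup>2 / ((1 + real N * r) * (1 + real (Suc N) * r))"
      unfolding power2_eq_square[of "1 + real (Suc N) * r"]
      by (intro divide_left_mono mult_right_mono mult_pos_pos p) (use p assms in \<open>auto simp: mult_right_mono\<close>)
    also have "\<dots> = r * (1 / (1 + real N * r) - 1 / (1 + real (Suc N) * r))"
    proof -
      have f: "1 / u - 1 / v = r / (u * v)" if "u > 0" "v > 0" "v = u + r" for u v
        using that by (simp add: field_simps)
      have "1 / (1 + real N * r) - 1 / (1 + real (Suc N) * r) = r / ((1 + real N * r) * (1 + real (Suc N) * r))"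
        by (rule f[OF p]) (simp add: distrib_right)
      then show ?thesis by (simp add: power2_eq_square)
    qed
    finally have "(\<Sum>m<Suc (Suc N). r\<^sup>2 / (1 + real m * r)\<^sup>2) \<le> r\<^sup>2 + r * (1 - 1 / (1 + real N * r)) + r * (1 / (1 + real N * r) - 1 / (1 + real (Suc N) * r))"
      unfolding sum.lessThan_Suc[of _ "Suc N"] by (rule add_mono[OF Suc.IH])
    also have "\<dots> = r\<^sup>2 + r * (1 - 1 / (1 + real (Suc N) * r))"
      by (simp only: right_diff_distrib)
    finally show ?case .
  qed simp
  have "(\<Sum>m<N. r\<^sup>2 / (1 + real m * r)\<^sup>2) \<le> (\<Sum>m<Suc N. r\<^sup>2 / (1 + real m * r)\<^sup>2)"
    by (simp add: zero_le_divide_iff)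
  also have "\<dots> \<le> r\<^sup>2 + r * (1 - 1 / (1 + real N * r))" by (rule *)
  also have "\<dots> \<le> r\<^sup>2 + r * 1"
    using assms by (intro add_left_mono mult_left_mono) (auto simp: add_nonneg_nonneg)
  finally show ?thesis by simp
qed

text \<open>The logarithmic derivative of \<open>Phi (exp (- x))\<close> with respect to
  \<open>x\<close>, see \<open>Phi_exp_deriv\<close>; the factor \<open>- exp (- x)\<close> comes
  from the chain rule.\<close>

definition Phi_log_deriv :: "complex \<Rightarrow> complex" where
  "Phi_log_deriv x = - exp (- x) * (deriv Phi (exp (- x)) / Phi (exp (- x)))"

text \<open>The logarithmic derivative of the quotient of \<open>Phi (exp (- x))\<close> by its
  expected leading form \<open>exp (- (Ln x / 2) - (pi\<^sup>2 / 6) / x)\<close>. Its boundedness in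
  the sector stands in for the modular transformation.\<close>

definition eta_defect :: "complex \<Rightarrow> complex" where
  "eta_defect x = Phi_log_deriv x - of_real (pi\<^sup>2 / 6) / x\<^sup>2 + 1 / (2 * x)"

lemma norm_exp_neg_less_1: "0 < Re x \<Longrightarrow> norm (exp (- x)) < 1"
  by (simp add: norm_exp_eq_Re)

lemma sample_sums:
  assumes "0 < Re x"
  shows "(\<lambda>m. x * sample (of_nat (Suc m) * x)) sums (x * (Phi_log_deriv x - of_real (pi\<^sup>2 / 6) / x\<^sup>2))"
proof -
  have x0: "x \<noteq> 0" using assms by auto
  have "(\<lambda>m. complex_of_real (1 / (real m + 1)\<^sup>2)) sums of_real (pi\<^sup>2 / 6)"
    using inverse_squares_sums by (simp only: sums_of_real_iff of_nat_power of_nat_add of_nat_1)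
  from sums_divide[OF this, of "x\<^sup>2"]
  have "(\<lambda>m. complex_of_real (1 / (real m + 1)\<^sup>2) / x\<^sup>2) sums (of_real (pi\<^sup>2 / 6) / x\<^sup>2)" .
  moreover have "complex_of_real (1 / (real m + 1)\<^sup>2) / x\<^sup>2 = 1 / (of_nat (Suc m) * x)\<^sup>2" for m
    unfolding power_mult_distrib by (simp add: add.commute)
  ultimately have "(\<lambda>m. 1 / (of_nat (Suc m) * x)\<^sup>2) sums (of_real (pi\<^sup>2 / 6) / x\<^sup>2)"
    by (simp only:)
  from sums_mult[OF sums_diff[OF Phi_logderiv_resummed[OF assms] this], of x]
  show ?thesis unfolding sample_def Phi_log_deriv_def by simp
qed

lemma sample_primitive_tendsto_0:
  assumes "0 < Re x"
  shows "(\<lambda>n. sample_primitive (of_nat n * x)) \<longlonglongrightarrow> 0"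
proof -
  have x0: "x \<noteq> 0" using assms by auto
  have p: "(\<lambda>n. exp (- x) ^ n) \<longlonglongrightarrow> 0"
    using norm_exp_neg_less_1[OF assms] by (rule LIMSEQ_power_zero)
  have "(\<lambda>n. inverse (of_nat n) * inverse x - exp (- x) ^ n / (1 - exp (- x) ^ n)) \<longlonglongrightarrow> 0 * inverse x - 0 / (1 - 0)"
    by (intro tendsto_intros p lim_inverse_n) auto
  then have "(\<lambda>n. inverse (of_nat n) * inverse x - exp (- x) ^ n / (1 - exp (- x) ^ n)) \<longlonglongrightarrow> 0"
    by simp
  moreover have "\<forall>\<^sub>F n in sequentially. inverse (of_nat n) * inverse x - exp (- x) ^ n / (1 - exp (- x) ^ n) = sample_primitive (of_nat n * x)"
    using eventually_gt_at_top[of 0]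
  proof eventually_elim
    case (elim n)
    define w where "w = exp (- x) ^ n"
    have w: "w \<noteq> 0" by (simp add: w_def)
    have "w = exp (- (of_nat n * x))" by (simp add: w_def exp_of_nat_mult[symmetric])
    then have "w * exp (of_nat n * x) = 1" by (simp flip: exp_add)
    then have e: "exp (of_nat n * x) = 1 / w" by (simp add: w nonzero_eq_divide_eq mult.commute)
    have f: "1 / (1 / w - 1) = w / (1 - w)" using w by (cases "w = 1") (auto simp: field_simps)
    show ?case unfolding sample_primitive_def e f w_def[symmetric] using elim x0 by (simp add: divide_inverse)
  qed
  ultimately show ?thesis by (rule Lim_transform_eventually)
qed

text \<open>The increments of \<open>sample_primitive\<close> telescope from 1/2 at 0 to 0 at
  infinity. So \<open>x * (Phi_log_deriv x - (pi\<^sup>2 / 6) / x\<^sup>2)\<close> is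
  \<open>- 1 / 2\<close> up to the error of the Riemann sum; the term \<open>1 / (2 * x)\<close> of
  the defect removes this value.\<close>

lemma eta_defect_near_0:
  obtains M where "M > 0" "\<And>x. x \<in> sector \<Longrightarrow> norm (x * eta_defect x) \<le> M * ((norm x)\<^sup>2 + norm x)"
proof -
  obtain M where M: "M > 0"
    "\<And>y. y \<in> insert 0 sector \<Longrightarrow> norm (deriv (deriv sample_primitive) y) \<le> M / (1 + norm y)\<^sup>2"
    by (rule second_deriv_bound) (rule that)
  show ?thesis
  proof (rule that[OF M(1)])
    fix x assume x: "x \<in> sector"
    have re: "0 < Re x" and x0: "x \<noteq> 0" using sector_Re_pos[OF x] by auto
    let ?s = "\<lambda>N. \<Sum>m<N. x * sample (of_nat (Suc m) * x)"
    have bd: "norm (?s N - (sample_primitive (of_nat N * x) - 1 / 2)) \<le> M * ((norm x)\<^sup>2 + norm x)" for N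
    proof -
      have "?s N - (sample_primitive (of_nat N * x) - 1 / 2) = (\<Sum>m<N. x * sample (of_nat (Suc m) * x) - (sample_primitive (of_nat (Suc m) * x) - sample_primitive (of_nat m * x)))"
      proof -
        have "sample_primitive 0 = 1 / 2" by (simp add: sample_primitive_def)
        then have "(\<Sum>m<N. sample_primitive (of_nat (Suc m) * x) - sample_primitive (of_nat m * x)) = sample_primitive (of_nat N * x) - 1 / 2"
          using sum_lessThan_telescope[of "\<lambda>m. sample_primitive (of_nat m * x)" N] by (simp del: of_nat_Suc)
        then show ?thesis by (simp only: sum_subtractf)
      qed
      also have "norm \<dots> \<le> (\<Sum>m<N. M * (norm x)\<^sup>2 / (1 + real m * norm x)\<^sup>2)"
        by (intro order_trans[OF norm_sum] sum_mono sample_step x M)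
      also have "\<dots> = M * (\<Sum>m<N. (norm x)\<^sup>2 / (1 + real m * norm x)\<^sup>2)"
        by (simp add: sum_distrib_left)
      also have "\<dots> \<le> M * ((norm x)\<^sup>2 + norm x)"
        using M(1) x0 by (intro mult_left_mono sum_inverse_square_bound) auto
      finally show ?thesis .
    qed
    have lim: "(\<lambda>N. norm (?s N - (sample_primitive (of_nat N * x) - 1 / 2))) \<longlonglongrightarrow> norm (x * (Phi_log_deriv x - of_real (pi\<^sup>2 / 6) / x\<^sup>2) - (0 - 1 / 2))"
      using sample_sums[OF re] unfolding sums_def
      by (intro tendsto_intros sample_primitive_tendsto_0 re)
    have "norm (x * (Phi_log_deriv x - of_real (pi\<^sup>2 / 6) / x\<^sup>2) - (0 - 1 / 2)) \<le> M * ((norm x)\<^sup>2 + norm x)"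
      by (rule LIMSEQ_le_const2[OF lim]) (use bd in blast)
    moreover have "x * (Phi_log_deriv x - of_real (pi\<^sup>2 / 6) / x\<^sup>2) - (0 - 1 / 2) = x * eta_defect x"
    proof -
      have "x * u - (0 - 1 / 2) = x * (u + 1 / (2 * x))" for u using x0 by (simp add: distrib_left)
      then show ?thesis unfolding eta_defect_def .
    qed
    ultimately show "norm (x * eta_defect x) \<le> M * ((norm x)\<^sup>2 + norm x)" by simp
  qed
qed

lemma norm_exp_sector_far:
  assumes "y \<in> sector" "1 \<le> norm y"
  shows "norm (exp (- y)) \<le> 3 / 4"
proof -
  have "sqrt 2 \<le> 3 / 2" by (rule real_le_lsqrt) (auto simp: power2_eq_square)
  then have "2 / 3 \<le> norm y / sqrt 2" using assms(2) by (simp add: field_simps)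
  then have "exp (- (norm y / sqrt 2)) \<le> exp (- (2 / 3))" by simp
  moreover have "exp (- (2 / 3)) \<le> (3 / 4 :: real)"
  proof -
    have "4 / 3 \<le> exp (2 / 3 :: real)" using exp_ge_add_one_self[of "2 / 3"] by simp
    then show ?thesis by (simp add: exp_minus field_simps)
  qed
  ultimately show ?thesis using norm_exp_sector[OF assms(1)] by linarith
qed

lemma Phi_log_deriv_far:
  assumes x: "x \<in> sector" "1 \<le> norm x"
  shows "norm (Phi_log_deriv x) \<le> 48"
proof -
  let ?g = "\<lambda>m. exp (- (of_nat (Suc m) * x)) / (1 - exp (- (of_nat (Suc m) * x)))\<^sup>2"
  have s: "?g sums Phi_log_deriv x"
    unfolding Phi_log_deriv_def by (rule Phi_logderiv_resummed[OF sector_Re_pos[OF x(1)]])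
  \<comment> \<open>The squared denominator costs at most a factor 16, and the powers of 3/4 sum to
    3, which gives 48.\<close>
  have bound: "norm (?g m) \<le> 16 * (3 / 4) ^ Suc m" for m
  proof -
    have y: "of_nat (Suc m) * x \<in> sector" using sector_scale[OF x(1), of "real (Suc m)"] by simp
    have "1 * 1 \<le> real (Suc m) * norm x" using x(2) by (intro mult_mono) auto
    then have n: "1 \<le> norm (of_nat (Suc m) * x)" by (simp add: norm_mult del: of_nat_Suc)
    have "(1 / 4)\<^sup>2 \<le> (norm (1 - exp (- (of_nat (Suc m) * x))))\<^sup>2"
      using norm_one_minus_exp_sector[OF y n] by (intro power_mono) auto
    moreover have "norm (exp (- (of_nat (Suc m) * x))) \<le> (3 / 4) ^ Suc m"
    proof -
      have "exp (- (of_nat (Suc m) * x)) = exp (- x) ^ Suc m"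
        by (simp only: exp_of_nat_mult[symmetric] mult_minus_right)
      then show ?thesis using norm_exp_sector_far[OF x] by (simp only: norm_power) (intro power_mono, auto)
    qed
    ultimately have "norm (?g m) \<le> (3 / 4) ^ Suc m / (1 / 4)\<^sup>2"
      unfolding norm_divide norm_power by (intro frac_le) auto
    then show ?thesis by (simp add: power2_eq_square)
  qed
  have g: "(\<lambda>m. 16 * (3 / 4 :: real) ^ Suc m) sums 48"
    using sums_mult[OF geometric_sums[of "3 / 4 :: real"], of 12] by simp
  have "norm (suminf ?g) \<le> (\<Sum>m. 16 * (3 / 4 :: real) ^ Suc m)"
    by (rule norm_suminf_le) (use bound g in \<open>auto simp: sums_iff\<close>)
  then show ?thesis using s g by (simp add: sums_iff)
qed

lemma eta_defect_bounded:
  obtains B where "B > 0" "\<And>x. x \<in> sector \<Longrightarrow> norm (eta_defect x) \<le> B"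
proof -
  obtain M where M: "M > 0" "\<And>x. x \<in> sector \<Longrightarrow> norm (x * eta_defect x) \<le> M * ((norm x)\<^sup>2 + norm x)"
    by (rule eta_defect_near_0) (rule that)
  define B where "B = max (2 * M) (48 + pi\<^sup>2 / 6 + 1 / 2)"
  show ?thesis
  proof (rule that[of B])
    show "B > 0" using M by (auto simp: B_def)
    fix x assume x: "x \<in> sector"
    then have x0: "norm x > 0" using sector_Re_pos[OF x] by auto
    show "norm (eta_defect x) \<le> B"
    proof (cases "norm x \<le> 1")
      case True
      have "norm x * norm (eta_defect x) \<le> norm x * (M * (norm x + 1))"
        using M(2)[OF x] by (simp add: norm_mult power2_eq_square algebra_simps)
      then have "norm (eta_defect x) \<le> M * (norm x + 1)" using x0 by simp
      also have "\<dots> \<le> M * 2" using True M by (intro mult_left_mono) auto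
      finally show ?thesis by (simp add: B_def)
    next
      case False
      then have n: "1 \<le> norm x" by simp
      have "norm (of_real (pi\<^sup>2 / 6) / x\<^sup>2) = pi\<^sup>2 / 6 / (norm x)\<^sup>2"
        by (simp only: norm_divide norm_power norm_of_real) simp
      also have "\<dots> \<le> pi\<^sup>2 / 6 / 1" using n by (intro divide_left_mono) auto
      finally have 1: "norm (of_real (pi\<^sup>2 / 6) / x\<^sup>2) \<le> pi\<^sup>2 / 6" by simp
      have 2: "norm (1 / (2 * x)) \<le> 1 / 2" 
      proof -
        have "1 / norm x \<le> 1 / 1" using n by (intro divide_left_mono) auto
        then show ?thesis by (simp add: norm_divide norm_mult)
      qed
      have "norm (eta_defect x) \<le> norm (Phi_log_deriv x) + norm (of_real (pi\<^sup>2 / 6) / x\<^sup>2) + norm (1 / (2 * x))"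
        unfolding eta_defect_def by (intro order_trans[OF norm_triangle_ineq] add_right_mono norm_triangle_ineq4)
      then show ?thesis using 1 2 Phi_log_deriv_far[OF x n] by (simp add: B_def)
    qed
  qed
qed

section \<open>From the logarithmic derivative to the product\<close>

lemma Phi_tendsto: "norm q < 1 \<Longrightarrow> (\<lambda>N. \<Prod>n<N. 1 - q ^ Suc n) \<longlonglongrightarrow> Phi q"
  using tendsto_uniform_limitI[OF Phi_uniform_limit[of "norm q"], of q] by simp

lemma Phi_cnj: "norm q < 1 \<Longrightarrow> Phi (cnj q) = cnj (Phi q)"
proof -
  assume q: "norm q < 1"
  have "(\<lambda>N. \<Prod>n<N. 1 - cnj q ^ Suc n) \<longlonglongrightarrow> cnj (Phi q)"
    using tendsto_cnj[OF Phi_tendsto[OF q]] by simp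
  then show ?thesis using Phi_tendsto[of "cnj q"] q LIMSEQ_unique by auto
qed

text \<open>Limits of the real partial products are only nonnegative; \<open>Phi_nonzero\<close>
  makes the inequality strict.\<close>

lemma Phi_real_pos:
  assumes "0 \<le> r" "r < 1"
  obtains p :: real where "p > 0" "Phi (of_real r) = of_real p"
proof -
  have n: "norm (complex_of_real r) < 1" using assms by simp
  have "cnj (Phi (of_real r)) = Phi (of_real r)" using Phi_cnj[OF n] by (metis complex_cnj_complex_of_real)
  then have eq: "Phi (of_real r) = of_real (Re (Phi (of_real r)))"
    by (metis Reals_cnj_iff of_real_Re)
  have lim: "(\<lambda>N. Re (\<Prod>n<N. 1 - complex_of_real r ^ Suc n)) \<longlonglongrightarrow> Re (Phi (of_real r))"
    by (intro tendsto_Re Phi_tendsto n)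
  have nn: "Re (\<Prod>n<N. 1 - complex_of_real r ^ Suc n) \<ge> 0" for N
  proof -
    have "(\<Prod>n<N. 1 - complex_of_real r ^ Suc n) = of_real (\<Prod>n<N. 1 - r ^ Suc n)" by simp
    moreover have "(\<Prod>n<N. 1 - r ^ Suc n) \<ge> 0"
    proof (rule prod_nonneg)
      fix n :: nat
      show "0 \<le> 1 - r ^ Suc n" using power_le_one[of r "Suc n"] assms by simp
    qed
    ultimately show ?thesis by (simp only: Re_complex_of_real)
  qed
  have "Re (Phi (of_real r)) \<ge> 0"
    by (rule LIMSEQ_le_const[OF lim]) (use nn in blast)
  moreover have "Re (Phi (of_real r)) \<noteq> 0" using Phi_nonzero[OF n] eq by (metis of_real_0)
  ultimately show ?thesis by (intro that[OF _ eq]) linarith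
qed

lemma norm_exp_minus_1_le:
  fixes w :: complex
  shows "norm (exp w - 1) \<le> norm w * exp (norm w)"
  using Taylor_exp_field[of w 0] by (simp add: mult.commute)

lemma convex_sector: "convex sector"
proof (rule convexI)
  fix x y :: complex and u v :: real
  assume *: "x \<in> sector" "y \<in> sector" "0 \<le> u" "0 \<le> v" "u + v = 1"
  have "\<bar>u * Im x + v * Im y\<bar> \<le> u * \<bar>Im x\<bar> + v * \<bar>Im y\<bar>"
    using * by (intro order_trans[OF abs_triangle_ineq]) (simp add: abs_mult)
  also have "\<dots> \<le> u * Re x + v * Re y"
    using * by (intro add_mono mult_left_mono) (auto simp: sector_def)
  finally have 1: "\<bar>u * Im x + v * Im y\<bar> \<le> u * Re x + v * Re y" .
  have "0 < u * Re x + v * Re y"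
  proof (cases "u = 0")
    case False
    then have "0 < u * Re x" using * by (simp add: sector_def)
    moreover have "0 \<le> v * Re y" using * by (simp add: sector_def)
    ultimately show ?thesis by linarith
  qed (use * in \<open>auto simp: sector_def\<close>)
  then show "u *\<^sub>R x + v *\<^sub>R y \<in> sector" using 1 by (simp add: sector_def)
qed

lemma Phi_exp_deriv:
  assumes "0 < Re x"
  shows "((\<lambda>x. Phi (exp (- x))) has_field_derivative Phi (exp (- x)) * Phi_log_deriv x) (at x)"
proof -
  have n: "norm (exp (- x)) < 1" by (rule norm_exp_neg_less_1[OF assms])
  have "(Phi has_field_derivative deriv Phi (exp (- x))) (at (exp (- x)))"
    by (rule holomorphic_derivI[OF Phi_holomorphic open_ball]) (use n in simp)
  moreover have "((\<lambda>x. exp (- x)) has_field_derivative - exp (- x)) (at x)"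
    by (auto intro!: derivative_eq_intros)
  ultimately have "((\<lambda>x. Phi (exp (- x))) has_field_derivative deriv Phi (exp (- x)) * (- exp (- x))) (at x)"
    by (rule DERIV_chain2)
  then show ?thesis using Phi_nonzero[OF n] by (simp add: Phi_log_deriv_def mult_ac)
qed

text \<open>The constant \<open>K\<close> equals \<open>sqrt (2 * pi)\<close>, but only its existence and positivity matter, because it
  cancels in every quotient formed later.\<close>

lemma Phi_sector_asymptotic:
  obtains K B where "K > (0::real)" "B > 0"
    "\<And>x. x \<in> sector \<Longrightarrow> \<exists>w. norm w \<le> B * norm x \<and>
       Phi (exp (- x)) = of_real K * exp (- (Ln x / 2) - of_real (pi\<^sup>2 / 6) / x) * exp w"
proof -
  obtain B where B: "B > 0" "\<And>x. x \<in> sector \<Longrightarrow> norm (eta_defect x) \<le> B"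
    by (rule eta_defect_bounded) (rule that)
  let ?H = "{x::complex. 0 < Re x}"
  have H: "open ?H" "convex ?H" by (rule open_halfspace_Re_gt) (rule convex_halfspace_Re_gt)
  \<comment> \<open>The quotient of the product by its expected leading form; its logarithmic
    derivative is the bounded function \<open>eta_defect\<close>.\<close>
  define E where "E = (\<lambda>x. Phi (exp (- x)) * exp (Ln x / 2 + of_real (pi\<^sup>2 / 6) / x))"
  have E0: "E x \<noteq> 0" if "0 < Re x" for x
    using Phi_nonzero[OF norm_exp_neg_less_1[OF that]] by (simp add: E_def)
  have dE: "(E has_field_derivative E x * eta_defect x) (at x)" if x: "0 < Re x" for x
  proof -
    have x0: "x \<noteq> 0" "x \<notin> \<real>\<^sub>\<le>\<^sub>0" using x by (auto simp: complex_nonpos_Reals_iff)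
    have d: "((\<lambda>x. exp (Ln x / 2 + of_real (pi\<^sup>2 / 6) / x)) has_field_derivative exp (Ln x / 2 + of_real (pi\<^sup>2 / 6) / x) * (1 / (2 * x) - of_real (pi\<^sup>2 / 6) / x\<^sup>2)) (at x)"
      using x0 by (auto intro!: derivative_eq_intros simp: field_simps power2_eq_square)
    show ?thesis unfolding E_def
      by (rule DERIV_cong[OF DERIV_mult[OF Phi_exp_deriv[OF x] d]])
        (simp add: eta_defect_def algebra_simps)
  qed
  have holE: "E holomorphic_on ?H"
    using dE by (intro holomorphic_onI) (auto simp: field_differentiable_def intro: has_field_derivative_at_within)
  have "(\<lambda>x. deriv E x / E x) holomorphic_on ?H"
    using E0 by (intro holomorphic_intros holomorphic_deriv holE H) auto
  then have "eta_defect holomorphic_on ?H"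
  proof (rule holomorphic_transform)
    show "deriv E x / E x = eta_defect x" if "x \<in> ?H" for x
      using DERIV_imp_deriv[OF dE[of x]] E0[of x] that by simp
  qed
  from primitive_on_convex_open[OF H this] obtain l where
    l: "\<And>x. 0 < Re x \<Longrightarrow> (l has_field_derivative eta_defect x) (at x)" by auto
  have "\<exists>c. \<forall>x\<in>?H. E x * exp (- l x) = c"
  proof (rule has_field_derivative_zero_constant[OF H(2)])
    fix x assume "x \<in> ?H"
    then have x: "0 < Re x" by simp
    have "((\<lambda>x. E x * exp (- l x)) has_field_derivative 0) (at x)"
      by (rule DERIV_cong[OF DERIV_mult[OF dE[OF x] DERIV_chain2[OF DERIV_exp DERIV_minus[OF l[OF x]]]]]) simp
    then show "((\<lambda>x. E x * exp (- l x)) has_field_derivative 0) (at x within ?H)"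
      by (rule has_field_derivative_at_within)
  qed
  then obtain c where c: "\<And>x. 0 < Re x \<Longrightarrow> E x * exp (- l x) = c" by auto
  have Ec: "E x = c * exp (l x)" if "0 < Re x" for x
    unfolding c[OF that, symmetric] by (simp add: mult.assoc flip: exp_add)
  have c0: "c \<noteq> 0" using E0[of 1] Ec[of 1] by auto
  \<comment> \<open>The sector is convex and the derivative of \<open>l\<close> is bounded there, so
    \<open>l\<close> is Lipschitz. This makes it converge at the tip 0, which lies outside the
    domain.\<close>
  have lip: "norm (l x - l y) \<le> B * norm (x - y)" if "x \<in> sector" "y \<in> sector" for x y
    by (rule field_differentiable_bound[OF convex_sector _ B(2)])
      (use that in \<open>auto intro: has_field_derivative_at_within l sector_Re_pos\<close>)
  \<comment> \<open>Real points tending to 0: along them \<open>E\<close> is positive, which makes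
    the limiting constant real and nonnegative.\<close>
  define u where "u = (\<lambda>n. complex_of_real (1 / real (Suc n)))"
  have us: "u n \<in> sector" for n by (simp add: u_def sector_def)
  have u0: "u \<longlonglongrightarrow> 0"
  proof -
    have "(\<lambda>n. 1 / real (Suc n)) \<longlonglongrightarrow> 0"
      using LIMSEQ_inverse_real_of_nat by (simp add: inverse_eq_divide)
    then have "(\<lambda>n. complex_of_real (1 / real (Suc n))) \<longlonglongrightarrow> complex_of_real 0"
      by (rule tendsto_of_real)
    then show ?thesis by (simp only: u_def of_real_0)
  qed
  have "Cauchy (\<lambda>n. l (u n))"
  proof (rule uniformly_continuous_on_Cauchy[OF _ _ us])
    have "B-lipschitz_on sector l"
      by (rule lipschitz_onI) (use lip B in \<open>auto simp: dist_norm\<close>)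
    then show "uniformly_continuous_on sector l" by (rule lipschitz_on_uniformly_continuous)
    show "Cauchy u" using u0 by (rule LIMSEQ_imp_Cauchy)
  qed
  then obtain l0 where l0: "(\<lambda>n. l (u n)) \<longlonglongrightarrow> l0"
    by (auto simp: Cauchy_convergent_iff convergent_def)
  have w: "norm (l x - l0) \<le> B * norm x" if x: "x \<in> sector" for x
  proof (rule LIMSEQ_le[of "\<lambda>n. norm (l x - l (u n))" _ "\<lambda>n. B * norm (x - u n)"])
    show "(\<lambda>n. norm (l x - l (u n))) \<longlonglongrightarrow> norm (l x - l0)" by (intro tendsto_intros l0)
    have "(\<lambda>n. B * norm (x - u n)) \<longlonglongrightarrow> B * norm (x - 0)" by (intro tendsto_intros u0)
    then show "(\<lambda>n. B * norm (x - u n)) \<longlonglongrightarrow> B * norm x" by simp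
  qed (use lip[OF x us] in blast)
  have "(\<lambda>n. c * exp (l (u n))) \<longlonglongrightarrow> c * exp l0" by (intro tendsto_intros l0)
  then have limE: "(\<lambda>n. E (u n)) \<longlonglongrightarrow> c * exp l0"
    using Ec[OF sector_Re_pos[OF us]] by simp
  have Epos: "\<exists>e>0. E (u n) = complex_of_real e" for n
  proof -
    define r where "r = 1 / real (Suc n)"
    have r: "r > 0" "u n = of_real r" by (simp_all add: r_def u_def)
    obtain p where p: "p > 0" "Phi (of_real (exp (- r))) = of_real p"
      by (rule Phi_real_pos[of "exp (- r)"]) (use r in auto)
    have "E (u n) = of_real (p * exp (ln r / 2 + (pi\<^sup>2 / 6) / r))"
      unfolding E_def r(2) using p(2) r(1) by (simp add: Ln_of_real exp_of_real[symmetric])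
    then show ?thesis using p(1) by (intro exI[of _ "p * exp (ln r / 2 + (pi\<^sup>2 / 6) / r)"]) auto
  qed
  define K where "K = Re (c * exp l0)"
  have "c * exp l0 \<in> \<real>"
    using limE Epos by (intro Lim_in_closed_set[OF closed_complex_Reals always_eventually _ limE]) (auto, metis Reals_of_real)
  then have K: "c * exp l0 = of_real K" unfolding K_def by (rule of_real_Re[symmetric])
  have "0 \<le> K" unfolding K_def
  proof (rule LIMSEQ_le_const[OF tendsto_Re[OF limE]])
    show "\<exists>N. \<forall>n\<ge>N. 0 \<le> Re (E (u n))" using Epos by (metis Re_complex_of_real less_imp_le)
  qed
  moreover have "K \<noteq> 0"
  proof
    assume "K = 0"
    then have "c * exp l0 = 0" using K by simp
    then show False using c0 by simp
  qed
  ultimately have K0: "K > 0" by simp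
  show ?thesis
  proof (rule that[OF K0 B(1)])
    fix x assume x: "x \<in> sector"
    have "Phi (exp (- x)) = E x * exp (- (Ln x / 2) - of_real (pi\<^sup>2 / 6) / x)"
      by (simp add: E_def mult.assoc flip: exp_add)
    also have "E x = of_real K * exp (l x - l0)"
      unfolding Ec[OF sector_Re_pos[OF x]] K[symmetric] by (simp add: exp_diff)
    finally have "Phi (exp (- x)) = of_real K * exp (- (Ln x / 2) - of_real (pi\<^sup>2 / 6) / x) * exp (l x - l0)"
      by (simp add: mult_ac)
    then show "\<exists>w. norm w \<le> B * norm x \<and>
       Phi (exp (- x)) = of_real K * exp (- (Ln x / 2) - of_real (pi\<^sup>2 / 6) / x) * exp w"
      using w[OF x] by blast
  qed
qed

subsection \<open>The summand and its Euler derivative\<close>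

definition eta_term :: "nat \<Rightarrow> complex \<Rightarrow> complex" where
  "eta_term k x = exp (- x) * Phi (exp (- x)) ^ k"

text \<open>\<open>x\<close> times the derivative of \<open>eta_term k\<close>, see
  \<open>eta_term_deriv\<close>. In this form the sums of derivatives are again dilated
  sums.\<close>

definition eta_term_euler :: "nat \<Rightarrow> complex \<Rightarrow> complex" where
  "eta_term_euler k x = x * eta_term k x * (- 1 + of_nat k * Phi_log_deriv x)"

lemma eta_term_deriv:
  assumes "0 < Re x"
  shows "(eta_term k has_field_derivative eta_term_euler k x / x) (at x)"
proof -
  have x0: "x \<noteq> 0" using assms by auto
  have d: "((\<lambda>x. Phi (exp (- x)) ^ k) has_field_derivative of_nat k * (Phi (exp (- x)) * Phi_log_deriv x * Phi (exp (- x)) ^ (k - 1))) (at x)"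
    using DERIV_power[OF Phi_exp_deriv[OF assms], of k] by simp
  have e: "((\<lambda>x. exp (- x)) has_field_derivative - exp (- x)) (at x)"
    by (auto intro!: derivative_eq_intros)
  have p: "of_nat k * (Phi (exp (- x)) * Phi_log_deriv x * Phi (exp (- x)) ^ (k - 1)) = of_nat k * Phi_log_deriv x * Phi (exp (- x)) ^ k"
    by (cases k) simp_all
  show ?thesis
    unfolding eta_term_def[abs_def]
    by (rule DERIV_cong[OF DERIV_mult[OF e d[unfolded p]]])
      (use x0 in \<open>simp add: eta_term_euler_def eta_term_def field_simps\<close>)
qed

lemma saddle_Suc: "x \<noteq> 0 \<Longrightarrow> saddle \<beta> c x = x * saddle (\<beta> + 1) c x"
proof -
  assume x: "x \<noteq> 0"
  have "x * saddle (\<beta> + 1) c x = exp (Ln x) * saddle (\<beta> + 1) c x" using x by simp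
  also have "\<dots> = saddle \<beta> c x"
    unfolding saddle_def exp_add[symmetric] by (rule arg_cong[where f = exp]) (simp add: algebra_simps)
  finally show ?thesis ..
qed

text \<open>The \<open>k\<close>-th power of the asymptotics of \<open>Phi\<close> leaves a factor
  \<open>exp v\<close> with \<open>v\<close> of order \<open>norm x\<close>, and
  \<open>norm (exp v - 1) \<le> norm v * exp (norm v)\<close> explains the shape of the error. For
  the Euler derivative, \<open>x * (- 1 + k * Phi_log_deriv x)\<close> equals \<open>c / x\<close>
  plus a remainder bounded by a multiple of \<open>exp (norm x)\<close>; the division by
  \<open>x\<close> is absorbed by raising \<beta> by one.\<close>

lemma eta_term_saddle:
  obtains \<kappa> B where "\<kappa> > 0" "B > 0"
    "\<And>x. x \<in> sector \<Longrightarrow> norm (eta_term k x - of_real \<kappa> * saddle (real k / 2) (real k * pi\<^sup>2 / 6) x)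
       \<le> B * norm x * exp (B * norm x) * norm (saddle (real k / 2) (real k * pi\<^sup>2 / 6) x)"
    "\<And>x. x \<in> sector \<Longrightarrow> norm (eta_term_euler k x - of_real (\<kappa> * (real k * pi\<^sup>2 / 6)) * saddle (real k / 2 + 1) (real k * pi\<^sup>2 / 6) x)
       \<le> B * norm x * exp (B * norm x) * norm (saddle (real k / 2 + 1) (real k * pi\<^sup>2 / 6) x)"
proof -
  obtain K B0 where K: "K > (0::real)" and B0: "B0 > 0" and
    P: "\<And>x. x \<in> sector \<Longrightarrow> \<exists>w. norm w \<le> B0 * norm x \<and>
       Phi (exp (- x)) = of_real K * exp (- (Ln x / 2) - of_real (pi\<^sup>2 / 6) / x) * exp w"
    by (rule Phi_sector_asymptotic) (rule that)
  obtain D where D: "D > 0" "\<And>x. x \<in> sector \<Longrightarrow> norm (eta_defect x) \<le> D"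
    by (rule eta_defect_bounded) (rule that)
  define c where "c = real k * pi\<^sup>2 / 6"
  define \<beta> where "\<beta> = real k / 2"
  define \<kappa> where "\<kappa> = K ^ k"
  have \<kappa>: "\<kappa> > 0" using K by (simp add: \<kappa>_def)
  have c0: "c \<ge> 0" by (simp add: c_def)
  define A where "A = real k * B0 + 1"
  have A: "A > 0" using B0 by (simp add: A_def add_nonneg_pos)
  define B1 where "B1 = max (\<kappa> * A) A"
  have B1: "B1 \<ge> \<kappa> * A" "B1 \<ge> A" "B1 > 0" using A by (auto simp: B1_def)
  have F: "norm (eta_term k x - of_real \<kappa> * saddle \<beta> c x) \<le> B1 * norm x * exp (B1 * norm x) * norm (saddle \<beta> c x)"
    if x: "x \<in> sector" for x
  proof -
    obtain w where w: "norm w \<le> B0 * norm x"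
      "Phi (exp (- x)) = of_real K * exp (- (Ln x / 2) - of_real (pi\<^sup>2 / 6) / x) * exp w"
      using P[OF x] by blast
    define v where "v = of_nat k * w - x"
    have "eta_term k x = of_real \<kappa> * exp (of_nat k * (- (Ln x / 2) - of_real (pi\<^sup>2 / 6) / x)) * (exp (- x) * exp (of_nat k * w))"
      unfolding eta_term_def w(2) power_mult_distrib exp_of_nat_mult[symmetric] \<kappa>_def by simp
    also have "exp (of_nat k * (- (Ln x / 2) - of_real (pi\<^sup>2 / 6) / x)) = saddle \<beta> c x"
      unfolding saddle_def \<beta>_def c_def by (simp add: algebra_simps)
    also have "exp (- x) * exp (of_nat k * w) = exp v"
      unfolding v_def exp_add[symmetric] by (simp add: algebra_simps)
    finally have eq: "eta_term k x - of_real \<kappa> * saddle \<beta> c x = of_real \<kappa> * saddle \<beta> c x * (exp v - 1)"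
      by (simp add: algebra_simps)
    have "norm v \<le> norm (of_nat k * w) + norm x" unfolding v_def by (rule norm_triangle_ineq4)
    also have "\<dots> \<le> real k * (B0 * norm x) + norm x"
      using w(1) by (simp add: norm_mult mult_left_mono)
    also have "\<dots> = A * norm x" by (simp add: A_def algebra_simps)
    finally have v: "norm v \<le> A * norm x" .
    have "norm (exp v - 1) \<le> norm v * exp (norm v)" by (rule norm_exp_minus_1_le)
    also have "\<dots> \<le> (A * norm x) * exp (A * norm x)" using v A by (intro mult_mono) auto
    also have "\<dots> \<le> (A * norm x) * exp (B1 * norm x)"
      using A B1 by (intro mult_left_mono) (auto intro: mult_right_mono)
    finally have "\<kappa> * norm (saddle \<beta> c x) * norm (exp v - 1) \<le> \<kappa> * norm (saddle \<beta> c x) * (A * norm x * exp (B1 * norm x))"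
      using \<kappa> by (intro mult_left_mono) auto
    also have "\<dots> = (\<kappa> * A) * (norm x * exp (B1 * norm x) * norm (saddle \<beta> c x))"
      by simp
    also have "\<dots> \<le> B1 * (norm x * exp (B1 * norm x) * norm (saddle \<beta> c x))"
      by (intro mult_right_mono B1) auto
    finally show ?thesis unfolding eq norm_mult using \<kappa> by (simp add: mult_ac)
  qed
  define E where "E = real k / 2 + 1 + real k * D"
  have "0 \<le> real k * D" using D by simp
  then have E: "E > 0" unfolding E_def by linarith
  \<comment> \<open>\<open>c * B1\<close> stems from the error of \<open>eta_term\<close> multiplied
    by \<open>c / x\<close>, and \<open>(\<kappa> + B1) * E\<close> from the remainder
    \<open>\<zeta>\<close>. Two further factors \<open>exp X\<close> are collected on the way, hence
    the \<open>B1 + 2\<close> in \<open>B\<close>.\<close>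
  define C where "C = c * B1 + (\<kappa> + B1) * E"
  define B where "B = max (max B1 C) (B1 + 2)"
  have BB: "B \<ge> B1" "B \<ge> C" "B \<ge> B1 + 2" "B > 0" using B1 by (auto simp: B_def)
  show ?thesis
  proof (rule that[OF \<kappa> BB(4)])
    fix x assume x: "x \<in> sector"
    have x0: "x \<noteq> 0" using sector_Re_pos[OF x] by auto
    have "B1 * norm x * exp (B1 * norm x) * norm (saddle \<beta> c x) \<le> B * norm x * exp (B * norm x) * norm (saddle \<beta> c x)"
      using B1 BB by (intro mult_right_mono mult_mono) (auto intro: mult_right_mono)
    then show "norm (eta_term k x - of_real \<kappa> * saddle (real k / 2) (real k * pi\<^sup>2 / 6) x)
       \<le> B * norm x * exp (B * norm x) * norm (saddle (real k / 2) (real k * pi\<^sup>2 / 6) x)"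
      using F[OF x] unfolding \<beta>_def c_def by linarith
    define S where "S = norm (saddle (\<beta> + 1) c x)"
    define X where "X = norm x"
    have X: "X > 0" using x0 by (simp add: X_def)
    have sS: "norm (saddle \<beta> c x) = X * S" unfolding saddle_Suc[OF x0, of \<beta> c] norm_mult X_def S_def ..
    define \<zeta> where "\<zeta> = - of_nat k / 2 - x + of_nat k * (x * eta_defect x)"
    have \<zeta>: "norm \<zeta> \<le> E * exp X"
    proof -
      have "norm \<zeta> \<le> norm (- of_nat k / 2 :: complex) + norm x + norm (of_nat k * (x * eta_defect x))"
        unfolding \<zeta>_def by (intro order_trans[OF norm_triangle_ineq] add_right_mono norm_triangle_ineq4)
      also have "\<dots> \<le> real k / 2 + X + real k * (X * D)"
        unfolding norm_mult X_def using D(2)[OF x] by (intro add_mono mult_left_mono) (auto simp: norm_divide intro!: mult_left_mono)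
      also have "\<dots> \<le> real k / 2 * exp X + exp X + real k * (exp X * D)"
      proof -
        have "1 + X \<le> exp X" by simp
        then have "X \<le> exp X" "1 \<le> exp X" using X by linarith+
        then show ?thesis using D(1) mult_left_mono[of 1 "exp X" "real k / 2"]
          by (intro add_mono mult_left_mono mult_right_mono) auto
      qed
      also have "\<dots> = E * exp X" by (simp add: E_def algebra_simps)
      finally show ?thesis .
    qed
    have "x * (- 1 + of_nat k * Phi_log_deriv x) = of_real c / x + \<zeta>"
    proof -
      have D: "Phi_log_deriv x = eta_defect x + of_real (pi\<^sup>2 / 6) / x\<^sup>2 - 1 / (2 * x)"
        by (simp add: eta_defect_def)
      have g: "x * (- 1 + of_nat k * (e + p / x\<^sup>2 - 1 / (2 * x))) = of_nat k * p / x + (- of_nat k / 2 - x + of_nat k * (x * e))" for e p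
        using x0 by (simp add: field_simps power2_eq_square)
      show ?thesis unfolding D g by (simp add: \<zeta>_def c_def)
    qed
    then have "eta_term_euler k x = eta_term k x * (of_real c / x + \<zeta>)"
      unfolding eta_term_euler_def by (metis mult.assoc mult.commute)
    moreover have "of_real (\<kappa> * c) * saddle (\<beta> + 1) c x = of_real c / x * (of_real \<kappa> * saddle \<beta> c x)"
      unfolding saddle_Suc[OF x0, of \<beta> c] using x0 by simp
    ultimately have eq: "eta_term_euler k x - of_real (\<kappa> * c) * saddle (\<beta> + 1) c x
        = of_real c / x * (eta_term k x - of_real \<kappa> * saddle \<beta> c x) + eta_term k x * \<zeta>"
      by (simp add: algebra_simps)
    have Fn: "norm (eta_term k x) \<le> (\<kappa> + B1) * exp ((B1 + 1) * X) * (X * S)"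
    proof -
      have "norm (eta_term k x) \<le> norm (of_real \<kappa> * saddle \<beta> c x) + norm (eta_term k x - of_real \<kappa> * saddle \<beta> c x)"
        by (rule norm_triangle_sub)
      also have "\<dots> \<le> \<kappa> * (X * S) + B1 * X * exp (B1 * X) * (X * S)"
        using F[OF x] \<kappa> by (intro add_mono) (simp_all add: norm_mult sS X_def)
      also have "\<dots> = (\<kappa> + B1 * (X * exp (B1 * X))) * (X * S)" by (simp add: algebra_simps)
      also have "\<dots> \<le> (\<kappa> * exp ((B1 + 1) * X) + B1 * exp ((B1 + 1) * X)) * (X * S)"
      proof (intro mult_right_mono add_mono mult_left_mono)
        have "1 + X \<le> exp X" by simp
        then have "X \<le> exp X" by linarith
        then have "X * exp (B1 * X) \<le> exp X * exp (B1 * X)" by (intro mult_right_mono) auto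
        then show "X * exp (B1 * X) \<le> exp ((B1 + 1) * X)" by (simp add: algebra_simps flip: exp_add)
        have "1 \<le> exp ((B1 + 1) * X)" using B1 X by simp
        then show "\<kappa> \<le> \<kappa> * exp ((B1 + 1) * X)" using \<kappa> by simp
      qed (use X B1 in \<open>auto simp: S_def\<close>)
      finally show ?thesis by (simp add: algebra_simps)
    qed
    have "norm (eta_term_euler k x - of_real (\<kappa> * c) * saddle (\<beta> + 1) c x) \<le>
        c / X * (B1 * X * exp (B1 * X) * (X * S)) + (\<kappa> + B1) * exp ((B1 + 1) * X) * (X * S) * (E * exp X)"
      unfolding eq
    proof (intro order_trans[OF norm_triangle_ineq] add_mono)
      show "norm (of_real c / x * (eta_term k x - of_real \<kappa> * saddle \<beta> c x)) \<le> c / X * (B1 * X * exp (B1 * X) * (X * S))"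
        unfolding norm_mult norm_divide X_def[symmetric] using F[OF x] c0 X
        by (intro mult_mono) (simp_all add: sS X_def)
      show "norm (eta_term k x * \<zeta>) \<le> (\<kappa> + B1) * exp ((B1 + 1) * X) * (X * S) * (E * exp X)"
        unfolding norm_mult using \<kappa> B1 X by (intro mult_mono Fn \<zeta>) (auto simp: S_def)
    qed
    also have "\<dots> = (c * B1 * exp (B1 * X) + (\<kappa> + B1) * E * (exp ((B1 + 1) * X) * exp X)) * (X * S)"
      using X by (simp add: algebra_simps)
    also have "exp ((B1 + 1) * X) * exp X = exp ((B1 + 2) * X)"
      by (simp add: algebra_simps flip: exp_add)
    also have "(c * B1 * exp (B1 * X) + (\<kappa> + B1) * E * exp ((B1 + 2) * X)) * (X * S) \<le> (c * B1 * exp (B * X) + (\<kappa> + B1) * E * exp (B * X)) * (X * S)"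
      using c0 B1 BB \<kappa> E X by (intro mult_right_mono add_mono mult_left_mono) (auto simp: S_def)
    also have "\<dots> = C * (exp (B * X) * (X * S))" by (simp add: C_def algebra_simps)
    also have "\<dots> \<le> B * (exp (B * X) * (X * S))"
      using BB X by (intro mult_right_mono) (auto simp: S_def)
    finally show "norm (eta_term_euler k x - of_real (\<kappa> * (real k * pi\<^sup>2 / 6)) * saddle (real k / 2 + 1) (real k * pi\<^sup>2 / 6) x)
       \<le> B * norm x * exp (B * norm x) * norm (saddle (real k / 2 + 1) (real k * pi\<^sup>2 / 6) x)"
      unfolding X_def S_def \<beta>_def c_def by (simp add: mult_ac)
  qed
qed

section \<open>Growth at the two ends of the sector\<close>

lemma sector_norm_le: "x \<in> sector \<Longrightarrow> norm x \<le> sqrt 2 * Re x"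
proof -
  assume x: "x \<in> sector"
  have "(norm x)\<^sup>2 = (Re x)\<^sup>2 + (Im x)\<^sup>2" by (rule cmod_power2)
  also have "\<dots> \<le> (Re x)\<^sup>2 + (Re x)\<^sup>2"
    using x by (intro add_left_mono) (auto simp: sector_def abs_le_square_iff[symmetric])
  also have "\<dots> = (sqrt 2 * Re x)\<^sup>2" by (simp add: power_mult_distrib)
  finally show ?thesis
    using x by (auto simp: sector_def intro: power2_le_imp_le)
qed

lemma exp_neg_le_power:
  fixes u :: real
  assumes "u > 0" "n > 0"
  shows "exp (- u) \<le> (real n / u) ^ n"
proof -
  have "u / real n \<le> exp (u / real n)"
    using exp_ge_add_one_self[of "u / real n"] by linarith
  then have "(u / real n) ^ n \<le> exp (u / real n) ^ n"
    using assms by (intro power_mono) auto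
  also have "\<dots> = exp u" using assms by (simp add: exp_of_nat_mult[symmetric])
  finally show ?thesis using assms by (simp add: exp_minus field_simps)
qed

text \<open>In the sector \<open>Re (c / x) \<ge> c / (sqrt 2 * norm x)\<close>, so the exponential
  beats every power of \<open>norm x\<close>. The integer \<open>n\<close> is at least
  \<open>\<beta> + 2\<close>, which leaves a factor \<open>(norm x)\<^sup>2\<close>.\<close>

lemma saddle_small:
  assumes c: "c > 0"
  obtains C where "C > 0" "\<And>x. x \<in> sector \<Longrightarrow> norm x \<le> 1 \<Longrightarrow> norm (saddle \<beta> c x) \<le> C * (norm x)\<^sup>2"
proof -
  define n where "n = Suc (nat \<lceil>\<beta> + 2\<rceil>)"
  have n: "\<beta> + 2 \<le> real n" "n > 0" unfolding n_def by linarith+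
  define A where "A = (real n * sqrt 2 / c) ^ n"
  have A: "A > 0" using n c by (simp add: A_def)
  show ?thesis
  proof (rule that[OF A])
    fix x assume x: "x \<in> sector" "norm x \<le> 1"
    define r where "r = norm x"
    have x0: "x \<noteq> 0" using sector_Re_pos[OF x(1)] by auto
    have r: "r > 0" "r \<le> 1" using x x0 by (auto simp: r_def)
    have "Re (of_real c / x) = c * Re x / r\<^sup>2"
      by (simp add: r_def Re_divide cmod_power2)
    also have "\<dots> \<ge> c * (r / sqrt 2) / r\<^sup>2"
      using sector_norm_le[OF x(1)] c by (intro divide_right_mono mult_left_mono) (auto simp: r_def field_simps)
    also have "c * (r / sqrt 2) / r\<^sup>2 = c / (sqrt 2 * r)" using r by (simp add: power2_eq_square)
    finally have re: "c / (sqrt 2 * r) \<le> Re (of_real c / x)" .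
    have "norm (saddle \<beta> c x) = exp (- \<beta> * ln r - Re (of_real c / x))"
      using x0 unfolding saddle_def norm_exp_eq_Re by (simp add: r_def del: Re_divide_of_real)
    also have "\<dots> \<le> exp (- \<beta> * ln r - c / (sqrt 2 * r))" using re by simp
    also have "\<dots> = r powr (- \<beta>) * exp (- (c / (sqrt 2 * r)))"
      using r by (simp add: powr_def flip: exp_add)
    also have "\<dots> \<le> r powr (- \<beta>) * (real n / (c / (sqrt 2 * r))) ^ n"
      using r c n by (intro mult_left_mono exp_neg_le_power) auto
    also have "(real n / (c / (sqrt 2 * r))) ^ n = A * r powr real n"
      using r by (simp add: A_def powr_realpow power_mult_distrib power_divide)
    also have "r powr (- \<beta>) * (A * r powr real n) = A * r powr (real n - \<beta>)"
      using r by (simp add: powr_add[symmetric] mult_ac)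
    also have "\<dots> \<le> A * r powr 2"
      using r n A by (intro mult_left_mono powr_mono') auto
    finally show "norm (saddle \<beta> c x) \<le> A * (norm x)\<^sup>2"
      using r by (simp add: r_def powr_numeral)
  qed
qed

lemma saddle_estimate_bounds:
  fixes \<kappa> :: real
  assumes c: "c > 0" and \<kappa>: "\<kappa> \<ge> 0" and B: "B \<ge> 0"
    and F: "\<And>x. x \<in> sector \<Longrightarrow> norm (F x - of_real \<kappa> * saddle \<beta> c x) \<le> B * norm x * exp (B * norm x) * norm (saddle \<beta> c x)"
    and far: "\<And>x. x \<in> sector \<Longrightarrow> 1 \<le> norm x \<Longrightarrow> norm (F x) * (norm x)\<^sup>2 \<le> C"
  obtains M where "\<And>x. x \<in> sector \<Longrightarrow> norm (F x) \<le> M * (norm x)\<^sup>2"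
    "\<And>x. x \<in> sector \<Longrightarrow> norm (F x) * (norm x)\<^sup>2 \<le> M"
proof -
  obtain A where A: "A > 0" "\<And>x. x \<in> sector \<Longrightarrow> norm x \<le> 1 \<Longrightarrow> norm (saddle \<beta> c x) \<le> A * (norm x)\<^sup>2"
    by (rule saddle_small[OF c]) (rule that)
  define K where "K = (\<kappa> + B * exp B) * A"
  have K: "K \<ge> 0" using \<kappa> B A by (simp add: K_def)
  define M where "M = max K C"
  have M: "K \<le> M" "C \<le> M" "0 \<le> M" using K by (auto simp: M_def)
  have near: "norm (F x) \<le> K * (norm x)\<^sup>2" if x: "x \<in> sector" "norm x \<le> 1" for x
  proof -
    have "norm (F x) \<le> norm (of_real \<kappa> * saddle \<beta> c x) + norm (F x - of_real \<kappa> * saddle \<beta> c x)"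
      by (rule norm_triangle_sub)
    also have "\<dots> \<le> \<kappa> * norm (saddle \<beta> c x) + B * norm x * exp (B * norm x) * norm (saddle \<beta> c x)"
      using F[OF x(1)] \<kappa> by (simp add: norm_mult)
    also have "\<dots> \<le> \<kappa> * norm (saddle \<beta> c x) + B * 1 * exp (B * 1) * norm (saddle \<beta> c x)"
      using x B by (intro add_left_mono mult_right_mono mult_mono) (auto simp: mult_left_le)
    also have "\<dots> = (\<kappa> + B * exp B) * norm (saddle \<beta> c x)" by (simp add: algebra_simps)
    also have "\<dots> \<le> (\<kappa> + B * exp B) * (A * (norm x)\<^sup>2)"
      using \<kappa> B by (intro mult_left_mono A x) auto
    finally show ?thesis by (simp add: K_def)
  qed
  show ?thesis
  proof (rule that[of M])
    fix x assume x: "x \<in> sector"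
    show "norm (F x) \<le> M * (norm x)\<^sup>2"
    proof (cases "norm x \<le> 1")
      case True
      then show ?thesis by (intro order_trans[OF near[OF x True] mult_right_mono[OF M(1)]]) simp
    next
      case False
      then have n: "1 \<le> (norm x)\<^sup>2" by (simp add: one_le_power)
      have "norm (F x) \<le> norm (F x) * (norm x)\<^sup>2" using n mult_left_mono[of 1 "(norm x)\<^sup>2" "norm (F x)"] by simp
      also have "\<dots> \<le> C" using far[OF x] False by simp
      also have "\<dots> \<le> M * (norm x)\<^sup>2" using M n mult_left_mono[of 1 "(norm x)\<^sup>2" M] by simp
      finally show ?thesis .
    qed
    show "norm (F x) * (norm x)\<^sup>2 \<le> M"
    proof (cases "norm x \<le> 1")
      case True
      then have n: "(norm x)\<^sup>2 \<le> 1" by (simp add: power_le_one)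
      have "norm (F x) * (norm x)\<^sup>2 \<le> K * (norm x)\<^sup>2 * (norm x)\<^sup>2"
        by (intro mult_right_mono near x True) auto
      also have "\<dots> \<le> K * 1 * 1" using n K by (intro mult_mono) auto
      finally show ?thesis using M by simp
    next
      case False
      then show ?thesis using far[OF x] M by linarith
    qed
  qed
qed

lemma Phi_bounded:
  assumes "r < 1"
  obtains C where "C > 0" "\<And>q. norm q \<le> r \<Longrightarrow> norm (Phi q) \<le> C"
proof -
  have "continuous_on (cball 0 r) Phi"
    by (rule continuous_on_subset[OF holomorphic_on_imp_continuous_on[OF Phi_holomorphic]]) (use assms in auto)
  then have "bounded (Phi ` cball 0 r)"
    by (intro compact_imp_bounded compact_continuous_image) auto
  then obtain C where "C > 0" "\<forall>z\<in>Phi ` cball 0 r. norm z \<le> C"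
    unfolding bounded_pos by blast
  then show ?thesis by (intro that[of C]) auto
qed

lemma eta_term_far:
  obtains C where "\<And>x. x \<in> sector \<Longrightarrow> 1 \<le> norm x \<Longrightarrow> norm (eta_term k x) * (norm x)\<^sup>2 \<le> C"
    "\<And>x. x \<in> sector \<Longrightarrow> 1 \<le> norm x \<Longrightarrow> norm (eta_term_euler k x) * (norm x)\<^sup>2 \<le> C"
proof -
  obtain P where P: "P > 0" "\<And>q. norm q \<le> 3 / 4 \<Longrightarrow> norm (Phi q) \<le> P"
    by (rule Phi_bounded[of "3 / 4"]) (simp, rule that)
  define K where "K = P ^ k * (3 * sqrt 2) ^ 3"
  define C where "C = K * (1 + 48 * real k)"
  have K: "K \<ge> 0" using P by (simp add: K_def)
  \<comment> \<open>The third power serves the Euler derivative, which carries an additional factor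
    \<open>x\<close>.\<close>
  have e3: "norm (eta_term k x) * (norm x) ^ 3 \<le> K" if x: "x \<in> sector" "1 \<le> norm x" for x
  proof -
    define r where "r = norm x"
    have r: "1 \<le> r" using x by (simp add: r_def)
    have "norm (eta_term k x) \<le> exp (- (r / sqrt 2)) * P ^ k"
      unfolding eta_term_def norm_mult norm_power r_def
      using P norm_exp_sector_far[OF x] by (intro mult_mono norm_exp_sector x power_mono) auto
    also have "exp (- (r / sqrt 2)) \<le> (real 3 / (r / sqrt 2)) ^ 3"
      using r by (intro exp_neg_le_power) auto
    finally have "norm (eta_term k x) \<le> (real 3 / (r / sqrt 2)) ^ 3 * P ^ k" using P by simp
    then have "norm (eta_term k x) * r ^ 3 \<le> (real 3 / (r / sqrt 2)) ^ 3 * P ^ k * r ^ 3"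
      using r by (intro mult_right_mono) auto
    also have "\<dots> = K" using r by (simp add: K_def power_divide power_mult_distrib)
    finally show ?thesis by (simp add: r_def)
  qed
  show ?thesis
  proof (rule that[of C])
    fix x assume x: "x \<in> sector" "1 \<le> norm x"
    have "norm (eta_term k x) * (norm x)\<^sup>2 \<le> norm (eta_term k x) * (norm x) ^ 3"
      using x by (intro mult_left_mono power_increasing) auto
    also have "\<dots> \<le> K" by (rule e3[OF x])
    also have "\<dots> \<le> C" using K by (simp add: C_def algebra_simps)
    finally show "norm (eta_term k x) * (norm x)\<^sup>2 \<le> C" .
    have "norm (- 1 + of_nat k * Phi_log_deriv x) \<le> 1 + real k * norm (Phi_log_deriv x)"
      by (rule order_trans[OF norm_triangle_ineq]) (simp add: norm_mult)
    also have "\<dots> \<le> 1 + real k * 48"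
      by (intro add_left_mono mult_left_mono Phi_log_deriv_far x) auto
    finally have d: "norm (- 1 + of_nat k * Phi_log_deriv x) \<le> 1 + 48 * real k" by simp
    have "norm (eta_term_euler k x) * (norm x)\<^sup>2 = (norm (eta_term k x) * (norm x) ^ 3) * norm (- 1 + of_nat k * Phi_log_deriv x)"
      by (simp add: eta_term_euler_def norm_mult power2_eq_square power3_eq_cube)
    also have "\<dots> \<le> K * (1 + 48 * real k)"
      using K by (intro mult_mono e3 d x) auto
    finally show "norm (eta_term_euler k x) * (norm x)\<^sup>2 \<le> C" by (simp add: C_def)
  qed
qed

lemma Phi_log_deriv_cnj:
  assumes "0 < Re x"
  shows "Phi_log_deriv (cnj x) = cnj (Phi_log_deriv x)"
proof -
  define g where "g = (\<lambda>m x. exp (- (of_nat (Suc m) * x)) / (1 - exp (- (of_nat (Suc m) * x)))\<^sup>2 :: complex)"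
  have s: "(\<lambda>m. g m y) sums Phi_log_deriv y" if "0 < Re y" for y
    unfolding Phi_log_deriv_def g_def by (rule Phi_logderiv_resummed[OF that])
  have "cnj (g m x) = g m (cnj x)" for m
    unfolding g_def complex_cnj_divide complex_cnj_power complex_cnj_diff exp_cnj by simp
  moreover have "(\<lambda>m. cnj (g m x)) sums cnj (Phi_log_deriv x)"
    unfolding sums_cnj by (rule s[OF assms])
  ultimately have "(\<lambda>m. g m (cnj x)) sums cnj (Phi_log_deriv x)" by (simp only:)
  moreover have "(\<lambda>m. g m (cnj x)) sums Phi_log_deriv (cnj x)"
    by (rule s) (use assms in simp)
  ultimately show ?thesis by (rule sums_unique2[symmetric])
qed

lemma eta_term_cnj:
  assumes "0 < Re x"
  shows "eta_term k (cnj x) = cnj (eta_term k x)"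
proof -
  have e: "exp (- cnj x) = cnj (exp (- x))" by (simp add: exp_cnj)
  show ?thesis
    unfolding eta_term_def e Phi_cnj[OF norm_exp_neg_less_1[OF assms]] by simp
qed

lemma eta_term_euler_cnj:
  assumes "0 < Re x"
  shows "eta_term_euler k (cnj x) = cnj (eta_term_euler k x)"
  unfolding eta_term_euler_def eta_term_cnj[OF assms] Phi_log_deriv_cnj[OF assms] by simp

lemma eta_term_holomorphic: "eta_term k holomorphic_on {x. 0 < Re x}"
proof (rule holomorphic_onI)
  fix x :: complex assume "x \<in> {x. 0 < Re x}"
  then have "(eta_term k has_field_derivative eta_term_euler k x / x) (at x within {x. 0 < Re x})"
    by (intro has_field_derivative_at_within[OF eta_term_deriv]) simp
  then show "eta_term k field_differentiable at x within {x. 0 < Re x}"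
    unfolding field_differentiable_def by blast
qed

lemma eta_term_euler_holomorphic: "eta_term_euler k holomorphic_on {x. 0 < Re x}"
proof -
  have o: "open {x::complex. 0 < Re x}" by (rule open_halfspace_Re_gt)
  have "(\<lambda>x. x * deriv (eta_term k) x) holomorphic_on {x. 0 < Re x}"
    by (intro holomorphic_intros holomorphic_deriv eta_term_holomorphic o)
  then show ?thesis
  proof (rule holomorphic_transform)
    fix x :: complex assume "x \<in> {x. 0 < Re x}"
    then have "x \<noteq> 0" "deriv (eta_term k) x = eta_term_euler k x / x"
      by (auto intro: DERIV_imp_deriv eta_term_deriv)
    then show "x * deriv (eta_term k) x = eta_term_euler k x" by simp
  qed
qed

text \<open>The frequencies \<open>\<theta>\<close> and \<open>1 - \<theta>\<close> have saddles at
  different distances from 0, whereas \<open>dilated_sum_ray\<close> provides one common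
  \<open>\<rho>\<close>; a translation of \<open>y\<close> reconciles them.\<close>

lemma ray_integral_shift:
  assumes "\<rho> > 0" "\<rho>' > 0"
  shows "ray_integral F \<theta> s t \<rho> = ray_integral F \<theta> s t \<rho>'"
proof -
  let ?f = "\<lambda>y. F (ray \<rho>' y) * ray \<rho>' y * wave \<theta> s t (ray \<rho>' y)"
  have r: "ray \<rho>' (ln (\<rho> / \<rho>') + 1 * y) = ray \<rho> y" for y
    using assms by (simp add: ray_def exp_add)
  have "integral\<^sup>L lborel ?f = (LINT y|lborel. ?f (ln (\<rho> / \<rho>') + 1 * y))"
    using lborel_integral_real_affine[of 1 ?f "ln (\<rho> / \<rho>')"] by simp
  then show ?thesis
    unfolding ray_integral_def r by (rule sym)
qed

subsection \<open>Resonant and nonresonant sums\<close>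

lemma saddle_amplitude_pos: "c > 0 \<Longrightarrow> \<theta> > 0 \<Longrightarrow> t > 0 \<Longrightarrow> saddle_amplitude \<beta> \<theta> c t > 0"
  by (simp add: saddle_amplitude_def saddle_scale_def saddle_exponent_def)

text \<open>All powers of \<open>t\<close> cancel and a constant times
  \<open>exp (- (D / sqrt t))\<close> remains; \<open>D > 0\<close> because the larger frequency has
  the larger saddle exponent.\<close>

lemma saddle_amplitude_ratio:
  assumes c: "c > 0" and \<theta>: "0 < \<theta>" "\<theta> < \<theta>'"
  shows "((\<lambda>t. saddle_amplitude \<beta> \<theta>' c t / saddle_amplitude \<beta> \<theta> c t) \<longlongrightarrow> 0) (at_right 0)"
proof -
  define a where "a = sqrt (2 * pi * \<theta> * c)"
  define a' where "a' = sqrt (2 * pi * \<theta>' * c)"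
  define b where "b = sqrt (c / (2 * pi * \<theta>))"
  define b' where "b' = sqrt (c / (2 * pi * \<theta>'))"
  have pos: "a > 0" "a' > 0" "b > 0" "b' > 0" "a < a'"
    using c \<theta> by (auto simp: a_def a'_def b_def b'_def)
  define K where "K = b' powr (1 - \<beta>) / b powr (1 - \<beta>) * sqrt (pi / a') / sqrt (pi / a)"
  define D where "D = sqrt 2 * (a' - a)"
  have D: "D > 0" using pos by (simp add: D_def)
  have eq: "saddle_amplitude \<beta> \<theta>' c t / saddle_amplitude \<beta> \<theta> c t = K * exp (- (D / sqrt t))" if t: "t > 0" for t
  proof -
    have s: "saddle_scale \<theta> c t = b * sqrt t" "saddle_scale \<theta>' c t = b' * sqrt t"
      by (simp_all add: saddle_scale_def b_def b'_def real_sqrt_mult real_sqrt_divide)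
    have e: "saddle_exponent \<theta> c t = a / sqrt t" "saddle_exponent \<theta>' c t = a' / sqrt t"
      by (simp_all add: saddle_exponent_def a_def a'_def real_sqrt_divide)
    have x: "exp (- (sqrt 2 * (a' / sqrt t))) = exp (- (sqrt 2 * (a / sqrt t))) * exp (- (D / sqrt t))"
      by (simp add: D_def algebra_simps diff_divide_distrib flip: exp_add)
    have r: "sqrt (pi / (a / sqrt t)) = sqrt (pi / a) * sqrt (sqrt t)" "sqrt (pi / (a' / sqrt t)) = sqrt (pi / a') * sqrt (sqrt t)"
      by (simp_all add: real_sqrt_mult real_sqrt_divide)
    have p: "(b * sqrt t) powr (1 - \<beta>) = b powr (1 - \<beta>) * sqrt t powr (1 - \<beta>)"
      "(b' * sqrt t) powr (1 - \<beta>) = b' powr (1 - \<beta>) * sqrt t powr (1 - \<beta>)"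
      using pos t by (auto intro!: powr_mult)
    have g: "(u' * w * (v' * z) * (E * X)) / (u * w * (v * z) * E) = u' / u * v' / v * X"
      if "w \<noteq> 0" "z \<noteq> 0" "E \<noteq> 0" for u' w v' z E X u v :: real
      using that by (simp add: field_simps)
    show ?thesis
      unfolding saddle_amplitude_def s e x r p K_def by (rule g) (use t in auto)
  qed
  have "((\<lambda>t. K * exp (- (D / sqrt t))) \<longlongrightarrow> 0) (at_right 0)"
    using D by real_asymp
  moreover have "\<forall>\<^sub>F t in at_right 0. K * exp (- (D / sqrt t)) = saddle_amplitude \<beta> \<theta>' c t / saddle_amplitude \<beta> \<theta> c t"
    using eq by (auto simp: eventually_at_right_less intro: eventually_mono[OF eventually_at_right_less])
  ultimately show ?thesis by (rule Lim_transform_eventually)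
qed

text \<open>Collects what the ray method needs, so that it applies both to \<open>eta_term\<close>
  and to \<open>eta_term_euler\<close>. \<open>M1\<close> and \<open>M2\<close> give integrability
  at the two ends of a ray and control the vertical sides of the rectangles.\<close>

locale saddle_function =
  fixes F :: "complex \<Rightarrow> complex" and \<kappa> \<beta> c B M :: real
  assumes hol: "F holomorphic_on {x. 0 < Re x}"
    and cnj: "\<And>x. 0 < Re x \<Longrightarrow> F (cnj x) = cnj (F x)"
    and c: "c > 0" and \<kappa>: "\<kappa> > 0" and B: "B > 0"
    and estimate: "\<And>x. x \<in> sector \<Longrightarrow> norm (F x - of_real \<kappa> * saddle \<beta> c x) \<le> B * norm x * exp (B * norm x) * norm (saddle \<beta> c x)"
    and M1: "\<And>x. x \<in> sector \<Longrightarrow> norm (F x) \<le> M * (norm x)\<^sup>2"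
    and M2: "\<And>x. x \<in> sector \<Longrightarrow> norm (F x) * (norm x)\<^sup>2 \<le> M"
begin

lemma ray_estimate:
  assumes "\<theta> > 0"
  obtains C T where "C > 0" "T > 0" "\<And>t \<rho>. 0 < t \<Longrightarrow> t < T \<Longrightarrow> \<rho> > 0 \<Longrightarrow>
     norm (ray_integral F \<theta> s t \<rho> - of_real (\<kappa> * saddle_amplitude \<beta> \<theta> c t) *
        cis ((1 - \<beta>) * pi / 4 + pi / 8 - 2 * pi * \<theta> * s + sqrt 2 * saddle_exponent \<theta> c t))
      \<le> C * sqrt t * saddle_amplitude \<beta> \<theta> c t"
proof -
  obtain C T where CT: "C > 0" "T > 0" "\<And>t. 0 < t \<Longrightarrow> t < T \<Longrightarrow>
     norm (ray_integral F \<theta> s t (saddle_scale \<theta> c t) - of_real (\<kappa> * saddle_amplitude \<beta> \<theta> c t) *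
        cis ((1 - \<beta>) * pi / 4 + pi / 8 - 2 * pi * \<theta> * s + sqrt 2 * saddle_exponent \<theta> c t))
      \<le> C * sqrt t * saddle_amplitude \<beta> \<theta> c t"
  proof (rule ray_asymptotic[of c \<theta> \<kappa> B F s \<beta>])
    show "integrable lborel (\<lambda>y. F (ray \<rho> y) * ray \<rho> y * wave \<theta> s t (ray \<rho> y))" if "\<rho> > 0" "t > 0" for \<rho> t
      by (rule ray_wave_integrable[OF hol that _ M1 M2]) (use assms in auto)
  qed (use c assms \<kappa> B estimate that in auto)
  show ?thesis
  proof (rule that[OF CT(1,2)])
    fix t \<rho> :: real assume t: "0 < t" "t < T" "\<rho> > 0"
    have "saddle_scale \<theta> c t > 0" using c assms t by (simp add: saddle_scale_def)
    then have "ray_integral F \<theta> s t \<rho> = ray_integral F \<theta> s t (saddle_scale \<theta> c t)"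
      using t by (intro ray_integral_shift) auto
    then show "norm (ray_integral F \<theta> s t \<rho> - of_real (\<kappa> * saddle_amplitude \<beta> \<theta> c t) *
        cis ((1 - \<beta>) * pi / 4 + pi / 8 - 2 * pi * \<theta> * s + sqrt 2 * saddle_exponent \<theta> c t))
      \<le> C * sqrt t * saddle_amplitude \<beta> \<theta> c t"
      using CT(3)[OF t(1,2)] by simp
  qed
qed

text \<open>The two ray contributions are conjugate, so twice a real part remains. The offset
  \<open>s\<close> enters the main term only through the phase \<open>- pi * s\<close>; this is how
  numerator and denominator come to have a common amplitude.\<close>

lemma alternating_sum:
  assumes s: "0 < s" "s \<le> 1"
  obtains C T where "C > 0" "T > 0" "\<And>t. 0 < t \<Longrightarrow> t < T \<Longrightarrow>
     \<exists>v::real. (\<lambda>m. (- 1) ^ m * F (of_real ((real m + s) * t))) sums of_real v \<and>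
       \<bar>v - 2 * \<kappa> * saddle_amplitude \<beta> (1 / 2) c t / t *
           cos ((1 - \<beta>) * pi / 4 + pi / 8 - pi * s + sqrt 2 * saddle_exponent (1 / 2) c t)\<bar>
         \<le> C * sqrt t * (2 * \<kappa> * saddle_amplitude \<beta> (1 / 2) c t / t)"
proof -
  obtain C T where CT: "C > 0" "T > 0" "\<And>t \<rho>. 0 < t \<Longrightarrow> t < T \<Longrightarrow> \<rho> > 0 \<Longrightarrow>
     norm (ray_integral F (1 / 2) s t \<rho> - of_real (\<kappa> * saddle_amplitude \<beta> (1 / 2) c t) *
        cis ((1 - \<beta>) * pi / 4 + pi / 8 - 2 * pi * (1 / 2) * s + sqrt 2 * saddle_exponent (1 / 2) c t))
      \<le> C * sqrt t * saddle_amplitude \<beta> (1 / 2) c t"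
    by (rule ray_estimate[of "1 / 2" s]) (simp, rule that)
  show ?thesis
  proof (rule that[of "C / \<kappa>" T])
    show "C / \<kappa> > 0" using CT \<kappa> by simp
    show "T > 0" by fact
    fix t :: real assume t: "0 < t" "t < T"
    define U where "U = ray_integral F (1 / 2) s t 1"
    define A where "A = saddle_amplitude \<beta> (1 / 2) c t"
    define \<psi> where "\<psi> = (1 - \<beta>) * pi / 4 + pi / 8 - pi * s + sqrt 2 * saddle_exponent (1 / 2) c t"
    have U: "norm (U - of_real (\<kappa> * A) * cis \<psi>) \<le> C * sqrt t * A"
      using CT(3)[OF t, of 1] by (simp add: U_def A_def \<psi>_def)
    have "cis (2 * pi * (1 / 2)) = -1" by simp
    then have h1: "(\<lambda>m. (- 1) ^ m * F (of_real ((real m + s) * t))) sums ((U + cnj U) / of_real t)"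
      using dilated_sum_ray[OF hol t(1) s, of "1 / 2" 1 M] cnj M1 M2 by (simp add: U_def)
    have h2: "(U + cnj U) / of_real t = of_real (2 * Re U / t)"
      by (simp add: complex_add_cnj)
    have h3: "\<bar>2 * Re U / t - 2 * \<kappa> * A / t * cos \<psi>\<bar> \<le> C / \<kappa> * sqrt t * (2 * \<kappa> * A / t)"
    proof -
      have "\<bar>Re (U - of_real (\<kappa> * A) * cis \<psi>)\<bar> \<le> C * sqrt t * A"
        using abs_Re_le_cmod U by (rule order_trans)
      then have "\<bar>Re U - \<kappa> * A * cos \<psi>\<bar> \<le> C * sqrt t * A" by simp
      then have "2 / t * \<bar>Re U - \<kappa> * A * cos \<psi>\<bar> \<le> 2 / t * (C * sqrt t * A)"
        using t by (intro mult_left_mono) auto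
      also have "2 / t * \<bar>Re U - \<kappa> * A * cos \<psi>\<bar> = \<bar>2 / t * (Re U - \<kappa> * A * cos \<psi>)\<bar>"
        unfolding abs_mult using t by simp
      also have "2 / t * (Re U - \<kappa> * A * cos \<psi>) = 2 * Re U / t - 2 * \<kappa> * A / t * cos \<psi>"
        by (simp add: algebra_simps)
      also have "2 / t * (C * sqrt t * A) = C / \<kappa> * sqrt t * (2 * \<kappa> * A / t)"
        using \<kappa> by simp
      finally show ?thesis .
    qed
    show "\<exists>v::real. (\<lambda>m. (- 1) ^ m * F (of_real ((real m + s) * t))) sums of_real v \<and>
       \<bar>v - 2 * \<kappa> * saddle_amplitude \<beta> (1 / 2) c t / t *
           cos ((1 - \<beta>) * pi / 4 + pi / 8 - pi * s + sqrt 2 * saddle_exponent (1 / 2) c t)\<bar>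
         \<le> C / \<kappa> * sqrt t * (2 * \<kappa> * saddle_amplitude \<beta> (1 / 2) c t / t)"
      using h1[unfolded h2] h3 unfolding A_def \<psi>_def by blast
  qed
qed

lemma ray_dominates:
  assumes \<theta>: "0 < \<theta>" "\<theta> < 1 / 2"
  obtains T where "T > 0" "\<And>t. 0 < t \<Longrightarrow> t < T \<Longrightarrow>
    norm (ray_integral F (1 - \<theta>) s t 1) < norm (ray_integral F \<theta> s t 1)"
proof -
  obtain C1 T1 where 1: "C1 > 0" "T1 > 0" "\<And>t \<rho>. 0 < t \<Longrightarrow> t < T1 \<Longrightarrow> \<rho> > 0 \<Longrightarrow>
     norm (ray_integral F \<theta> s t \<rho> - of_real (\<kappa> * saddle_amplitude \<beta> \<theta> c t) *
        cis ((1 - \<beta>) * pi / 4 + pi / 8 - 2 * pi * \<theta> * s + sqrt 2 * saddle_exponent \<theta> c t))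
      \<le> C1 * sqrt t * saddle_amplitude \<beta> \<theta> c t"
    by (rule ray_estimate[of \<theta> s]) (use \<theta> in simp, rule that)
  obtain C2 T2 where 2: "C2 > 0" "T2 > 0" "\<And>t \<rho>. 0 < t \<Longrightarrow> t < T2 \<Longrightarrow> \<rho> > 0 \<Longrightarrow>
     norm (ray_integral F (1 - \<theta>) s t \<rho> - of_real (\<kappa> * saddle_amplitude \<beta> (1 - \<theta>) c t) *
        cis ((1 - \<beta>) * pi / 4 + pi / 8 - 2 * pi * (1 - \<theta>) * s + sqrt 2 * saddle_exponent (1 - \<theta>) c t))
      \<le> C2 * sqrt t * saddle_amplitude \<beta> (1 - \<theta>) c t"
    by (rule ray_estimate[of "1 - \<theta>" s]) (use \<theta> in simp, rule that)
  \<comment> \<open>The thresholds separate the two rays at the level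
    \<open>\<kappa> / 2 * A\<close>: the weaker one stays below it, and the error of the stronger
    one consumes less than half of its main term \<open>\<kappa> * A\<close>.\<close>
  have "\<forall>\<^sub>F t in at_right 0. saddle_amplitude \<beta> (1 - \<theta>) c t / saddle_amplitude \<beta> \<theta> c t < \<kappa> / (2 * (\<kappa> + C2))"
    using saddle_amplitude_ratio[OF c \<theta>(1), of "1 - \<theta>" \<beta>] \<theta> \<kappa> 2(1) by (intro order_tendstoD(2)) auto
  moreover have "((\<lambda>t. C1 * sqrt t) \<longlongrightarrow> 0) (at_right 0)"
    by (auto intro!: tendsto_eq_intros)
  then have "\<forall>\<^sub>F t in at_right 0. C1 * sqrt t < \<kappa> / 2"
    using \<kappa> by (intro order_tendstoD(2)) auto
  ultimately have "\<forall>\<^sub>F t in at_right 0. saddle_amplitude \<beta> (1 - \<theta>) c t / saddle_amplitude \<beta> \<theta> c t < \<kappa> / (2 * (\<kappa> + C2)) \<and> C1 * sqrt t < \<kappa> / 2"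
    by (rule eventually_conj)
  then obtain T3 where 3: "T3 > 0" "\<And>t. 0 < t \<Longrightarrow> t < T3 \<Longrightarrow> saddle_amplitude \<beta> (1 - \<theta>) c t / saddle_amplitude \<beta> \<theta> c t < \<kappa> / (2 * (\<kappa> + C2)) \<and> C1 * sqrt t < \<kappa> / 2"
    unfolding eventually_at_right_field by auto
  show ?thesis
  proof (rule that[of "min (min T1 T2) (min T3 1)"])
    show "min (min T1 T2) (min T3 1) > 0" using 1 2 3 by simp
    fix t :: real assume t: "0 < t" "t < min (min T1 T2) (min T3 1)"
    define A where "A = saddle_amplitude \<beta> \<theta> c t"
    define A' where "A' = saddle_amplitude \<beta> (1 - \<theta>) c t"
    have A: "A > 0" "A' > 0" using c \<theta> t by (auto simp: A_def A'_def intro!: saddle_amplitude_pos)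
    have t3: "A' / A < \<kappa> / (2 * (\<kappa> + C2))" "C1 * sqrt t < \<kappa> / 2" using 3(2)[of t] t by (auto simp: A_def A'_def)
    have low: "norm (ray_integral F \<theta> s t 1) \<ge> \<kappa> * A - C1 * sqrt t * A"
    proof -
      have tri: "norm w \<ge> p - q" if "norm (w - of_real p * cis x) \<le> q" "p \<ge> 0" for w p q x
        using that norm_triangle_ineq2[of "of_real p * cis x" w] by (simp add: norm_mult norm_minus_commute)
      show ?thesis by (rule tri[OF 1(3)[of t 1, folded A_def]]) (use t \<kappa> A in auto)
    qed
    have up: "norm (ray_integral F (1 - \<theta>) s t 1) \<le> \<kappa> * A' + C2 * sqrt t * A'"
    proof -
      have tri: "norm w \<le> p + q" if "norm (w - of_real p * cis x) \<le> q" "p \<ge> 0" for w p q x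
        using that norm_triangle_ineq2[of w "of_real p * cis x"] by (simp add: norm_mult)
      show ?thesis by (rule tri[OF 2(3)[of t 1, folded A'_def]]) (use t \<kappa> A in auto)
    qed
    have "\<kappa> * A' + C2 * sqrt t * A' \<le> (\<kappa> + C2) * A'"
    proof -
      have "C2 * sqrt t \<le> C2 * 1" using t 2(1) by (intro mult_left_mono) auto
      then have "(\<kappa> + C2 * sqrt t) * A' \<le> (\<kappa> + C2) * A'" using A by (intro mult_right_mono) auto
      then show ?thesis by (simp add: algebra_simps)
    qed
    also have "\<dots> < \<kappa> / 2 * A"
    proof -
      have "A' < \<kappa> / (2 * (\<kappa> + C2)) * A" using t3(1) A by (simp add: pos_divide_less_eq)
      then have "(\<kappa> + C2) * A' < (\<kappa> + C2) * (\<kappa> / (2 * (\<kappa> + C2)) * A)"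
        using \<kappa> 2(1) by (intro mult_strict_left_mono) auto
      also have "\<dots> = \<kappa> / 2 * A" using \<kappa> 2(1) by (simp add: field_simps)
      finally show ?thesis .
    qed
    also have "\<dots> \<le> \<kappa> * A - C1 * sqrt t * A"
    proof -
      have "C1 * sqrt t * A \<le> \<kappa> / 2 * A" using t3(2) A by (intro mult_right_mono) auto
      then show ?thesis by linarith
    qed
    finally show "norm (ray_integral F (1 - \<theta>) s t 1) < norm (ray_integral F \<theta> s t 1)"
      using low up by linarith
  qed
qed

text \<open>Only the moduli of the two ray contributions are compared: being different, they cannot
  cancel, whatever the phases.\<close>

lemma nonresonant_sum:
  assumes s: "0 < s" "s \<le> 1" and \<theta>: "0 < \<theta>" "\<theta> < 1" "\<theta> \<noteq> 1 / 2"
  obtains T where "T > 0" "\<And>t. 0 < t \<Longrightarrow> t < T \<Longrightarrow>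
     \<exists>v. v \<noteq> 0 \<and> (\<lambda>m. cis (2 * pi * \<theta>) ^ m * F (of_real ((real m + s) * t))) sums v"
proof -
  have "\<exists>T>0. \<forall>t. 0 < t \<and> t < T \<longrightarrow> norm (ray_integral F (1 - \<theta>) s t 1) \<noteq> norm (ray_integral F \<theta> s t 1)"
  proof (cases "\<theta> < 1 / 2")
    case True
    obtain T where "T > 0" "\<And>t. 0 < t \<Longrightarrow> t < T \<Longrightarrow>
      norm (ray_integral F (1 - \<theta>) s t 1) < norm (ray_integral F \<theta> s t 1)"
      by (rule ray_dominates[OF \<theta>(1) True]) (rule that)
    then show ?thesis by (intro exI[of _ T]) force
  next
    case False
    then have \<theta>': "0 < 1 - \<theta>" "1 - \<theta> < 1 / 2" using \<theta> by auto
    obtain T where "T > 0" "\<And>t. 0 < t \<Longrightarrow> t < T \<Longrightarrow>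
      norm (ray_integral F (1 - (1 - \<theta>)) s t 1) < norm (ray_integral F (1 - \<theta>) s t 1)"
      by (rule ray_dominates[OF \<theta>']) (rule that)
    then show ?thesis by (intro exI[of _ T]) force
  qed
  then obtain T where T: "T > 0" "\<And>t. 0 < t \<Longrightarrow> t < T \<Longrightarrow>
    norm (ray_integral F (1 - \<theta>) s t 1) \<noteq> norm (ray_integral F \<theta> s t 1)" by blast
  show ?thesis
  proof (rule that[OF T(1)])
    fix t :: real assume t: "0 < t" "t < T"
    define U where "U = ray_integral F \<theta> s t 1"
    define V where "V = ray_integral F (1 - \<theta>) s t 1"
    have "(\<lambda>m. cis (2 * pi * \<theta>) ^ m * F (of_real ((real m + s) * t))) sums ((U + cnj V) / of_real t)"
      using dilated_sum_ray[OF hol t(1) s \<theta>(1,2), of 1 M] cnj M1 M2 by (simp add: U_def V_def)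
    moreover have "U + cnj V \<noteq> 0"
    proof
      assume "U + cnj V = 0"
      then have "norm U = norm (cnj V)" by (metis add_eq_0_iff2 norm_minus_cancel)
      then show False using T(2)[OF t] by (simp add: U_def V_def)
    qed
    ultimately show "\<exists>v. v \<noteq> 0 \<and> (\<lambda>m. cis (2 * pi * \<theta>) ^ m * F (of_real ((real m + s) * t))) sums v"
      using t by (intro exI[of _ "(U + cnj V) / of_real t"]) auto
  qed
qed

end

lemma eta_saddle_functions:
  assumes k: "k \<ge> 1"
  obtains \<kappa> B M where
    "saddle_function (eta_term k) \<kappa> (real k / 2) (real k * pi\<^sup>2 / 6) B M"
    "saddle_function (eta_term_euler k) (\<kappa> * (real k * pi\<^sup>2 / 6)) (real k / 2 + 1) (real k * pi\<^sup>2 / 6) B M"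
proof -
  define c where "c = real k * pi\<^sup>2 / 6"
  have c: "c > 0" using k by (simp add: c_def)
  obtain \<kappa> B where \<kappa>: "\<kappa> > 0" and B: "B > 0" and
    e1: "\<And>x. x \<in> sector \<Longrightarrow> norm (eta_term k x - of_real \<kappa> * saddle (real k / 2) c x)
       \<le> B * norm x * exp (B * norm x) * norm (saddle (real k / 2) c x)" and
    e2: "\<And>x. x \<in> sector \<Longrightarrow> norm (eta_term_euler k x - of_real (\<kappa> * c) * saddle (real k / 2 + 1) c x)
       \<le> B * norm x * exp (B * norm x) * norm (saddle (real k / 2 + 1) c x)"
    by (rule eta_term_saddle[of k, folded c_def]) (rule that, assumption, assumption, assumption, assumption)
  obtain C where C1: "\<And>x. x \<in> sector \<Longrightarrow> 1 \<le> norm x \<Longrightarrow> norm (eta_term k x) * (norm x)\<^sup>2 \<le> C"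
    and C2: "\<And>x. x \<in> sector \<Longrightarrow> 1 \<le> norm x \<Longrightarrow> norm (eta_term_euler k x) * (norm x)\<^sup>2 \<le> C"
    by (rule eta_term_far[of k]) (rule that)
  obtain M1 where M1: "\<And>x. x \<in> sector \<Longrightarrow> norm (eta_term k x) \<le> M1 * (norm x)\<^sup>2"
    "\<And>x. x \<in> sector \<Longrightarrow> norm (eta_term k x) * (norm x)\<^sup>2 \<le> M1"
    by (rule saddle_estimate_bounds[OF c less_imp_le[OF \<kappa>] less_imp_le[OF B] e1 C1]) (assumption | rule that)+
  have \<kappa>c: "\<kappa> * c > 0" using \<kappa> c by simp
  obtain M2 where M2: "\<And>x. x \<in> sector \<Longrightarrow> norm (eta_term_euler k x) \<le> M2 * (norm x)\<^sup>2"
    "\<And>x. x \<in> sector \<Longrightarrow> norm (eta_term_euler k x) * (norm x)\<^sup>2 \<le> M2"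
    by (rule saddle_estimate_bounds[OF c less_imp_le[OF \<kappa>c] less_imp_le[OF B] e2 C2]) (assumption | rule that)+
  define M where "M = max M1 M2"
  have M: "M1 \<le> M" "M2 \<le> M" by (auto simp: M_def)
  show ?thesis
  proof (rule that[of \<kappa> B M]; unfold_locales; (fold c_def)?)
    fix x assume x: "x \<in> sector"
    show "norm (eta_term k x) \<le> M * (norm x)\<^sup>2"
      using M1(1)[OF x] mult_right_mono[OF M(1) zero_le_power2[of "norm x"]] by linarith
    show "norm (eta_term k x) * (norm x)\<^sup>2 \<le> M" using M1(2)[OF x] M by linarith
    show "norm (eta_term_euler k x) \<le> M * (norm x)\<^sup>2"
      using M2(1)[OF x] mult_right_mono[OF M(2) zero_le_power2[of "norm x"]] by linarith
    show "norm (eta_term_euler k x) * (norm x)\<^sup>2 \<le> M" using M2(2)[OF x] M by linarith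
  qed (use c \<kappa> \<kappa>c B e1 e2 eta_term_cnj eta_term_euler_cnj eta_term_holomorphic eta_term_euler_holomorphic in auto)
qed

subsection \<open>Zeros of an oscillating function\<close>

lemma abs_sin_ge_half:
  fixes x :: real
  assumes "\<bar>x\<bar> \<le> pi / 4"
  shows "\<bar>x\<bar> / 2 \<le> \<bar>sin x\<bar>"
proof -
  have *: "y / 2 \<le> sin y" if y: "0 \<le> y" "y \<le> pi / 4" for y :: real
  proof -
    have "(\<lambda>y. sin y - y / 2) 0 \<le> (\<lambda>y. sin y - y / 2) y"
    proof (rule DERIV_nonneg_imp_nondecreasing[OF y(1)])
      fix z assume z: "0 \<le> z" "z \<le> y"
      have "cos (pi / 3) \<le> cos z" using z y by (intro cos_monotone_0_pi_le) auto
      then show "\<exists>w. ((\<lambda>y. sin y - y / 2) has_real_derivative w) (at z) \<and> 0 \<le> w"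
        by (intro exI[of _ "cos z - 1 / 2"]) (auto intro!: derivative_eq_intros simp: cos_60)
    qed
    then show ?thesis by simp
  qed
  show ?thesis using *[of "\<bar>x\<bar>"] assms by (cases "x \<ge> 0") auto
qed

lemma sin_half_odd_pi: "\<bar>sin (pi * (real_of_int j + 1 / 2))\<bar> = 1" "cos (pi * (real_of_int j + 1 / 2)) = 0"
proof -
  show c: "cos (pi * (real_of_int j + 1 / 2)) = 0"
    by (simp add: distrib_left cos_add)
  show "\<bar>sin (pi * (real_of_int j + 1 / 2))\<bar> = 1"
    using sin_cos_squared_add[of "pi * (real_of_int j + 1 / 2)"] unfolding c by (auto simp: power2_eq_1_iff)
qed

lemma abs_cos_eq_abs_sin_offset:
  "\<bar>cos a\<bar> = \<bar>sin (a - pi * (real_of_int j + 1 / 2))\<bar>"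
proof -
  define e where "e = pi * (real_of_int j + 1 / 2)"
  have "cos a = cos (e + (a - e))" by simp
  also have "\<dots> = - sin e * sin (a - e)"
    unfolding cos_add using sin_half_odd_pi(2)[of j] by (simp add: e_def)
  finally show ?thesis using sin_half_odd_pi(1)[of j] by (simp add: e_def abs_mult)
qed

text \<open>The floor selects the interval between consecutive multiples of \<pi> that contains
  \<open>a\<close>. Its midpoint is a zero of the cosine, and at distance \<pi>/4 or more from it
  the cosine has modulus at least 1/2.\<close>

lemma near_half_odd_pi:
  assumes "\<bar>cos a\<bar> \<le> 1 / 8"
  shows "\<bar>a - pi * (real_of_int \<lfloor>a / pi\<rfloor> + 1 / 2)\<bar> < pi / 4"
proof (rule ccontr)
  define x where "x = a - pi * (real_of_int \<lfloor>a / pi\<rfloor> + 1 / 2)"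
  assume "\<not> ?thesis"
  then have x1: "pi / 4 \<le> \<bar>x\<bar>" by (simp add: x_def)
  have f: "real_of_int \<lfloor>a / pi\<rfloor> \<le> a / pi" "a / pi < real_of_int \<lfloor>a / pi\<rfloor> + 1" by linarith+
  have "real_of_int \<lfloor>a / pi\<rfloor> * pi \<le> a / pi * pi" by (rule mult_right_mono[OF f(1)]) simp
  moreover have "a / pi * pi < (real_of_int \<lfloor>a / pi\<rfloor> + 1) * pi" by (rule mult_strict_right_mono[OF f(2)]) simp
  ultimately have "real_of_int \<lfloor>a / pi\<rfloor> * pi \<le> a" "a < (real_of_int \<lfloor>a / pi\<rfloor> + 1) * pi"
    by simp_all
  then have "- (pi / 2) \<le> x" "x < pi / 2" unfolding x_def by (simp_all add: algebra_simps)
  then have x2: "\<bar>x\<bar> \<le> pi / 2" by simp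
  have "sin (pi / 4) \<le> sin \<bar>x\<bar>" using x1 x2 by (intro sin_monotone_2pi_le) auto
  moreover have "sin \<bar>x\<bar> = \<bar>sin x\<bar>"
  proof -
    have "0 \<le> sin \<bar>x\<bar>" using x2 by (intro sin_ge_zero) auto
    then show ?thesis by (cases "x \<ge> 0") auto
  qed
  moreover have "\<bar>sin x\<bar> \<le> 1 / 8" using assms abs_cos_eq_abs_sin_offset[of a "\<lfloor>a / pi\<rfloor>"] by (simp add: x_def)
  moreover have "1 / 2 \<le> sin (pi / 4)"
    using sin_monotone_2pi_le[of "pi / 6" "pi / 4"] by (simp add: sin_30)
  ultimately show False by linarith
qed

text \<open>The real-variable part in isolation: \<open>S\<close> stands for the denominator,
  \<open>S'\<close> for its derivative, \<open>N\<close> for the numerator, and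
  \<open>\<gamma>\<close> for \<open>pi / a\<close>. The assumption \<open>D\<close> is what formal
  differentiation of \<open>- amp t * cos (p / sqrt t - \<phi>)\<close> suggests when
  \<open>amp\<close> contains the factor \<open>exp (- (p / sqrt t))\<close>: decay and phase then
  vary at the same rate, which causes the \<open>sqrt 2\<close> and the shift by \<pi>/4.\<close>

locale phase_system =
  fixes p \<phi> \<gamma> C T\<^sub>0 :: real and S S' N amp :: "real \<Rightarrow> real"
  assumes p: "p > 0" and \<gamma>: "0 < \<gamma>" "\<gamma> \<le> pi / 2" and C: "C > 0" and T\<^sub>0: "T\<^sub>0 > 0"
    and amp: "\<And>t. 0 < t \<Longrightarrow> t < T\<^sub>0 \<Longrightarrow> amp t > 0"
    and S: "\<And>t. 0 < t \<Longrightarrow> t < T\<^sub>0 \<Longrightarrow> \<bar>S t + amp t * cos (p / sqrt t - \<phi>)\<bar> \<le> C * sqrt t * amp t"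
    and N: "\<And>t. 0 < t \<Longrightarrow> t < T\<^sub>0 \<Longrightarrow> \<bar>N t - amp t * cos (p / sqrt t - \<phi> - \<gamma>)\<bar> \<le> C * sqrt t * amp t"
    and D: "\<And>t. 0 < t \<Longrightarrow> t < T\<^sub>0 \<Longrightarrow>
      \<bar>t * S' t + amp t * (p / sqrt t / sqrt 2) * cos (p / sqrt t - \<phi> - pi / 4)\<bar> \<le> C * sqrt t * amp t * (p / sqrt t)"
    and der: "\<And>t. 0 < t \<Longrightarrow> t < T\<^sub>0 \<Longrightarrow> (S has_real_derivative S' t) (at t)"
begin

text \<open>Below this bound \<open>C * sqrt t < sin \<gamma> / 16\<close>: small against the cosine
  at the ends of a window and against the main term of \<open>N\<close> at a zero.\<close>

definition "T\<^sub>1 = min T\<^sub>0 ((sin \<gamma> / 16 / C)\<^sup>2)"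

definition window :: "nat \<Rightarrow> real \<Rightarrow> bool" where
  "window j t \<longleftrightarrow> 0 < t \<and> \<bar>p / sqrt t - \<phi> - pi * (real j + 1 / 2)\<bar> < pi / 4"

lemma sin_\<gamma>: "0 < sin \<gamma>" "sin \<gamma> \<le> 1"
  using \<gamma> by (auto intro: sin_gt_zero)

lemma T\<^sub>1: "T\<^sub>1 > 0" "T\<^sub>1 \<le> T\<^sub>0"
  using T\<^sub>0 sin_\<gamma> C by (auto simp: T\<^sub>1_def)

lemma small:
  assumes "0 < t" "t < T\<^sub>1"
  shows "C * sqrt t < sin \<gamma> / 16" "C * sqrt t < 1 / 16"
proof -
  have "sqrt t < sqrt ((sin \<gamma> / 16 / C)\<^sup>2)" using assms by (intro real_sqrt_less_mono) (simp add: T\<^sub>1_def)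
  also have "\<dots> = sin \<gamma> / 16 / C" using sin_\<gamma> C by simp
  finally show "C * sqrt t < sin \<gamma> / 16" using C by (simp add: pos_less_divide_eq mult_ac)
  then show "C * sqrt t < 1 / 16" using sin_\<gamma> by linarith
qed

lemma cos_at_zero:
  assumes "0 < t" "t < T\<^sub>1" "S t = 0"
  shows "\<bar>cos (p / sqrt t - \<phi>)\<bar> \<le> C * sqrt t"
proof -
  have t0: "t < T\<^sub>0" using assms T\<^sub>1 by linarith
  have a: "amp t > 0" by (rule amp[OF assms(1) t0])
  have "amp t * \<bar>cos (p / sqrt t - \<phi>)\<bar> \<le> amp t * (C * sqrt t)"
    using S[OF assms(1) t0] assms(3) a by (simp add: abs_mult mult_ac)
  then show ?thesis using a by simp
qed

lemma sin_large:
  fixes a :: real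
  assumes "\<bar>cos a\<bar> \<le> 1 / 8"
  shows "7 / 8 \<le> \<bar>sin a\<bar>"
proof -
  have "(cos a)\<^sup>2 \<le> (1 / 8)\<^sup>2" using assms by (metis abs_ge_zero power2_abs power_mono)
  then have "(7 / 8)\<^sup>2 \<le> (sin a)\<^sup>2" unfolding sin_squared_eq by (simp add: power2_eq_square)
  then show ?thesis using abs_le_square_iff[of "7 / 8" "sin a"] by simp
qed

lemma derivative_form:
  assumes t: "0 < t" "t < T\<^sub>1"
  obtains \<delta> where "t * S' t = - (amp t * (p / sqrt t) / 2) * (sin (p / sqrt t - \<phi>) + cos (p / sqrt t - \<phi>) + \<delta>)" "\<bar>\<delta>\<bar> \<le> 2 * (C * sqrt t)"
proof -
  have t0: "t < T\<^sub>0" using t T\<^sub>1 by linarith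
  define \<alpha> where "\<alpha> = p / sqrt t - \<phi>"
  define Q where "Q = amp t * (p / sqrt t)"
  have Q: "Q > 0" using amp[OF t(1) t0] p t by (simp add: Q_def)
  define \<epsilon> where "\<epsilon> = t * S' t + amp t * (p / sqrt t / sqrt 2) * cos (\<alpha> - pi / 4)"
  have \<epsilon>: "\<bar>\<epsilon>\<bar> \<le> C * sqrt t * Q" using D[OF t(1) t0] t(1) by (simp add: \<epsilon>_def \<alpha>_def Q_def mult_ac)
  have c: "cos (\<alpha> - pi / 4) = (cos \<alpha> + sin \<alpha>) * (sqrt 2 / 2)"
    unfolding cos_diff cos_45 sin_45 by (simp add: algebra_simps)
  have "amp t * (p / sqrt t / sqrt 2) * cos (\<alpha> - pi / 4) = Q / 2 * (cos \<alpha> + sin \<alpha>)"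
    unfolding c Q_def by simp
  then have "t * S' t = - (Q / 2) * (sin \<alpha> + cos \<alpha> + - 2 * \<epsilon> / Q)"
    using Q by (simp add: \<epsilon>_def field_simps)
  moreover have "\<bar>- 2 * \<epsilon> / Q\<bar> \<le> 2 * (C * sqrt t)"
    using \<epsilon> Q by (simp add: abs_mult pos_divide_le_eq)
  ultimately show ?thesis using that unfolding \<alpha>_def Q_def by blast
qed

text \<open>Where the cosine is at most 1/8 the sine is at least 7/8 in modulus, so the cosine and
  an error below 1/8 cannot cancel it.\<close>

lemma derivative_nonzero:
  assumes t: "0 < t" "t < T\<^sub>1" and c: "\<bar>cos (p / sqrt t - \<phi>)\<bar> \<le> 1 / 8"
  shows "S' t \<noteq> 0"
proof
  assume 0: "S' t = 0"
  obtain \<delta> where \<delta>: "t * S' t = - (amp t * (p / sqrt t) / 2) * (sin (p / sqrt t - \<phi>) + cos (p / sqrt t - \<phi>) + \<delta>)" "\<bar>\<delta>\<bar> \<le> 2 * (C * sqrt t)"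
    by (rule derivative_form[OF t]) (rule that)
  have "amp t * (p / sqrt t) \<noteq> 0" using amp[of t] p t T\<^sub>1 by simp
  then have "sin (p / sqrt t - \<phi>) + cos (p / sqrt t - \<phi>) + \<delta> = 0" using \<delta>(1) 0 by simp
  then show False using sin_large[OF c] c \<delta>(2) small(2)[OF t] by linarith
qed

text \<open>At a zero the cosine is \<open>O(sqrt t)\<close>, so \<open>N\<close> is close to
  \<open>amp t * sin \<alpha> * sin \<gamma>\<close>, and \<open>t * S' t\<close> to
  \<open>- (amp t * (p / sqrt t) / 2) * sin \<alpha>\<close>. The factor
  \<open>amp t * sin \<alpha>\<close>, whose sign varies with the zero, cancels in the quotient;
  hence the residues do not alternate in sign.\<close>

lemma at_zero:
  assumes t: "0 < t" "t < T\<^sub>1" and z: "S t = 0"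
  shows "S' t \<noteq> 0" "N t \<noteq> 0"
    "\<exists>e. - (N t / S' t) = 2 * t * sin \<gamma> / (p / sqrt t) * (1 + e) \<and> \<bar>e\<bar> \<le> 10 * C / sin \<gamma> * sqrt t \<and> - 1 < e"
proof -
  define \<alpha> where "\<alpha> = p / sqrt t - \<phi>"
  have t0: "t < T\<^sub>0" using t T\<^sub>1 by linarith
  have a: "amp t > 0" by (rule amp[OF t(1) t0])
  have P: "p / sqrt t > 0" using p t by simp
  have cs: "\<bar>cos \<alpha>\<bar> \<le> C * sqrt t" unfolding \<alpha>_def by (rule cos_at_zero[OF t z])
  then have c8: "\<bar>cos \<alpha>\<bar> \<le> 1 / 8" using small(2)[OF t] by linarith
  show S'0: "S' t \<noteq> 0" using derivative_nonzero[OF t] c8 by (simp add: \<alpha>_def)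
  have s: "7 / 8 \<le> \<bar>sin \<alpha>\<bar>" by (rule sin_large[OF c8])
  obtain \<delta> where \<delta>: "t * S' t = - (amp t * (p / sqrt t) / 2) * (sin \<alpha> + cos \<alpha> + \<delta>)" "\<bar>\<delta>\<bar> \<le> 2 * (C * sqrt t)"
    by (rule derivative_form[OF t, folded \<alpha>_def]) (rule that)
  define d2 where "d2 = cos \<alpha> + \<delta>"
  have d2: "\<bar>d2\<bar> \<le> 3 * (C * sqrt t)" using cs \<delta>(2) unfolding d2_def by linarith
  define d1 where "d1 = N t / amp t - sin \<alpha> * sin \<gamma>"
  have Nf: "N t = amp t * (sin \<alpha> * sin \<gamma> + d1)" using a by (simp add: d1_def)
  have d1: "\<bar>d1\<bar> \<le> 2 * (C * sqrt t)"
  proof -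
    have "\<bar>N t / amp t - cos (\<alpha> - \<gamma>)\<bar> = \<bar>N t - amp t * cos (\<alpha> - \<gamma>)\<bar> / amp t"
    proof -
      have "N t / amp t - cos (\<alpha> - \<gamma>) = (N t - amp t * cos (\<alpha> - \<gamma>)) / amp t"
        using a by (simp add: field_simps)
      then show ?thesis using a by (simp only: abs_divide abs_of_pos)
    qed
    also have "\<dots> \<le> C * sqrt t"
      using N[OF t(1) t0] a by (simp add: \<alpha>_def pos_divide_le_eq)
    finally have 1: "\<bar>N t / amp t - (cos \<alpha> * cos \<gamma> + sin \<alpha> * sin \<gamma>)\<bar> \<le> C * sqrt t"
      by (simp add: cos_diff)
    have "\<bar>cos \<alpha> * cos \<gamma>\<bar> \<le> C * sqrt t * 1"
      unfolding abs_mult using cs C by (intro mult_mono) auto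
    then show ?thesis using 1 unfolding d1_def by linarith
  qed
  define X where "X = sin \<alpha> + d2"
  have X: "1 / 2 \<le> \<bar>X\<bar>" using s d2 small(2)[OF t] unfolding X_def by linarith
  show "N t \<noteq> 0"
  proof
    assume "N t = 0"
    then have "sin \<alpha> * sin \<gamma> = - d1" using a by (simp add: Nf)
    then have "\<bar>sin \<alpha>\<bar> * sin \<gamma> = \<bar>d1\<bar>" using sin_\<gamma> by (metis abs_minus_cancel abs_mult abs_of_pos)
    moreover have "7 / 8 * sin \<gamma> \<le> \<bar>sin \<alpha>\<bar> * sin \<gamma>" using s sin_\<gamma> by (intro mult_right_mono) auto
    ultimately show False using d1 small(1)[OF t] sin_\<gamma> by linarith
  qed
  \<comment> \<open>The errors \<open>d1\<close> and \<open>sin \<gamma> * d2\<close> amount to at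
    most \<open>5 * (C * sqrt t)\<close>, and \<open>X\<close> has modulus at least 1/2; this is the
    origin of the factor 10. Below \<open>T\<^sub>1\<close> it gives a modulus less than 10/16,
    hence \<open>- 1 < e\<close>.\<close>
  define e where "e = (d1 - sin \<gamma> * d2) / (sin \<gamma> * X)"
  have e: "1 + e = (sin \<alpha> * sin \<gamma> + d1) / (sin \<gamma> * X)"
  proof -
    have "sin \<gamma> * X \<noteq> 0" using X sin_\<gamma> by auto
    then have "1 + e = (sin \<gamma> * X + (d1 - sin \<gamma> * d2)) / (sin \<gamma> * X)"
      unfolding e_def by (simp add: add_divide_distrib)
    also have "sin \<gamma> * X + (d1 - sin \<gamma> * d2) = sin \<alpha> * sin \<gamma> + d1"
      by (simp add: X_def algebra_simps)
    finally show ?thesis .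
  qed
  have "S' t = - (amp t * (p / sqrt t) / 2) * X / t"
    using \<delta>(1) t by (simp add: X_def d2_def field_simps)
  have "- (N t / S' t) = 2 * t * sin \<gamma> / (p / sqrt t) * (1 + e)"
  proof -
    have q: "- (u * w / (- (u * Y / 2) * x / v)) = 2 * v * z / Y * (w / (z * x))"
      if "u \<noteq> 0" "Y \<noteq> 0" "x \<noteq> 0" "v \<noteq> 0" "z \<noteq> 0" for u w Y x v z :: real
      using that by (simp add: field_simps)
    show ?thesis
      unfolding e Nf \<open>S' t = _\<close> by (rule q) (use a P t X sin_\<gamma> in auto)
  qed
  moreover have eb: "\<bar>e\<bar> \<le> 10 * C / sin \<gamma> * sqrt t"
  proof -
    have "\<bar>d1 - sin \<gamma> * d2\<bar> \<le> \<bar>d1\<bar> + \<bar>sin \<gamma> * d2\<bar>" by (rule abs_triangle_ineq4)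
    also have "\<bar>sin \<gamma> * d2\<bar> \<le> 1 * \<bar>d2\<bar>" unfolding abs_mult using sin_\<gamma> by (intro mult_right_mono) auto
    finally have "\<bar>d1 - sin \<gamma> * d2\<bar> \<le> 5 * (C * sqrt t)" using d1 d2 by linarith
    moreover have "sin \<gamma> * (1 / 2) \<le> \<bar>sin \<gamma> * X\<bar>" unfolding abs_mult using X sin_\<gamma> by (intro mult_mono) auto
    ultimately have "\<bar>e\<bar> \<le> 5 * (C * sqrt t) / (sin \<gamma> * (1 / 2))"
      unfolding e_def abs_divide using sin_\<gamma> C t by (intro frac_le) auto
    then show ?thesis by (simp add: field_simps)
  qed
  moreover have "- 1 < e"
  proof -
    have "10 * C / sin \<gamma> * sqrt t = 10 * (C * sqrt t) / sin \<gamma>" by simp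
    also have "\<dots> < 1" using small(1)[OF t] sin_\<gamma> by (simp add: pos_divide_less_eq)
    finally show ?thesis using eb by linarith
  qed
  ultimately show "\<exists>e. - (N t / S' t) = 2 * t * sin \<gamma> / (p / sqrt t) * (1 + e) \<and> \<bar>e\<bar> \<le> 10 * C / sin \<gamma> * sqrt t \<and> - 1 < e"
    by blast
qed

text \<open>Within \<pi>/4 of the centre the sine has at least half the modulus of its argument, so
  smallness of the cosine becomes closeness of the phase to the centre. This sharpens the window
  from \<pi>/4 to \<open>O(sqrt t)\<close>.\<close>

lemma phase_at_zero:
  assumes "0 < t" "t < T\<^sub>1" "S t = 0" "window j t"
  shows "\<bar>p / sqrt t - \<phi> - pi * (real j + 1 / 2)\<bar> \<le> 2 * (C * sqrt t)"
proof -
  define x where "x = p / sqrt t - \<phi> - pi * (real_of_int (int j) + 1 / 2)"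
  have "\<bar>x\<bar> / 2 \<le> \<bar>sin x\<bar>" using assms(4) by (intro abs_sin_ge_half) (simp add: x_def window_def)
  also have "\<dots> = \<bar>cos (p / sqrt t - \<phi>)\<bar>" unfolding x_def by (rule abs_cos_eq_abs_sin_offset[symmetric])
  also have "\<dots> \<le> C * sqrt t" by (rule cos_at_zero[OF assms(1-3)])
  finally show ?thesis by (simp add: x_def)
qed

lemma phase_antimono: "0 < t \<Longrightarrow> t \<le> u \<Longrightarrow> p / sqrt u \<le> p / sqrt t"
  using p by (intro divide_left_mono) auto

lemma phase_solve:
  assumes "y > 0"
  shows "0 < (p / y)\<^sup>2" "p / sqrt ((p / y)\<^sup>2) = y"
  using p assms by auto

lemma phase_gt_imp_less:
  assumes "0 < t" "0 < u" "p / sqrt u < p / sqrt t"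
  shows "t < u"
  using phase_antimono[of u t] assms by linarith

text \<open>By Rolle's theorem two zeros would enclose a critical point. Both zeros have a phase
  within 1/8 of the centre of the window; by monotonicity of the phase so has the critical point,
  and there the slope does not vanish.\<close>

lemma window_unique_zero:
  assumes w: "window j t" "window j u" and t: "t < T\<^sub>1" "u < T\<^sub>1" and z: "S t = 0" "S u = 0"
  shows "t = u"
proof -
  have contra: False if tu: "t < u" and w: "window j t" "window j u" and t: "t < T\<^sub>1" "u < T\<^sub>1" and z: "S t = 0" "S u = 0" for t u
  proof -
    have pos: "0 < t" "0 < u" using w by (auto simp: window_def)
    have "\<exists>z. z > t \<and> z < u \<and> S u - S t = (u - t) * S' z"
      by (rule MVT2[OF tu]) (use pos t T\<^sub>1 in \<open>auto intro!: der\<close>)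
    then obtain v where v: "t < v" "v < u" "S' v = 0" using z tu by auto
    have b1: "\<bar>p / sqrt t - \<phi> - pi * (real j + 1 / 2)\<bar> \<le> 1 / 8"
      using phase_at_zero[OF pos(1) t(1) z(1) w(1)] small(2)[OF pos(1) t(1)] by linarith
    have b2: "\<bar>p / sqrt u - \<phi> - pi * (real j + 1 / 2)\<bar> \<le> 1 / 8"
      using phase_at_zero[OF pos(2) t(2) z(2) w(2)] small(2)[OF pos(2) t(2)] by linarith
    have "p / sqrt u \<le> p / sqrt v" "p / sqrt v \<le> p / sqrt t"
      using v pos by (auto intro!: phase_antimono)
    then have b3: "\<bar>p / sqrt v - \<phi> - pi * (real j + 1 / 2)\<bar> \<le> 1 / 8"
      using b1 b2 by linarith
    have "\<bar>cos (p / sqrt v - \<phi>)\<bar> = \<bar>sin (p / sqrt v - \<phi> - pi * (real j + 1 / 2))\<bar>"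
      using abs_cos_eq_abs_sin_offset[of "p / sqrt v - \<phi>" "int j"] by simp
    also have "\<dots> \<le> \<bar>p / sqrt v - \<phi> - pi * (real j + 1 / 2)\<bar>" by (rule abs_sin_x_le_abs_x)
    finally have "\<bar>cos (p / sqrt v - \<phi>)\<bar> \<le> 1 / 8" using b3 by linarith
    then have "S' v \<noteq> 0" using v pos t by (intro derivative_nonzero) auto
    then show False using v by simp
  qed
  show ?thesis
    using contra[OF _ w t z] contra[OF _ w(2,1) t(2,1) z(2,1)] by (cases t u rule: linorder_cases) auto
qed

text \<open>At the two ends of the window the cosine has modulus \<open>sqrt 2 / 2\<close> and
  opposite signs, while the relative error is below 1/16; so \<open>S\<close> changes sign.\<close>

lemma window_zero_exists:
  assumes j: "p / sqrt T\<^sub>1 \<le> pi * real j + \<phi>"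
  shows "\<exists>t. window j t \<and> S t = 0"
proof -
  define e where "e = pi * (real j + 1 / 2)"
  have y0: "p / sqrt T\<^sub>1 > 0" using p T\<^sub>1 by simp
  have "e = pi * real j + pi / 2" by (simp add: e_def algebra_simps)
  then have e: "p / sqrt T\<^sub>1 < \<phi> + e - pi / 4" using j pi_gt_zero by linarith
  \<comment> \<open>The ends of the window as values of \<open>t\<close>. The phase decreases in
    \<open>t\<close>, so the smaller phase belongs to \<open>hi\<close>.\<close>
  define hi where "hi = (p / (\<phi> + e - pi / 4))\<^sup>2"
  define lo where "lo = (p / (\<phi> + e + pi / 4))\<^sup>2"
  have pos: "\<phi> + e - pi / 4 > 0" "\<phi> + e + pi / 4 > 0" using e y0 pi_gt_zero by linarith+
  have hi: "hi > 0" "p / sqrt hi = \<phi> + e - pi / 4" unfolding hi_def by (rule phase_solve[OF pos(1)])+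
  have lo: "lo > 0" "p / sqrt lo = \<phi> + e + pi / 4" unfolding lo_def by (rule phase_solve[OF pos(2)])+
  have hiT: "hi < T\<^sub>1" by (rule phase_gt_imp_less[OF hi(1) T\<^sub>1(1)]) (use hi e in simp)
  have lohi: "lo < hi" by (rule phase_gt_imp_less[OF lo(1) hi(1)]) (use hi lo pi_gt_zero in simp)
  have loT: "lo < T\<^sub>1" using lohi hiT by simp
  have at0: "hi < T\<^sub>0" "lo < T\<^sub>0" using hiT loT T\<^sub>1 by auto
  have e': "e = pi * (real_of_int (int j) + 1 / 2)" by (simp add: e_def)
  have ce: "cos e = 0" "\<bar>sin e\<bar> = 1"
    unfolding e' by (rule sin_half_odd_pi)+
  have h2: "1 / 2 < sqrt 2 / 2" by simp
  have chi: "cos (p / sqrt hi - \<phi>) = sin e * (sqrt 2 / 2)"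
    unfolding hi using ce by (simp add: cos_diff sin_45 algebra_simps)
  have clo: "cos (p / sqrt lo - \<phi>) = - sin e * (sqrt 2 / 2)"
    unfolding lo using ce by (simp add: cos_add sin_45)
  have Shi: "\<bar>S hi + amp hi * (sin e * (sqrt 2 / 2))\<bar> < amp hi * (sqrt 2 / 2)"
  proof -
    have "\<bar>S hi + amp hi * (sin e * (sqrt 2 / 2))\<bar> \<le> C * sqrt hi * amp hi" using S[OF hi(1) at0(1)] unfolding chi .
    also have "\<dots> < sqrt 2 / 2 * amp hi"
    proof (rule mult_strict_right_mono)
      show "C * sqrt hi < sqrt 2 / 2" using small(2)[OF hi(1) hiT] h2 by linarith
    qed (rule amp[OF hi(1) at0(1)])
    finally show ?thesis by (simp add: mult_ac)
  qed
  have Slo: "\<bar>S lo + amp lo * (- sin e * (sqrt 2 / 2))\<bar> < amp lo * (sqrt 2 / 2)"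
  proof -
    have "\<bar>S lo + amp lo * (- sin e * (sqrt 2 / 2))\<bar> \<le> C * sqrt lo * amp lo" using S[OF lo(1) at0(2)] unfolding clo .
    also have "\<dots> < sqrt 2 / 2 * amp lo"
    proof (rule mult_strict_right_mono)
      show "C * sqrt lo < sqrt 2 / 2" using small(2)[OF lo(1) loT] h2 by linarith
    qed (rule amp[OF lo(1) at0(2)])
    finally show ?thesis by (simp add: mult_ac)
  qed
  have cont: "\<forall>x. lo \<le> x \<and> x \<le> hi \<longrightarrow> isCont S x"
    using lo at0 by (auto intro!: DERIV_isCont der)
  have "\<exists>t. lo < t \<and> t < hi \<and> S t = 0"
  proof (cases "sin e = 1")
    case True
    have s: "S hi < 0" "S lo > 0" using Shi Slo unfolding True by linarith+
    have "\<exists>t\<ge>lo. t \<le> hi \<and> S t = 0" by (rule IVT2) (use s lohi cont in auto)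
    then show ?thesis using s by (metis less_irrefl order_le_less)
  next
    case False
    then have m: "sin e = - 1" using ce(2) by (simp add: abs_if split: if_splits)
    have s: "S hi > 0" "S lo < 0" using Shi Slo unfolding m by linarith+
    have "\<exists>t\<ge>lo. t \<le> hi \<and> S t = 0" by (rule IVT) (use s lohi cont in auto)
    then show ?thesis using s by (metis less_irrefl order_le_less)
  qed
  then obtain t where t: "lo < t" "t < hi" "S t = 0" by blast
  have t0: "0 < t" using t lo by linarith
  have strict: "p / sqrt v < p / sqrt u" if "0 < u" "u < v" for u v
    using p that by (intro divide_strict_left_mono) auto
  have "p / sqrt t < \<phi> + e + pi / 4" using strict[OF lo(1) t(1)] lo by simp
  moreover have "\<phi> + e - pi / 4 < p / sqrt t" using strict[OF t0 t(2)] hi by simp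
  ultimately have "\<bar>p / sqrt t - \<phi> - e\<bar> < pi / 4" by linarith
  then have "window j t" using t0 by (simp add: window_def e_def)
  then show ?thesis using t by blast
qed

lemma indexing:
  obtains J \<delta> where "\<delta> > 0" "J \<ge> 1"
    "\<And>j. J \<le> j \<Longrightarrow> \<exists>!t. window j t \<and> S t = 0"
    "\<And>j t. J \<le> j \<Longrightarrow> window j t \<Longrightarrow> t < T\<^sub>1"
    "\<And>t. 0 < t \<Longrightarrow> t < \<delta> \<Longrightarrow> S t = 0 \<Longrightarrow> \<exists>j\<ge>J. window j t"
proof -
  have "\<exists>n::nat. (p / sqrt T\<^sub>1 + \<bar>\<phi>\<bar>) / pi \<le> real n" by (rule real_arch_simple)
  then obtain J0 :: nat where J0: "(p / sqrt T\<^sub>1 + \<bar>\<phi>\<bar>) / pi \<le> real J0" ..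
  \<comment> \<open>From this index on each entire window lies below \<open>T\<^sub>1\<close>, not
    only its zero; this later excludes further poles anywhere in the window.\<close>
  define J where "J = Suc J0"
  have J: "p / sqrt T\<^sub>1 \<le> pi * real j + \<phi>" if "J \<le> j" for j
  proof -
    have "p / sqrt T\<^sub>1 + \<bar>\<phi>\<bar> \<le> real J0 * pi" using J0 unfolding pos_divide_le_eq[OF pi_gt_zero] .
    also have "\<dots> \<le> real j * pi" using that by (intro mult_right_mono) (auto simp: J_def)
    also have "\<dots> = pi * real j" by (rule mult.commute)
    finally show ?thesis by linarith
  qed
  have lt: "t < T\<^sub>1" if j: "J \<le> j" and w: "window j t" for j t
  proof -
    have "\<bar>p / sqrt t - \<phi> - pi * (real j + 1 / 2)\<bar> < pi / 4" using w by (simp add: window_def)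
    then have "pi * (real j + 1 / 2) - pi / 4 < p / sqrt t - \<phi>" by linarith
    moreover have "pi * (real j + 1 / 2) = pi * real j + pi / 2" by (simp add: algebra_simps)
    ultimately have "pi * real j < p / sqrt t - \<phi>" using pi_gt_zero by linarith
    then have "p / sqrt T\<^sub>1 < p / sqrt t" using J[OF j] by linarith
    moreover have "0 < t" using w by (simp add: window_def)
    ultimately show ?thesis by (intro phase_gt_imp_less[OF _ T\<^sub>1(1)])
  qed
  \<comment> \<open>A value of \<open>p / sqrt t\<close> above \<open>Y\<close> exceeds
    \<open>pi * (J + 1)\<close> even after subtracting \<open>\<phi>\<close>, so the index found by
    the floor is at least \<open>J\<close>.\<close>
  define Y where "Y = pi * (real J + 1) + \<bar>\<phi>\<bar> + 1"
  have "0 \<le> pi * (real J + 1)" by simp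
  then have Y: "Y > 0" unfolding Y_def by linarith
  define \<delta> where "\<delta> = min T\<^sub>1 ((p / Y)\<^sup>2)"
  show ?thesis
  proof (rule that[of \<delta> J])
    show "\<delta> > 0" using T\<^sub>1(1) phase_solve(1)[OF Y] unfolding \<delta>_def by linarith
    show "J \<ge> 1" by (simp add: J_def)
    show "\<exists>!t. window j t \<and> S t = 0" if j: "J \<le> j" for j
    proof (rule ex_ex1I)
      show "\<exists>t. window j t \<and> S t = 0" by (rule window_zero_exists[OF J[OF j]])
      show "t = u" if "window j t \<and> S t = 0" "window j u \<and> S u = 0" for t u
      proof (rule window_unique_zero[of j t u])
        show "t < T\<^sub>1" "u < T\<^sub>1" using that lt[OF j] by blast+
      qed (use that in blast)+
    qed
    show "t < T\<^sub>1" if "J \<le> j" "window j t" for j t by (rule lt[OF that])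
    show "\<exists>j\<ge>J. window j t" if t: "0 < t" "t < \<delta>" and z: "S t = 0" for t
    proof -
      have tT: "t < T\<^sub>1" using t by (simp add: \<delta>_def)
      define \<alpha> where "\<alpha> = p / sqrt t - \<phi>"
      have "Y = p / sqrt ((p / Y)\<^sup>2)" by (rule phase_solve(2)[OF Y, symmetric])
      also have "\<dots> \<le> p / sqrt t" by (rule phase_antimono[OF t(1)]) (use t in \<open>simp add: \<delta>_def\<close>)
      finally have "pi * (real J + 1) \<le> \<alpha>" unfolding \<alpha>_def Y_def by linarith
      then have "real J + 1 \<le> \<alpha> / pi" by (simp add: pos_le_divide_eq mult.commute)
      then have fl: "int J \<le> \<lfloor>\<alpha> / pi\<rfloor>" by linarith
      have "\<bar>cos \<alpha>\<bar> \<le> 1 / 8" using cos_at_zero[OF t(1) tT z] small(2)[OF t(1) tT] by (simp add: \<alpha>_def)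
      from near_half_odd_pi[OF this] have "\<bar>\<alpha> - pi * (real_of_int \<lfloor>\<alpha> / pi\<rfloor> + 1 / 2)\<bar> < pi / 4" .
      moreover have "real (nat \<lfloor>\<alpha> / pi\<rfloor>) = real_of_int \<lfloor>\<alpha> / pi\<rfloor>" using fl by simp
      ultimately have "window (nat \<lfloor>\<alpha> / pi\<rfloor>) t" using t(1) unfolding window_def \<alpha>_def by simp
      moreover have "J \<le> nat \<lfloor>\<alpha> / pi\<rfloor>" using fl by linarith
      ultimately show ?thesis by blast
    qed
  qed
qed

end

subsection \<open>Numerators and denominators\<close>

lemma theta_term_bound:
  fixes e :: "nat \<Rightarrow> nat"
  assumes r: "0 \<le> r" "r < 1" and e: "\<And>m. m \<le> e m" "\<And>m. 1 \<le> e m"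
  obtains C where "C > 0" "\<And>m (z :: complex) q. norm z = 1 \<Longrightarrow> norm q \<le> r \<Longrightarrow> norm (z ^ m * q ^ e m * Phi (q ^ e m) ^ k) \<le> C * r ^ m"
proof -
  obtain P where P: "P > 0" "\<And>q. norm q \<le> r \<Longrightarrow> norm (Phi q) \<le> P"
    by (rule Phi_bounded[OF r(2)]) (rule that)
  show ?thesis
  proof (rule that[of "P ^ k"])
    show "P ^ k > 0" using P by simp
    fix m and z q :: complex assume z: "norm z = 1" and q: "norm q \<le> r"
    have "norm (q ^ e m) \<le> r ^ e m" unfolding norm_power using q by (intro power_mono) auto
    also have "r ^ e m \<le> r ^ m" using r e by (intro power_decreasing) auto
    finally have 1: "norm (q ^ e m) \<le> r ^ m" .
    have "norm (q ^ e m) \<le> r ^ e m" unfolding norm_power using q by (intro power_mono) auto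
    also have "r ^ e m \<le> r ^ 1" using r e by (intro power_decreasing) auto
    finally have "norm (Phi (q ^ e m)) \<le> P" by (intro P) simp
    then have 2: "norm (Phi (q ^ e m) ^ k) \<le> P ^ k" unfolding norm_power by (intro power_mono) auto
    have "norm (z ^ m * q ^ e m * Phi (q ^ e m) ^ k) = norm (q ^ e m) * norm (Phi (q ^ e m) ^ k)"
      unfolding norm_mult norm_power z by simp
    also have "\<dots> \<le> r ^ m * P ^ k" using 1 2 r by (intro mult_mono) auto
    finally show "norm (z ^ m * q ^ e m * Phi (q ^ e m) ^ k) \<le> P ^ k * r ^ m" by (simp add: mult.commute)
  qed
qed

text \<open>Common form of numerator and denominator, with exponents \<open>a * m + 1\<close> and
  \<open>a * (m + 1)\<close>. The conditions \<open>m \<le> e m\<close> and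
  \<open>1 \<le> e m\<close> imposed in the lemmas yield a geometric majorant.\<close>

definition theta_series :: "nat \<Rightarrow> (nat \<Rightarrow> nat) \<Rightarrow> complex \<Rightarrow> complex \<Rightarrow> complex" where
  "theta_series k e z q = (\<Sum>m. z ^ m * q ^ e m * Phi (q ^ e m) ^ k)"

lemma theta_series_uniform:
  assumes r: "0 \<le> r" "r < 1" and e: "\<And>m. m \<le> e m" "\<And>m. 1 \<le> e m" and z: "norm z = 1"
  shows "uniform_limit (cball 0 r) (\<lambda>n q. \<Sum>m<n. z ^ m * q ^ e m * Phi (q ^ e m) ^ k) (theta_series k e z) sequentially"
proof -
  obtain C where C: "C > 0" "\<And>m (z :: complex) q. norm z = 1 \<Longrightarrow> norm q \<le> r \<Longrightarrow> norm (z ^ m * q ^ e m * Phi (q ^ e m) ^ k) \<le> C * r ^ m"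
    by (rule theta_term_bound[where k = k, OF r e]) (rule that)
  show ?thesis
    unfolding theta_series_def
  proof (rule Weierstrass_m_test)
    show "summable (\<lambda>m. C * r ^ m)" using r by (intro summable_mult summable_geometric) simp
    show "norm (z ^ m * q ^ e m * Phi (q ^ e m) ^ k) \<le> C * r ^ m" if "q \<in> cball 0 r" for m q
      using that by (intro C z) simp
  qed
qed

lemma theta_series_summable:
  assumes q: "norm q < 1" and e: "\<And>m. m \<le> e m" "\<And>m. 1 \<le> e m" and z: "norm z = 1"
  shows "summable (\<lambda>m. z ^ m * q ^ e m * Phi (q ^ e m) ^ k)"
proof -
  obtain C where C: "C > 0" "\<And>m z q'. norm z = 1 \<Longrightarrow> norm q' \<le> norm q \<Longrightarrow> norm (z ^ m * q' ^ e m * Phi (q' ^ e m) ^ k) \<le> C * norm q ^ m"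
    by (rule theta_term_bound[where k = k, OF norm_ge_zero q e]) (rule that)
  show ?thesis
  proof (rule summable_comparison_test')
    show "summable (\<lambda>m. C * norm q ^ m)" using q by (intro summable_mult summable_geometric) simp
    show "norm (z ^ m * q ^ e m * Phi (q ^ e m) ^ k) \<le> C * norm q ^ m" for m by (intro C z) simp
  qed
qed

lemma norm_power_less_1:
  fixes q :: complex
  assumes "norm q < 1" "1 \<le> n"
  shows "norm (q ^ n) < 1"
proof -
  have "norm q ^ n \<le> norm q ^ 1" using assms by (intro power_decreasing) auto
  then show ?thesis using assms by (simp add: norm_power)
qed

lemma theta_term_holomorphic:
  assumes e: "1 \<le> n"
  shows "(\<lambda>q. z ^ m * q ^ n * Phi (q ^ n) ^ k) holomorphic_on ball 0 1"
proof -
  have "(\<lambda>q. Phi (q ^ n)) holomorphic_on ball 0 1"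
    by (rule holomorphic_on_compose_gen[OF _ Phi_holomorphic, unfolded o_def])
      (use norm_power_less_1[OF _ e] in \<open>auto intro!: holomorphic_intros\<close>)
  then show ?thesis by (intro holomorphic_intros)
qed

lemma theta_series_holomorphic:
  assumes e: "\<And>m. m \<le> e m" "\<And>m. 1 \<le> e m" and z: "norm z = 1"
  shows "theta_series k e z holomorphic_on ball 0 1"
proof (rule holomorphic_uniform_sequence)
  show "(\<lambda>q. \<Sum>m<n. z ^ m * q ^ e m * Phi (q ^ e m) ^ k) holomorphic_on ball 0 1" for n
    by (intro holomorphic_on_sum theta_term_holomorphic e)
  fix x :: complex assume x: "x \<in> ball 0 1"
  define r where "r = (norm x + 1) / 2"
  have r: "norm x < r" "r < 1" "0 \<le> r" using x by (auto simp: r_def)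
  have sub: "cball x (r - norm x) \<subseteq> cball 0 r"
  proof
    fix y assume "y \<in> cball x (r - norm x)"
    then show "y \<in> cball 0 r" using norm_triangle_ineq2[of y x] by (simp add: dist_norm norm_minus_commute)
  qed
  show "\<exists>d>0. cball x d \<subseteq> ball 0 1 \<and> uniform_limit (cball x d) (\<lambda>n q. \<Sum>m<n. z ^ m * q ^ e m * Phi (q ^ e m) ^ k) (theta_series k e z) sequentially"
  proof (intro exI[of _ "r - norm x"] conjI)
    show "uniform_limit (cball x (r - norm x)) (\<lambda>n q. \<Sum>m<n. z ^ m * q ^ e m * Phi (q ^ e m) ^ k) (theta_series k e z) sequentially"
      by (rule uniform_limit_on_subset[OF theta_series_uniform[OF r(3,2) e z] sub])
    show "cball x (r - norm x) \<subseteq> ball 0 1" using sub r by auto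
  qed (use r in auto)
qed auto

lemma W_den_theta: "W_den a k z = theta_series k (\<lambda>m. a * (m + 1)) z"
  by (rule ext) (simp only: W_den_def theta_series_def)

lemma W_num_theta: "W_num a k z = theta_series k (\<lambda>m. a * m + 1) z"
  by (rule ext) (simp only: W_num_def theta_series_def)

lemma den_exponent: "a \<ge> 1 \<Longrightarrow> m \<le> a * (m + 1)" "a \<ge> 1 \<Longrightarrow> 1 \<le> a * (m + 1)" for a m :: nat
  by (metis le_add1 le_trans mult.commute mult_le_mono2 nat_mult_1_right) simp

lemma num_exponent: "a \<ge> 1 \<Longrightarrow> m \<le> a * m + 1" "1 \<le> a * m + 1" for a m :: nat
  by (metis add.commute le_add2 le_trans mult.commute mult_le_mono2 nat_mult_1_right) simp

lemma W_den_holomorphic: "a \<ge> 1 \<Longrightarrow> norm z = 1 \<Longrightarrow> W_den a k z holomorphic_on ball 0 1"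
  unfolding W_den_theta by (intro theta_series_holomorphic den_exponent)

lemma W_num_holomorphic: "a \<ge> 1 \<Longrightarrow> norm z = 1 \<Longrightarrow> W_num a k z holomorphic_on ball 0 1"
  unfolding W_num_theta by (intro theta_series_holomorphic num_exponent)

section \<open>Exponential variables and reduction to dilation 1\<close>

lemma eta_term_power:
  assumes "exp (- x) ^ n = exp (- y)"
  shows "exp (- x) ^ n * Phi (exp (- x) ^ n) ^ k = eta_term k y"
  by (simp add: eta_term_def assms)

lemma exp_dilate_den:
  assumes "a \<ge> 1"
  shows "exp (- (x / of_nat a)) ^ (a * (m + 1)) = exp (- (of_nat (Suc m) * x :: complex))"
proof -
  have "exp (- (x / of_nat a)) ^ (a * (m + 1)) = exp (of_nat (a * (m + 1)) * (- (x / of_nat a)))"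
    by (rule exp_of_nat_mult[symmetric])
  also have "of_nat (a * (m + 1)) * (- (x / of_nat a)) = - (of_nat (Suc m) * x)"
    using assms by (simp add: field_simps)
  finally show ?thesis .
qed

lemma exp_dilate_num:
  assumes "a \<ge> 1"
  shows "exp (- (x / of_nat a)) ^ (a * m + 1) = exp (- ((of_nat m + 1 / of_nat a) * x :: complex))"
proof -
  have "exp (- (x / of_nat a)) ^ (a * m + 1) = exp (of_nat (a * m + 1) * (- (x / of_nat a)))"
    by (rule exp_of_nat_mult[symmetric])
  also have "of_nat (a * m + 1) * (- (x / of_nat a)) = - ((of_nat m + 1 / of_nat a) * x)"
    using assms by (simp add: field_simps)
  finally show ?thesis .
qed

lemma W_den_exp:
  assumes "a \<ge> 1"
  shows "W_den a k z (exp (- (x / of_nat a))) = (\<Sum>m. z ^ m * eta_term k (of_nat (Suc m) * x))"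
  unfolding W_den_def mult.assoc eta_term_power[OF exp_dilate_den[OF assms]] ..

lemma W_num_exp:
  assumes "a \<ge> 1"
  shows "W_num a k z (exp (- (x / of_nat a))) = (\<Sum>m. z ^ m * eta_term k ((of_nat m + 1 / of_nat a) * x))"
  unfolding W_num_def mult.assoc eta_term_power[OF exp_dilate_num[OF assms]] ..

lemma calD_eq:
  assumes "norm Q < 1"
  shows "calD k Q * Q = W_den 1 k (- 1) Q"
proof (cases "Q = 0")
  case True
  then show ?thesis by (simp add: W_den_def)
next
  case False
  have "summable (\<lambda>m. (- 1) ^ m * Q ^ (m + 1) * Phi (Q ^ (m + 1)) ^ k)"
    using theta_series_summable[OF assms, of "\<lambda>m. m + 1" "- 1" k] by simp
  then have "(\<lambda>m. (- 1) ^ m * Q ^ (m + 1) * Phi (Q ^ (m + 1)) ^ k) sums W_den 1 k (- 1) Q"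
    unfolding W_den_def by (simp only: mult_1 summable_sums)
  from sums_divide[OF this, of Q]
  have "(\<lambda>m. (- 1) ^ m * Q ^ m * Phi (Q ^ (m + 1)) ^ k) sums (W_den 1 k (- 1) Q / Q)"
    using False by (simp add: mult.assoc)
  then have "calD k Q = W_den 1 k (- 1) Q / Q" unfolding calD_def by (rule sums_unique[symmetric])
  then show ?thesis using False by simp
qed

text \<open>The denominators depend on \<open>q\<close> only through \<open>q ^ a\<close>. Therefore
  zeros are studied for dilation 1 alone, and those for different dilations share one index.\<close>

lemma W_den_dilate: "W_den a k z q = W_den 1 k z (q ^ a)"
  by (simp only: W_den_def power_mult mult_1)

text \<open>Termwise differentiation under locally uniform convergence. Multiplying by
  \<open>x\<close> merges the inner derivative \<open>m + 1\<close> with \<open>x\<close> into the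
  argument of the Euler derivative.\<close>

lemma W_den_exp_deriv:
  assumes x: "0 < Re x"
  obtains d where "((\<lambda>x. W_den 1 k (- 1) (exp (- x))) has_field_derivative d) (at x)"
    "(\<lambda>m. (- 1) ^ m * eta_term_euler k (of_nat (Suc m) * x)) sums (x * d)"
proof -
  define g where "g = (\<lambda>x. W_den 1 k (- 1) (exp (- x)))"
  define f where "f = (\<lambda>n x. \<Sum>m<n. (- 1) ^ m * eta_term k (of_nat (Suc m) * x))"
  \<comment> \<open>On this half-plane \<open>exp (- y)\<close> stays in a disc of radius below 1,
    which gives uniform convergence.\<close>
  define A where "A = {y. Re x / 2 < Re y}"
  have A: "open A" "x \<in> A" using x open_halfspace_Re_gt[of "Re x / 2"] by (auto simp: A_def)
  have ul: "uniform_limit A f g sequentially"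
  proof -
    define r where "r = exp (- (Re x / 2))"
    have r: "0 \<le> r" "r < 1" using x by (auto simp: r_def)
    have "uniform_limit (cball 0 r) (\<lambda>n q. \<Sum>m<n. (- 1) ^ m * q ^ (1 * (m + 1)) * Phi (q ^ (1 * (m + 1))) ^ k) (W_den 1 k (- 1)) sequentially"
      unfolding W_den_theta by (rule theta_series_uniform[OF r]) auto
    then have "uniform_limit A (\<lambda>n y. \<Sum>m<n. (- 1) ^ m * exp (- y) ^ (1 * (m + 1)) * Phi (exp (- y) ^ (1 * (m + 1))) ^ k) g sequentially"
      unfolding g_def by (rule uniform_limit_compose') (auto simp: A_def r_def)
    also have "(\<lambda>n y. \<Sum>m<n. (- 1) ^ m * exp (- y) ^ (1 * (m + 1)) * Phi (exp (- y) ^ (1 * (m + 1))) ^ k) = f"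
      unfolding f_def mult.assoc using eta_term_power[OF exp_dilate_den[of 1]] by simp
    finally show ?thesis .
  qed
  have d: "((\<lambda>x. (- 1) ^ m * eta_term k (of_nat (Suc m) * x)) has_field_derivative (- 1) ^ m * (eta_term_euler k (of_nat (Suc m) * y) / y)) (at y)"
    if y: "y \<in> A" for y m
  proof -
    have re: "0 < Re y" using y x by (auto simp: A_def)
    then have y0: "y \<noteq> 0" by auto
    have "0 < Re (of_nat (Suc m) * y)" using re by simp
    from DERIV_chain2[where f = "eta_term k" and g = "\<lambda>x. of_nat (Suc m) * x" and x = y and s = UNIV and Db = "of_nat (Suc m)", OF eta_term_deriv[OF this]]
    have "((\<lambda>x. eta_term k (of_nat (Suc m) * x)) has_field_derivative eta_term_euler k (of_nat (Suc m) * y) / (of_nat (Suc m) * y) * of_nat (Suc m)) (at y)"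
      by (auto intro!: derivative_eq_intros simp del: of_nat_Suc)
    then have "((\<lambda>x. eta_term k (of_nat (Suc m) * x)) has_field_derivative eta_term_euler k (of_nat (Suc m) * y) / y) (at y)"
      using y0 by (simp del: of_nat_Suc)
    then show ?thesis by (rule DERIV_cmult)
  qed
  have df: "(f n has_field_derivative (\<Sum>m<n. (- 1) ^ m * (eta_term_euler k (of_nat (Suc m) * y) / y))) (at y)" if "y \<in> A" for n y
    unfolding f_def by (rule DERIV_sum) (rule d[OF that])
  have "\<exists>g'. \<forall>y\<in>A. (g has_field_derivative g' y) (at y) \<and>
      (\<lambda>n. \<Sum>m<n. (- 1) ^ m * (eta_term_euler k (of_nat (Suc m) * y) / y)) \<longlonglongrightarrow> g' y"
  proof (rule has_complex_derivative_uniform_sequence[OF A(1) df])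
    fix y assume "y \<in> A"
    then obtain e where e: "0 < e" "cball y e \<subseteq> A" using A(1) open_contains_cball by blast
    then show "\<exists>e>0. cball y e \<subseteq> A \<and> uniform_limit (cball y e) f g sequentially"
      using uniform_limit_on_subset[OF ul] by blast
  qed
  then obtain g' where g': "(g has_field_derivative g' x) (at x)"
      "(\<lambda>n. \<Sum>m<n. (- 1) ^ m * (eta_term_euler k (of_nat (Suc m) * x) / x)) \<longlonglongrightarrow> g' x"
    using A(2) by blast
  have x0: "x \<noteq> 0" using x by auto
  have "(\<lambda>m. (- 1) ^ m * (eta_term_euler k (of_nat (Suc m) * x) / x)) sums g' x"
    unfolding sums_def by (rule g'(2))
  from sums_mult[OF this, of x]
  have "(\<lambda>m. (- 1) ^ m * eta_term_euler k (of_nat (Suc m) * x)) sums (x * g' x)"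
    using x0 by (simp add: mult.left_commute[of x] del: of_nat_Suc)
  then show ?thesis by (intro that[of "g' x"] g'(1)[unfolded g_def])
qed

lemma W_den_exp_1: "W_den 1 k z (exp (- x)) = (\<Sum>m. z ^ m * eta_term k (of_nat (Suc m) * x))"
  using W_den_exp[of 1 k z x] by simp

lemma of_nat_Suc_mult_of_real: "of_nat (Suc m) * complex_of_real t = of_real ((real m + 1) * t)"
  by (simp add: add.commute)

lemma eta_term_real_pos:
  assumes "x > 0"
  obtains r :: real where "r > 0" "eta_term k (of_real x) = of_real r"
proof -
  obtain p :: real where p: "p > 0" "Phi (of_real (exp (- x))) = of_real p"
    by (rule Phi_real_pos[of "exp (- x)"]) (use assms in auto)
  show ?thesis
  proof (rule that[of "exp (- x) * p ^ k"])
    have "exp (- complex_of_real x) = of_real (exp (- x))" by (simp add: exp_of_real[symmetric] del: exp_of_real)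
    then show "eta_term k (of_real x) = of_real (exp (- x) * p ^ k)"
      unfolding eta_term_def using p by simp
  qed (use p in simp)
qed

lemma W_den_nonzero_near_1:
  assumes k: "k \<ge> 1" and z: "norm z = 1" "z \<noteq> - 1"
  obtains T where "T > 0" "\<And>t. 0 < t \<Longrightarrow> t < T \<Longrightarrow> W_den 1 k z (exp (- of_real t)) \<noteq> 0"
proof (cases "z = 1")
  case True
  show ?thesis
  proof (rule that[of 1])
    fix t :: real assume t: "0 < t"
    have "\<exists>r. r > 0 \<and> eta_term k (of_nat (Suc m) * of_real t) = of_real r" for m
    proof -
      have pos: "(real m + 1) * t > 0" using t by simp
      show ?thesis
        unfolding of_nat_Suc_mult_of_real using eta_term_real_pos[OF pos] by metis
    qed
    then obtain r where r: "\<And>m. r m > 0" "\<And>m. eta_term k (of_nat (Suc m) * of_real t) = of_real (r m)" by metis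
    have "summable (\<lambda>m. 1 ^ m * exp (- of_real t) ^ (1 * (m + 1)) * Phi (exp (- of_real t) ^ (1 * (m + 1))) ^ k)"
      by (rule theta_series_summable) (use t in auto)
    then have "summable (\<lambda>m. 1 ^ m * eta_term k (of_nat (Suc m) * of_real t))"
      unfolding mult.assoc using eta_term_power[OF exp_dilate_den[of 1 "of_real t"]] by simp
    then have "summable (\<lambda>m. complex_of_real (r m))" using r(2) by (simp del: of_nat_Suc)
    then have sr: "summable r" by (simp add: summable_complex_iff)
    have "W_den 1 k z (exp (- of_real t)) = (\<Sum>m. of_real (r m))"
      unfolding W_den_exp_1 True using r(2) by (simp del: of_nat_Suc)
    also have "\<dots> = of_real (\<Sum>m. r m)" by (rule suminf_of_real[OF sr, symmetric])
    also have "\<dots> \<noteq> 0" using suminf_pos[OF sr r(1)] by simp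
    finally show "W_den 1 k z (exp (- of_real t)) \<noteq> 0" .
  qed simp
next
  case False
  define \<theta> where "\<theta> = Arg2pi z / (2 * pi)"
  have z_eq: "z = cis (2 * pi * \<theta>)"
    using z(1) unfolding complex_norm_eq_1_exp \<theta>_def by (simp add: cis_conv_exp)
  have "0 \<le> \<theta>" "\<theta> < 1" using Arg2pi[of z] by (auto simp: \<theta>_def)
  moreover have "\<theta> \<noteq> 0" using False z_eq by auto
  moreover have "\<theta> \<noteq> 1 / 2"
  proof
    assume "\<theta> = 1 / 2"
    then have "2 * pi * \<theta> = pi" by simp
    then have "z = cis pi" unfolding z_eq by (rule arg_cong)
    then show False using z(2) by simp
  qed
  ultimately have \<theta>: "0 < \<theta>" "\<theta> < 1" "\<theta> \<noteq> 1 / 2" by auto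
  obtain \<kappa> B M where sf: "saddle_function (eta_term k) \<kappa> (real k / 2) (real k * pi\<^sup>2 / 6) B M"
    by (rule eta_saddle_functions[OF k]) (rule that)
  have "(0 :: real) < 1" "(1 :: real) \<le> 1" by auto
  then obtain T where T: "T > 0" "\<And>t. 0 < t \<Longrightarrow> t < T \<Longrightarrow>
     \<exists>v. v \<noteq> 0 \<and> (\<lambda>m. cis (2 * pi * \<theta>) ^ m * eta_term k (of_real ((real m + 1) * t))) sums v"
    by (rule saddle_function.nonresonant_sum[OF sf _ _ \<theta>]) (rule that)
  show ?thesis
  proof (rule that[OF T(1)])
    fix t :: real assume t: "0 < t" "t < T"
    obtain v where "v \<noteq> 0" "(\<lambda>m. z ^ m * eta_term k (of_real ((real m + 1) * t))) sums v"
      using T(2)[OF t] unfolding z_eq by blast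
    then show "W_den 1 k z (exp (- of_real t)) \<noteq> 0"
      unfolding W_den_exp_1 of_nat_Suc_mult_of_real by (simp add: sums_iff)
  qed
qed

lemma norm_root_of_unity:
  fixes z :: complex
  assumes "z ^ d = 1" "d \<ge> 1"
  shows "norm z = 1"
proof -
  have "norm z ^ d = 1" using assms(1) by (metis norm_one norm_power)
  then show ?thesis using power_eq_imp_eq_base[of "norm z" d 1] assms(2) by simp
qed

lemma W_den_nonzero_roots:
  assumes k: "k \<ge> 1" and d: "d \<ge> 1"
  obtains T where "T > 0" "\<And>t z. 0 < t \<Longrightarrow> t < T \<Longrightarrow> z ^ d = 1 \<Longrightarrow> z \<noteq> - 1 \<Longrightarrow> W_den 1 k z (exp (- of_real t)) \<noteq> 0"
proof -
  define Z where "Z = {z :: complex. z ^ d = 1} - {- 1}"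
  have fin: "finite Z" unfolding Z_def using finite_roots_unity[of d] d by simp
  have ev: "\<forall>\<^sub>F t in at_right 0. W_den 1 k z (exp (- of_real t)) \<noteq> 0" if "z \<in> Z" for z
  proof -
    have zd: "z ^ d = 1" "z \<noteq> - 1" using that by (auto simp: Z_def)
    have "norm z = 1" by (rule norm_root_of_unity[OF zd(1) d])
    then obtain T where "T > 0" "\<And>t. 0 < t \<Longrightarrow> t < T \<Longrightarrow> W_den 1 k z (exp (- of_real t)) \<noteq> 0"
      by (rule W_den_nonzero_near_1[OF k _ zd(2)]) (rule that)
    then show ?thesis unfolding eventually_at_right_field by blast
  qed
  have "\<forall>\<^sub>F t in at_right 0. \<forall>z\<in>Z. W_den 1 k z (exp (- of_real t)) \<noteq> 0"
    using ev by (simp add: eventually_ball_finite_distrib[OF fin])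
  then obtain T where "T > 0" "\<And>t. 0 < t \<Longrightarrow> t < T \<Longrightarrow> \<forall>z\<in>Z. W_den 1 k z (exp (- of_real t)) \<noteq> 0"
    unfolding eventually_at_right_field by blast
  then show ?thesis by (intro that[of T]) (auto simp: Z_def)
qed

text \<open>Real parts provide real functions for the intermediate and mean value theorems; that the
  complex values are real for small \<open>t\<close> is part of
  \<open>denominator_phase_system\<close>.\<close>

definition den_real :: "nat \<Rightarrow> real \<Rightarrow> real" where
  "den_real k t = Re (W_den 1 k (- 1) (exp (- of_real t)))"

definition den_slope :: "nat \<Rightarrow> real \<Rightarrow> real" where
  "den_slope k t = Re (deriv (\<lambda>x. W_den 1 k (- 1) (exp (- x))) (of_real t))"

definition num_real :: "nat \<Rightarrow> nat \<Rightarrow> real \<Rightarrow> real" where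
  "num_real a k t = Re (W_num a k (- 1) (exp (- (of_real t / of_nat a))))"

abbreviation phase_coeff :: "nat \<Rightarrow> real" where
  "phase_coeff k \<equiv> pi powr (3 / 2) * sqrt (real k / 3)"

lemma phase_eq: "phase k t = phase_coeff k / sqrt t"
  by (simp add: phase_def real_sqrt_divide real_sqrt_mult)

text \<open>For \<open>\<theta> = 1 / 2\<close> and \<open>c = k * pi\<^sup>2 / 6\<close> one has
  \<open>2 * (2 * pi * \<theta> * c / t) = pi ^ 3 * k / (3 * t)\<close>, so the oscillation at the
  saddle is the phase \<Theta> of the theorem.\<close>

lemma saddle_exponent_phase:
  assumes "t > 0"
  shows "sqrt 2 * saddle_exponent (1 / 2) (real k * pi\<^sup>2 / 6) t = phase k t"
proof -
  have "sqrt 2 * saddle_exponent (1 / 2) (real k * pi\<^sup>2 / 6) t = sqrt (pi ^ 3 * (real k / (3 * t)))"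
    unfolding saddle_exponent_def real_sqrt_mult[symmetric] by (simp add: power2_eq_square power3_eq_cube field_simps)
  also have "\<dots> = sqrt (pi ^ 3) * sqrt (real k / (3 * t))" by (rule real_sqrt_mult)
  also have "sqrt (pi ^ 3) = pi powr (3 / 2)"
  proof -
    have "pi powr (3 / 2) = (pi powr 3) powr (1 / 2)" unfolding powr_powr by simp
    also have "\<dots> = sqrt (pi ^ 3)" by (simp add: powr_half_sqrt)
    finally show ?thesis ..
  qed
  finally show ?thesis by (simp add: phase_def)
qed

text \<open>Raising \<beta> by one divides the amplitude by the saddle scale \<open>\<rho>\<close>,
  and \<open>c\<close> is \<open>\<rho>\<close> times the saddle exponent. Hence the Euler
  derivative exceeds the denominator in amplitude by the phase divided by
  \<open>sqrt 2\<close>.\<close>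

lemma saddle_amplitude_Suc_exponent:
  assumes c: "c > 0" and t: "t > 0"
  shows "c * saddle_amplitude (\<beta> + 1) (1 / 2) c t = saddle_amplitude \<beta> (1 / 2) c t * saddle_exponent (1 / 2) c t"
proof -
  define \<rho> where "\<rho> = saddle_scale (1 / 2) c t"
  have \<rho>: "\<rho> > 0" using c t by (simp add: \<rho>_def saddle_scale_def)
  have "\<rho> powr (1 - (\<beta> + 1)) = \<rho> powr (1 - \<beta>) / \<rho>"
    using \<rho> by (simp add: powr_minus_divide powr_diff)
  then have A: "saddle_amplitude (\<beta> + 1) (1 / 2) c t = saddle_amplitude \<beta> (1 / 2) c t / \<rho>"
    by (simp add: saddle_amplitude_def \<rho>_def)
  have "\<rho> * saddle_exponent (1 / 2) c t = sqrt (c\<^sup>2)"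
    unfolding \<rho>_def saddle_scale_def saddle_exponent_def real_sqrt_mult[symmetric]
    using t by (simp add: power2_eq_square)
  then have "c = \<rho> * saddle_exponent (1 / 2) c t" using c by simp
  then have "c / \<rho> = saddle_exponent (1 / 2) c t" using \<rho> by (simp add: field_simps)
  moreover have "c * (saddle_amplitude \<beta> (1 / 2) c t / \<rho>) = saddle_amplitude \<beta> (1 / 2) c t * (c / \<rho>)" by simp
  ultimately show ?thesis unfolding A by (simp only:)
qed

lemma denominator_phase_system:
  assumes k: "k \<ge> 1" and a: "a \<ge> 2"
  obtains C T amp where
    "phase_system (phase_coeff k) (phase_shift k) (pi / real a) C T (den_real k) (den_slope k) (num_real a k) amp"
    "\<And>t. 0 < t \<Longrightarrow> t < T \<Longrightarrow> W_den 1 k (- 1) (exp (- of_real t)) = of_real (den_real k t)"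
    "\<And>t. 0 < t \<Longrightarrow> t < T \<Longrightarrow> W_num a k (- 1) (exp (- (of_real t / of_nat a))) = of_real (num_real a k t)"
    "\<And>t. 0 < t \<Longrightarrow> t < T \<Longrightarrow>
      ((\<lambda>x. W_den 1 k (- 1) (exp (- x))) has_field_derivative of_real (den_slope k t)) (at (of_real t))"
proof -
  define c where "c = real k * pi\<^sup>2 / 6"
  define \<beta> where "\<beta> = real k / 2"
  have c: "c > 0" using k by (simp add: c_def)
  obtain \<kappa> B M where sf: "saddle_function (eta_term k) \<kappa> \<beta> c B M"
    and sf': "saddle_function (eta_term_euler k) (\<kappa> * c) (\<beta> + 1) c B M"
    by (rule eta_saddle_functions[OF k, folded c_def \<beta>_def]) (rule that)
  have \<kappa>: "\<kappa> > 0" using saddle_function.\<kappa>[OF sf] .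
  define amp where "amp = (\<lambda>t. 2 * \<kappa> * saddle_amplitude \<beta> (1 / 2) c t / t)"
  have ph: "sqrt 2 * saddle_exponent (1 / 2) c t = phase k t" if "t > 0" for t
    unfolding c_def by (rule saddle_exponent_phase[OF that])
  have s1: "(0::real) < 1" "(1::real) \<le> 1" by auto
  have sa: "0 < 1 / real a" "1 / real a \<le> 1" using a by auto
  obtain C1 T1 where 1: "C1 > 0" "T1 > 0" "\<And>t. 0 < t \<Longrightarrow> t < T1 \<Longrightarrow>
     \<exists>v::real. (\<lambda>m. (- 1) ^ m * eta_term k (of_real ((real m + 1) * t))) sums of_real v \<and>
       \<bar>v - amp t * cos ((1 - \<beta>) * pi / 4 + pi / 8 - pi * 1 + sqrt 2 * saddle_exponent (1 / 2) c t)\<bar> \<le> C1 * sqrt t * amp t"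
    using saddle_function.alternating_sum[OF sf s1] unfolding amp_def by blast
  obtain C2 T2 where 2: "C2 > 0" "T2 > 0" "\<And>t. 0 < t \<Longrightarrow> t < T2 \<Longrightarrow>
     \<exists>v::real. (\<lambda>m. (- 1) ^ m * eta_term k (of_real ((real m + 1 / real a) * t))) sums of_real v \<and>
       \<bar>v - amp t * cos ((1 - \<beta>) * pi / 4 + pi / 8 - pi * (1 / real a) + sqrt 2 * saddle_exponent (1 / 2) c t)\<bar> \<le> C2 * sqrt t * amp t"
    using saddle_function.alternating_sum[OF sf sa] unfolding amp_def by blast
  define amp' where "amp' = (\<lambda>t. 2 * (\<kappa> * c) * saddle_amplitude (\<beta> + 1) (1 / 2) c t / t)"
  obtain C3 T3 where 3: "C3 > 0" "T3 > 0" "\<And>t. 0 < t \<Longrightarrow> t < T3 \<Longrightarrow>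
     \<exists>v::real. (\<lambda>m. (- 1) ^ m * eta_term_euler k (of_real ((real m + 1) * t))) sums of_real v \<and>
       \<bar>v - amp' t * cos ((1 - (\<beta> + 1)) * pi / 4 + pi / 8 - pi * 1 + sqrt 2 * saddle_exponent (1 / 2) c t)\<bar> \<le> C3 * sqrt t * amp' t"
    using saddle_function.alternating_sum[OF sf' s1] unfolding amp'_def by blast
  have amp': "amp' t = amp t * (phase k t / sqrt 2)" if t: "t > 0" for t
  proof -
    have "amp' t = 2 * \<kappa> * (c * saddle_amplitude (\<beta> + 1) (1 / 2) c t) / t" by (simp add: amp'_def)
    also have "\<dots> = amp t * saddle_exponent (1 / 2) c t"
      unfolding saddle_amplitude_Suc_exponent[OF c t] amp_def by simp
    also have "saddle_exponent (1 / 2) c t = phase k t / sqrt 2" unfolding ph[OF t, symmetric] by simp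
    finally show ?thesis .
  qed
  define C where "C = C1 + C2 + C3"
  define T where "T = min T1 (min T2 T3)"
  have T: "T > 0" "T \<le> T1" "T \<le> T2" "T \<le> T3" using 1 2 3 by (auto simp: T_def)
  have C: "C1 \<le> C" "C2 \<le> C" "C3 \<le> C" "C > 0" using 1 2 3 by (auto simp: C_def)
  have amp: "amp t > 0" if "0 < t" for t
  proof -
    have "saddle_amplitude \<beta> (1 / 2) c t > 0" by (rule saddle_amplitude_pos) (use c that in auto)
    then show ?thesis using \<kappa> that by (simp add: amp_def)
  qed
  have den: "W_den 1 k (- 1) (exp (- of_real t)) = of_real (den_real k t)"
    "\<bar>den_real k t + amp t * cos (phase k t - phase_shift k)\<bar> \<le> C * sqrt t * amp t" if t: "0 < t" "t < T" for t
  proof -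
    obtain v where v: "(\<lambda>m. (- 1) ^ m * eta_term k (of_real ((real m + 1) * t))) sums of_real v"
       "\<bar>v - amp t * cos ((1 - \<beta>) * pi / 4 + pi / 8 - pi * 1 + sqrt 2 * saddle_exponent (1 / 2) c t)\<bar> \<le> C1 * sqrt t * amp t"
      using 1(3)[OF t(1)] less_le_trans[OF t(2) T(2)] by blast
    have w: "W_den 1 k (- 1) (exp (- of_real t)) = of_real v"
      unfolding W_den_exp_1 of_nat_Suc_mult_of_real by (rule sums_unique[OF v(1), symmetric])
    then have dv: "den_real k t = v" by (simp add: den_real_def)
    show "W_den 1 k (- 1) (exp (- of_real t)) = of_real (den_real k t)" unfolding dv by (rule w)
    \<comment> \<open>With \<open>s = 1\<close> the constants collect to
      \<open>- phase_shift k - pi\<close>; this \<pi> is the minus sign in front of the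
      amplitude.\<close>
    have eq: "(1 - \<beta>) * pi / 4 + pi / 8 - pi * 1 + phase k t = phase k t - phase_shift k - pi"
      by (simp add: \<beta>_def phase_shift_def field_simps)
    have "\<bar>v + amp t * cos (phase k t - phase_shift k)\<bar> \<le> C1 * sqrt t * amp t"
      using v(2) unfolding ph[OF t(1)] eq by simp
    also have "\<dots> \<le> C * sqrt t * amp t" using C amp[OF t(1)] t by (intro mult_right_mono) auto
    finally show "\<bar>den_real k t + amp t * cos (phase k t - phase_shift k)\<bar> \<le> C * sqrt t * amp t" unfolding dv .
  qed
  have num: "W_num a k (- 1) (exp (- (of_real t / of_nat a))) = of_real (num_real a k t)"
    "\<bar>num_real a k t - amp t * cos (phase k t - phase_shift k - pi / real a)\<bar> \<le> C * sqrt t * amp t" if t: "0 < t" "t < T" for t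
  proof -
    obtain v where v: "(\<lambda>m. (- 1) ^ m * eta_term k (of_real ((real m + 1 / real a) * t))) sums of_real v"
       "\<bar>v - amp t * cos ((1 - \<beta>) * pi / 4 + pi / 8 - pi * (1 / real a) + sqrt 2 * saddle_exponent (1 / 2) c t)\<bar> \<le> C2 * sqrt t * amp t"
      using 2(3)[OF t(1)] less_le_trans[OF t(2) T(3)] by blast
    have "(of_nat m + 1 / of_nat a) * complex_of_real t = of_real ((real m + 1 / real a) * t)" for m by simp
    then have w: "W_num a k (- 1) (exp (- (of_real t / of_nat a))) = of_real v"
      using W_num_exp[of a k "- 1" "of_real t"] sums_unique[OF v(1)] a by simp
    then have dv: "num_real a k t = v" by (simp add: num_real_def)
    show "W_num a k (- 1) (exp (- (of_real t / of_nat a))) = of_real (num_real a k t)" unfolding dv by (rule w)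
    have eq: "(1 - \<beta>) * pi / 4 + pi / 8 - pi * (1 / real a) + phase k t = phase k t - phase_shift k - pi / real a"
      by (simp add: \<beta>_def phase_shift_def field_simps)
    have "\<bar>v - amp t * cos (phase k t - phase_shift k - pi / real a)\<bar> \<le> C2 * sqrt t * amp t"
      using v(2) unfolding ph[OF t(1)] eq .
    also have "\<dots> \<le> C * sqrt t * amp t" using C amp[OF t(1)] t by (intro mult_right_mono) auto
    finally show "\<bar>num_real a k t - amp t * cos (phase k t - phase_shift k - pi / real a)\<bar> \<le> C * sqrt t * amp t" unfolding dv .
  qed
  have slope: "((\<lambda>x. W_den 1 k (- 1) (exp (- x))) has_field_derivative of_real (den_slope k t)) (at (of_real t))"
    "\<bar>t * den_slope k t + amp t * (phase k t / sqrt 2) * cos (phase k t - phase_shift k - pi / 4)\<bar> \<le> C * sqrt t * amp t * phase k t"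
    if t: "0 < t" "t < T" for t
  proof -
    obtain v where v: "(\<lambda>m. (- 1) ^ m * eta_term_euler k (of_real ((real m + 1) * t))) sums of_real v"
       "\<bar>v - amp' t * cos ((1 - (\<beta> + 1)) * pi / 4 + pi / 8 - pi * 1 + sqrt 2 * saddle_exponent (1 / 2) c t)\<bar> \<le> C3 * sqrt t * amp' t"
      using 3(3)[OF t(1)] less_le_trans[OF t(2) T(4)] by blast
    have "0 < Re (of_real t)" using t by simp
    then obtain d where d: "((\<lambda>x. W_den 1 k (- 1) (exp (- x))) has_field_derivative d) (at (of_real t))"
      "(\<lambda>m. (- 1) ^ m * eta_term_euler k (of_nat (Suc m) * of_real t)) sums (of_real t * d)"
      by (rule W_den_exp_deriv) (rule that)
    have "of_real t * d = of_real v"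
      using sums_unique2[OF d(2)[unfolded of_nat_Suc_mult_of_real] v(1)] .
    then have dv: "d = of_real (v / t)" using t by (simp add: field_simps)
    have ds: "den_slope k t = v / t" unfolding den_slope_def DERIV_imp_deriv[OF d(1)] dv by simp
    show "((\<lambda>x. W_den 1 k (- 1) (exp (- x))) has_field_derivative of_real (den_slope k t)) (at (of_real t))"
      using d(1) unfolding ds dv .
    have tv: "t * (v / t) = v" using t by simp
    have p0: "0 \<le> phase k t" using t by (simp add: phase_def)
    \<comment> \<open>The raised \<beta> contributes the additional shift by \<pi>/4.\<close>
    have eq: "(1 - (\<beta> + 1)) * pi / 4 + pi / 8 - pi * 1 + phase k t = phase k t - phase_shift k - pi / 4 - pi"
      by (simp add: \<beta>_def phase_shift_def field_simps)
    have "\<bar>v + amp' t * cos (phase k t - phase_shift k - pi / 4)\<bar> \<le> C3 * sqrt t * amp' t"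
      using v(2) unfolding ph[OF t(1)] eq cos_minus_pi by simp
    also have "\<dots> \<le> C * sqrt t * amp t * phase k t"
    proof -
      have "phase k t / sqrt 2 \<le> phase k t / 1" by (rule divide_left_mono) (use p0 in auto)
      then have "phase k t / sqrt 2 \<le> phase k t" by simp
      then have "amp' t \<le> amp t * phase k t" unfolding amp'[OF t(1)] using amp[OF t(1)] by (intro mult_left_mono) auto
      then have "C3 * sqrt t * amp' t \<le> C3 * sqrt t * (amp t * phase k t)"
        using 3(1) t by (intro mult_left_mono) auto
      also have "\<dots> \<le> C * sqrt t * (amp t * phase k t)"
        using C amp[OF t(1)] t p0 by (intro mult_right_mono) auto
      finally show ?thesis by (simp add: mult.assoc)
    qed
    finally show "\<bar>t * den_slope k t + amp t * (phase k t / sqrt 2) * cos (phase k t - phase_shift k - pi / 4)\<bar> \<le> C * sqrt t * amp t * phase k t"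
      unfolding ds amp'[OF t(1), symmetric] tv .
  qed
  show ?thesis
  proof (rule that[of C T amp])
    show "phase_system (phase_coeff k) (phase_shift k) (pi / real a) C T (den_real k) (den_slope k) (num_real a k) amp"
    proof (unfold_locales; (unfold phase_eq[symmetric])?)
      show "phase_coeff k > 0" using k by simp
      show "0 < pi / real a" using a by simp
      show "pi / real a \<le> pi / 2" using a by (intro divide_left_mono) auto
      show "C > 0" "T > 0" by (fact C T)+
      fix t assume t: "0 < t" "t < T"
      show "amp t > 0" by (rule amp[OF t(1)])
      show "\<bar>den_real k t + amp t * cos (phase k t - phase_shift k)\<bar> \<le> C * sqrt t * amp t" by (rule den(2)[OF t])
      show "\<bar>num_real a k t - amp t * cos (phase k t - phase_shift k - pi / real a)\<bar> \<le> C * sqrt t * amp t" by (rule num(2)[OF t])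
      show "\<bar>t * den_slope k t + amp t * (phase k t / sqrt 2) * cos (phase k t - phase_shift k - pi / 4)\<bar> \<le> C * sqrt t * amp t * phase k t"
        by (rule slope(2)[OF t])
      have "((\<lambda>t. W_den 1 k (- 1) (exp (- complex_of_real t))) has_vector_derivative of_real (den_slope k t)) (at t)"
        by (rule has_vector_derivative_real_field[OF slope(1)[OF t]])
      from has_field_derivative_Re[OF this] show "(den_real k has_real_derivative den_slope k t) (at t)"
        by (simp add: den_real_def[abs_def])
    qed
  qed (fact den(1) num(1) slope(1))+
qed

subsection \<open>Poles and residues\<close>

lemma nonzero_ball:
  fixes f :: "'i \<Rightarrow> complex \<Rightarrow> complex"
  assumes fin: "finite D" and U: "open U" "q \<in> U" and f: "\<And>z. z \<in> D \<Longrightarrow> f z holomorphic_on U" "\<And>z. z \<in> D \<Longrightarrow> f z q \<noteq> 0"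
  obtains e where "e > 0" "ball q e \<subseteq> U" "\<And>z w. z \<in> D \<Longrightarrow> w \<in> ball q e \<Longrightarrow> f z w \<noteq> 0"
proof -
  define V where "V = U \<inter> (\<Inter>z\<in>D. U \<inter> f z -` (- {0}))"
  have "open (U \<inter> f z -` (- {0}))" if "z \<in> D" for z
    by (rule continuous_open_preimage[OF holomorphic_on_imp_continuous_on[OF f(1)[OF that]] U(1)]) auto
  then have "open V" unfolding V_def using fin U(1) by blast
  moreover have "q \<in> V" using U f(2) by (auto simp: V_def)
  ultimately obtain e where e: "e > 0" "ball q e \<subseteq> V" using open_contains_ball by blast
  show ?thesis
  proof (rule that[OF e(1)])
    show "ball q e \<subseteq> U" using e(2) by (auto simp: V_def)
    fix z w assume z: "z \<in> D" and "w \<in> ball q e"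
    then have "w \<in> V" using e(2) by blast
    then show "f z w \<noteq> 0" using z unfolding V_def by blast
  qed
qed

lemma W_not_pole:
  assumes a: "a \<ge> 1" and d: "d \<ge> 1" and q: "norm q < 1" and nz: "\<And>z. z ^ d = 1 \<Longrightarrow> W_den a k z q \<noteq> 0"
  shows "\<not> is_pole (W a d k) q"
proof -
  define D where "D = {z :: complex. z ^ d = 1}"
  have fin: "finite D" unfolding D_def using finite_roots_unity[of d] d by simp
  have hol: "W_den a k z holomorphic_on ball 0 1" "W_num a k z holomorphic_on ball 0 1" if "z \<in> D" for z
    using that d by (auto simp: D_def intro!: W_den_holomorphic W_num_holomorphic a norm_root_of_unity)
  have qb: "q \<in> ball 0 1" using q by simp
  obtain e where e: "e > 0" "ball q e \<subseteq> ball 0 1" "\<And>z w. z \<in> D \<Longrightarrow> w \<in> ball q e \<Longrightarrow> W_den a k z w \<noteq> 0"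
    by (rule nonzero_ball[OF fin open_ball qb, of "W_den a k"]) (use hol nz D_def in auto)
  have "W a d k holomorphic_on ball q e"
    unfolding W_def[abs_def] D_def[symmetric]
    by (intro holomorphic_intros holomorphic_on_divide) (use hol e in \<open>auto intro: holomorphic_on_subset\<close>)
  then show ?thesis using e(1) by (intro not_is_pole_holomorphic[of "ball q e"]) auto
qed

text \<open>Evenness of \<open>d\<close> makes -1 one of the roots. The other summands are
  holomorphic near \<open>q\<close>, so they can be multiplied into the numerator: \<open>W\<close>
  becomes a quotient \<open>G / f\<close> with \<open>f\<close> the denominator at -1, which has a
  simple zero.\<close>

lemma W_simple_pole:
  assumes a: "a \<ge> 1" and d: "d \<ge> 1" "even d" and q: "norm q < 1"
    and nz: "\<And>z. z ^ d = 1 \<Longrightarrow> z \<noteq> - 1 \<Longrightarrow> W_den a k z q \<noteq> 0"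
    and z: "W_den a k (- 1) q = 0" and der: "(W_den a k (- 1) has_field_derivative g') (at q)" "g' \<noteq> 0"
    and num: "W_num a k (- 1) q \<noteq> 0"
  shows "simple_pole (W a d k) q" "residue (W a d k) q = W_num a k (- 1) q / (of_nat d * g')"
proof -
  define D where "D = {z :: complex. z ^ d = 1}"
  have fin: "finite D" unfolding D_def using finite_roots_unity[of d] d by simp
  have m1: "- 1 \<in> D" using d by (simp add: D_def)
  have hol: "W_den a k z holomorphic_on ball 0 1" "W_num a k z holomorphic_on ball 0 1" if "z \<in> D" for z
    using that d by (auto simp: D_def intro!: W_den_holomorphic W_num_holomorphic a norm_root_of_unity)
  have qb: "q \<in> ball 0 1" using q by simp
  obtain e where e: "e > 0" "ball q e \<subseteq> ball 0 1" "\<And>z w. z \<in> D - {- 1} \<Longrightarrow> w \<in> ball q e \<Longrightarrow> W_den a k z w \<noteq> 0"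
    by (rule nonzero_ball[OF _ open_ball qb, of "D - {- 1}" "W_den a k"]) (use fin hol nz D_def in auto)
  define h where "h = (\<lambda>w. 1 / of_nat d * (\<Sum>z\<in>D - {- 1}. W_num a k z w / W_den a k z w))"
  define f where "f = W_den a k (- 1)"
  define G where "G = (\<lambda>w. h w * f w + 1 / of_nat d * W_num a k (- 1) w)"
  have holh: "h holomorphic_on ball q e"
    unfolding h_def
    by (intro holomorphic_intros holomorphic_on_divide) (use hol e in \<open>auto intro: holomorphic_on_subset\<close>)
  have holf: "f holomorphic_on ball q e" unfolding f_def by (rule holomorphic_on_subset[OF hol(1)[OF m1] e(2)])
  have holG: "G holomorphic_on ball q e"
    unfolding G_def by (intro holomorphic_intros holh holf holomorphic_on_subset[OF hol(2)[OF m1] e(2)])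
  have G: "G q = W_num a k (- 1) q / of_nat d" using z by (simp add: G_def f_def)
  have G0: "G q \<noteq> 0" unfolding G using num d by simp
  have fq: "f q = 0" using z by (simp add: f_def)
  have derf: "(f has_field_derivative g') (at q)" using der(1) by (simp add: f_def)
  have ne: "\<forall>\<^sub>F w in at q. f w \<noteq> 0"
  proof -
    have "((\<lambda>w. (f w - f q) / (w - q)) \<longlongrightarrow> g') (at q)" using derf by (simp add: has_field_derivative_iff)
    from tendsto_imp_eventually_ne[OF this der(2)] show ?thesis
      by eventually_elim (auto simp: fq)
  qed
  have W_eq: "W a d k w = G w / f w" if "f w \<noteq> 0" for w
  proof -
    have "(\<Sum>z\<in>D. W_num a k z w / W_den a k z w) = W_num a k (- 1) w / f w + (\<Sum>z\<in>D - {- 1}. W_num a k z w / W_den a k z w)"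
      unfolding f_def by (rule sum.remove[OF fin m1])
    then have "W a d k w = 1 / of_nat d * (W_num a k (- 1) w / f w) + h w"
      unfolding W_def D_def[symmetric] h_def by (simp add: distrib_left)
    also have "\<dots> = G w / f w" using that by (simp add: G_def add_divide_distrib)
    finally show ?thesis .
  qed
  \<comment> \<open>The equality is claimed only off the zeros of \<open>f\<close>; pole, order and
    residue depend on a punctured neighbourhood alone.\<close>
  have ev: "\<forall>\<^sub>F w in at q. W a d k w = G w / f w"
    using ne by eventually_elim (rule W_eq)
  note simple = holG holf open_ball connected_ball _ derf G0 fq der(2)
  have zo: "zorder (\<lambda>w. G w / f w) q = - 1"
    by (rule porder_simple_pole_deriv[OF simple]) (use e in simp)
  have re: "residue (\<lambda>w. G w / f w) q = G q / g'"
    by (rule residue_simple_pole_deriv[OF simple]) (use e in simp)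
  have cont: "isCont G q" "isCont f q"
    using holomorphic_on_imp_continuous_on[OF holG] holomorphic_on_imp_continuous_on[OF holf] e(1)
    by (auto simp: continuous_on_eq_continuous_at)
  have "filterlim f (at 0) (at q)"
    using cont(2) ne unfolding filterlim_at isCont_def fq by auto
  then have pole: "is_pole (\<lambda>w. G w / f w) q" by (rule is_pole_divide[OF cont(1) _ G0])
  obtain e' where e': "e' > 0" "\<And>w. w \<noteq> q \<Longrightarrow> dist w q < e' \<Longrightarrow> f w \<noteq> 0"
    using ne unfolding eventually_at by blast
  have iso: "isolated_singularity_at (\<lambda>w. G w / f w) q"
  proof (rule isolated_singularity_at_holomorphic)
    show "(\<lambda>w. G w / f w) holomorphic_on ball q (min e e') - {q}"
      by (intro holomorphic_on_divide holomorphic_on_subset[OF holG] holomorphic_on_subset[OF holf])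
        (use e' in \<open>auto simp: dist_commute\<close>)
  qed (use e e' in auto)
  show "simple_pole (W a d k) q"
    unfolding simple_pole_def is_pole_cong[OF ev refl] isolated_singularity_at_cong[OF ev refl] zorder_cong[OF ev refl]
    using zo pole iso by blast
  show "residue (W a d k) q = W_num a k (- 1) q / (of_nat d * g')"
    unfolding residue_cong[OF ev refl] re G by simp
qed

lemma phase_system_restrict:
  assumes "phase_system p \<phi> \<gamma> C T S S' N amp" "0 < T'" "T' \<le> T"
  shows "phase_system p \<phi> \<gamma> C T' S S' N amp"
  using assms unfolding phase_system_def by (meson less_le_trans)

lemma of_real_exp_dilate: "complex_of_real (exp (- t / real a)) = exp (- (of_real t / of_nat a))"
  by (simp add: exp_of_real[symmetric] del: exp_of_real)

lemma exp_dilate_power: "a \<ge> 1 \<Longrightarrow> exp (- (of_real t / of_nat a)) ^ a = exp (- complex_of_real t)"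
  by (simp add: exp_of_nat_mult[symmetric])

text \<open>The chain rule for \<open>x = - a * ln q\<close>, with factor \<open>- a / q\<close>.
  Passing through \<open>q ^ a\<close> avoids the logarithm.\<close>

lemma den_deriv_in_q:
  assumes a: "a \<ge> 1" and t: "t > 0"
    and D: "((\<lambda>x. W_den 1 k z (exp (- x))) has_field_derivative D) (at (of_real t))" and z: "norm z = 1"
  defines "q \<equiv> exp (- (of_real t / of_nat a))"
  shows "(W_den a k z has_field_derivative - (of_nat a * D / q)) (at q)"
proof -
  have Q: "q ^ a = exp (- of_real t)" unfolding q_def by (rule exp_dilate_power[OF a])
  have Q1: "exp (- complex_of_real t) \<in> ball 0 1" using t by simp
  define E where "E = deriv (W_den 1 k z) (exp (- of_real t))"
  have E: "(W_den 1 k z has_field_derivative E) (at (exp (- of_real t)))"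
    unfolding E_def by (rule holomorphic_derivI[OF W_den_holomorphic open_ball Q1]) (use z in auto)
  have "((\<lambda>x. W_den 1 k z (exp (- x))) has_field_derivative E * (- exp (- of_real t))) (at (of_real t))"
    by (rule DERIV_chain2[where f = "W_den 1 k z" and g = "\<lambda>x. exp (- x)", OF E]) (auto intro!: derivative_eq_intros)
  from DERIV_unique[OF this D] have DE: "D = - (E * q ^ a)" unfolding Q by simp
  have E': "(W_den 1 k z has_field_derivative E) (at (q ^ a))" unfolding Q by (rule E)
  have "((\<lambda>w. W_den 1 k z (w ^ a)) has_field_derivative E * (of_nat a * q ^ (a - 1))) (at q)"
    by (rule DERIV_chain2[where f = "W_den 1 k z" and g = "\<lambda>w. w ^ a", OF E']) (auto intro!: derivative_eq_intros)
  moreover have "q ^ a = q ^ (a - 1) * q" using a by (metis One_nat_def Suc_pred less_eq_Suc_le power_Suc2)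
  then have "E * (of_nat a * q ^ (a - 1)) = - (of_nat a * D / q)"
    unfolding DE by (simp add: q_def)
  ultimately show ?thesis by (simp add: W_den_dilate[of a, abs_def])
qed

text \<open>For small \<open>t\<close> only the denominator at -1 can vanish, so regularity, poles
  and residues of \<open>W\<close> are decided by three real functions.\<close>

lemma pole_criterion:
  assumes a: "a \<ge> 2" and d: "d \<ge> 2" "even d" and k: "k \<ge> 1"
  obtains C T amp where
    "phase_system (phase_coeff k) (phase_shift k) (pi / real a) C T (den_real k) (den_slope k) (num_real a k) amp"
    "\<And>t. 0 < t \<Longrightarrow> t < T \<Longrightarrow> W_den 1 k (- 1) (exp (- of_real t)) = of_real (den_real k t)"
    "\<And>t. 0 < t \<Longrightarrow> t < T \<Longrightarrow> den_real k t \<noteq> 0 \<Longrightarrow> \<not> is_pole (W a d k) (of_real (exp (- t / real a)))"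
    "\<And>t. 0 < t \<Longrightarrow> t < T \<Longrightarrow> den_real k t = 0 \<Longrightarrow> den_slope k t \<noteq> 0 \<Longrightarrow> num_real a k t \<noteq> 0 \<Longrightarrow>
       simple_pole (W a d k) (of_real (exp (- t / real a))) \<and>
       residue (W a d k) (of_real (exp (- t / real a))) =
         of_real (exp (- t / real a) / (real a * real d) * - (num_real a k t / den_slope k t))"
proof -
  obtain C T1 amp where 1:
    "phase_system (phase_coeff k) (phase_shift k) (pi / real a) C T1 (den_real k) (den_slope k) (num_real a k) amp"
    "\<And>t. 0 < t \<Longrightarrow> t < T1 \<Longrightarrow> W_den 1 k (- 1) (exp (- of_real t)) = of_real (den_real k t)"
    "\<And>t. 0 < t \<Longrightarrow> t < T1 \<Longrightarrow> W_num a k (- 1) (exp (- (of_real t / of_nat a))) = of_real (num_real a k t)"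
    "\<And>t. 0 < t \<Longrightarrow> t < T1 \<Longrightarrow>
      ((\<lambda>x. W_den 1 k (- 1) (exp (- x))) has_field_derivative of_real (den_slope k t)) (at (of_real t))"
    by (rule denominator_phase_system[OF k a]) (rule that)
  have d1: "d \<ge> 1" and a1: "a \<ge> 1" using d a by auto
  obtain T2 where 2: "T2 > 0" "\<And>t z. 0 < t \<Longrightarrow> t < T2 \<Longrightarrow> z ^ d = 1 \<Longrightarrow> z \<noteq> - 1 \<Longrightarrow> W_den 1 k z (exp (- of_real t)) \<noteq> 0"
    by (rule W_den_nonzero_roots[OF k d1]) (rule that)
  define T where "T = min T1 T2"
  have T: "0 < T" "T \<le> T1" using phase_system.T\<^sub>0[OF 1(1)] 2(1) by (auto simp: T_def)
  have TT: "t < T1" "t < T2" if "t < T" for t using that by (auto simp: T_def)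
  have den: "W_den a k z (of_real (exp (- t / real a))) = W_den 1 k z (exp (- of_real t))" for z t
    unfolding W_den_dilate[of a] of_real_exp_dilate exp_dilate_power[OF a1] ..
  have small: "norm (complex_of_real (exp (- t / real a))) < 1" if "0 < t" for t
    using that a by simp
  show ?thesis
  proof (rule that[of C T amp])
    show "phase_system (phase_coeff k) (phase_shift k) (pi / real a) C T (den_real k) (den_slope k) (num_real a k) amp"
      by (rule phase_system_restrict[OF 1(1) T])
    fix t assume t: "0 < t" "t < T"
    show den_eq: "W_den 1 k (- 1) (exp (- of_real t)) = of_real (den_real k t)" by (rule 1(2)[OF t(1) TT(1)[OF t(2)]])
    have nz: "W_den a k z (of_real (exp (- t / real a))) \<noteq> 0" if "z ^ d = 1" "z \<noteq> - 1" for z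
      unfolding den by (rule 2(2)[OF t(1) TT(2)[OF t(2)] that])
    show "\<not> is_pole (W a d k) (of_real (exp (- t / real a)))" if z: "den_real k t \<noteq> 0"
    proof (rule W_not_pole[OF a1 d1 small[OF t(1)]])
      fix z :: complex assume "z ^ d = 1"
      then show "W_den a k z (of_real (exp (- t / real a))) \<noteq> 0"
        using nz[of z] z den_eq den[of "- 1" t] by (cases "z = - 1") simp_all
    qed
    assume z: "den_real k t = 0" "den_slope k t \<noteq> 0" "num_real a k t \<noteq> 0"
    define q where "q = complex_of_real (exp (- t / real a))"
    have q0: "q \<noteq> 0" by (simp add: q_def)
    have der: "(W_den a k (- 1) has_field_derivative - (of_nat a * of_real (den_slope k t) / q)) (at q)"
      unfolding q_def of_real_exp_dilate by (rule den_deriv_in_q[OF a1 t(1) 1(4)[OF t(1) TT(1)[OF t(2)]]]) simp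
    have num: "W_num a k (- 1) q = of_real (num_real a k t)"
      unfolding q_def of_real_exp_dilate by (rule 1(3)[OF t(1) TT(1)[OF t(2)]])
    have sp: "W_den a k (- 1) q = 0" "- (of_nat a * of_real (den_slope k t) / q) \<noteq> 0" "W_num a k (- 1) q \<noteq> 0"
      using z den_eq q0 a by (simp_all only: num) (simp_all add: q_def den[of "- 1" t, simplified])
    note pole = W_simple_pole[OF a1 d1 d(2) small[OF t(1)] nz sp(1)[unfolded q_def] der[unfolded q_def] sp(2,3)[unfolded q_def]]
    have "residue (W a d k) q = of_real (num_real a k t) / (of_nat d * - (of_nat a * of_real (den_slope k t) / q))"
      using pole(2) num unfolding q_def by simp
    also have "\<dots> = q / (of_nat a * of_nat d) * - (of_real (num_real a k t) / of_real (den_slope k t))"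
      using q0 by (simp add: field_simps)
    also have "\<dots> = of_real (exp (- t / real a) / (real a * real d) * - (num_real a k t / den_slope k t))"
      by (simp add: q_def)
    finally show "simple_pole (W a d k) (of_real (exp (- t / real a))) \<and>
       residue (W a d k) (of_real (exp (- t / real a))) =
         of_real (exp (- t / real a) / (real a * real d) * - (num_real a k t / den_slope k t))"
      using pole(1) unfolding q_def by blast
  qed
qed

subsection \<open>Asymptotics along the zeros\<close>

lemma one_minus_exp_ratio:
  fixes u :: "nat \<Rightarrow> real"
  assumes u: "u \<longlonglongrightarrow> 0" "\<And>j. u j > 0"
  shows "(\<lambda>j. (1 - exp (- u j)) / u j) \<longlonglongrightarrow> 1"
proof -
  have "((\<lambda>x::real. (1 - exp (- x)) / x) \<longlongrightarrow> 1) (at_right 0)" by real_asymp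
  moreover have "filterlim u (at_right 0) sequentially"
    unfolding filterlim_at using u by (auto simp: less_imp_neq[symmetric])
  ultimately show ?thesis by (rule filterlim_compose)
qed

text \<open>The coarse window already determines \<open>p / sqrt (t j)\<close> up to a bounded
  error, so it is asymptotic to \<open>pi * j\<close>.\<close>

lemma phase_limits:
  fixes t :: "nat \<Rightarrow> real" and p \<phi> :: real
  assumes p: "p > 0" and t: "\<And>j. t j > 0"
    and w: "\<And>j. J \<le> j \<Longrightarrow> \<bar>p / sqrt (t j) - \<phi> - pi * (real j + 1 / 2)\<bar> < pi / 4"
  shows "(\<lambda>j. real j * sqrt (t j)) \<longlonglongrightarrow> p / pi" "t \<longlonglongrightarrow> 0"
proof -
  have lim: "(\<lambda>j. (p / sqrt (t j)) / real j) \<longlonglongrightarrow> pi"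
  proof (rule real_tendsto_sandwich)
    show "(\<lambda>j. (\<phi> + pi * (real j + 1 / 2) - pi / 4) / real j) \<longlonglongrightarrow> pi" by real_asymp
    show "(\<lambda>j. (\<phi> + pi * (real j + 1 / 2) + pi / 4) / real j) \<longlonglongrightarrow> pi" by real_asymp
    show "\<forall>\<^sub>F j in sequentially. (\<phi> + pi * (real j + 1 / 2) - pi / 4) / real j \<le> (p / sqrt (t j)) / real j"
      using eventually_ge_at_top[of J]
    proof eventually_elim
      case (elim j)
      have "\<phi> + pi * (real j + 1 / 2) - pi / 4 \<le> p / sqrt (t j)" using w[OF elim] by linarith
      then show ?case by (rule divide_right_mono) simp
    qed
    show "\<forall>\<^sub>F j in sequentially. (p / sqrt (t j)) / real j \<le> (\<phi> + pi * (real j + 1 / 2) + pi / 4) / real j"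
      using eventually_ge_at_top[of J]
    proof eventually_elim
      case (elim j)
      have "p / sqrt (t j) \<le> \<phi> + pi * (real j + 1 / 2) + pi / 4" using w[OF elim] by linarith
      then show ?case by (rule divide_right_mono) simp
    qed
  qed
  have "(\<lambda>j. p / ((p / sqrt (t j)) / real j)) \<longlonglongrightarrow> p / pi"
    by (intro tendsto_divide tendsto_const lim) simp
  moreover have "p / ((p / sqrt (t j)) / real j) = real j * sqrt (t j)" for j
    using p t[of j] by simp
  ultimately show *: "(\<lambda>j. real j * sqrt (t j)) \<longlonglongrightarrow> p / pi" by simp
  have "(\<lambda>j. (real j * sqrt (t j) * (1 / real j))\<^sup>2) \<longlonglongrightarrow> (p / pi * 0)\<^sup>2"
    by (intro tendsto_power tendsto_mult *) real_asymp
  moreover have "\<forall>\<^sub>F j in sequentially. (real j * sqrt (t j) * (1 / real j))\<^sup>2 = t j"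
    using eventually_gt_at_top[of 0] by eventually_elim (use t less_imp_le in auto)
  ultimately show "t \<longlonglongrightarrow> 0" using Lim_transform_eventually by fastforce
qed

lemma pole_asymptotics:
  fixes t q r e :: "nat \<Rightarrow> real"
  assumes k: "k \<ge> 1" and a: "a \<ge> 2" and d: "d \<ge> 1"
    and t: "\<And>j. t j > 0" and w: "\<And>j. J \<le> j \<Longrightarrow> in_phase_window k j (t j)"
    and sharp: "\<And>j. J \<le> j \<Longrightarrow> \<bar>phase k (t j) - phase_shift k - pi * (real j + 1 / 2)\<bar> \<le> K * sqrt (t j)"
    and q: "\<And>j. q j = exp (- t j / real a)"
    and e: "\<And>j. \<bar>e j\<bar> \<le> M * sqrt (t j)"
    and r: "\<And>j. J \<le> j \<Longrightarrow> r j = 2 * q j * t j * sin (pi / real a) / (real a * real d * phase k (t j)) * (1 + e j)"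
  shows "q \<longlonglongrightarrow> 1"
    "(\<lambda>j. phase k (t j) - pi * (real j + (real k + 1) / 8)) \<in> O(\<lambda>j. 1 / real j)"
    "(\<lambda>j. 1 - q j) \<sim>[at_top] (\<lambda>j. pi * real k / (3 * real a * real j ^ 2))"
    "e \<in> O(\<lambda>j. sqrt (t j))"
    "r \<sim>[at_top] (\<lambda>j. 2 * real k * sin (pi / real a) / (3 * real a * real d * real j ^ 3))"
proof -
  define p where "p = phase_coeff k"
  have p: "p > 0" using k by (simp add: p_def)
  \<comment> \<open>The constants of both equivalences come from this identity, equivalent to
    \<open>(p / pi)\<^sup>2 = pi * k / 3\<close>.\<close>
  have "p\<^sup>2 = (pi powr (3 / 2))\<^sup>2 * (real k / 3)" by (simp add: p_def power_mult_distrib)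
  also have "(pi powr (3 / 2))\<^sup>2 = pi powr (3 / 2 + 3 / 2)" unfolding powr_add by (simp add: power2_eq_square)
  also have "\<dots> = pi ^ 3" by simp
  finally have p2: "p\<^sup>2 = pi ^ 3 * (real k / 3)" .
  have "\<bar>p / sqrt (t j) - phase_shift k - pi * (real j + 1 / 2)\<bar> < pi / 4" if "J \<le> j" for j
    using w[OF that] by (simp add: in_phase_window_def phase_eq p_def)
  from phase_limits[OF p t this]
  have lim: "(\<lambda>j. real j * sqrt (t j)) \<longlonglongrightarrow> p / pi" "t \<longlonglongrightarrow> 0" by simp_all
  have st: "(\<lambda>j. sqrt (t j)) \<longlonglongrightarrow> 0" using tendsto_real_sqrt[OF lim(2)] by simp
  have "(\<lambda>j. exp (- t j / real a)) \<longlonglongrightarrow> exp (- 0 / real a)"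
    by (intro tendsto_intros lim) (use a in simp)
  then show q1: "q \<longlonglongrightarrow> 1" by (simp add: q[abs_def])
  have ba: "(\<lambda>j. sqrt (t j)) \<in> O(\<lambda>j. 1 / real j)"
  proof (rule bigoI_tendsto)
    show "(\<lambda>j. sqrt (t j) / (1 / real j)) \<longlonglongrightarrow> p / pi" using lim(1) by (simp add: mult.commute)
    show "\<forall>\<^sub>F j in sequentially. 1 / real j \<noteq> 0" using eventually_gt_at_top[of 0] by eventually_elim simp
  qed
  have "(\<lambda>j. phase k (t j) - pi * (real j + (real k + 1) / 8)) \<in> O(\<lambda>j. sqrt (t j))"
  proof (rule bigoI[of _ K])
    show "\<forall>\<^sub>F j in sequentially. norm (phase k (t j) - pi * (real j + (real k + 1) / 8)) \<le> K * norm (sqrt (t j))"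
      using eventually_ge_at_top[of J]
    proof eventually_elim
      case (elim j)
      \<comment> \<open>The centre of the window is \<open>phase_shift k + pi * (j + 1 / 2)\<close>,
        and \<open>(k - 3) / 8 + 1 / 2 = (k + 1) / 8\<close>.\<close>
      have "phase k (t j) - pi * (real j + (real k + 1) / 8) = phase k (t j) - phase_shift k - pi * (real j + 1 / 2)"
        by (simp add: phase_shift_def field_simps)
      then show ?case using sharp[OF elim] t[of j] by simp
    qed
  qed
  from landau_o.big_trans[OF this ba]
  show "(\<lambda>j. phase k (t j) - pi * (real j + (real k + 1) / 8)) \<in> O(\<lambda>j. 1 / real j)" .
  show "e \<in> O(\<lambda>j. sqrt (t j))"
    by (rule bigoI[of _ M]) (use e less_imp_le[OF t] in simp)
  have "(\<lambda>j. M * sqrt (t j)) \<longlonglongrightarrow> 0" using tendsto_mult_left[OF st, of M] by simp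
  then have e0: "e \<longlonglongrightarrow> 0"
    by (rule Lim_null_comparison[rotated]) (use e in auto)
  have sin: "sin (pi / real a) > 0" using a by (intro sin_gt_zero) (auto simp: field_simps)
  have ta: "(\<lambda>j. t j / real a) \<longlonglongrightarrow> 0" using tendsto_divide[OF lim(2) tendsto_const[of "real a"]] a by simp
  have sq: "(real j * sqrt (t j))\<^sup>2 = real j ^ 2 * t j" for j using t[of j] by (simp add: power_mult_distrib)
  show "(\<lambda>j. 1 - q j) \<sim>[at_top] (\<lambda>j. pi * real k / (3 * real a * real j ^ 2))"
  proof (rule asymp_equivI')
    have "(\<lambda>j. (1 - exp (- (t j / real a))) / (t j / real a) * (real j * sqrt (t j))\<^sup>2 * (3 / (pi * real k)))
        \<longlonglongrightarrow> 1 * (p / pi)\<^sup>2 * (3 / (pi * real k))"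
      by (intro tendsto_mult tendsto_power lim(1) tendsto_const one_minus_exp_ratio[OF ta]) (use t a in simp)
    also have "1 * (p / pi)\<^sup>2 * (3 / (pi * real k)) = 1"
      unfolding power_divide p2 using k by (simp add: power2_eq_square power3_eq_cube)
    finally have l: "(\<lambda>j. (1 - exp (- (t j / real a))) / (t j / real a) * (real j * sqrt (t j))\<^sup>2 * (3 / (pi * real k))) \<longlonglongrightarrow> 1" .
    have "\<forall>\<^sub>F j in sequentially. (1 - exp (- (t j / real a))) / (t j / real a) * (real j * sqrt (t j))\<^sup>2 * (3 / (pi * real k))
        = (1 - q j) / (pi * real k / (3 * real a * real j ^ 2))"
      using eventually_gt_at_top[of 0]
    proof eventually_elim
      case (elim j)
      then show ?case unfolding sq q using t[of j] a k by (simp add: field_simps)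
    qed
    with l show "(\<lambda>j. (1 - q j) / (pi * real k / (3 * real a * real j ^ 2))) \<longlonglongrightarrow> 1"
      by (rule Lim_transform_eventually)
  qed
  show "r \<sim>[at_top] (\<lambda>j. 2 * real k * sin (pi / real a) / (3 * real a * real d * real j ^ 3))"
  proof (rule asymp_equivI')
    have "(\<lambda>j. q j * (1 + e j) * (real j * sqrt (t j)) ^ 3 * (3 / (p * real k))) \<longlonglongrightarrow> 1 * (1 + 0) * (p / pi) ^ 3 * (3 / (p * real k))"
      by (intro tendsto_mult tendsto_add tendsto_power lim(1) tendsto_const q1 e0)
    also have "1 * (1 + 0) * (p / pi) ^ 3 * (3 / (p * real k)) = p\<^sup>2 * 3 / (pi ^ 3 * real k)"
      using p by (simp add: power2_eq_square power3_eq_cube)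
    also have "\<dots> = 1" unfolding p2 using k by simp
    finally have l: "(\<lambda>j. q j * (1 + e j) * (real j * sqrt (t j)) ^ 3 * (3 / (p * real k))) \<longlonglongrightarrow> 1" .
    have "\<forall>\<^sub>F j in sequentially. q j * (1 + e j) * (real j * sqrt (t j)) ^ 3 * (3 / (p * real k))
        = r j / (2 * real k * sin (pi / real a) / (3 * real a * real d * real j ^ 3))"
      using eventually_ge_at_top[of J] eventually_gt_at_top[of 0]
    proof eventually_elim
      case (elim j)
      have "sqrt (t j) ^ 3 = t j * sqrt (t j)" using t[of j] by (simp add: power3_eq_cube)
      then have c: "(real j * sqrt (t j)) ^ 3 = real j ^ 3 * (t j * sqrt (t j))" by (simp add: power_mult_distrib)
      have rj: "r j = 2 * q j * (t j * sqrt (t j)) * sin (pi / real a) / (real a * real d * p) * (1 + e j)"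
        unfolding r[OF elim(1)] phase_eq p_def[symmetric] by simp
      show ?case unfolding c rj using sin a d k p elim(2) by (simp add: field_simps)
    qed
    with l show "(\<lambda>j. r j / (2 * real k * sin (pi / real a) / (3 * real a * real d * real j ^ 3))) \<longlonglongrightarrow> 1"
      by (rule Lim_transform_eventually)
  qed
qed

text \<open>A finite set is closed, so it would contain the limit. Distinctness of the members of
  the sequence need not be shown.\<close>

lemma infinite_below_limit:
  fixes u :: "nat \<Rightarrow> real"
  assumes u: "u \<longlonglongrightarrow> l" and X: "\<forall>\<^sub>F j in sequentially. u j \<in> X" "l \<notin> X"
  shows "infinite X"
proof
  assume "finite X"
  then have "closed X" by (rule finite_imp_closed)
  from Lim_in_closed_set[OF this X(1) _ u] show False using X(2) by simp
qed

theorem theorem4p7: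
  fixes a d k :: nat
  assumes "a \<ge> 2" and "d \<ge> 2" and "even d" and "k \<ge> 1"
  shows
    "(\<forall>\<epsilon>>0. infinite {x::real. 0 < x \<and> 1 - \<epsilon> < x \<and> x < 1 \<and> simple_pole (W a d k) (of_real x)}) \<and>
     (\<exists>(J::nat) (t::nat \<Rightarrow> real) (q::nat \<Rightarrow> real) (r::nat \<Rightarrow> real).
        (\<forall>j\<ge>J. t j > 0 \<and> q j = exp (- t j / real a) \<and>
           in_phase_window k j (t j) \<and> simple_pole (W a d k) (of_real (q j)) \<and>
           (\<forall>s. in_phase_window k j s \<and> is_pole (W a d k) (of_real (exp (- s / real a))) \<longrightarrow> s = t j) \<and>
           residue (W a d k) (of_real (q j)) = of_real (r j) \<and> r j > 0) \<and>
        (\<exists>\<delta>. 0 < \<delta> \<and> \<delta> < 1 \<and>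
           (\<forall>x. \<delta> < x \<and> x < 1 \<longrightarrow>
              (is_pole (W a d k) (of_real x) \<longleftrightarrow> (\<exists>j\<ge>J. x = q j)))) \<and>
        (\<lambda>j. phase k (t j) - pi * (real j + (real k + 1) / 8)) \<in> O(\<lambda>j. 1 / real j) \<and>
        (\<lambda>j. 1 - q j) \<sim>[at_top] (\<lambda>j. pi * real k / (3 * real a * real j ^ 2)) \<and>
        (\<exists>e::nat \<Rightarrow> real. e \<in> O(\<lambda>j. sqrt (t j)) \<and>
           (\<forall>j\<ge>J. r j = 2 * q j * t j * sin (pi / real a) / (real a * real d * phase k (t j)) * (1 + e j))) \<and>
        r \<sim>[at_top] (\<lambda>j. 2 * real k * sin (pi / real a) / (3 * real a * real d * real j ^ 3)) \<and>
        (\<exists>\<delta>. 0 < \<delta> \<and> \<delta> < 1 \<and>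
           (\<forall>Q. \<delta> < Q \<and> Q < 1 \<longrightarrow>
              (calD k (of_real Q) = 0 \<longleftrightarrow> (\<exists>j\<ge>J. Q = q j ^ a)))) \<and>
        (\<forall>j\<ge>J. (\<forall>x. indexed_den_zero a k j x \<longleftrightarrow> x = q j) \<and>
           (\<exists>p. (\<forall>x. indexed_den_zero 2 k j x \<longleftrightarrow> x = p) \<and> q j = p powr (2 / real a))))"
proof -
  note a = assms(1) and d = assms(2,3) and k = assms(4)
  define S where "S = den_real k"
  obtain C T amp where ps:
    "phase_system (phase_coeff k) (phase_shift k) (pi / real a) C T S (den_slope k) (num_real a k) amp"
    and den: "\<And>t. 0 < t \<Longrightarrow> t < T \<Longrightarrow> W_den 1 k (- 1) (exp (- of_real t)) = of_real (S t)"
    and reg: "\<And>t. 0 < t \<Longrightarrow> t < T \<Longrightarrow> S t \<noteq> 0 \<Longrightarrow> \<not> is_pole (W a d k) (of_real (exp (- t / real a)))"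
    and sing: "\<And>t. 0 < t \<Longrightarrow> t < T \<Longrightarrow> S t = 0 \<Longrightarrow> den_slope k t \<noteq> 0 \<Longrightarrow> num_real a k t \<noteq> 0 \<Longrightarrow>
       simple_pole (W a d k) (of_real (exp (- t / real a))) \<and>
       residue (W a d k) (of_real (exp (- t / real a))) =
         of_real (exp (- t / real a) / (real a * real d) * - (num_real a k t / den_slope k t))"
    by (rule pole_criterion[OF a d k, folded S_def]) (rule that)
  interpret phase_system "phase_coeff k" "phase_shift k" "pi / real a" C T S "den_slope k" "num_real a k" amp
    by (rule ps)
  have window: "window j t \<longleftrightarrow> in_phase_window k j t" for j t
    by (simp add: window_def in_phase_window_def phase_eq)
  obtain J \<delta> where \<delta>: "\<delta> > 0" and J: "J \<ge> 1"
    "\<And>j. J \<le> j \<Longrightarrow> \<exists>!t. in_phase_window k j t \<and> S t = 0"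
    "\<And>j t. J \<le> j \<Longrightarrow> in_phase_window k j t \<Longrightarrow> t < T\<^sub>1"
    "\<And>t. 0 < t \<Longrightarrow> t < \<delta> \<Longrightarrow> S t = 0 \<Longrightarrow> \<exists>j\<ge>J. in_phase_window k j t"
    by (rule indexing[unfolded window]) (rule that)
  have wpos: "0 < t" if "in_phase_window k j t" for j t using that by (simp add: in_phase_window_def)
  \<comment> \<open>The value 1 for \<open>j < J\<close> is a dummy that keeps \<open>t j\<close>
    positive for every index, so that the asymptotic lemmas apply to the whole sequence.\<close>
  define t where "t = (\<lambda>j. if J \<le> j then THE t. in_phase_window k j t \<and> S t = 0 else 1)"
  have t: "in_phase_window k j (t j)" "S (t j) = 0" if "J \<le> j" for j
    using theI'[OF J(2)[OF that]] that by (simp_all add: t_def)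
  have uniq: "s = t j" if "J \<le> j" "in_phase_window k j s" "S s = 0" for j s
    using J(2)[OF that(1)] t[OF that(1)] that by blast
  have t0: "t j > 0" for j using wpos[OF t(1)] by (cases "J \<le> j") (auto simp: t_def)
  have tT: "t j < T\<^sub>1" "t j < T" if "J \<le> j" for j using J(3)[OF that t(1)[OF that]] T\<^sub>1(2) by auto
  define q where "q = (\<lambda>j. exp (- t j / real a))"
  define r where "r = (\<lambda>j. q j / (real a * real d) * - (num_real a k (t j) / den_slope k (t j)))"
  define M where "M = 10 * C / sin (pi / real a)"
  have M: "0 \<le> M" using C sin_\<gamma> by (simp add: M_def)
  have "\<exists>e. \<bar>e\<bar> \<le> M * sqrt (t j) \<and> (J \<le> j \<longrightarrow> - 1 < e \<and>
      - (num_real a k (t j) / den_slope k (t j)) = 2 * t j * sin (pi / real a) / phase k (t j) * (1 + e))" for j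
  proof (cases "J \<le> j")
    case True
    then show ?thesis using at_zero(3)[OF t0 tT(1)[OF True] t(2)[OF True]] unfolding M_def phase_eq by blast
  next
    case False
    then show ?thesis using M t0[of j] by (intro exI[of _ 0]) simp
  qed
  then obtain e where e: "\<And>j. \<bar>e j\<bar> \<le> M * sqrt (t j)" "\<And>j. J \<le> j \<Longrightarrow> - 1 < e j"
    "\<And>j. J \<le> j \<Longrightarrow> - (num_real a k (t j) / den_slope k (t j)) = 2 * t j * sin (pi / real a) / phase k (t j) * (1 + e j)"
    by metis
  have r: "r j = 2 * q j * t j * sin (pi / real a) / (real a * real d * phase k (t j)) * (1 + e j)" if "J \<le> j" for j
    unfolding r_def e(3)[OF that] by simp
  have phase_pos: "0 < phase k (t j)" for j using k t0[of j] by (simp add: phase_def)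
  have r0: "r j > 0" if "J \<le> j" for j
    unfolding r[OF that] using t0[of j] sin_\<gamma> a d phase_pos[of j] e(2)[OF that] by (intro mult_pos_pos divide_pos_pos) (auto simp: q_def)
  have sharp: "\<bar>phase k (t j) - phase_shift k - pi * (real j + 1 / 2)\<bar> \<le> 2 * C * sqrt (t j)" if "J \<le> j" for j
    using phase_at_zero[OF t0 tT(1)[OF that] t(2)[OF that], unfolded window, OF t(1)[OF that]] by (simp add: phase_eq)
  have pole: "simple_pole (W a d k) (of_real (q j))" "residue (W a d k) (of_real (q j)) = of_real (r j)" if "J \<le> j" for j
    using sing[OF t0 tT(2)[OF that] t(2)[OF that] at_zero(1,2)[OF t0 tT(1)[OF that] t(2)[OF that]]]
    unfolding q_def r_def by blast+
  have d1: "d \<ge> 1" using d by simp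
  have q_eq: "q j = exp (- t j / real a)" for j by (simp add: q_def)
  have asym: "q \<longlonglongrightarrow> 1"
    "(\<lambda>j. phase k (t j) - pi * (real j + (real k + 1) / 8)) \<in> O(\<lambda>j. 1 / real j)"
    "(\<lambda>j. 1 - q j) \<sim>[at_top] (\<lambda>j. pi * real k / (3 * real a * real j ^ 2))"
    "e \<in> O(\<lambda>j. sqrt (t j))"
    "r \<sim>[at_top] (\<lambda>j. 2 * real k * sin (pi / real a) / (3 * real a * real d * real j ^ 3))"
    by (rule pole_asymptotics[OF k a d1 t0 t(1) sharp q_eq e(1) r]; assumption)+
  define \<delta>' where "\<delta>' = min \<delta> T"
  have \<delta>': "0 < \<delta>'" "\<And>t. t < \<delta>' \<Longrightarrow> t < \<delta>" "\<And>t. t < \<delta>' \<Longrightarrow> t < T" using \<delta> T\<^sub>0 by (auto simp: \<delta>'_def)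
  \<comment> \<open>A sufficiently small zero falls into some window of index at least
    \<open>J\<close>, and uniqueness identifies it with \<open>t j\<close>. Both the poles of
    \<open>W\<close> and the zeros of \<open>calD\<close> are characterised through this
    equivalence.\<close>
  have zero_iff: "S s = 0 \<longleftrightarrow> (\<exists>j\<ge>J. s = t j)" if s: "0 < s" "s < \<delta>'" for s
    using J(4)[OF s(1) \<delta>'(2)[OF s(2)]] uniq t by blast
  have pole_iff: "is_pole (W a d k) (of_real x) \<longleftrightarrow> (\<exists>j\<ge>J. x = q j)" if x: "exp (- \<delta>' / real a) < x" "x < 1" for x
  proof -
    have x0: "x > 0" using x(1) by (meson exp_gt_zero less_trans)
    define s where "s = - real a * ln x"
    have xs: "x = exp (- s / real a)" using x0 a by (simp add: s_def)
    have s: "0 < s" "s < \<delta>'" using x a unfolding xs by (auto simp: divide_strict_right_mono field_simps)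
    have inj: "x = q j \<longleftrightarrow> s = t j" for j unfolding xs q_def using a by (simp add: field_simps)
    have "is_pole (W a d k) (of_real x) \<longleftrightarrow> S s = 0"
    proof
      assume "is_pole (W a d k) (of_real x)"
      then show "S s = 0" using reg[OF s(1) \<delta>'(3)[OF s(2)]] unfolding xs by blast
    next
      assume "S s = 0"
      then obtain j where j: "J \<le> j" "s = t j" using zero_iff[OF s] by blast
      have "x = q j" using j(2) inj by blast
      then show "is_pole (W a d k) (of_real x)" using pole(1)[OF j(1)] by (simp add: simple_pole_def)
    qed
    then show ?thesis unfolding zero_iff[OF s] inj .
  qed
  have calD_iff: "calD k (of_real x) = 0 \<longleftrightarrow> (\<exists>j\<ge>J. x = q j ^ a)" if x: "exp (- \<delta>') < x" "x < 1" for x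
  proof -
    have x0: "x > 0" using x(1) by (meson exp_gt_zero less_trans)
    define s where "s = - ln x"
    have xs: "x = exp (- s)" using x0 by (simp add: s_def)
    have s: "0 < s" "s < \<delta>'" using x unfolding xs by auto
    have qa: "q j ^ a = exp (- t j)" for j using a by (simp add: q_def exp_of_nat_mult[symmetric])
    have "calD k (of_real x) * of_real x = of_real (S s)"
      using calD_eq[of "of_real x" k] den[OF s(1) \<delta>'(3)[OF s(2)]] x x0 by (simp add: xs exp_of_real[symmetric] del: exp_of_real)
    then have "calD k (of_real x) = 0 \<longleftrightarrow> S s = 0" using x0 by (metis mult_eq_0_iff of_real_eq_0_iff less_irrefl)
    then show ?thesis unfolding zero_iff[OF s] qa xs by simp
  qed
  \<comment> \<open>Stated for every dilation \<open>b\<close>: the same \<open>t j\<close> serves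
    \<open>a\<close> and 2, which gives the power relation between their zeros.\<close>
  have indexed: "indexed_den_zero b k j x \<longleftrightarrow> x = exp (- t j / real b)" if b: "b \<ge> 1" and j: "J \<le> j" for b j x
  proof -
    have "W_den b k (- 1) (of_real (exp (- s / real b))) = of_real (S s)" if "in_phase_window k j s" for s
      unfolding W_den_dilate[of b] of_real_exp_dilate exp_dilate_power[OF b]
      by (rule den[OF wpos[OF that]]) (use J(3)[OF j that] T\<^sub>1(2) in simp)
    then show ?thesis
      unfolding indexed_den_zero_def using t[OF j] uniq[OF j] by (metis of_real_eq_0_iff)
  qed
  have "infinite {x::real. 0 < x \<and> 1 - \<epsilon> < x \<and> x < 1 \<and> simple_pole (W a d k) (of_real x)}" if eps: "0 < \<epsilon>" for \<epsilon> :: real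
  proof (rule infinite_below_limit[OF asym(1)])
    have "\<forall>\<^sub>F j in sequentially. 1 - \<epsilon> < q j" by (rule order_tendstoD(1)[OF asym(1)]) (use eps in linarith)
    then show "\<forall>\<^sub>F j in sequentially. q j \<in> {x::real. 0 < x \<and> 1 - \<epsilon> < x \<and> x < 1 \<and> simple_pole (W a d k) (of_real x)}"
      using eventually_ge_at_top[of J]
    proof eventually_elim
      case (elim j)
      then show ?case using pole(1)[OF elim(2)] t0[of j] a by (simp add: q_def)
    qed
  qed simp
  moreover have "(\<forall>j\<ge>J. t j > 0 \<and> q j = exp (- t j / real a) \<and>
           in_phase_window k j (t j) \<and> simple_pole (W a d k) (of_real (q j)) \<and>
           (\<forall>s. in_phase_window k j s \<and> is_pole (W a d k) (of_real (exp (- s / real a))) \<longrightarrow> s = t j) \<and>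
           residue (W a d k) (of_real (q j)) = of_real (r j) \<and> r j > 0)"
  proof (intro allI impI conjI)
    fix j assume j: "J \<le> j"
    show "t j > 0" by (rule t0)
    show "q j = exp (- t j / real a)" by (rule q_eq)
    show "in_phase_window k j (t j)" by (rule t(1)[OF j])
    show "simple_pole (W a d k) (of_real (q j))" "residue (W a d k) (of_real (q j)) = of_real (r j)" by (rule pole[OF j])+
    show "r j > 0" by (rule r0[OF j])
    fix s assume s: "in_phase_window k j s \<and> is_pole (W a d k) (of_real (exp (- s / real a)))"
    \<comment> \<open>The entire window lies below \<open>T\<close>, so any pole in it is a zero of
      \<open>S\<close> and falls under uniqueness.\<close>
    have "s < T" using J(3)[OF j] s T\<^sub>1(2) by fastforce
    then have "S s = 0" using reg[of s] s wpos by blast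
    then show "s = t j" using uniq[OF j] s by blast
  qed
  moreover have "\<exists>\<delta>. 0 < \<delta> \<and> \<delta> < 1 \<and> (\<forall>x. \<delta> < x \<and> x < 1 \<longrightarrow> (is_pole (W a d k) (of_real x) \<longleftrightarrow> (\<exists>j\<ge>J. x = q j)))"
    using \<delta>'(1) a pole_iff by (intro exI[of _ "exp (- \<delta>' / real a)"]) simp
  moreover have "\<exists>\<delta>. 0 < \<delta> \<and> \<delta> < 1 \<and> (\<forall>Q. \<delta> < Q \<and> Q < 1 \<longrightarrow> (calD k (of_real Q) = 0 \<longleftrightarrow> (\<exists>j\<ge>J. Q = q j ^ a)))"
    using \<delta>'(1) calD_iff by (intro exI[of _ "exp (- \<delta>')"]) simp
  moreover have "\<forall>j\<ge>J. (\<forall>x. indexed_den_zero a k j x \<longleftrightarrow> x = q j) \<and>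
           (\<exists>p. (\<forall>x. indexed_den_zero 2 k j x \<longleftrightarrow> x = p) \<and> q j = p powr (2 / real a))"
  proof (intro allI impI conjI exI)
    fix j x assume j: "J \<le> j"
    show "indexed_den_zero a k j x \<longleftrightarrow> x = q j" unfolding q_def by (rule indexed[OF _ j]) (use a in simp)
    show "indexed_den_zero 2 k j x \<longleftrightarrow> x = exp (- t j / real 2)" by (rule indexed[OF _ j]) simp
    show "q j = exp (- t j / real 2) powr (2 / real a)" by (simp add: q_def powr_def)
  qed
  moreover have "\<exists>e::nat \<Rightarrow> real. e \<in> O(\<lambda>j. sqrt (t j)) \<and>
           (\<forall>j\<ge>J. r j = 2 * q j * t j * sin (pi / real a) / (real a * real d * phase k (t j)) * (1 + e j))"
    using asym(4) r by blast
  ultimately show ?thesis using asym(2,3,5) by blast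
qed

end
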